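(* Let $V$ be a complex vector space of finite dimension $N\ge2$ with a nondegenerate symmetric bilinear form, let $n=\lfloor N/2\rfloor$ and $\mathfrak g=\mathfrak{so}(V)$. The image of the algebra homomorphism $$\chi\colon\mathrm{End}_{\mathcal{ASB}(N,\sigma_N2^n;\kappa_N)}(\mathbf 1)\to Z(\mathfrak g)$$ induced by the affine incarnation functor $\hat{\mathbf F}'$ is equal to $Z(\mathfrak g)^{\mathrm G(V)}$.
   Context: **Representation theory.** Work over $\mathbb C$. $\Phi_V$ is the form on $V$; $[n]=\{1,\dots,n\}$; $\sigma_N=(-1)^{\binom n2+nN}$, $\kappa_N=(-1)^{nN}$. $\mathrm{Cl}=T(V)/(vw+wv-2\Phi_V(v,w):v,w\in V)$ is the Clifford algebra, $\mathbb Z/2$-graded with $V$ odd; $\iota$ is the antiautomorphism of $\mathrm{Cl}$ that is the identity on $V$. $\mathrm{Pin}(V)$ is the group of homogeneous invertible $g\in\mathrm{Cl}$ with $gVg^{-1}=V$ and $g\iota(g)=1$; $\mathrm{Spin}(V)=\mathrm{Pin}(V)\cap\mathrm{Cl}_{\bar0}$. $\mathrm G(V)=\mathrm{Pin}(V)$ if $N$ is even and $\mathrm G(V)=\mathrm{Spin}(V)$ if $N$ is odd. The vector module is $V$ with $g\cdot v=gvg^{-1}$. Fix an orthonormal basis $e_1,\dots,e_N$ of $V$ and put $\psi_j=\frac12(e_{2j-1}+\sqrt{-1}e_{2j})$, $\psi_j^\dagger=\frac12(e_{2j-1}-\sqrt{-1}e_{2j})$, $1\le j\le n$. The spin module is $S=\Lambda(\mathrm{span}\{\psi_1^\dagger,\dots,\psi_n^\dagger\})$,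 with basis $x_I=\psi_{i_1}^\dagger\wedge\dots\wedge\psi_{i_k}^\dagger$ for $I=\{i_1<\dots<i_k\}\subseteq[n]$; $\mathrm{Cl}$ acts by $\psi_i^\dagger x_I=\psi_i^\dagger\wedge x_I$, $\psi_ix_I=(-1)^{|\{j\in I:j<i\}|}x_{I\setminus\{i\}}$ if $i\in I$ and $0$ otherwise, and, if $N$ is odd, $e_Nx_I=\varepsilon(-1)^{|I|}x_I$ for a fixed choice $\varepsilon\in\{\pm1\}$. $\Phi_S$ is the bilinear form on $S$ with $\Phi_S(x_I,x_J)=(-1)^{\binom{|I|}2+nN|I|+|\{(i,j)\in I\times J:\,i>j\}|}$ if $J=[n]\setminus I$ and $0$ otherwise. For $U\in\{S,V\}$ with basis $B_U$, the left dual basis $\{x^\vee\}$ is defined by $\Phi_U(x^\vee,y)=\delta_{x,y}$, and $\Phi_U^\vee\colon\mathbb C\to U\otimes U$, $1\mapsto\sum_{x\in B_U}x\otimes x^\vee$. **Lie algebra.** For $u,v\in V$ let $M_{u,v}\in\mathfrak{so}(V)$, $M_{u,v}w=\Phi_V(v,w)u-\Phi_V(u,w)v$. $\mathfrak{so}(V)$ acts naturally on $V$ and acts on $S$ with $M_{u,v}$ acting as $\frac14(uv-vu)\in\mathrm{Cl}$. Put $\Omega=\sum_{1\le i<j\le N}M_{e_i,e_j}\otimes M_{e_j,e_i}$, $C=\sum_{1\le i<j\le N}M_{e_i,e_j}M_{e_j,e_i}\in U(\mathfrak{so}(V))$, $\tilde\Omega=2\Omega+C\otimes1$. $\mathfrak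 g$-Mod is the category of all $\mathfrak g$-modules; $Z(\mathfrak g)$ is the centre of $U(\mathfrak g)$; $\mathrm G(V)$ acts on $\mathfrak g$, hence on $U(\mathfrak g)$ and $Z(\mathfrak g)$, by the adjoint action (conjugation), and $Z(\mathfrak g)^{\mathrm G(V)}$ is the subalgebra of invariants. **Spin Brauer category.** For a commutative ring $\Bbbk$ in which $2$ is invertible (here $\mathbb C$), $d,D\in\Bbbk$, $\kappa\in\{\pm1\}$, $\mathcal{SB}(d,D;\kappa)$ is the strict $\Bbbk$-linear monoidal category (unit object $\mathbf 1$) with generating objects $\mathsf S,\mathsf V$; generating morphisms, for $\mathsf X,\mathsf Y\in\{\mathsf S,\mathsf V\}$, $\cap_{\mathsf X}\colon\mathsf X\otimes\mathsf X\to\mathbf 1$, $\cup_{\mathsf X}\colon\mathbf 1\to\mathsf X\otimes\mathsf X$, $s_{\mathsf X,\mathsf Y}\colon\mathsf X\otimes\mathsf Y\to\mathsf Y\otimes\mathsf X$, and $\mu\colon\mathsf V\otimes\mathsf S\to\mathsf S$; and relations, for all $\mathsf X,\mathsf Y,\mathsf Z\in\{\mathsf S,\mathsf V\}$: (1) $s_{\mathsf Y,\mathsf X}s_{\mathsf X,\mathsf Y}=1$; $(s_{\mathsf Y,\mathsf Z}\otimes1_{\mathsf X})(1_{\mathsf Y}\otimes s_{\mathsf X,\mathsf Z})(s_{\mathsf X,\mathsf Y}\otimes1_{\mathsf Z})=(1_{\mathsf Z}\otimes s_{\mathsf X,\mathsf Y})(s_{\mathsf X,\mathsf Z}\otimes1_{\mathsf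 Y})(1_{\mathsf X}\otimes s_{\mathsf Y,\mathsf Z})$; $(1_{\mathsf X}\otimes\cap_{\mathsf X})(\cup_{\mathsf X}\otimes1_{\mathsf X})=1_{\mathsf X}=(\cap_{\mathsf X}\otimes1_{\mathsf X})(1_{\mathsf X}\otimes\cup_{\mathsf X})$; $\cap_{\mathsf X}s_{\mathsf X,\mathsf X}=\cap_{\mathsf X}$; $(1_{\mathsf Y}\otimes\cap_{\mathsf X})(s_{\mathsf X,\mathsf Y}\otimes1_{\mathsf X})=(\cap_{\mathsf X}\otimes1_{\mathsf Y})(1_{\mathsf X}\otimes s_{\mathsf Y,\mathsf X})$; (2) $s_{\mathsf S,\mathsf X}(\mu\otimes1_{\mathsf X})=(1_{\mathsf X}\otimes\mu)(s_{\mathsf V,\mathsf X}\otimes1_{\mathsf S})(1_{\mathsf V}\otimes s_{\mathsf S,\mathsf X})$; (3) $(\cap_{\mathsf S}\otimes1_{\mathsf S\otimes\mathsf V})(1_{\mathsf S}\otimes\mu\otimes1_{\mathsf S\otimes\mathsf V})(1_{\mathsf S\otimes\mathsf V}\otimes\cup_{\mathsf S}\otimes1_{\mathsf V})(1_{\mathsf S}\otimes\cup_{\mathsf V})=(1_{\mathsf S\otimes\mathsf V}\otimes\cap_{\mathsf S})(1_{\mathsf S\otimes\mathsf V}\otimes\mu\otimes1_{\mathsf S})(1_{\mathsf S}\otimes\cup_{\mathsf V}\otimes1_{\mathsf S\otimes\mathsf S})(\cup_{\mathsf S}\otimes1_{\mathsf S})$ as morphisms $\mathsf S\to\mathsf S\otimes\mathsf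 V$; (4) $\mu\, s_{\mathsf S,\mathsf V}=\kappa\mu'$, where $\mu':=(\cap_{\mathsf S}\otimes1_{\mathsf S})(1_{\mathsf S}\otimes\mu\otimes1_{\mathsf S})(1_{\mathsf S\otimes\mathsf V}\otimes\cup_{\mathsf S})\colon\mathsf S\otimes\mathsf V\to\mathsf S$; (5) $\mu(1_{\mathsf V}\otimes\mu)+\mu(1_{\mathsf V}\otimes\mu)(s_{\mathsf V,\mathsf V}\otimes1_{\mathsf S})=2\,\cap_{\mathsf V}\otimes1_{\mathsf S}$; (6) $\cap_{\mathsf V}\cup_{\mathsf V}=d\,1_{\mathbf 1}$, $\cap_{\mathsf S}\cup_{\mathsf S}=D\,1_{\mathbf 1}$. Further put $\delta=(1_{\mathsf V}\otimes\mu)(\cup_{\mathsf V}\otimes1_{\mathsf S})\colon\mathsf S\to\mathsf V\otimes\mathsf S$, $\delta'=(\mu'\otimes1_{\mathsf V})(1_{\mathsf S}\otimes\cup_{\mathsf V})\colon\mathsf S\to\mathsf S\otimes\mathsf V$, $b=(\mu'\otimes\mu)(1_{\mathsf S}\otimes\cup_{\mathsf V}\otimes1_{\mathsf S})\in\mathrm{End}(\mathsf S\otimes\mathsf S)$. **Affine spin Brauer category.** $\mathcal{ASB}(d,D;\kappa)$ is obtained from $\mathcal{SB}(d,D;\kappa)$ by adjoining generating morphisms ("dots") $y_{\mathsf S}\colon\mathsf S\to\mathsf S$, $y_{\mathsf V}\colon\mathsf V\to\mathsf V$ and the relations $s_{\mathsf V,\mathsf V}(y_{\mathsf V}\otimes1)-(1\otimes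 y_{\mathsf V})s_{\mathsf V,\mathsf V}=2(1_{\mathsf V\otimes\mathsf V}-\cup_{\mathsf V}\cap_{\mathsf V})$; $s_{\mathsf S,\mathsf S}(y_{\mathsf S}\otimes1)-(1\otimes y_{\mathsf S})s_{\mathsf S,\mathsf S}=\frac18\big((\mu\otimes\mu')(1_{\mathsf V}\otimes s_{\mathsf S,\mathsf S}\otimes1_{\mathsf V})(\delta\otimes\delta')-b\,s_{\mathsf S,\mathsf S}\,b\big)$; $s_{\mathsf S,\mathsf V}(y_{\mathsf S}\otimes1)-(1\otimes y_{\mathsf S})s_{\mathsf S,\mathsf V}=s_{\mathsf S,\mathsf V}-\kappa\,\delta\mu'$; $s_{\mathsf V,\mathsf S}(y_{\mathsf V}\otimes1)-(1\otimes y_{\mathsf V})s_{\mathsf V,\mathsf S}=s_{\mathsf V,\mathsf S}-\kappa\,\delta'\mu$; $\cap_{\mathsf X}(y_{\mathsf X}\otimes1)=-\cap_{\mathsf X}(1\otimes y_{\mathsf X})$ for $\mathsf X\in\{\mathsf S,\mathsf V\}$; $y_{\mathsf S}\,\mu=\mu(y_{\mathsf V}\otimes1_{\mathsf S})+\mu(1_{\mathsf V}\otimes y_{\mathsf S})$. **Affine incarnation functor and $\chi$.** $\hat{\mathbf F}'\colon\mathcal{ASB}(N,\sigma_N2^n;\kappa_N)\to\mathcal End_{\mathbb C}(\mathfrak g\text{-Mod})$ (target: monoidal category of $\mathbb C$-linear endofunctors and natural transformations) is the $\mathbb C$-linear monoidal functor with $\mathsf S\mapsto S\otimes-$, $\mathsf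 V\mapsto V\otimes-$; with $\cap_{\mathsf S},\cap_{\mathsf V},\cup_{\mathsf S},\cup_{\mathsf V}$ sent to $\Phi_S\otimes-$, $\Phi_V\otimes-$, $\Phi_S^\vee\otimes-$, $\Phi_V^\vee\otimes-$; $\mu$ to $(v\otimes x\mapsto vx)\otimes-$; $s_{\mathsf S,\mathsf S}$ to $\sigma_N\,\mathrm{flip}\otimes-$ and the other $s_{\mathsf X,\mathsf Y}$ to $\mathrm{flip}\otimes-$ ($\mathrm{flip}(u\otimes w)=w\otimes u$); and with $y_{\mathsf S},y_{\mathsf V}$ sent to the natural transformations acting on $S\otimes M$, $V\otimes M$ by $\tilde\Omega$. $\mathrm{End}$ of the identity functor of $\mathfrak g$-Mod is identified with $Z(\mathfrak g)$ by evaluation at the identity element of the regular module $U(\mathfrak g)$; thus $\hat{\mathbf F}'$ induces $\chi$. *)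

theory Defs
  imports Complex_Main "HOL-Algebra.QuotRing" "HOL-Algebra.Module" "HOL-Library.Poly_Mapping"
begin

section \<open>Algebras presented by generators and relations\<close>

text \<open>
  Finitely supported functions on words, multiplied by convolution, form the free
  associative algebra. \<open>Poly_Mapping\<close> needs the words to be an additively written monoid.
\<close>

instantiation list :: (type) monoid_add
begin
definition zero_list :: "'a list" where "zero_list = []"
definition plus_list :: "'a list \<Rightarrow> 'a list \<Rightarrow> 'a list" where "plus_list xs ys = xs @ ys"
instance by standard (simp_all add: zero_list_def plus_list_def)
end

type_synonym 'a nc_poly = "'a list \<Rightarrow>\<^sub>0 complex"

definition letter :: "'a \<Rightarrow> 'a nc_poly"
  where "letter x = Poly_Mapping.single [x] 1"

definition const :: "complex \<Rightarrow> 'a nc_poly"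
  where "const c = Poly_Mapping.single [] c"

definition free_alg :: "'a set \<Rightarrow> 'a nc_poly ring"
  where "free_alg A =
    \<lparr>carrier = {p. \<forall>w\<in>Poly_Mapping.keys p. set w \<subseteq> A}, mult = (*), one = 1, zero = 0, add = (+)\<rparr>"

text \<open>
  If \<open>A\<close> is a complex vector space with addition \<open>pl\<close> and scalar multiplication \<open>sc\<close>, then the
  free algebra on the set \<open>A\<close> modulo these relations is the tensor algebra \<open>T(A)\<close>; a quotient of
  \<open>T(A)\<close> is written below as one quotient of the free algebra.
\<close>

definition linear_relations ::
    "'a set \<Rightarrow> ('a \<Rightarrow> 'a \<Rightarrow> 'a) \<Rightarrow> (complex \<Rightarrow> 'a \<Rightarrow> 'a) \<Rightarrow> 'a nc_poly set"
  where "linear_relations A pl sc =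
    {letter (pl x y) - letter x - letter y | x y. x \<in> A \<and> y \<in> A}
    \<union> {letter (sc c x) - const c * letter x | c x. x \<in> A}"

definition map_letters :: "('a \<Rightarrow> 'b) \<Rightarrow> 'a nc_poly \<Rightarrow> 'b nc_poly"
  where "map_letters f p =
    (\<Sum>w\<in>Poly_Mapping.keys p. Poly_Mapping.single (map f w) (Poly_Mapping.lookup p w))"

definition reverse_words :: "'a nc_poly \<Rightarrow> 'a nc_poly"
  where "reverse_words p =
    (\<Sum>w\<in>Poly_Mapping.keys p. Poly_Mapping.single (rev w) (Poly_Mapping.lookup p w))"


section \<open>The spin Brauer category and its affine version\<close>

datatype gob = Spin | Vect

text \<open>
  Objects are words in the generating objects: the tensor product is \<open>@\<close> and the unit object is
  \<open>[]\<close>. \<open>mor\<close> is the type of formal expressions for morphisms; \<open>g \<bullet> f\<close> is the composite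
  \<open>g \<circ> f\<close>, and \<open>Zero a b\<close> is the zero morphism from \<open>a\<close> to \<open>b\<close>.
\<close>

datatype mor =
    Cap gob
  | Cup gob
  | Swap gob gob
  | Mu
  | Dot gob
  | Idm "gob list"
  | Comp mor mor (infixl "\<bullet>" 70)
  | Tens mor mor (infixl "\<boxtimes>" 75)
  | Zero "gob list" "gob list"
  | Plus mor mor (infixl "\<boxplus>" 60)
  | Scal complex mor (infixr "\<star>" 65)

abbreviation Minus :: "mor \<Rightarrow> mor \<Rightarrow> mor" (infixl "\<boxminus>" 60)
  where "f \<boxminus> g \<equiv> f \<boxplus> (-1) \<star> g"

primrec src :: "mor \<Rightarrow> gob list" where
  "src (Cap X) = [X, X]"
| "src (Cup X) = []"
| "src (Swap X Y) = [X, Y]"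
| "src Mu = [Vect, Spin]"
| "src (Dot X) = [X]"
| "src (Idm a) = a"
| "src (g \<bullet> f) = src f"
| "src (f \<boxtimes> g) = src f @ src g"
| "src (Zero a b) = a"
| "src (f \<boxplus> g) = src f"
| "src (c \<star> f) = src f"

primrec tgt :: "mor \<Rightarrow> gob list" where
  "tgt (Cap X) = []"
| "tgt (Cup X) = [X, X]"
| "tgt (Swap X Y) = [Y, X]"
| "tgt Mu = [Spin]"
| "tgt (Dot X) = [X]"
| "tgt (Idm a) = a"
| "tgt (g \<bullet> f) = tgt g"
| "tgt (f \<boxtimes> g) = tgt f @ tgt g"
| "tgt (Zero a b) = b"
| "tgt (f \<boxplus> g) = tgt f"
| "tgt (c \<star> f) = tgt f"

primrec wf_mor :: "mor \<Rightarrow> bool" where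
  "wf_mor (Cap X) \<longleftrightarrow> True"
| "wf_mor (Cup X) \<longleftrightarrow> True"
| "wf_mor (Swap X Y) \<longleftrightarrow> True"
| "wf_mor Mu \<longleftrightarrow> True"
| "wf_mor (Dot X) \<longleftrightarrow> True"
| "wf_mor (Idm a) \<longleftrightarrow> True"
| "wf_mor (g \<bullet> f) \<longleftrightarrow> wf_mor g \<and> wf_mor f \<and> src g = tgt f"
| "wf_mor (f \<boxtimes> g) \<longleftrightarrow> wf_mor f \<and> wf_mor g"
| "wf_mor (Zero a b) \<longleftrightarrow> True"
| "wf_mor (f \<boxplus> g) \<longleftrightarrow> wf_mor f \<and> wf_mor g \<and> src f = src g \<and> tgt f = tgt g"
| "wf_mor (c \<star> f) \<longleftrightarrow> wf_mor f"

definition arrows :: "gob list \<Rightarrow> gob list \<Rightarrow> mor set"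
  where "arrows a b = {f. wf_mor f \<and> src f = a \<and> tgt f = b}"

definition Mu' :: mor
  where "Mu' = (Cap Spin \<boxtimes> Idm [Spin]) \<bullet> (Idm [Spin] \<boxtimes> Mu \<boxtimes> Idm [Spin])
    \<bullet> (Idm [Spin, Vect] \<boxtimes> Cup Spin)"

definition Delta :: mor
  where "Delta = (Idm [Vect] \<boxtimes> Mu) \<bullet> (Cup Vect \<boxtimes> Idm [Spin])"

definition Delta' :: mor
  where "Delta' = (Mu' \<boxtimes> Idm [Vect]) \<bullet> (Idm [Spin] \<boxtimes> Cup Vect)"

definition Bead :: mor
  where "Bead = (Mu' \<boxtimes> Mu) \<bullet> (Idm [Spin] \<boxtimes> Cup Vect \<boxtimes> Idm [Spin])"

inductive SB_relation :: "complex \<Rightarrow> complex \<Rightarrow> complex \<Rightarrow> mor \<Rightarrow> mor \<Rightarrow> bool"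
  for d D \<kappa> where
  swap_swap: "SB_relation d D \<kappa> (Swap Y X \<bullet> Swap X Y) (Idm [X, Y])"
| braid: "SB_relation d D \<kappa>
    ((Swap Y Z \<boxtimes> Idm [X]) \<bullet> (Idm [Y] \<boxtimes> Swap X Z) \<bullet> (Swap X Y \<boxtimes> Idm [Z]))
    ((Idm [Z] \<boxtimes> Swap X Y) \<bullet> (Swap X Z \<boxtimes> Idm [Y]) \<bullet> (Idm [X] \<boxtimes> Swap Y Z))"
| zigzag_left: "SB_relation d D \<kappa>
    ((Idm [X] \<boxtimes> Cap X) \<bullet> (Cup X \<boxtimes> Idm [X])) (Idm [X])"
| zigzag_right: "SB_relation d D \<kappa>
    (Idm [X]) ((Cap X \<boxtimes> Idm [X]) \<bullet> (Idm [X] \<boxtimes> Cup X))"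
| cap_swap: "SB_relation d D \<kappa> (Cap X \<bullet> Swap X X) (Cap X)"
| cap_slide: "SB_relation d D \<kappa>
    ((Idm [Y] \<boxtimes> Cap X) \<bullet> (Swap X Y \<boxtimes> Idm [X]))
    ((Cap X \<boxtimes> Idm [Y]) \<bullet> (Idm [X] \<boxtimes> Swap Y X))"
| mu_slide: "SB_relation d D \<kappa>
    (Swap Spin X \<bullet> (Mu \<boxtimes> Idm [X]))
    ((Idm [X] \<boxtimes> Mu) \<bullet> (Swap Vect X \<boxtimes> Idm [Spin]) \<bullet> (Idm [Vect] \<boxtimes> Swap Spin X))"
| mu_rotate: "SB_relation d D \<kappa>
    ((Cap Spin \<boxtimes> Idm [Spin, Vect]) \<bullet> (Idm [Spin] \<boxtimes> Mu \<boxtimes> Idm [Spin, Vect])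
      \<bullet> (Idm [Spin, Vect] \<boxtimes> Cup Spin \<boxtimes> Idm [Vect]) \<bullet> (Idm [Spin] \<boxtimes> Cup Vect))
    ((Idm [Spin, Vect] \<boxtimes> Cap Spin) \<bullet> (Idm [Spin, Vect] \<boxtimes> Mu \<boxtimes> Idm [Spin])
      \<bullet> (Idm [Spin] \<boxtimes> Cup Vect \<boxtimes> Idm [Spin, Spin]) \<bullet> (Cup Spin \<boxtimes> Idm [Spin]))"
| mu_swap: "SB_relation d D \<kappa> (Mu \<bullet> Swap Spin Vect) (\<kappa> \<star> Mu')"
| clifford: "SB_relation d D \<kappa>
    (Mu \<bullet> (Idm [Vect] \<boxtimes> Mu) \<boxplus> Mu \<bullet> (Idm [Vect] \<boxtimes> Mu) \<bullet> (Swap Vect Vect \<boxtimes> Idm [Spin]))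
    (2 \<star> (Cap Vect \<boxtimes> Idm [Spin]))"
| dim_Vect: "SB_relation d D \<kappa> (Cap Vect \<bullet> Cup Vect) (d \<star> Idm [])"
| dim_Spin: "SB_relation d D \<kappa> (Cap Spin \<bullet> Cup Spin) (D \<star> Idm [])"

inductive dot_relation :: "complex \<Rightarrow> mor \<Rightarrow> mor \<Rightarrow> bool" for \<kappa> where
  dot_VV: "dot_relation \<kappa>
    (Swap Vect Vect \<bullet> (Dot Vect \<boxtimes> Idm [Vect]) \<boxminus> (Idm [Vect] \<boxtimes> Dot Vect) \<bullet> Swap Vect Vect)
    (2 \<star> (Idm [Vect, Vect] \<boxminus> Cup Vect \<bullet> Cap Vect))"
| dot_SS: "dot_relation \<kappa>
    (Swap Spin Spin \<bullet> (Dot Spin \<boxtimes> Idm [Spin]) \<boxminus> (Idm [Spin] \<boxtimes> Dot Spin) \<bullet> Swap Spin Spin)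
    ((1/8) \<star> ((Mu \<boxtimes> Mu') \<bullet> (Idm [Vect] \<boxtimes> Swap Spin Spin \<boxtimes> Idm [Vect]) \<bullet> (Delta \<boxtimes> Delta')
      \<boxminus> Bead \<bullet> Swap Spin Spin \<bullet> Bead))"
| dot_SV: "dot_relation \<kappa>
    (Swap Spin Vect \<bullet> (Dot Spin \<boxtimes> Idm [Vect]) \<boxminus> (Idm [Vect] \<boxtimes> Dot Spin) \<bullet> Swap Spin Vect)
    (Swap Spin Vect \<boxminus> \<kappa> \<star> (Delta \<bullet> Mu'))"
| dot_VS: "dot_relation \<kappa>
    (Swap Vect Spin \<bullet> (Dot Vect \<boxtimes> Idm [Spin]) \<boxminus> (Idm [Spin] \<boxtimes> Dot Vect) \<bullet> Swap Vect Spin)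
    (Swap Vect Spin \<boxminus> \<kappa> \<star> (Delta' \<bullet> Mu))"
| dot_cap: "dot_relation \<kappa>
    (Cap X \<bullet> (Dot X \<boxtimes> Idm [X])) ((-1) \<star> (Cap X \<bullet> (Idm [X] \<boxtimes> Dot X)))"
| dot_mu: "dot_relation \<kappa>
    (Dot Spin \<bullet> Mu) (Mu \<bullet> (Dot Vect \<boxtimes> Idm [Spin]) \<boxplus> Mu \<bullet> (Idm [Vect] \<boxtimes> Dot Spin))"

text \<open>
  The least congruence containing the generating relations and the laws of a strict
  \<open>\<complex>\<close>-linear monoidal category.
\<close>

inductive ASB_eq :: "complex \<Rightarrow> complex \<Rightarrow> complex \<Rightarrow> mor \<Rightarrow> mor \<Rightarrow> bool"
  for d D \<kappa> where
  SB: "SB_relation d D \<kappa> f g \<Longrightarrow> ASB_eq d D \<kappa> f g"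
| dot: "dot_relation \<kappa> f g \<Longrightarrow> ASB_eq d D \<kappa> f g"
| refl: "wf_mor f \<Longrightarrow> ASB_eq d D \<kappa> f f"
| sym: "ASB_eq d D \<kappa> f g \<Longrightarrow> ASB_eq d D \<kappa> g f"
| trans: "ASB_eq d D \<kappa> f g \<Longrightarrow> ASB_eq d D \<kappa> g h \<Longrightarrow> ASB_eq d D \<kappa> f h"
| cong_comp: "ASB_eq d D \<kappa> g g' \<Longrightarrow> ASB_eq d D \<kappa> f f' \<Longrightarrow> src g = tgt f \<Longrightarrow>
    ASB_eq d D \<kappa> (g \<bullet> f) (g' \<bullet> f')"
| cong_tens: "ASB_eq d D \<kappa> f f' \<Longrightarrow> ASB_eq d D \<kappa> g g' \<Longrightarrow> ASB_eq d D \<kappa> (f \<boxtimes> g) (f' \<boxtimes> g')"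
| cong_plus: "ASB_eq d D \<kappa> f f' \<Longrightarrow> ASB_eq d D \<kappa> g g' \<Longrightarrow> src f = src g \<Longrightarrow> tgt f = tgt g \<Longrightarrow>
    ASB_eq d D \<kappa> (f \<boxplus> g) (f' \<boxplus> g')"
| cong_scal: "ASB_eq d D \<kappa> f f' \<Longrightarrow> ASB_eq d D \<kappa> (c \<star> f) (c \<star> f')"
| comp_assoc: "wf_mor (h \<bullet> g \<bullet> f) \<Longrightarrow> ASB_eq d D \<kappa> (h \<bullet> g \<bullet> f) (h \<bullet> (g \<bullet> f))"
| comp_id_left: "wf_mor f \<Longrightarrow> ASB_eq d D \<kappa> (Idm (tgt f) \<bullet> f) f"
| comp_id_right: "wf_mor f \<Longrightarrow> ASB_eq d D \<kappa> (f \<bullet> Idm (src f)) f"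
| tens_id: "ASB_eq d D \<kappa> (Idm a \<boxtimes> Idm b) (Idm (a @ b))"
| interchange: "wf_mor (g \<bullet> f) \<Longrightarrow> wf_mor (g' \<bullet> f') \<Longrightarrow>
    ASB_eq d D \<kappa> ((g \<boxtimes> g') \<bullet> (f \<boxtimes> f')) ((g \<bullet> f) \<boxtimes> (g' \<bullet> f'))"
| tens_assoc: "wf_mor (f \<boxtimes> g \<boxtimes> h) \<Longrightarrow> ASB_eq d D \<kappa> (f \<boxtimes> g \<boxtimes> h) (f \<boxtimes> (g \<boxtimes> h))"
| tens_unit_left: "wf_mor f \<Longrightarrow> ASB_eq d D \<kappa> (Idm [] \<boxtimes> f) f"
| tens_unit_right: "wf_mor f \<Longrightarrow> ASB_eq d D \<kappa> (f \<boxtimes> Idm []) f"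
| plus_assoc: "wf_mor (f \<boxplus> g \<boxplus> h) \<Longrightarrow> ASB_eq d D \<kappa> (f \<boxplus> g \<boxplus> h) (f \<boxplus> (g \<boxplus> h))"
| plus_comm: "wf_mor (f \<boxplus> g) \<Longrightarrow> ASB_eq d D \<kappa> (f \<boxplus> g) (g \<boxplus> f)"
| plus_zero: "wf_mor f \<Longrightarrow> ASB_eq d D \<kappa> (f \<boxplus> Zero (src f) (tgt f)) f"
| plus_minus: "wf_mor f \<Longrightarrow> ASB_eq d D \<kappa> (f \<boxminus> f) (Zero (src f) (tgt f))"
| scal_one: "wf_mor f \<Longrightarrow> ASB_eq d D \<kappa> (1 \<star> f) f"
| scal_scal: "wf_mor f \<Longrightarrow> ASB_eq d D \<kappa> (b \<star> c \<star> f) ((b * c) \<star> f)"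
| scal_add: "wf_mor f \<Longrightarrow> ASB_eq d D \<kappa> ((b + c) \<star> f) (b \<star> f \<boxplus> c \<star> f)"
| scal_plus: "wf_mor (f \<boxplus> g) \<Longrightarrow> ASB_eq d D \<kappa> (c \<star> (f \<boxplus> g)) (c \<star> f \<boxplus> c \<star> g)"
| comp_plus_left: "wf_mor ((g \<boxplus> g') \<bullet> f) \<Longrightarrow>
    ASB_eq d D \<kappa> ((g \<boxplus> g') \<bullet> f) (g \<bullet> f \<boxplus> g' \<bullet> f)"
| comp_plus_right: "wf_mor (g \<bullet> (f \<boxplus> f')) \<Longrightarrow>
    ASB_eq d D \<kappa> (g \<bullet> (f \<boxplus> f')) (g \<bullet> f \<boxplus> g \<bullet> f')"
| comp_scal_left: "wf_mor (g \<bullet> f) \<Longrightarrow> ASB_eq d D \<kappa> ((c \<star> g) \<bullet> f) (c \<star> (g \<bullet> f))"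
| comp_scal_right: "wf_mor (g \<bullet> f) \<Longrightarrow> ASB_eq d D \<kappa> (g \<bullet> (c \<star> f)) (c \<star> (g \<bullet> f))"
| tens_plus_left: "wf_mor ((f \<boxplus> f') \<boxtimes> g) \<Longrightarrow>
    ASB_eq d D \<kappa> ((f \<boxplus> f') \<boxtimes> g) (f \<boxtimes> g \<boxplus> f' \<boxtimes> g)"
| tens_plus_right: "wf_mor (f \<boxtimes> (g \<boxplus> g')) \<Longrightarrow>
    ASB_eq d D \<kappa> (f \<boxtimes> (g \<boxplus> g')) (f \<boxtimes> g \<boxplus> f \<boxtimes> g')"
| tens_scal_left: "wf_mor (f \<boxtimes> g) \<Longrightarrow> ASB_eq d D \<kappa> ((c \<star> f) \<boxtimes> g) (c \<star> (f \<boxtimes> g))"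
| tens_scal_right: "wf_mor (f \<boxtimes> g) \<Longrightarrow> ASB_eq d D \<kappa> (f \<boxtimes> (c \<star> g)) (c \<star> (f \<boxtimes> g))"

definition ASB_hom ::
    "complex \<Rightarrow> complex \<Rightarrow> complex \<Rightarrow> gob list \<Rightarrow> gob list \<Rightarrow> mor set set"
  where "ASB_hom d D \<kappa> a b = arrows a b // {(f, g). ASB_eq d D \<kappa> f g}"

lemma Mu'_simps [simp]:
  "src Mu' = [Spin, Vect]" "tgt Mu' = [Spin]" "wf_mor Mu'"
  by (simp_all add: Mu'_def)

lemma Delta_simps [simp]:
  "src Delta = [Spin]" "tgt Delta = [Vect, Spin]" "wf_mor Delta"
  "src Delta' = [Spin]" "tgt Delta' = [Spin, Vect]" "wf_mor Delta'"
  "src Bead = [Spin, Spin]" "tgt Bead = [Spin, Spin]" "wf_mor Bead"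
  by (simp_all add: Delta_def Delta'_def Bead_def)

lemma ASB_eq_wf:
  assumes "ASB_eq d D \<kappa> f g"
  shows "wf_mor f \<and> wf_mor g \<and> src f = src g \<and> tgt f = tgt g"
  using assms by induction (auto elim!: SB_relation.cases dot_relation.cases)

lemma ASB_eq_equiv:
  "equiv {f. wf_mor f} {(f, g). ASB_eq d D \<kappa> f g}"
  by (rule equivI) (auto intro!: refl_onI symI transI dest: ASB_eq_wf
    intro: ASB_eq.refl ASB_eq.sym ASB_eq.trans)


section \<open>Modules over a Lie algebra and tensoring with \<open>S\<close> and \<open>V\<close>\<close>

record ('g, 'a) lie_module = "(complex, 'a) module" +
  act :: "'g \<Rightarrow> 'a \<Rightarrow> 'a"

text \<open>\<open>XI I\<close> stands for the basis vector \<open>x\<^sub>I\<close> of \<open>S\<close>, \<open>EI i\<close> for the basis vector \<open>e\<^sub>i\<close> of \<open>V\<close>.\<close>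

datatype label = XI "nat set" | EI nat

text \<open>
  Given a basis \<open>B\<close> of \<open>X\<close>, every element of \<open>X \<otimes> M\<close> is \<open>\<Sum>b\<in>B. b \<otimes> m\<^sub>b\<close> for a unique family
  \<open>m\<close> in \<open>M\<close>. It is represented by \<open>Tensor m\<close>. Thus the modules with carrier in the type
  \<open>'a tens\<close> are closed under \<open>X \<otimes> -\<close> for \<open>X = S, V\<close>, and both are endofunctors of the category of
  these modules. The type \<open>'a\<close> is arbitrary; a module with carrier in \<open>'a\<close> is included through
  \<open>Pure\<close>.
\<close>

datatype 'a tens = Pure (unpure: 'a) | Tensor (component: "label \<Rightarrow> 'a tens")

primrec coord :: "label list \<Rightarrow> 'a tens \<Rightarrow> 'a tens" where
  "coord [] t = t"
| "coord (b # l) t = coord l (component t b)"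


section \<open>Clifford algebra, spin module, incarnation functor\<close>

definition sigma :: "nat \<Rightarrow> complex"
  where "sigma N = (-1) ^ (((N div 2) choose 2) + (N div 2) * N)"

definition kappa :: "nat \<Rightarrow> complex"
  where "kappa N = (-1) ^ ((N div 2) * N)"

locale spin_setting = vector_space scale
  for scale :: "complex \<Rightarrow> 'v::ab_group_add \<Rightarrow> 'v" +
  fixes \<Phi> :: "'v \<Rightarrow> 'v \<Rightarrow> complex"
    and N :: nat
    and e :: "nat \<Rightarrow> 'v"
    and \<epsilon> :: complex
  assumes N_ge_2: "2 \<le> N"
    and dim_V: "dim UNIV = N"
    and form_linear: "\<And>u. Vector_Spaces.linear scale (*) (\<Phi> u)"
    and form_sym: "\<And>u v. \<Phi> u v = \<Phi> v u"
    and form_nondegenerate: "\<And>u. (\<forall>v. \<Phi> u v = 0) \<Longrightarrow> u = 0"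
    and basis: "span (e ` {1..N}) = UNIV"
    and orthonormal: "\<And>i j. i \<in> {1..N} \<Longrightarrow> j \<in> {1..N} \<Longrightarrow> \<Phi> (e i) (e j) = (if i = j then 1 else 0)"
    and eps: "\<epsilon> = 1 \<or> \<epsilon> = -1"
begin

definition n :: nat
  where "n = N div 2"

subsection \<open>The Clifford algebra and the group \<open>G(V)\<close>\<close>

definition Cl_ideal :: "'v nc_poly set"
  where "Cl_ideal = Idl\<^bsub>free_alg UNIV\<^esub> (linear_relations UNIV (+) scale
    \<union> {letter v * letter w + letter w * letter v - const (2 * \<Phi> v w) | v w. True})"

definition Cl :: "'v nc_poly set ring"
  where "Cl = free_alg UNIV Quot Cl_ideal"

definition Cl_even :: "'v nc_poly set set"
  where "Cl_even = {Cl_ideal +>\<^bsub>free_alg UNIV\<^esub> p | p. \<forall>w\<in>Poly_Mapping.keys p. even (length w)}"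

definition Cl_odd :: "'v nc_poly set set"
  where "Cl_odd = {Cl_ideal +>\<^bsub>free_alg UNIV\<^esub> p | p. \<forall>w\<in>Poly_Mapping.keys p. odd (length w)}"

definition Cl_vec :: "'v \<Rightarrow> 'v nc_poly set"
  where "Cl_vec v = Cl_ideal +>\<^bsub>free_alg UNIV\<^esub> letter v"

text \<open>
  Reversal of words preserves the ideal, so it maps the coset of \<open>p\<close> onto the coset of the
  reversed \<open>p\<close>.
\<close>

definition Cl_rev :: "'v nc_poly set \<Rightarrow> 'v nc_poly set"
  where "Cl_rev x = reverse_words ` x"

definition Pin :: "'v nc_poly set set"
  where "Pin = {g \<in> Units Cl. g \<in> Cl_even \<union> Cl_odd
    \<and> (\<lambda>x. g \<otimes>\<^bsub>Cl\<^esub> x \<otimes>\<^bsub>Cl\<^esub> inv\<^bsub>Cl\<^esub> g) ` range Cl_vec = range Cl_vec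
    \<and> g \<otimes>\<^bsub>Cl\<^esub> Cl_rev g = \<one>\<^bsub>Cl\<^esub>}"

definition SpinGroup :: "'v nc_poly set set"
  where "SpinGroup = Pin \<inter> Cl_even"

definition GV :: "'v nc_poly set set"
  where "GV = (if even N then Pin else SpinGroup)"

definition vec_act :: "'v nc_poly set \<Rightarrow> 'v \<Rightarrow> 'v"
  where "vec_act g v = (THE w. Cl_vec w = g \<otimes>\<^bsub>Cl\<^esub> Cl_vec v \<otimes>\<^bsub>Cl\<^esub> inv\<^bsub>Cl\<^esub> g)"

subsection \<open>The Lie algebra and its enveloping algebra\<close>

definition so :: "('v \<Rightarrow> 'v) set"
  where "so = {A. Vector_Spaces.linear scale scale A \<and> (\<forall>v w. \<Phi> (A v) w + \<Phi> v (A w) = 0)}"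

definition M_op :: "'v \<Rightarrow> 'v \<Rightarrow> 'v \<Rightarrow> 'v"
  where "M_op u v w = scale (\<Phi> v w) u - scale (\<Phi> u w) v"

definition U_ideal :: "('v \<Rightarrow> 'v) nc_poly set"
  where "U_ideal = Idl\<^bsub>free_alg so\<^esub>
    (linear_relations so (\<lambda>A B v. A v + B v) (\<lambda>c A v. scale c (A v))
    \<union> {letter A * letter B - letter B * letter A - letter (\<lambda>v. A (B v) - B (A v)) | A B.
        A \<in> so \<and> B \<in> so})"

definition Ug :: "('v \<Rightarrow> 'v) nc_poly set ring"
  where "Ug = free_alg so Quot U_ideal"

definition Zg :: "('v \<Rightarrow> 'v) nc_poly set set"
  where "Zg = {z \<in> carrier Ug. \<forall>u\<in>carrier Ug. z \<otimes>\<^bsub>Ug\<^esub> u = u \<otimes>\<^bsub>Ug\<^esub> z}"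

text \<open>
  \<open>G(V)\<close> acts on \<open>\<gg>\<close> by conjugation; the induced automorphism of the free algebra preserves
  \<open>U_ideal\<close>, so that the image of a coset is a coset.
\<close>

definition Ad :: "'v nc_poly set \<Rightarrow> ('v \<Rightarrow> 'v) \<Rightarrow> ('v \<Rightarrow> 'v)"
  where "Ad g A = vec_act g \<circ> A \<circ> vec_act (inv\<^bsub>Cl\<^esub> g)"

definition Ad_U :: "'v nc_poly set \<Rightarrow> ('v \<Rightarrow> 'v) nc_poly set \<Rightarrow> ('v \<Rightarrow> 'v) nc_poly set"
  where "Ad_U g z = map_letters (Ad g) ` z"

definition Zg_invariants :: "('v \<Rightarrow> 'v) nc_poly set set"
  where "Zg_invariants = {z \<in> Zg. \<forall>g\<in>GV. Ad_U g z = z}"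

definition U_regular :: "('v \<Rightarrow> 'v, ('v \<Rightarrow> 'v) nc_poly set tens) lie_module"
  where "U_regular =
    \<lparr>carrier = Pure ` carrier Ug, mult = undefined, one = undefined, zero = Pure \<zero>\<^bsub>Ug\<^esub>,
     add = (\<lambda>s t. Pure (unpure s \<oplus>\<^bsub>Ug\<^esub> unpure t)),
     smult = (\<lambda>c t. Pure ((U_ideal +>\<^bsub>free_alg so\<^esub> const c) \<otimes>\<^bsub>Ug\<^esub> unpure t)),
     act = (\<lambda>A t. Pure ((U_ideal +>\<^bsub>free_alg so\<^esub> letter A) \<otimes>\<^bsub>Ug\<^esub> unpure t))\<rparr>"

subsection \<open>The spin module\<close>

text \<open>
  Operators on \<open>S\<close> are given by their matrices in the basis \<open>x\<^sub>I\<close>: the entry at \<open>I J\<close> is the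
  coefficient of \<open>x\<^sub>I\<close> in the image of \<open>x\<^sub>J\<close>.
\<close>

definition psi :: "nat \<Rightarrow> nat set \<Rightarrow> nat set \<Rightarrow> complex"
  where "psi i I J = (if i \<in> J \<and> I = J - {i} then (-1) ^ card {j \<in> J. j < i} else 0)"

definition psi_dag :: "nat \<Rightarrow> nat set \<Rightarrow> nat set \<Rightarrow> complex"
  where "psi_dag i I J = (if i \<notin> J \<and> I = insert i J then (-1) ^ card {j \<in> J. j < i} else 0)"

text \<open>
  Action of \<open>e\<^sub>k\<close>, from \<open>e\<^sub>2\<^sub>j\<^sub>-\<^sub>1 = \<psi>\<^sub>j + \<psi>\<^sub>j\<^sup>\<dagger>\<close> and \<open>e\<^sub>2\<^sub>j = -\<i> (\<psi>\<^sub>j - \<psi>\<^sub>j\<^sup>\<dagger>)\<close>.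
\<close>

definition e_mat :: "nat \<Rightarrow> nat set \<Rightarrow> nat set \<Rightarrow> complex"
  where "e_mat k I J =
    (if odd N \<and> k = N then (if I = J then \<epsilon> * (-1) ^ card J else 0)
     else if odd k then psi ((k + 1) div 2) I J + psi_dag ((k + 1) div 2) I J
     else - \<i> * (psi (k div 2) I J - psi_dag (k div 2) I J))"

definition mat_mult ::
    "(nat set \<Rightarrow> nat set \<Rightarrow> complex) \<Rightarrow> (nat set \<Rightarrow> nat set \<Rightarrow> complex) \<Rightarrow> nat set \<Rightarrow> nat set \<Rightarrow> complex"
  where "mat_mult P Q I J = (\<Sum>K\<in>Pow {1..n}. P I K * Q K J)"

definition upper_pairs :: "(nat \<times> nat) set"
  where "upper_pairs = {(i, j). 1 \<le> i \<and> i < j \<and> j \<le> N}"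

text \<open>
  The matrix of \<open>A \<in> \<ss>\<oo>(V)\<close> acting on \<open>S\<close>: since
  \<open>A = (\<Sum>(i, j)\<in>upper_pairs. \<Phi>(e\<^sub>i, A e\<^sub>j) M\<^bsub>e\<^sub>i,e\<^sub>j\<^esub>)\<close>, this is the linear extension of
  \<open>M\<^bsub>u,v\<^esub> \<mapsto> (uv - vu)/4\<close>.
\<close>

definition spin_rep :: "('v \<Rightarrow> 'v) \<Rightarrow> nat set \<Rightarrow> nat set \<Rightarrow> complex"
  where "spin_rep A I J = (\<Sum>(i, j)\<in>upper_pairs. \<Phi> (e i) (A (e j)) *
    ((mat_mult (e_mat i) (e_mat j) I J - mat_mult (e_mat j) (e_mat i) I J) / 4))"

subsection \<open>Linear maps between tensor words\<close>

primrec basis_of :: "gob \<Rightarrow> label set" where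
  "basis_of Spin = XI ` Pow {1..n}"
| "basis_of Vect = EI ` {1..N}"

fun rep :: "gob \<Rightarrow> ('v \<Rightarrow> 'v) \<Rightarrow> label \<Rightarrow> label \<Rightarrow> complex" where
  "rep Spin A (XI I) (XI J) = spin_rep A I J"
| "rep Vect A (EI i) (EI j) = \<Phi> (e i) (A (e j))"
| "rep _ _ _ _ = 0"

fun form :: "gob \<Rightarrow> label \<Rightarrow> label \<Rightarrow> complex" where
  "form Spin (XI I) (XI J) =
    (if J = {1..n} - I
     then (-1) ^ ((card I choose 2) + n * N * card I + card {(i, j). i \<in> I \<and> j \<in> J \<and> i > j})
     else 0)"
| "form Vect (EI i) (EI j) = \<Phi> (e i) (e j)"
| "form _ _ _ = 0"

text \<open>\<open>dual_coord X b\<close> is the coordinate vector of the left dual basis vector \<open>b\<^sup>\<or>\<close>.\<close>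

definition dual_coord :: "gob \<Rightarrow> label \<Rightarrow> label \<Rightarrow> complex"
  where "dual_coord X b = (THE f. (\<forall>c. c \<notin> basis_of X \<longrightarrow> f c = 0) \<and>
    (\<forall>y\<in>basis_of X. (\<Sum>c\<in>basis_of X. f c * form X c y) = (if b = y then 1 else 0)))"

fun mu_coeff :: "label \<Rightarrow> label \<Rightarrow> label \<Rightarrow> complex" where
  "mu_coeff (XI I) (EI k) (XI J) = e_mat k I J"
| "mu_coeff _ _ _ = 0"

primrec array :: "gob list \<Rightarrow> (label list \<Rightarrow> 'a tens) \<Rightarrow> 'a tens" where
  "array [] f = f []"
| "array (X # w) f = Tensor (\<lambda>b\<in>basis_of X. array w (\<lambda>l. f (b # l)))"

text \<open>
  \<open>first_op a b K M\<close> is \<open>K \<otimes> id\<^sub>M\<close> for the linear map \<open>K\<close> from the tensor word \<open>a\<close> to the tensor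
  word \<open>b\<close> with matrix entries \<open>K l' l\<close> (row \<open>l'\<close>, column \<open>l\<close>), and \<open>last_op a h\<close> is \<open>id\<^sub>a \<otimes> h\<close>.
\<close>

definition first_op :: "gob list \<Rightarrow> gob list \<Rightarrow> (label list \<Rightarrow> label list \<Rightarrow> complex) \<Rightarrow>
    ('v \<Rightarrow> 'v, 'a tens) lie_module \<Rightarrow> 'a tens \<Rightarrow> 'a tens"
  where "first_op a b K M t =
    array b (\<lambda>l'. \<Oplus>\<^bsub>M\<^esub>l\<in>listset (map basis_of a). K l' l \<odot>\<^bsub>M\<^esub> coord l t)"

definition last_op :: "gob list \<Rightarrow> ('a tens \<Rightarrow> 'a tens) \<Rightarrow> 'a tens \<Rightarrow> 'a tens"
  where "last_op a h t = array a (\<lambda>l. h (coord l t))"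

definition rep_op :: "gob \<Rightarrow> ('v \<Rightarrow> 'v) \<Rightarrow> ('v \<Rightarrow> 'v, 'a tens) lie_module \<Rightarrow> 'a tens \<Rightarrow> 'a tens"
  where "rep_op X A = first_op [X] [X] (\<lambda>l' l. rep X A (hd l') (hd l))"

subsection \<open>The affine incarnation functor\<close>

definition tensor_module ::
    "gob \<Rightarrow> ('v \<Rightarrow> 'v, 'a tens) lie_module \<Rightarrow> ('v \<Rightarrow> 'v, 'a tens) lie_module"
  where "tensor_module X M =
    \<lparr>carrier = Tensor ` (basis_of X \<rightarrow>\<^sub>E carrier M), mult = undefined, one = undefined,
     zero = array [X] (\<lambda>_. \<zero>\<^bsub>M\<^esub>),
     add = (\<lambda>s t. array [X] (\<lambda>l. coord l s \<oplus>\<^bsub>M\<^esub> coord l t)),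
     smult = (\<lambda>c t. array [X] (\<lambda>l. c \<odot>\<^bsub>M\<^esub> coord l t)),
     act = (\<lambda>A t. array [X] (\<lambda>l.
       coord l (rep_op X A M t) \<oplus>\<^bsub>M\<^esub> coord l (last_op [X] (act M A) t)))\<rparr>"

definition F_ob :: "gob list \<Rightarrow> ('v \<Rightarrow> 'v, 'a tens) lie_module \<Rightarrow> ('v \<Rightarrow> 'v, 'a tens) lie_module"
  where "F_ob = foldr tensor_module"

definition Omega_tilde :: "gob \<Rightarrow> ('v \<Rightarrow> 'v, 'a tens) lie_module \<Rightarrow> 'a tens \<Rightarrow> 'a tens"
  where "Omega_tilde X M t =
    (2 \<odot>\<^bsub>tensor_module X M\<^esub>
      finsum (tensor_module X M)
        (\<lambda>(i, j). rep_op X (M_op (e i) (e j)) M (last_op [X] (act M (M_op (e j) (e i))) t))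
        upper_pairs)
    \<oplus>\<^bsub>tensor_module X M\<^esub>
      finsum (tensor_module X M)
        (\<lambda>(i, j). rep_op X (M_op (e i) (e j)) M (rep_op X (M_op (e j) (e i)) M t))
        upper_pairs"

text \<open>
  \<open>F_mor f M\<close> is the component at the \<open>\<gg>\<close>-module \<open>M\<close> of the natural transformation assigned to
  \<open>f\<close>. The tensor product in the category of endofunctors is composition, so \<open>f \<boxtimes> g\<close> goes to the
  horizontal composite: apply the functor \<open>F_ob (src f)\<close> to the component of \<open>g\<close> at \<open>M\<close>, then
  take the component of \<open>f\<close> at \<open>F_ob (tgt g) M\<close>.
\<close>

primrec F_mor :: "mor \<Rightarrow> ('v \<Rightarrow> 'v, 'a tens) lie_module \<Rightarrow> 'a tens \<Rightarrow> 'a tens" where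
  "F_mor (Cap X) = first_op [X, X] [] (\<lambda>_ l. form X (l ! 0) (l ! 1))"
| "F_mor (Cup X) = first_op [] [X, X] (\<lambda>l' _. dual_coord X (l' ! 0) (l' ! 1))"
| "F_mor (Swap X Y) = first_op [X, Y] [Y, X] (\<lambda>l' l.
    if l' = rev l then (if X = Spin \<and> Y = Spin then sigma N else 1) else 0)"
| "F_mor Mu = first_op [Vect, Spin] [Spin] (\<lambda>l' l. mu_coeff (l' ! 0) (l ! 0) (l ! 1))"
| "F_mor (Dot X) = Omega_tilde X"
| "F_mor (Idm a) = (\<lambda>M t. t)"
| "F_mor (g \<bullet> f) = (\<lambda>M t. F_mor g M (F_mor f M t))"
| "F_mor (f \<boxtimes> g) = (\<lambda>M t. F_mor f (F_ob (tgt g) M) (last_op (src f) (F_mor g M) t))"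
| "F_mor (Zero a b) = (\<lambda>M t. \<zero>\<^bsub>F_ob b M\<^esub>)"
| "F_mor (f \<boxplus> g) = (\<lambda>M t. F_mor f M t \<oplus>\<^bsub>F_ob (tgt f) M\<^esub> F_mor g M t)"
| "F_mor (c \<star> f) = (\<lambda>M t. c \<odot>\<^bsub>F_ob (tgt f) M\<^esub> F_mor f M t)"

text \<open>
  An endomorphism of the identity functor is identified with the value of its component at the
  regular module on the unit of \<open>U(\<gg>)\<close>; \<open>the_elem\<close> passes to classes of morphism expressions.
\<close>

definition chi :: "mor set \<Rightarrow> ('v \<Rightarrow> 'v) nc_poly set"
  where "chi x = the_elem ((\<lambda>f. unpure (F_mor f U_regular (Pure \<one>\<^bsub>Ug\<^esub>))) ` x)"

end

end

theory Submission imports Defs "HOL-Library.Function_Algebras" begin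

text \<open>
  Families indexed by label words, with values in a complex vector space on which \<open>so\<close> acts, model
  the objects \<open>X\<^sub>1 \<otimes> \<dots> \<otimes> X\<^sub>k \<otimes> M\<close>. On them the functor becomes an explicit linear operator \<open>G f \<rho>\<close>, and
  the defining relations are identities of matrices. The operators commute with \<open>so\<close> and, up to the
  adjoint action, with \<open>G(V)\<close>; applied to the regular module this makes the image central and
  invariant. For the converse, every element of \<open>U(so)\<close> is a combination of the monomials
  \<open>W(c) = M\<^bsub>x\<^sub>1,y\<^sub>1\<^esub> \<cdots> M\<^bsub>x\<^sub>k,y\<^sub>k\<^esub>\<close>. The coefficients of an invariant can be chosen orthogonal
  to all relations between the \<open>W(c)\<close>, and are then themselves an orthogonally invariant tensor. By the
  first fundamental theorem such a tensor is a combination of pairings, i.e. comes from a morphism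
  made of caps and crossings, and composing it with \<open>k\<close> dotted cups realizes the invariant.
\<close>

text \<open>Averaging over a compact group is replaced throughout by positivity. In the basis
  \<open>e i\<close> the generators of \<open>so\<close> act on coefficient tensors by real matrices
  and the adjoint of a polarization operator is the opposite one, so the Hermitian complement of a
  stable subspace is stable. This is why coefficients orthogonal to the relations inherit
  invariance, and also why the remainder in the first fundamental theorem vanishes: one sum of
  squares is evaluated in two ways. Invariance under \<open>so\<close> alone would still admit
  determinant-like tensors. They are excluded by the elements \<open>flp a\<close> of G(V), products
  of all basis vectors except \<open>e a\<close>: up to a sign that is invisible on
  \<open>so\<close> they are reflections, and their length N - 1 is even when G(V) is the Spin
  group. Parity matters a second time: moving a Clifford word across the form on S costs a power of
  \<open>kappa N\<close>, which is 1 for the words that represent G(V). Finally, a dotted cup yields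
  a multiple of a generator plus a Casimir scalar symmetric in its two indices; the antisymmetrized
  cup \<open>D1\<close> isolates 4 times the generator.\<close>

hide_fact (open) ASB_eq.refl ASB_eq.sym ASB_eq.trans

section \<open>Orthogonal projection in finitely many complex coordinates\<close>

lemma cnj_mult_self: "cnj z * z = of_real ((cmod z)\<^sup>2)"
  by (metis complex_norm_square mult.commute of_real_power)

text \<open>Orthogonal projection of \<open>t\<close> onto the subspace \<open>P\<close> for the
  Hermitian product of the coordinates in \<open>Z\<close>. This is Gram-Schmidt by induction on
  \<open>Z\<close>: the members of \<open>P\<close> that vanish at a new coordinate \<open>z\<close>
  are supported on the old coordinates and have codimension at most one in \<open>P\<close>.\<close>

lemma orthogonal_decomposition:
  fixes P :: "('b => complex) set" and t :: "'b => complex"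
  assumes "finite Z"
    and "(\<lambda>_. 0) \<in> P" and "\<And>p q. p \<in> P ==> q \<in> P ==> (\<lambda>x. p x + q x) \<in> P"
    and "\<And>c p. p \<in> P ==> (\<lambda>x. c * p x) \<in> P"
    and "\<And>p x. p \<in> P ==> x \<notin> Z ==> p x = 0"
  shows "\<exists>p\<in>P. \<forall>u\<in>P. (\<Sum>x\<in>Z. cnj (u x) * (t x - p x)) = 0"
  using assms
proof (induction Z arbitrary: P t rule: finite_induct)
  case empty
  then show ?case by (intro bexI[of _ "\<lambda>_. 0"]) auto
next
  case (insert z Z)
  note P = insert.prems
  define P0 where "P0 = {p \<in> P. p z = 0}"
  have IH: "\<exists>p\<in>P0. \<forall>u\<in>P0. (\<Sum>x\<in>Z. cnj (u x) * (t x - p x)) = 0" for t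
  proof (rule insert.IH)
    show "p x = 0" if "p \<in> P0" "x \<notin> Z" for p x
      using P(4)[of p x] that by (auto simp: P0_def)
  qed (auto simp: P0_def intro!: P)
  have sumz: "(\<Sum>x\<in>insert z Z. f x) = f z + (\<Sum>x\<in>Z. f x)" for f :: "'b => complex"
    using insert.hyps by simp
  show ?case
  proof (cases "\<forall>p\<in>P. p z = 0")
    case True
    then have "P = P0" by (auto simp: P0_def)
    with IH[of t] obtain p where "p \<in> P" "\<forall>u\<in>P. (\<Sum>x\<in>Z. cnj (u x) * (t x - p x)) = 0" by auto
    with True show ?thesis by (intro bexI[of _ p]) (auto simp: sumz)
  next
    case False
    then obtain u0 where u0: "u0 \<in> P" "u0 z \<noteq> 0" by auto
    obtain p1 where p1: "p1 \<in> P0" "\<And>u. u \<in> P0 ==> (\<Sum>x\<in>Z. cnj (u x) * (u0 x - p1 x)) = 0"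
      using IH[of u0] by auto
    obtain p2 where p2: "p2 \<in> P0" "\<And>u. u \<in> P0 ==> (\<Sum>x\<in>Z. cnj (u x) * (t x - p2 x)) = 0"
      using IH[of t] by auto
    \<comment> \<open>Since \<open>p1\<close> vanishes at \<open>z\<close>, \<open>u1\<close> still
      does not; it is orthogonal to \<open>P0\<close> and spans \<open>P\<close> together with
      \<open>P0\<close>.\<close>
    define u1 where "u1 = (\<lambda>x. u0 x - p1 x)"
    have u1P: "u1 \<in> P"
      using P(2)[OF u0(1), of "\<lambda>x. -1 * p1 x"] P(3)[of p1 "-1"] p1(1)
      by (auto simp: u1_def P0_def)
    have u1z: "u1 z \<noteq> 0" using p1(1) u0(2) by (auto simp: u1_def P0_def)
    define s where "s = (\<lambda>u v. \<Sum>x\<in>insert z Z. cnj (u x) * v x :: complex)"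
    have s_lin: "s u (\<lambda>x. v x - c * w x) = s u v - c * s u w" for u v w c
      by (simp add: s_def sum_subtractf[symmetric] sum_distrib_left algebra_simps del: sum.insert_if sum.insert)
    have s_lin': "s (\<lambda>x. u x + c * v x) w = s u w + cnj c * s v w" for u v w c
      by (simp add: s_def sum.distrib[symmetric] sum_distrib_left algebra_simps del: sum.insert_if sum.insert)
    have nz: "s u1 u1 \<noteq> 0"
    proof -
      have eq: "s u1 u1 = of_real (\<Sum>x\<in>insert z Z. (cmod (u1 x))\<^sup>2)"
        unfolding s_def of_real_sum by (simp add: cnj_mult_self)
      have "(\<Sum>x\<in>insert z Z. (cmod (u1 x))\<^sup>2) \<ge> (cmod (u1 z))\<^sup>2"
        by (rule member_le_sum) (use insert.hyps in auto)
      moreover have "(cmod (u1 z))\<^sup>2 > 0" using u1z by simp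
      ultimately show ?thesis unfolding eq by (metis of_real_eq_0_iff not_le order_refl)
    qed
    have o1: "s u u1 = 0" if "u \<in> P0" for u
      using p1(2)[OF that] that by (simp add: s_def sumz u1_def P0_def del: sum.insert)
    have o2: "s u (\<lambda>x. t x - p2 x) = 0" if "u \<in> P0" for u
      using p2(2)[OF that] that by (simp add: s_def sumz P0_def del: sum.insert)
    \<comment> \<open>The Fourier coefficient, along \<open>u1\<close>, of what the projection to
      \<open>P0\<close> leaves over.\<close>
    define \<alpha> where "\<alpha> = s u1 (\<lambda>x. t x - p2 x) / s u1 u1"
    define p where "p = (\<lambda>x. p2 x + \<alpha> * u1 x)"
    have "p \<in> P" using P(2)[of p2 "\<lambda>x. \<alpha> * u1 x"] P(3)[OF u1P, of \<alpha>] p2(1)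
      by (auto simp: p_def P0_def)
    moreover have "s u (\<lambda>x. t x - p x) = 0" if u: "u \<in> P" for u
    proof -
      \<comment> \<open>Subtracting this multiple of \<open>u1\<close> kills the value at
        \<open>z\<close> and leaves a member of \<open>P0\<close>.\<close>
      define c where "c = u z / u1 z"
      define u' where "u' = (\<lambda>x. u x + (- c) * u1 x)"
      have "u' \<in> P" unfolding u'_def by (intro P(2) P(3) u u1P)
      then have u': "u' \<in> P0" using u1z by (simp add: P0_def u'_def c_def)
      have a: "(\<lambda>x. t x - p x) = (\<lambda>x. (t x - p2 x) - \<alpha> * u1 x)" by (simp add: p_def fun_eq_iff)
      have b: "u = (\<lambda>x. u' x + c * u1 x)" by (simp add: u'_def fun_eq_iff)
      have "s u (\<lambda>x. t x - p x) = s u' (\<lambda>x. (t x - p2 x) - \<alpha> * u1 x) + cnj c * s u1 (\<lambda>x. (t x - p2 x) - \<alpha> * u1 x)"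
        by (subst a, subst b, rule s_lin')
      also have "\<dots> = 0" unfolding s_lin o1[OF u'] o2[OF u'] using nz by (simp add: \<alpha>_def)
      finally show ?thesis .
    qed
    ultimately show ?thesis unfolding s_def by blast
  qed
qed

section \<open>Index words and polarization operators on coefficient tensors\<close>

definition words :: "'i set => nat => 'i list set"
  where "words I m = {c. set c \<subseteq> I \<and> length c = m}"

lemma words_0 [simp]: "words I 0 = {[]}" by (auto simp: words_def)

lemma finite_words [simp]: "finite I ==> finite (words I m)"
  using finite_lists_length_eq[of I m] by (simp add: words_def)

lemma sum_words_Suc: "finite I ==> (\<Sum>c\<in>words I (Suc m). f c) = (\<Sum>x\<in>I. \<Sum>c\<in>words I m. f (x # c))"
proof -
  assume fin: "finite I"
  have "words I (Suc m) = (\<lambda>(x, c). x # c) ` (I \<times> words I m)"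
    by (auto simp: words_def length_Suc_conv image_iff)
  then have "(\<Sum>c\<in>words I (Suc m). f c) = (\<Sum>(x, c)\<in>I \<times> words I m. f (x # c))"
    by (simp add: sum.reindex inj_on_def case_prod_unfold o_def)
  then show ?thesis by (simp add: sum.cartesian_product)
qed

lemma sum_words_append: "finite I ==> (\<Sum>c\<in>words I (i + k). f c) = (\<Sum>u\<in>words I i. \<Sum>v\<in>words I k. f (u @ v))"
  by (induction i arbitrary: f) (simp_all add: sum_words_Suc)

text \<open>On coefficient tensors this is the derivation action of the matrix unit that sends
  \<open>e b\<close> to \<open>e a\<close>: the value at \<open>c\<close> collects all replacements
  of a single \<open>a\<close> by \<open>b\<close>. Symmetry in \<open>a\<close> and
  \<open>b\<close> thus expresses invariance under the orthogonal Lie algebra. The target is a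
  general additive monoid because the operator is later applied to word-indexed elements of an
  algebra.\<close>

primrec polarize :: "'i => 'i => 'i list => ('i list => 'n::comm_monoid_add) => 'n" where
  "polarize a b [] = (\<lambda>t. 0)"
| "polarize a b (x # c) = (\<lambda>t. (if x = a then t (b # c) else 0) + polarize a b c (\<lambda>d. t (x # d)))"

lemma polarize_append:
  "polarize a b (u @ w) t = polarize a b u (\<lambda>u'. t (u' @ w)) + polarize a b w (\<lambda>w'. t (u @ w'))"
  by (induction u arbitrary: t) (simp_all add: add.assoc)

lemma polarize_cong:
  assumes "\<And>d. set d \<subseteq> insert b (set c) ==> length d = length c ==> t d = t' d"
  shows "polarize a b c t = polarize a b c t'"
  using assms
proof (induction c arbitrary: t t')
  case (Cons x c)
  have "polarize a b c (\<lambda>d. t (x # d)) = polarize a b c (\<lambda>d. t' (x # d))"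
    by (rule Cons.IH, rule Cons.prems) auto
  moreover have "t (b # c) = t' (b # c)" by (rule Cons.prems) auto
  ultimately show ?case by simp
qed simp

lemma polarize_nth:
  "polarize a b c t = (\<Sum>k<length c. if c ! k = a then t (c[k := b]) else 0)"
  by (induction c arbitrary: t)
    (simp_all add: sum.lessThan_Suc_shift cong: if_cong del: sum.lessThan_Suc)

lemma polarize_hom:
  assumes "h 0 = 0" "\<And>x y. h (x + y) = h x + h y"
  shows "h (polarize a b c t) = polarize a b c (\<lambda>d. h (t d))"
  by (induction c arbitrary: t) (simp_all add: assms)

lemma polarize_zero [simp]: "polarize a b c (\<lambda>_. 0) = 0"
  by (induction c) simp_all

lemma polarize_add: "polarize a b c (\<lambda>d. t d + u d) = polarize a b c t + polarize a b c u"
  by (induction c arbitrary: t u) (simp_all add: algebra_simps)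

lemma polarize_sum: "polarize a b c (\<lambda>d. \<Sum>i\<in>A. t i d) = (\<Sum>i\<in>A. polarize a b c (t i))"
  by (induction A rule: infinite_finite_induct) (simp_all add: polarize_add)

lemma polarize_diag: "polarize a a c t = of_nat (count_list c a) * (t c :: 'n::semiring_1)"
  by (induction c arbitrary: t) (simp_all add: algebra_simps)

text \<open>Opposite matrix units are transposes: a replacement made on one side is undone on the
  other. A biadditive \<open>\<beta>\<close> is allowed because the lemma serves both the Hermitian
  product of two tensors and the pairing of a tensor with algebra elements.\<close>

lemma polarize_adjoint:
  fixes \<beta> :: "'x::comm_monoid_add => 'y::comm_monoid_add => 'z::comm_monoid_add"
  assumes fin: "finite I" and ab: "a \<in> I" "b \<in> I"
    and add: "\<And>x x' y. \<beta> (x + x') y = \<beta> x y + \<beta> x' y" "\<And>x y y'. \<beta> x (y + y') = \<beta> x y + \<beta> x y'"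
    and zero: "\<And>y. \<beta> 0 y = 0" "\<And>x. \<beta> x 0 = 0"
  shows "(\<Sum>c\<in>words I m. \<beta> (polarize a b c t) (u c)) = (\<Sum>c\<in>words I m. \<beta> (t c) (polarize b a c u))"
proof (induction m arbitrary: t u)
  case (Suc m)
  have 1: "(\<Sum>x\<in>I. \<Sum>c\<in>words I m. \<beta> (if x = a then t (b # c) else 0) (u (x # c)))
     = (\<Sum>c\<in>words I m. \<beta> (t (b # c)) (u (a # c)))"
  proof -
    have "(\<Sum>x\<in>I. \<Sum>c\<in>words I m. \<beta> (if x = a then t (b # c) else 0) (u (x # c)))
      = (\<Sum>x\<in>I. if x = a then \<Sum>c\<in>words I m. \<beta> (t (b # c)) (u (a # c)) else 0)"
      by (intro sum.cong refl) (auto simp: zero)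
    then show ?thesis using fin ab by simp
  qed
  have 2: "(\<Sum>x\<in>I. \<Sum>c\<in>words I m. \<beta> (t (x # c)) (if x = b then u (a # c) else 0))
     = (\<Sum>c\<in>words I m. \<beta> (t (b # c)) (u (a # c)))"
  proof -
    have "(\<Sum>x\<in>I. \<Sum>c\<in>words I m. \<beta> (t (x # c)) (if x = b then u (a # c) else 0))
      = (\<Sum>x\<in>I. if x = b then \<Sum>c\<in>words I m. \<beta> (t (b # c)) (u (a # c)) else 0)"
      by (intro sum.cong refl) (auto simp: zero)
    then show ?thesis using fin ab by simp
  qed
  show ?case
    by (simp add: sum_words_Suc[OF fin] add sum.distrib 1 2 Suc.IH)
qed (simp add: zero)

text \<open>The sum over \<open>a\<close>, \<open>b\<close> of the squared norms of
  \<open>polarize a b\<close> applied to \<open>t\<close> is computed twice. By adjointness and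
  invariance it is the pairing of \<open>t\<close> with the sum of the operators
  \<open>polarize b a\<close> squared, which is m times the squared norm once traces vanish. On the
  other hand, the terms with \<open>a = b\<close> alone contribute at least 2m times that norm,
  because all multiplicities are even. Hence the norm is 0.\<close>

lemma traceless_invariant_vanishes:
  fixes t :: "'i list => complex"
  assumes fin: "finite I" and m: "m > 0"
    and inv: "\<And>a b c. a \<in> I ==> b \<in> I ==> c \<in> words I m ==> polarize a b c t = polarize b a c t"
    and even: "\<And>a c. a \<in> I ==> c \<in> words I m ==> t c \<noteq> 0 ==> even (count_list c a)"
    and trace: "\<And>i j c. i < j ==> j < m ==> c \<in> words I m ==> (\<Sum>a\<in>I. t (c[i := a, j := a])) = 0"
    and c: "c \<in> words I m"
  shows "t c = 0"
proof -
  have upd: "c[k := a] \<in> words I m" if "c \<in> words I m" "a \<in> I" for c k a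
    using that set_update_subset_insert[of c k a] by (auto simp: words_def)
  have trace': "(\<Sum>a\<in>I. t (c[k := a, l := a])) = 0" if "k \<noteq> l" "k < m" "l < m" "c \<in> words I m" for c k l
    using trace[of k l c] trace[of l k c] that by (cases "k < l") (auto simp: list_update_swap)
  \<comment> \<open>If the same position is replaced twice, both indices equal its letter and
    \<open>t c\<close> remains. Two different positions must carry the same letter, and the sum over
    \<open>a\<close> then is a trace.\<close>
  have twice: "(\<Sum>a\<in>I. \<Sum>b\<in>I. polarize b a c (\<lambda>d. polarize b a d t)) = of_nat m * t c" if c: "c \<in> words I m" for c
  proof -
    have len: "length c = m" and cI: "\<And>k. k < m ==> c ! k \<in> I" using c by (auto simp: words_def)
    have "(\<Sum>a\<in>I. \<Sum>b\<in>I. polarize b a c (\<lambda>d. polarize b a d t))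
      = (\<Sum>a\<in>I. \<Sum>b\<in>I. \<Sum>k<m. if c ! k = b then (\<Sum>l<m. if c[k := a] ! l = b then t (c[k := a, l := a]) else 0) else 0)"
      by (simp add: polarize_nth len cong: if_cong)
    also have "\<dots> = (\<Sum>a\<in>I. \<Sum>k<m. \<Sum>b\<in>I. if c ! k = b then (\<Sum>l<m. if c[k := a] ! l = b then t (c[k := a, l := a]) else 0) else 0)"
      by (rule sum.cong[OF refl], rule sum.swap)
    also have "\<dots> = (\<Sum>a\<in>I. \<Sum>k<m. \<Sum>l<m. if c[k := a] ! l = c ! k then t (c[k := a, l := a]) else 0)"
      by (intro sum.cong refl) (simp add: fin cI)
    also have "\<dots> = (\<Sum>k<m. \<Sum>a\<in>I. \<Sum>l<m. if c[k := a] ! l = c ! k then t (c[k := a, l := a]) else 0)"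
      by (rule sum.swap)
    also have "\<dots> = (\<Sum>k<m. \<Sum>l<m. \<Sum>a\<in>I. if c[k := a] ! l = c ! k then t (c[k := a, l := a]) else 0)"
      by (rule sum.cong[OF refl], rule sum.swap)
    also have "\<dots> = (\<Sum>k<m. \<Sum>l<m. if l = k then t c else 0)"
    proof (intro sum.cong refl)
      fix k l assume "k \<in> {..<m}" "l \<in> {..<m}"
      then have kl: "k < m" "l < m" by auto
      show "(\<Sum>a\<in>I. if c[k := a] ! l = c ! k then t (c[k := a, l := a]) else 0) = (if l = k then t c else 0)"
      proof (cases "l = k")
        case True
        have "(\<Sum>a\<in>I. if c[k := a] ! l = c ! k then t (c[k := a, l := a]) else 0)
          = (\<Sum>a\<in>I. if a = c ! k then t c else 0)"
          using kl len True by (intro sum.cong refl) auto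
        then show ?thesis using True fin cI[OF kl(1)] by simp
      next
        case False
        then have "(\<Sum>a\<in>I. if c[k := a] ! l = c ! k then t (c[k := a, l := a]) else 0)
          = (if c ! l = c ! k then \<Sum>a\<in>I. t (c[k := a, l := a]) else 0)"
          by (auto intro!: sum.cong)
        then show ?thesis using trace'[of k l c] False kl c by auto
      qed
    qed
    also have "\<dots> = of_nat m * t c" by simp
    finally show ?thesis .
  qed
  have cnjp: "cnj (polarize a b d t) = polarize a b d (\<lambda>d. cnj (t d))" for a b d
    by (rule polarize_hom) auto
  have "(\<Sum>a\<in>I. \<Sum>b\<in>I. \<Sum>c\<in>words I m. cnj (polarize a b c t) * polarize a b c t)
    = (\<Sum>a\<in>I. \<Sum>b\<in>I. \<Sum>c\<in>words I m. cnj (t c) * polarize b a c (\<lambda>d. polarize b a d t))"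
  proof (rule sum.cong[OF refl], rule sum.cong[OF refl])
    fix a b assume ab: "a \<in> I" "b \<in> I"
    have "(\<Sum>c\<in>words I m. cnj (polarize a b c t) * polarize a b c t)
      = (\<Sum>c\<in>words I m. cnj (t c) * polarize b a c (\<lambda>d. polarize a b d t))"
      unfolding cnjp by (rule polarize_adjoint[OF fin ab]) (auto simp: algebra_simps)
    \<comment> \<open>Invariance reverses the inner operator, so that an operator followed by its
      adjoint becomes the square evaluated in \<open>twice\<close>.\<close>
    also have "\<dots> = (\<Sum>c\<in>words I m. cnj (t c) * polarize b a c (\<lambda>d. polarize b a d t))"
    proof (intro sum.cong refl arg_cong2[where f = "(*)"])
      fix c assume c: "c \<in> words I m"
      show "polarize b a c (\<lambda>d. polarize a b d t) = polarize b a c (\<lambda>d. polarize b a d t)"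
        by (rule polarize_cong, rule inv) (use ab c in \<open>auto simp: words_def\<close>)
    qed
    finally show "(\<Sum>c\<in>words I m. cnj (polarize a b c t) * polarize a b c t)
      = (\<Sum>c\<in>words I m. cnj (t c) * polarize b a c (\<lambda>d. polarize b a d t))" .
  qed
  also have "\<dots> = (\<Sum>c\<in>words I m. cnj (t c) * (\<Sum>a\<in>I. \<Sum>b\<in>I. polarize b a c (\<lambda>d. polarize b a d t)))"
    by (simp add: sum_distrib_left sum.swap[of _ "words I m" I])
  also have "\<dots> = (\<Sum>c\<in>words I m. cnj (t c) * (of_nat m * t c))"
    by (intro sum.cong refl) (simp add: twice)
  also have "\<dots> = of_real (real m * (\<Sum>c\<in>words I m. (cmod (t c))\<^sup>2))"
    by (simp add: sum_distrib_left cnj_mult_self[symmetric] mult_ac del: of_real_power)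
  finally have "complex_of_real (\<Sum>a\<in>I. \<Sum>b\<in>I. \<Sum>c\<in>words I m. (cmod (polarize a b c t))\<^sup>2)
     = of_real (real m * (\<Sum>c\<in>words I m. (cmod (t c))\<^sup>2))"
    by (simp add: cnj_mult_self)
  then have total: "(\<Sum>a\<in>I. \<Sum>b\<in>I. \<Sum>c\<in>words I m. (cmod (polarize a b c t))\<^sup>2)
     = real m * (\<Sum>c\<in>words I m. (cmod (t c))\<^sup>2)"
    by (simp only: of_real_eq_iff)
  \<comment> \<open>Only the terms with equal indices are kept; there polarization multiplies by the
    multiplicity of \<open>a\<close>.\<close>
  have "(\<Sum>a\<in>I. \<Sum>c\<in>words I m. (cmod (polarize a a c t))\<^sup>2)
     \<le> (\<Sum>a\<in>I. \<Sum>b\<in>I. \<Sum>c\<in>words I m. (cmod (polarize a b c t))\<^sup>2)"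
  proof (rule sum_mono)
    fix a assume "a \<in> I"
    then show "(\<Sum>c\<in>words I m. (cmod (polarize a a c t))\<^sup>2) \<le> (\<Sum>b\<in>I. \<Sum>c\<in>words I m. (cmod (polarize a b c t))\<^sup>2)"
      by (intro member_le_sum[of a I "\<lambda>b. \<Sum>c\<in>words I m. (cmod (polarize a b c t))\<^sup>2"]) (auto simp: fin sum_nonneg)
  qed
  moreover have "(\<Sum>a\<in>I. \<Sum>c\<in>words I m. (cmod (polarize a a c t))\<^sup>2)
      \<ge> (\<Sum>a\<in>I. \<Sum>c\<in>words I m. 2 * real (count_list c a) * (cmod (t c))\<^sup>2)"
  proof (intro sum_mono)
    fix a c assume ac: "a \<in> I" "c \<in> words I m"
    have "2 * real (count_list c a) * (cmod (t c))\<^sup>2 \<le> (real (count_list c a))\<^sup>2 * (cmod (t c))\<^sup>2"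
    proof (cases "t c = 0")
      case False
      then have "even (count_list c a)" using even ac by blast
      then obtain k where "count_list c a = 2 * k" by blast
      \<comment> \<open>An even number is 0 or at least 2, so its double is at most its
        square.\<close>
      then have "2 * real (count_list c a) \<le> (real (count_list c a))\<^sup>2"
        by (cases k) (auto simp: power2_eq_square algebra_simps)
      then show ?thesis by (rule mult_right_mono) simp
    qed simp
    then show "2 * real (count_list c a) * (cmod (t c))\<^sup>2 \<le> (cmod (polarize a a c t))\<^sup>2"
      by (simp add: polarize_diag norm_mult power_mult_distrib)
  qed
  moreover have "(\<Sum>a\<in>I. \<Sum>c\<in>words I m. 2 * real (count_list c a) * (cmod (t c))\<^sup>2)
     = 2 * real m * (\<Sum>c\<in>words I m. (cmod (t c))\<^sup>2)"
  proof -
    have cnt: "(\<Sum>a\<in>I. count_list c a) = m" if "c \<in> words I m" for c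
      using sum_count_set[of c I] that fin by (auto simp: words_def)
    have "(\<Sum>a\<in>I. \<Sum>c\<in>words I m. 2 * real (count_list c a) * (cmod (t c))\<^sup>2)
      = (\<Sum>c\<in>words I m. \<Sum>a\<in>I. 2 * real (count_list c a) * (cmod (t c))\<^sup>2)" by (rule sum.swap)
    also have "\<dots> = (\<Sum>c\<in>words I m. 2 * real (\<Sum>a\<in>I. count_list c a) * (cmod (t c))\<^sup>2)"
      by (simp add: sum_distrib_left sum_distrib_right)
    also have "\<dots> = 2 * real m * (\<Sum>c\<in>words I m. (cmod (t c))\<^sup>2)"
      by (simp add: cnt sum_distrib_left mult.assoc)
    finally show ?thesis .
  qed
  ultimately have "2 * real m * (\<Sum>c\<in>words I m. (cmod (t c))\<^sup>2) \<le> real m * (\<Sum>c\<in>words I m. (cmod (t c))\<^sup>2)"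
    using total by linarith
  then have "real m * (\<Sum>c\<in>words I m. (cmod (t c))\<^sup>2) \<le> 0" by simp
  then have "(\<Sum>c\<in>words I m. (cmod (t c))\<^sup>2) \<le> 0" using m by (simp add: mult_le_0_iff)
  then have "(\<Sum>c\<in>words I m. (cmod (t c))\<^sup>2) = 0" by (meson antisym sum_nonneg zero_le_power2)
  then have "\<forall>c\<in>words I m. (cmod (t c))\<^sup>2 = 0" using fin by (subst (asm) sum_nonneg_eq_0_iff) auto
  then show ?thesis using c by auto
qed
subsection \<open>Brauer tensors\<close>

definition swap_at :: "nat => 'i list => 'i list"
  where "swap_at i c = (if Suc i < length c then take i c @ [c ! Suc i, c ! i] @ drop (i + 2) c else c)"

lemma swap_at_append: "length u = i ==> swap_at i (u @ x # y # v) = u @ y # x # v"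
  by (simp add: swap_at_def nth_append)

lemma split_at:
  assumes "Suc i < length c"
  obtains u x y v where "c = u @ x # y # v" "length u = i"
  using assms by (metis Cons_nth_drop_Suc Suc_lessD id_take_nth_drop length_take min.absorb4)

lemma swap_at_swap_at [simp]: "swap_at i (swap_at i c) = c"
proof (cases "Suc i < length c")
  case True
  then show ?thesis by (metis split_at swap_at_append)
qed (simp add: swap_at_def)

lemma swap_at_words [simp]: "swap_at i c \<in> words I m \<longleftrightarrow> c \<in> words I m"
proof (cases "Suc i < length c")
  case True
  then obtain u x y v where "c = u @ x # y # v" "length u = i" by (rule split_at)
  then show ?thesis by (auto simp: swap_at_append words_def)
qed (simp add: swap_at_def)

lemma count_swap_at [simp]: "count_list (swap_at i c) a = count_list c a"
proof (cases "Suc i < length c")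
  case True
  then obtain u x y v where "c = u @ x # y # v" "length u = i" by (rule split_at)
  then show ?thesis by (auto simp: swap_at_append count_list_append)
qed (simp add: swap_at_def)

lemma polarize_swap_at:
  "polarize a b c (\<lambda>d. t (swap_at i d)) = polarize a b (swap_at i c) t"
proof (cases "Suc i < length c")
  case True
  then obtain u x y v where c: "c = u @ x # y # v" "length u = i" by (rule split_at)
  have "polarize a b u (\<lambda>u'. t (swap_at i (u' @ x # y # v))) = polarize a b u (\<lambda>u'. t (u' @ y # x # v))"
    by (rule polarize_cong) (simp add: c swap_at_append)
  then show ?thesis using c by (simp add: polarize_append swap_at_append add_ac)
next
  case False
  have "polarize a b c (\<lambda>d. t (swap_at i d)) = polarize a b c t"
    by (rule polarize_cong) (use False in \<open>simp add: swap_at_def\<close>)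
  then show ?thesis using False by (simp add: swap_at_def)
qed

text \<open>The span of the coefficient tensors of perfect matchings, that is, of products of
  Kronecker deltas. The rules insert a delta at neighbouring positions and exchange neighbours; they
  mirror caps and crossings, so that a derivation turns into a morphism by induction.\<close>

inductive brauer :: "'i set => nat => ('i list => complex) => bool" for I where
  unit: "brauer I 0 (\<lambda>c. if c = [] then 1 else 0)"
| zero: "brauer I m (\<lambda>_. 0)"
| add: "brauer I m p ==> brauer I m q ==> brauer I m (\<lambda>c. p c + q c)"
| scale: "brauer I m p ==> brauer I m (\<lambda>c. k * p c)"
| cap: "brauer I m p ==> i \<le> m ==> brauer I (m + 2)
    (\<lambda>c. if c \<in> words I (m + 2) \<and> c ! i = c ! Suc i then p (take i c @ drop (i + 2) c) else 0)"
| swap: "brauer I m p ==> Suc i < m ==> brauer I m (\<lambda>c. p (swap_at i c))"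

lemma brauer_support: "brauer I m p ==> c \<notin> words I m ==> p c = 0"
  by (induction arbitrary: c rule: brauer.induct) auto

lemma brauer_even: "brauer I m p ==> p c \<noteq> 0 ==> even (count_list c a)"
proof (induction arbitrary: c rule: brauer.induct)
  case (cap m p i)
  from cap.prems have c: "c \<in> words I (m + 2)" "c ! i = c ! Suc i" "p (take i c @ drop (i + 2) c) \<noteq> 0"
    by (auto split: if_splits)
  have "Suc i < length c" using c(1) cap.hyps by (simp add: words_def)
  then obtain u x y v where "c = u @ x # y # v" "length u = i" by (rule split_at)
  then show ?case using c cap.IH[of "u @ v"] by (auto simp: nth_append count_list_append)
next
  case (swap m p i)
  then show ?case by (metis count_swap_at)
next
  case (add m p q)
  then show ?case by (metis add.right_neutral)
qed (auto split: if_splits)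

text \<open>The case to check is an inserted delta at letters \<open>x\<close>, \<open>y\<close>.
  Besides the polarization of the shorter tensor, it contributes one term for \<open>x = a\<close>,
  \<open>y = b\<close> and one for \<open>x = b\<close>, \<open>y = a\<close>; together they are
  symmetric in \<open>a\<close> and \<open>b\<close>.\<close>

lemma brauer_invariant:
  "brauer I m p ==> a \<in> I ==> b \<in> I ==> c \<in> words I m ==> polarize a b c p = polarize b a c p"
proof (induction arbitrary: c a b rule: brauer.induct)
  case (scale m p k)
  have "polarize a b c (\<lambda>c. k * p c) = k * polarize a b c p" for a b
    by (rule polarize_hom[symmetric]) (auto simp: algebra_simps)
  with scale show ?case by simp
next
  case (swap m p i)
  then show ?case by (simp add: polarize_swap_at)
next
  case (cap m p i)
  define T where "T = (\<lambda>c. if c \<in> words I (m + 2) \<and> c ! i = c ! Suc i then p (take i c @ drop (i + 2) c) else 0)"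
  have "Suc i < length c" using cap.prems(3) cap.hyps by (simp add: words_def)
  then obtain u x y v where c: "c = u @ x # y # v" "length u = i" by (rule split_at)
  have I: "set u \<subseteq> I" "x \<in> I" "y \<in> I" "set v \<subseteq> I" "length u + length v = m"
    using cap.prems c by (auto simp: words_def)
  have t: "T (u' @ x' # y' # v') = (if x' = y' then p (u' @ v') else 0)"
    if "length u' = i" "length v' = length v" "set u' \<subseteq> I" "set v' \<subseteq> I" "x' \<in> I" "y' \<in> I" for u' v' x' y'
    using that I c by (auto simp: T_def words_def nth_append)
  have 1: "polarize a b u (\<lambda>u'. T (u' @ x # y # v)) = (if x = y then polarize a b u (\<lambda>u'. p (u' @ v)) else 0)"
    if "b \<in> I" for a b
  proof -
    have "polarize a b u (\<lambda>u'. T (u' @ x # y # v)) = polarize a b u (\<lambda>u'. if x = y then p (u' @ v) else 0)"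
      by (rule polarize_cong, rule t) (use I c that in auto)
    then show ?thesis by simp
  qed
  have 2: "polarize a b v (\<lambda>v'. T (u @ x # y # v')) = (if x = y then polarize a b v (\<lambda>v'. p (u @ v')) else 0)"
    if "b \<in> I" for a b
  proof -
    have "polarize a b v (\<lambda>v'. T (u @ x # y # v')) = polarize a b v (\<lambda>v'. if x = y then p (u @ v') else 0)"
      by (rule polarize_cong, rule t) (use I c that in auto)
    then show ?thesis by simp
  qed
  have "polarize a b c T = (if x = y then polarize a b (u @ v) p else 0)
    + (if x = a \<and> y = b then p (u @ v) else 0) + (if x = b \<and> y = a then p (u @ v) else 0)"
    if "a \<in> I" "b \<in> I" for a b
  proof -
    have "polarize a b c T = polarize a b u (\<lambda>u'. T (u' @ x # y # v))
       + ((if x = a then T (u @ b # y # v) else 0) + ((if y = a then T (u @ x # b # v) else 0)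
       + polarize a b v (\<lambda>v'. T (u @ x # y # v'))))"
      unfolding c(1) polarize_append polarize.simps append_assoc append_Cons append_Nil by (rule refl)
    also have "T (u @ b # y # v) = (if b = y then p (u @ v) else 0)" by (rule t) (use I c that in auto)
    also have "T (u @ x # b # v) = (if x = b then p (u @ v) else 0)" by (rule t) (use I c that in auto)
    finally have "polarize a b c T = (if x = y then polarize a b u (\<lambda>u'. p (u' @ v)) else 0)
       + ((if x = a then if b = y then p (u @ v) else 0 else 0)
       + ((if y = a then if x = b then p (u @ v) else 0 else 0)
       + (if x = y then polarize a b v (\<lambda>v'. p (u @ v')) else 0)))"
      unfolding 1[OF that(2)] 2[OF that(2)] .
    then show ?thesis unfolding polarize_append
      by (cases "x = y"; cases "x = a"; cases "b = y"; cases "y = a"; cases "x = b"; simp)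
  qed
  note T = this[OF cap.prems(1,2)] this[OF cap.prems(2,1)]
  have "polarize a b (u @ v) p = polarize b a (u @ v) p"
    by (rule cap.IH) (use cap.prems I in \<open>auto simp: words_def\<close>)
  then show ?case unfolding T_def[symmetric] T by (simp add: add_ac)
qed (simp_all add: polarize_add)

text \<open>Remove from \<open>t\<close> its orthogonal projection to the Brauer tensors. A
  contraction of the remainder is an invariant with two indices fewer, hence a Brauer tensor by
  induction, and pairing the remainder with that tensor with a delta put back gives the squared norm
  of the contraction. So all traces of the remainder vanish and
  \<open>traceless_invariant_vanishes\<close> applies. Evenness of multiplicities replaces
  invariance under reflections.\<close>

theorem orthogonal_FFT:
  fixes t :: "'i list => complex"
  assumes fin: "finite I"
    and "\<And>c. c \<notin> words I m ==> t c = 0"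
    and "\<And>a b c. a \<in> I ==> b \<in> I ==> c \<in> words I m ==> polarize a b c t = polarize b a c t"
    and "\<And>a c. a \<in> I ==> t c \<noteq> 0 ==> even (count_list c a)"
  shows "brauer I m t"
  using assms(2-)
proof (induction m arbitrary: t rule: less_induct)
  case (less m)
  show ?case
  proof (cases "m = 0")
    case True
    have "t = (\<lambda>c. t [] * (if c = [] then 1 else 0))" using less.prems(1) True by (auto simp: fun_eq_iff)
    then show ?thesis using brauer.scale[OF brauer.unit, of I "t []"] True by simp
  next
    case False
    have "\<exists>p\<in>{p. brauer I m p}. \<forall>u\<in>{p. brauer I m p}. (\<Sum>c\<in>words I m. cnj (u c) * (t c - p c)) = 0"
      by (rule orthogonal_decomposition)
        (auto simp: fin intro: brauer.zero brauer.add brauer.scale brauer_support)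
    then obtain p where p: "brauer I m p" "\<And>u. brauer I m u ==> (\<Sum>c\<in>words I m. cnj (u c) * (t c - p c)) = 0"
      by auto
    \<comment> \<open>All properties of the remainder that survive a permutation of the positions;
      general members are considered so that distant traces can be moved next to each other.\<close>
    define Q where "Q = {q. (\<forall>c. c \<notin> words I m \<longrightarrow> q c = 0)
      \<and> (\<forall>a\<in>I. \<forall>b\<in>I. \<forall>c\<in>words I m. polarize a b c q = polarize b a c q)
      \<and> (\<forall>a\<in>I. \<forall>c. q c \<noteq> 0 \<longrightarrow> even (count_list c a))
      \<and> (\<forall>u. brauer I m u \<longrightarrow> (\<Sum>c\<in>words I m. cnj (u c) * q c) = 0)}"
    have swapQ: "(\<lambda>c. q (swap_at i c)) \<in> Q" if q: "q \<in> Q" and i: "Suc i < m" for q i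
    proof -
      have "(\<Sum>c\<in>words I m. cnj (u c) * q (swap_at i c)) = 0" if u: "brauer I m u" for u
      proof -
        have "(\<Sum>c\<in>words I m. cnj (u c) * q (swap_at i c)) = (\<Sum>c\<in>words I m. cnj (u (swap_at i c)) * q c)"
          by (rule sum.reindex_bij_witness[of _ "swap_at i" "swap_at i"]) auto
        also have "\<dots> = 0" using q brauer.swap[OF u i] by (auto simp: Q_def)
        finally show ?thesis .
      qed
      then show ?thesis using q by (auto simp: Q_def polarize_swap_at) (metis count_swap_at)
    qed
    have adj: "(\<Sum>a\<in>I. q (u @ a # a # v)) = 0"
      if q: "q \<in> Q" and uv: "length u + length v + 2 = m" "set u \<subseteq> I" "set v \<subseteq> I" for q u v
    proof -
      define i where "i = length u"
      define m' where "m' = m - 2"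
      have m: "m = m' + 2" "i \<le> m'" using uv by (auto simp: m'_def i_def)
      \<comment> \<open>The contraction of positions \<open>i\<close> and
        \<open>i + 1\<close>.\<close>
      define r where "r = (\<lambda>c. if c \<in> words I m' then \<Sum>a\<in>I. q (take i c @ a # a # drop i c) else 0)"
      have r_app: "r (u' @ v') = (\<Sum>a\<in>I. q (u' @ a # a # v'))"
        if "length u' = i" "length u' + length v' = m'" "set u' \<subseteq> I" "set v' \<subseteq> I" for u' v'
        using that by (simp add: r_def words_def)
      have "brauer I m' r"
      proof (rule less.IH)
        show "m' < m" using m by simp
        show "r c = 0" if "c \<notin> words I m'" for c using that by (simp add: r_def)
        show "even (count_list c a)" if a: "a \<in> I" and "r c \<noteq> 0" for a c
        proof -
          from \<open>r c \<noteq> 0\<close> obtain b where "q (take i c @ b # b # drop i c) \<noteq> 0"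
            by (auto simp: r_def split: if_splits elim: sum.not_neutral_contains_not_neutral)
          then have "even (count_list (take i c @ b # b # drop i c) a)" using q a unfolding Q_def by blast
          moreover have "count_list c a = count_list (take i c) a + count_list (drop i c) a"
            by (metis append_take_drop_id count_list_append)
          ultimately show ?thesis by (cases "a = b") (simp_all add: count_list_append)
        qed
        show "polarize a b c r = polarize b a c r" if ab: "a \<in> I" "b \<in> I" and c: "c \<in> words I m'" for a b c
        proof -
          define u1 v1 where "u1 = take i c" and "v1 = drop i c"
          have uv1: "c = u1 @ v1" "length u1 = i" "length u1 + length v1 = m'" "set u1 \<subseteq> I" "set v1 \<subseteq> I"
            using c m by (auto simp: u1_def v1_def words_def dest: in_set_takeD in_set_dropD)
          \<comment> \<open>Polarizing before the contraction also hits the contracted pair. The two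
            extra terms are exchanged by swapping \<open>a\<close> and \<open>b\<close>, so the
            contraction inherits invariance.\<close>
          have eq: "polarize a b c r + (q (u1 @ b # a # v1) + q (u1 @ a # b # v1))
             = (\<Sum>x\<in>I. polarize a b (u1 @ x # x # v1) q)"
            if ab: "a \<in> I" "b \<in> I" for a b
          proof -
            have 1: "polarize a b u1 (\<lambda>u'. r (u' @ v1)) = (\<Sum>x\<in>I. polarize a b u1 (\<lambda>u'. q (u' @ x # x # v1)))"
              unfolding polarize_sum[symmetric] by (rule polarize_cong, rule r_app) (use uv1 ab in auto)
            have 2: "polarize a b v1 (\<lambda>v'. r (u1 @ v')) = (\<Sum>x\<in>I. polarize a b v1 (\<lambda>v'. q (u1 @ x # x # v')))"
              unfolding polarize_sum[symmetric] by (rule polarize_cong, rule r_app) (use uv1 ab in auto)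
            have 3: "(\<Sum>x\<in>I. if x = a then q (u1 @ b # x # v1) else 0) = q (u1 @ b # a # v1)"
              "(\<Sum>x\<in>I. if x = a then q (u1 @ x # b # v1) else 0) = q (u1 @ a # b # v1)"
              using fin ab by simp_all
            show ?thesis
              unfolding uv1(1) polarize_append polarize.simps sum.distrib 1 2 3 by (simp add: add_ac)
          qed
          have "(\<Sum>x\<in>I. polarize a b (u1 @ x # x # v1) q) = (\<Sum>x\<in>I. polarize b a (u1 @ x # x # v1) q)"
            using q ab uv1 m by (intro sum.cong refl) (auto simp: Q_def words_def)
          with eq[OF ab] eq[OF ab(2,1)] show ?thesis by (metis add.commute add_right_cancel)
        qed
      qed
      \<comment> \<open>The Brauer tensor obtained from \<open>r\<close> by putting the delta back;
        its pairing with \<open>q\<close> is the squared norm of \<open>r\<close>.\<close>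
      define w where "w = (\<lambda>c. if c \<in> words I m \<and> c ! i = c ! Suc i then r (take i c @ drop (i + 2) c) else 0)"
      have "brauer I m w"
        using brauer.cap[OF \<open>brauer I m' r\<close>, of i] m by (simp add: w_def)
      moreover have "(\<Sum>c\<in>words I m. cnj (u c) * q c) = 0" if "brauer I m u" for u
        using q that unfolding Q_def by blast
      ultimately have "0 = (\<Sum>c\<in>words I m. cnj (w c) * q c)" by metis
      also have "\<dots> = (\<Sum>u\<in>words I i. \<Sum>c\<in>words I (2 + (m' - i)). cnj (w (u @ c)) * q (u @ c))"
      proof -
        have "i + (2 + (m' - i)) = m" using m by simp
        then show ?thesis
          using sum_words_append[OF fin, of "\<lambda>c. cnj (w c) * q c" i "2 + (m' - i)"] by (simp only:)
      qed
      also have "\<dots> = (\<Sum>u\<in>words I i. \<Sum>x\<in>I. \<Sum>y\<in>I. \<Sum>v\<in>words I (m' - i). cnj (w (u @ x # y # v)) * q (u @ x # y # v))"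
        by (simp add: sum_words_Suc[OF fin] numeral_2_eq_2)
      also have "\<dots> = (\<Sum>u\<in>words I i. \<Sum>x\<in>I. \<Sum>y\<in>I. \<Sum>v\<in>words I (m' - i).
          if y = x then cnj (r (u @ v)) * q (u @ x # x # v) else 0)"
        using m by (intro sum.cong refl) (auto simp: w_def words_def nth_append)
      also have "\<dots> = (\<Sum>u\<in>words I i. \<Sum>x\<in>I. \<Sum>v\<in>words I (m' - i). cnj (r (u @ v)) * q (u @ x # x # v))"
        by (intro sum.cong refl, subst sum.swap, intro sum.cong refl) (simp add: fin)
      also have "\<dots> = (\<Sum>u\<in>words I i. \<Sum>v\<in>words I (m' - i). cnj (r (u @ v)) * r (u @ v))"
        by (intro sum.cong refl, subst sum.swap, intro sum.cong refl)
          (use m in \<open>auto simp: r_app words_def sum_distrib_left\<close>)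
      also have "\<dots> = (\<Sum>c\<in>words I (i + (m' - i)). cnj (r c) * r c)"
        by (simp add: sum_words_append[OF fin])
      also have "\<dots> = of_real (\<Sum>c\<in>words I m'. (cmod (r c))\<^sup>2)"
        using m by (simp add: cnj_mult_self)
      finally have "(\<Sum>c\<in>words I m'. (cmod (r c))\<^sup>2) = 0" by (metis of_real_eq_0_iff)
      then have "\<forall>c\<in>words I m'. (cmod (r c))\<^sup>2 = 0" using fin by (subst (asm) sum_nonneg_eq_0_iff) auto
      moreover have "u @ v \<in> words I m'" using uv m by (auto simp: words_def)
      ultimately have "r (u @ v) = 0" by auto
      then show ?thesis using r_app[of u v] uv m by (simp add: i_def)
    qed
    \<comment> \<open>Traces over positions at distance \<open>Suc d\<close>: a transposition of
      neighbours brings the second position one step closer to the first.\<close>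
    have tr: "(\<Sum>a\<in>I. q (c[i := a, i + Suc d := a])) = 0"
      if "q \<in> Q" "i + Suc d < m" "c \<in> words I m" for q i d c
      using that
    proof (induction d arbitrary: q c)
      case 0
      then have "Suc i < length c" by (simp add: words_def)
      then obtain u x y v where c: "c = u @ x # y # v" "length u = i" by (rule split_at)
      have "c[i := a, i + Suc 0 := a] = u @ a # a # v" for a
        using c by (simp add: list_update_append)
      then show ?case using adj[OF 0(1), of u v] 0(3) c by (simp add: words_def)
    next
      case (Suc d)
      define k where "k = i + Suc d"
      have ik: "i < k" "Suc k < length c" using Suc.prems by (auto simp: k_def words_def)
      obtain u x y v where c: "c = u @ x # y # v" "length u = k" using ik(2) by (rule split_at)
      have Sk: "i + Suc (Suc d) = Suc k" by (simp add: k_def)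
      have "c[i := a, i + Suc (Suc d) := a] = swap_at k ((swap_at k c)[i := a, k := a])" for a
        unfolding Sk using ik c by (simp add: swap_at_append list_update_append)
      then have "(\<Sum>a\<in>I. q (c[i := a, i + Suc (Suc d) := a]))
        = (\<Sum>a\<in>I. (\<lambda>c. q (swap_at k c)) ((swap_at k c)[i := a, i + Suc d := a]))"
        by (simp add: k_def)
      also have "\<dots> = 0"
        by (rule Suc.IH) (use swapQ[OF Suc.prems(1), of k] Suc.prems in \<open>auto simp: k_def\<close>)
      finally show ?case .
    qed
    define q where "q = (\<lambda>c. t c - p c)"
    have q_add: "q = (\<lambda>c. t c + (-1) * p c)" by (simp add: q_def)
    have pm: "brauer I m (\<lambda>c. (-1) * p c)" by (rule brauer.scale[OF p(1)])
    have qQ: "q \<in> Q"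
    proof -
      have "polarize a b c q = polarize b a c q" if "a \<in> I" "b \<in> I" "c \<in> words I m" for a b c
        using that brauer_invariant[OF pm that] less.prems(2)[OF that] unfolding q_add by (simp only: polarize_add)
      moreover have "even (count_list c a)" if "a \<in> I" "q c \<noteq> 0" for a c
        using that less.prems(3)[of a c] brauer_even[OF p(1), of c a] by (cases "t c = 0") (auto simp: q_def)
      moreover have "q c = 0" if "c \<notin> words I m" for c
        using that less.prems(1) brauer_support[OF p(1)] by (simp add: q_def)
      ultimately show ?thesis using p(2) unfolding Q_def q_def by blast
    qed
    have "q c = 0" if c: "c \<in> words I m" for c
    proof (rule traceless_invariant_vanishes[OF fin])
      show "(\<Sum>a\<in>I. q (c[i := a, j := a])) = 0" if "i < j" "j < m" "c \<in> words I m" for i j c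
        using tr[OF qQ, of i "j - i - 1" c] that by simp
    qed (use qQ c False in \<open>auto simp: Q_def\<close>)
    moreover have "q c = 0" if "c \<notin> words I m" for c using qQ that by (simp add: Q_def)
    ultimately have "t = p" by (auto simp: fun_eq_iff q_def)
    then show ?thesis using p(1) by simp
  qed
qed

section \<open>Complex vector spaces as a type class\<close>

text \<open>A class rather than a locale, so that functions and finitely supported families with
  values in such a space are again instances and iterated tensor words keep one overloaded scalar
  multiplication.\<close>

class cvec = ab_group_add +
  fixes cscale :: "complex => 'a => 'a" (infixr "*\<^sub>c" 75)
  assumes cscale_add_right: "c *\<^sub>c (x + y) = c *\<^sub>c x + c *\<^sub>c y"
    and cscale_add_left: "(c + d) *\<^sub>c x = c *\<^sub>c x + d *\<^sub>c x"
    and cscale_cscale [simp]: "c *\<^sub>c d *\<^sub>c x = (c * d) *\<^sub>c x"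
    and cscale_one [simp]: "1 *\<^sub>c x = x"

interpretation cvec: vector_space "cscale :: complex => 'a => 'a::cvec"
  by standard (simp_all add: cscale_add_right cscale_add_left)

instantiation complex :: cvec
begin
definition cscale_complex :: "complex => complex => complex" where "cscale_complex c x = c * x"
instance by standard (simp_all add: cscale_complex_def algebra_simps)
end

instantiation "fun" :: (type, cvec) cvec
begin
definition cscale_fun :: "complex => ('a => 'b) => 'a => 'b" where "cscale_fun c f = (\<lambda>x. c *\<^sub>c f x)"
instance by standard (simp_all add: cscale_fun_def fun_eq_iff cscale_add_right cscale_add_left)
end

lemma cscale_fun_apply [simp]: "(c *\<^sub>c f) x = c *\<^sub>c f x"
  by (simp add: cscale_fun_def)

lemma sum_fun_apply [simp]: "(\<Sum>i\<in>A. f i) x = (\<Sum>i\<in>A. f i x)"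
  by (induction A rule: infinite_finite_induct) simp_all

lemmas cscale_diff_right = cvec.scale_right_diff_distrib
  and cscale_diff_left = cvec.scale_left_diff_distrib

lemma cscale_sum_right: "c *\<^sub>c (\<Sum>i\<in>A. f i :: 'a::cvec) = (\<Sum>i\<in>A. c *\<^sub>c f i)"
  by (induction A rule: infinite_finite_induct) (simp_all add: cscale_add_right)

lemma cscale_sum_left: "(\<Sum>i\<in>A. f i) *\<^sub>c (x :: 'a::cvec) = (\<Sum>i\<in>A. f i *\<^sub>c x)"
  by (induction A rule: infinite_finite_induct) (simp_all add: cscale_add_left)

lemma cscale_complex [simp]: "c *\<^sub>c (x::complex) = c * x"
  by (simp add: cscale_complex_def)

definition clin :: "('a::cvec => 'b::cvec) => bool"
  where "clin h \<longleftrightarrow> (\<forall>x y. h (x + y) = h x + h y) \<and> (\<forall>c x. h (c *\<^sub>c x) = c *\<^sub>c h x)"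

lemma clinI: "(\<And>x y. h (x + y) = h x + h y) ==> (\<And>c x. h (c *\<^sub>c x) = c *\<^sub>c h x) ==> clin h"
  by (simp add: clin_def)

lemma clin_add: "clin h ==> h (x + y) = h x + h y" by (simp add: clin_def)
lemma clin_scale: "clin h ==> h (c *\<^sub>c x) = c *\<^sub>c h x" by (simp add: clin_def)
lemma clin_0: "clin h ==> h 0 = 0" using clin_scale[of h 0 0] by simp
lemma clin_minus: "clin h ==> h (- x) = - h x" using clin_scale[of h "-1" x] by simp
lemma clin_diff: "clin h ==> h (x - y) = h x - h y" using clin_add[of h x "-y"] by (simp add: clin_minus)
lemma clin_sum: "clin h ==> h (\<Sum>i\<in>A. f i) = (\<Sum>i\<in>A. h (f i))"
  by (induction A rule: infinite_finite_induct) (simp_all add: clin_0 clin_add)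
lemma clin_comp: "clin h ==> clin k ==> clin (\<lambda>x. h (k x))" by (simp add: clin_def)
lemma clin_id: "clin (\<lambda>x. x)" by (simp add: clin_def)

lemmas clin_simps = clin_add clin_scale clin_0 clin_minus clin_diff clin_sum

section \<open>The orthogonal Lie algebra and the spin module\<close>

context spin_setting
begin

abbreviation bas :: "gob => label set" where "bas \<equiv> basis_of"

abbreviation BS :: "label set" where "BS \<equiv> basis_of Spin"

abbreviation BV :: "label set" where "BV \<equiv> basis_of Vect"

abbreviation mu :: "label => label => label => complex" where "mu \<equiv> mu_coeff"

lemma form_add_right: "\<Phi> u (v + w) = \<Phi> u v + \<Phi> u w"
  using form_linear[of u] by (simp add: Vector_Spaces.linear_iff)

lemma form_scale_right: "\<Phi> u (scale c v) = c * \<Phi> u v"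
  using form_linear[of u] by (simp add: Vector_Spaces.linear_iff)

lemma form_add_left: "\<Phi> (v + w) u = \<Phi> v u + \<Phi> w u"
  by (metis form_add_right form_sym)

lemma form_scale_left: "\<Phi> (scale c v) u = c * \<Phi> v u"
  by (metis form_scale_right form_sym)

lemma form_zero [simp]: "\<Phi> u 0 = 0" "\<Phi> 0 u = 0"
  using form_scale_right[of u 0 0] form_scale_left[of 0 0 u] by simp_all

lemma form_minus_right: "\<Phi> u (- v) = - \<Phi> u v"
  using form_add_right[of u v "-v"] by (simp add: add_eq_0_iff)

lemma form_minus_left: "\<Phi> (- v) u = - \<Phi> v u"
  by (metis form_minus_right form_sym)

lemma form_diff_right: "\<Phi> u (v - w) = \<Phi> u v - \<Phi> u w"
  using form_add_right[of u v "-w"] by (simp add: form_minus_right)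

lemma form_diff_left: "\<Phi> (v - w) u = \<Phi> v u - \<Phi> w u"
  by (metis form_diff_right form_sym)

lemma form_sum_right: "\<Phi> u (\<Sum>i\<in>A. f i) = (\<Sum>i\<in>A. \<Phi> u (f i))"
  by (induction A rule: infinite_finite_induct) (simp_all add: form_add_right)

lemma form_sum_left: "\<Phi> (\<Sum>i\<in>A. f i) u = (\<Sum>i\<in>A. \<Phi> (f i) u)"
  by (induction A rule: infinite_finite_induct) (simp_all add: form_add_left)

lemmas form_simps = form_add_right form_add_left form_scale_right form_scale_left
  form_minus_right form_minus_left form_diff_right form_diff_left form_sum_right form_sum_left

lemma eq_by_basis:
  assumes "\<And>i. i \<in> {1..N} ==> \<Phi> (e i) v = \<Phi> (e i) w"
  shows "v = w"
proof -
  have "\<Phi> x (v - w) = 0" if "x \<in> span (e ` {1..N})" for x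
    using that
  proof (rule span_induct)
    show "subspace {x. \<Phi> x (v - w) = 0}" by (auto simp: subspace_def form_simps)
    show "\<Phi> x (v - w) = 0" if "x \<in> e ` {1..N}" for x
      using that assms by (auto simp: form_simps)
  qed
  then have "v - w = 0" by (intro form_nondegenerate) (metis basis UNIV_I form_sym)
  then show ?thesis by simp
qed

lemma expand: "v = (\<Sum>i=1..N. scale (\<Phi> (e i) v) (e i))"
  by (rule eq_by_basis) (simp add: form_simps orthonormal if_distrib cong: if_cong)

lemma linear_expand:
  assumes "Vector_Spaces.linear scale scale A"
  shows "A v = (\<Sum>i=1..N. scale (\<Phi> (e i) v) (A (e i)))"
proof -
  interpret A: Vector_Spaces.linear scale scale A by fact
  show ?thesis by (subst expand[of v]) (simp add: A.sum A.scale)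
qed

lemma so_lin: assumes "A \<in> so"
  shows "A (v + w) = A v + A w" "A (scale c v) = scale c (A v)"
  using assms by (auto simp: so_def Vector_Spaces.linear_iff)

lemma so_form: "A \<in> so ==> \<Phi> (A v) w = - \<Phi> v (A w)"
  by (simp add: so_def add_eq_0_iff)

lemma soI:
  assumes "\<And>v w. A (v + w) = A v + A w" "\<And>c v. A (scale c v) = scale c (A v)"
    "\<And>v w. \<Phi> (A v) w = - \<Phi> v (A w)"
  shows "A \<in> so"
  using assms vector_space_axioms by (auto simp: so_def Vector_Spaces.linear_iff)

lemma so_expand: "A \<in> so ==> A v = (\<Sum>i=1..N. scale (\<Phi> (e i) v) (A (e i)))"
  by (rule linear_expand) (simp add: so_def)

lemma so_diff: assumes "A \<in> so" shows "A (v - w) = A v - A w"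
  using so_lin(1)[OF assms, of v "scale (-1) w"] so_lin(2)[OF assms, of "-1" w] by simp

lemma so_add: "A \<in> so ==> B \<in> so ==> (\<lambda>v. A v + B v) \<in> so"
  by (rule soI) (simp_all add: so_lin[of A] so_lin[of B] so_form[of A] so_form[of B] form_simps scale_right_distrib)

lemma so_scale: "A \<in> so ==> (\<lambda>v. scale c (A v)) \<in> so"
  by (rule soI) (simp_all add: so_lin[of A] so_form[of A] form_simps scale_right_distrib mult.commute)

lemma so_zero: "(\<lambda>v. 0) \<in> so"
  by (rule soI) simp_all

lemma so_bracket: "A \<in> so ==> B \<in> so ==> (\<lambda>v. A (B v) - B (A v)) \<in> so"
  by (rule soI) (simp_all add: so_lin[of A] so_lin[of B] so_form[of A] so_form[of B] form_simps scale_right_diff_distrib)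

lemma so_M: "M_op u v \<in> so"
  by (rule soI) (simp_all add: M_op_def form_simps scale_left_distrib scale_right_diff_distrib mult.commute form_sym)

lemma so_sum: "finite I ==> (\<And>i. i \<in> I ==> A i \<in> so) ==> (\<lambda>v. \<Sum>i\<in>I. A i v) \<in> so"
  by (induction I rule: finite_induct) (simp_all add: so_zero so_add)

abbreviation ent :: "('v => 'v) => nat => nat => complex"
  where "ent A i j \<equiv> \<Phi> (e i) (A (e j))"

lemma ent_antisym: "A \<in> so ==> ent A j i = - ent A i j"
  using so_form[of A "e i" "e j"] form_sym[of "A (e i)" "e j"] by simp

lemma ent_bracket:
  assumes "A \<in> so" "B \<in> so"
  shows "ent (\<lambda>v. A (B v) - B (A v)) i j = (\<Sum>k=1..N. ent A i k * ent B k j - ent B i k * ent A k j)"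
  by (simp add: form_simps so_expand[OF assms(1), of "B (e j)"] so_expand[OF assms(2), of "A (e j)"]
      sum_subtractf mult.commute)

lemma ent_M:
  assumes "i \<in> {1..N}" "j \<in> {1..N}" "k \<in> {1..N}" "l \<in> {1..N}"
  shows "ent (M_op (e i) (e j)) k l = (if j = l \<and> i = k then 1 else 0) - (if i = l \<and> j = k then 1 else 0)"
  unfolding M_op_def form_diff_right form_scale_right
    orthonormal[OF assms(2,4)] orthonormal[OF assms(3,1)] orthonormal[OF assms(1,4)] orthonormal[OF assms(3,2)]
  by (cases "j = l"; cases "i = k"; cases "i = l"; cases "j = k"; simp)

lemma finite_upper_pairs [simp]: "finite upper_pairs"
  by (rule finite_subset[of _ "{1..N} \<times> {1..N}"]) (auto simp: upper_pairs_def)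

text \<open>Sums over pairs with i < j are not stable under a change of orthonormal frame, sums over
  all ordered pairs are. This lemma trades one for the other.\<close>

lemma sum_upper_pairs:
  fixes f :: "nat => nat => 'b::cvec"
  assumes sym: "\<And>i j. i \<in> {1..N} ==> j \<in> {1..N} ==> f j i = f i j"
    and diag: "\<And>i. i \<in> {1..N} ==> f i i = 0"
  shows "(\<Sum>(i, j)\<in>upper_pairs. f i j) = (1/2) *\<^sub>c (\<Sum>i=1..N. \<Sum>j=1..N. f i j)"
proof -
  let ?L = "{(i, j). 1 \<le> j \<and> j < i \<and> i \<le> N}" and ?D = "{(i, j). 1 \<le> i \<and> i = j \<and> i \<le> N}"
  have sub: "?L \<subseteq> {1..N} \<times> {1..N}" "?D \<subseteq> {1..N} \<times> {1..N}" by auto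
  have fin: "finite ?L" "finite ?D"
    by (rule finite_subset[OF sub(1)], simp, rule finite_subset[OF sub(2)], simp)
  have split: "{1..N} \<times> {1..N} = upper_pairs \<union> (?L \<union> ?D)" by (auto simp: upper_pairs_def)
  have "(\<Sum>i=1..N. \<Sum>j=1..N. f i j) = (\<Sum>(i, j)\<in>{1..N} \<times> {1..N}. f i j)"
    by (simp add: sum.cartesian_product)
  also have "\<dots> = (\<Sum>(i, j)\<in>upper_pairs. f i j) + ((\<Sum>(i, j)\<in>?L. f i j) + (\<Sum>(i, j)\<in>?D. f i j))"
  proof -
    have "upper_pairs \<inter> (?L \<union> ?D) = {}" "?L \<inter> ?D = {}" by (auto simp: upper_pairs_def)
    then show ?thesis
      unfolding split using fin by (simp only: sum.union_disjoint finite_upper_pairs finite_Un)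
  qed
  also have "(\<Sum>(i, j)\<in>?L. f i j) = (\<Sum>(i, j)\<in>upper_pairs. f i j)"
    by (rule sum.reindex_bij_witness[of _ prod.swap prod.swap]) (auto simp: upper_pairs_def sym)
  also have "(\<Sum>(i, j)\<in>?D. f i j) = 0" by (rule sum.neutral) (auto simp: diag)
  finally have "(\<Sum>i=1..N. \<Sum>j=1..N. f i j) = 2 *\<^sub>c (\<Sum>(i, j)\<in>upper_pairs. f i j)"
    using cscale_add_left[of 1 1 "\<Sum>(i, j)\<in>upper_pairs. f i j"] by simp
  then show ?thesis by simp
qed

lemma so_expand_M:
  assumes A: "A \<in> so"
  shows "A = (\<lambda>v. \<Sum>i=1..N. \<Sum>j=1..N. scale (ent A i j / 2) (M_op (e i) (e j) v))"
proof
  fix v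
  show "A v = (\<Sum>i=1..N. \<Sum>j=1..N. scale (ent A i j / 2) (M_op (e i) (e j) v))"
  proof (rule eq_by_basis)
    fix k assume k: "k \<in> {1..N}"
    have "\<Phi> (e k) (\<Sum>i=1..N. \<Sum>j=1..N. scale (ent A i j / 2) (M_op (e i) (e j) v))
      = (\<Sum>i=1..N. \<Sum>j=1..N. (if i = k then ent A i j / 2 * \<Phi> (e j) v else 0) - (if j = k then ent A i j / 2 * \<Phi> (e i) v else 0))"
      unfolding form_sum_right
    proof (intro sum.cong refl)
      fix i j assume ij: "i \<in> {1..N}" "j \<in> {1..N}"
      have "\<Phi> (e k) (M_op (e i) (e j) v) = \<Phi> (e j) v * (if k = i then 1 else 0) - \<Phi> (e i) v * (if k = j then 1 else 0)"
        using k ij by (simp only: M_op_def form_diff_right form_scale_right orthonormal)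
      then show "\<Phi> (e k) (scale (ent A i j / 2) (M_op (e i) (e j) v))
        = (if i = k then ent A i j / 2 * \<Phi> (e j) v else 0) - (if j = k then ent A i j / 2 * \<Phi> (e i) v else 0)"
        by (auto simp: form_scale_right)
    qed
    also have "\<dots> = (\<Sum>j=1..N. ent A k j / 2 * \<Phi> (e j) v) - (\<Sum>i=1..N. ent A i k / 2 * \<Phi> (e i) v)"
    proof -
      have "(\<Sum>i=1..N. \<Sum>j=1..N. if i = k then ent A i j / 2 * \<Phi> (e j) v else 0)
        = (\<Sum>i=1..N. if i = k then \<Sum>j=1..N. ent A k j / 2 * \<Phi> (e j) v else 0)"
        by (intro sum.cong refl) auto
      then show ?thesis using k by (simp add: sum_subtractf)
    qed
    also have "(\<Sum>i=1..N. ent A i k / 2 * \<Phi> (e i) v) = (\<Sum>i=1..N. - (ent A k i / 2 * \<Phi> (e i) v))"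
    proof (rule sum.cong[OF refl])
      fix i show "ent A i k / 2 * \<Phi> (e i) v = - (ent A k i / 2 * \<Phi> (e i) v)"
        using ent_antisym[OF A, of i k] by simp
    qed
    also have "(\<Sum>j=1..N. ent A k j / 2 * \<Phi> (e j) v) - (\<Sum>i=1..N. - (ent A k i / 2 * \<Phi> (e i) v))
       = (\<Sum>j=1..N. ent A k j * \<Phi> (e j) v)"
      unfolding sum_subtractf[symmetric] by (intro sum.cong refl) simp
    also have "\<dots> = \<Phi> (e k) (A v)"
      by (subst so_expand[OF A]) (auto simp: form_simps mult.commute intro!: sum.cong)
    finally show "\<Phi> (e k) (A v) = \<Phi> (e k) (\<Sum>i=1..N. \<Sum>j=1..N. scale (ent A i j / 2) (M_op (e i) (e j) v))" by simp
  qed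
qed

end

section \<open>Signs of the fermionic operators on the exterior basis\<close>

definition flip :: "nat => nat set => nat set"
  where "flip j J = (if j \<in> J then J - {j} else insert j J)"

definition ksign :: "nat => nat set => complex"
  where "ksign j J = (-1) ^ card {i \<in> J. i < j}"

lemma flip_flip [simp]: "flip j (flip j J) = J" by (auto simp: flip_def)
lemma flip_commute: "flip i (flip j J) = flip j (flip i J)" by (auto simp: flip_def)
lemma in_flip [simp]: "i \<in> flip j J \<longleftrightarrow> (if i = j then i \<notin> J else i \<in> J)" by (auto simp: flip_def)
lemma finite_flip [simp]: "finite (flip j J) \<longleftrightarrow> finite J" by (auto simp: flip_def)

lemma parity_card_flip:
  assumes "finite J" shows "(-1::complex) ^ card (flip j J) = - ((-1) ^ card J)"
proof (cases "j \<in> J")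
  case True
  then have "card J = Suc (card (J - {j}))" using card_Suc_Diff1[of J j] assms by simp
  then have "(-1::complex) ^ card J = - ((-1) ^ card (J - {j}))" by (simp only: power_Suc) simp
  then show ?thesis using True by (simp only: flip_def if_True minus_minus)
qed (simp add: flip_def assms)

lemma ksign_flip: "finite J ==> ksign j (flip i J) = (if i < j then - ksign j J else ksign j J)"
proof -
  assume fin: "finite J"
  have "{x \<in> flip i J. x < j} = (if i < j then flip i {x \<in> J. x < j} else {x \<in> J. x < j})"
    by (auto simp: flip_def)
  then show ?thesis using fin parity_card_flip[of "{x \<in> J. x < j}" i] by (simp add: ksign_def)
qed

lemma ksign_sq [simp]: "ksign j J * ksign j J = 1"
  by (simp add: ksign_def power_add[symmetric] mult_2[symmetric] power_mult)

context spin_setting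
begin

text \<open>Each \<open>e k\<close> acts by a monomial matrix: it sends the basis vector of
  \<open>J\<close> to that of \<open>tg k J\<close>, with the scalar \<open>eta k J\<close> defined
  next. The indices 2j - 1 and 2j both flip the mode j; the last basis vector for odd
  \<open>N\<close> acts diagonally through the parity of \<open>J\<close>.\<close>

definition tg :: "nat => nat set => nat set"
  where "tg k J = (if odd N \<and> k = N then J else flip ((k + 1) div 2) J)"

definition eta :: "nat => nat set => complex"
  where "eta k J = (if odd N \<and> k = N then \<epsilon> * (-1) ^ card J
    else if odd k then ksign ((k + 1) div 2) J
    else if k div 2 \<in> J then - \<i> * ksign ((k + 1) div 2) J else \<i> * ksign ((k + 1) div 2) J)"

lemma eps_sq [simp]: "\<epsilon> * \<epsilon> = 1" using eps by auto

lemma e_mat_eta: "e_mat k I J = (if I = tg k J then eta k J else 0)"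
  by (auto simp: e_mat_def eta_def tg_def psi_def psi_dag_def flip_def ksign_def)

lemma tg_tg [simp]: "tg k (tg k J) = J" by (simp add: tg_def)
lemma tg_commute: "tg k (tg l J) = tg l (tg k J)" by (simp add: tg_def flip_commute)
lemma tg_eq_iff: "I = tg k J \<longleftrightarrow> J = tg k I" by auto

lemma finite_tg [simp]: "finite (tg k J) \<longleftrightarrow> finite J" by (simp add: tg_def)

lemma tg_Z: assumes "k \<in> {1..N}" "J \<subseteq> {1..n}" shows "tg k J \<subseteq> {1..n}"
proof (cases "odd N \<and> k = N")
  case False
  then have "(k + 1) div 2 \<in> {1..n}" using assms(1) unfolding n_def by (auto; presburger)
  then show ?thesis using assms(2) False by (auto simp: tg_def flip_def)
qed (use assms in \<open>simp add: tg_def\<close>)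

definition ephase :: "nat => bool => complex"
  where "ephase k b = (if odd k then 1 else if b then - \<i> else \<i>)"

lemma eta_special: "odd N \<and> k = N ==> eta k J = \<epsilon> * (-1) ^ card J" "odd N \<and> k = N ==> tg k J = J"
  by (simp_all add: eta_def tg_def)

lemma eta_normal:
  assumes "\<not> (odd N \<and> k = N)"
  shows "eta k J = ephase k ((k + 1) div 2 \<in> J) * ksign ((k + 1) div 2) J" "tg k J = flip ((k + 1) div 2) J"
proof -
  have "even k ==> (k + 1) div 2 = k div 2" by presburger
  then show "eta k J = ephase k ((k + 1) div 2 \<in> J) * ksign ((k + 1) div 2) J"
    using assms by (auto simp: eta_def ephase_def)
  show "tg k J = flip ((k + 1) div 2) J" using assms by (auto simp: tg_def)
qed

lemma ephase_mult: "ephase k (\<not> b) * ephase k b = 1" by (simp add: ephase_def)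

lemma ephase_not: "even k ==> ephase k (\<not> b) = - ephase k b" by (simp add: ephase_def)

lemma eta_sq: assumes "finite J" shows "eta k (tg k J) * eta k J = 1"
proof (cases "odd N \<and> k = N")
  case True
  have "(\<epsilon> * (-1) ^ card J) * (\<epsilon> * (-1) ^ card J) = (\<epsilon> * \<epsilon>) * ((-1) ^ card J * (-1) ^ card J)"
    by (simp only: mult_ac)
  also have "\<dots> = 1" by (simp add: power_add[symmetric] mult_2[symmetric] power_mult)
  finally show ?thesis unfolding eta_special[OF True] .
next
  case False
  have r: "(a * s) * (b * s) = (a * b) * (s * s)" for a b s :: complex by (simp only: mult_ac)
  show ?thesis unfolding eta_normal[OF False]
    unfolding ksign_flip[OF assms] in_flip by (simp only: less_irrefl if_False if_True simp_thms) (subst r, simp only: ephase_mult ksign_sq mult_1)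
qed

text \<open>Exactly one of the two factors feels the other. For different modes the sign of the
  higher mode counts one element more or less; within one mode the phase of the even index depends
  on membership; the diagonal operator sees the changed parity of \<open>J\<close>.\<close>

lemma eta_anti:
  assumes fin: "finite J" and kl: "k \<noteq> l"
  shows "eta k (tg l J) * eta l J = - (eta l (tg k J) * eta k J)"
proof -
  have main: "eta k (tg l J) * eta l J = - (eta l (tg k J) * eta k J)"
    if "\<not> (odd N \<and> k = N)" and "odd N \<and> l = N \<or> (k + 1) div 2 < (l + 1) div 2
      \<or> odd k \<and> even l \<and> (k + 1) div 2 = (l + 1) div 2" for k l
  proof (cases "odd N \<and> l = N")
    case True
    show ?thesis unfolding eta_special[OF True] eta_normal[OF that(1)] using fin
      by (simp add: parity_card_flip)
  next
    case False
    show ?thesis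
    proof (cases "(k + 1) div 2 < (l + 1) div 2")
      case True
      then have ne: "(k + 1) div 2 \<noteq> (l + 1) div 2" "\<not> (l + 1) div 2 < (k + 1) div 2" by linarith+
      show ?thesis unfolding eta_normal[OF that(1)] eta_normal[OF False] ksign_flip[OF fin] in_flip
        using True ne by (simp only: if_True if_False ne(1) ne(1)[symmetric] ) simp
    next
      case lt: False
      then have eq: "(l + 1) div 2 = (k + 1) div 2" and k: "odd k" and l: "even l"
        using that(2) False by auto
      show ?thesis unfolding eta_normal[OF that(1)] eta_normal[OF False] ksign_flip[OF fin] in_flip eq
        using k by (simp only: ephase_not[OF l] less_irrefl if_True if_False HOL.simp_thms) (simp add: ephase_def)
    qed
  qed
  \<comment> \<open>Distinct indices of the same mode have opposite parities, so one of the two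
    orders of \<open>k\<close> and \<open>l\<close> falls under \<open>main\<close>.\<close>
  have "odd k \<and> even l \<or> even k \<and> odd l" if "(k + 1) div 2 = (l + 1) div 2"
    using that kl by presburger
  then consider "\<not> (odd N \<and> k = N)" "odd N \<and> l = N \<or> (k + 1) div 2 < (l + 1) div 2
      \<or> odd k \<and> even l \<and> (k + 1) div 2 = (l + 1) div 2"
    | "\<not> (odd N \<and> l = N)" "odd N \<and> k = N \<or> (l + 1) div 2 < (k + 1) div 2
      \<or> odd l \<and> even k \<and> (l + 1) div 2 = (k + 1) div 2"
    using kl by (metis linorder_neqE_nat)
  then show ?thesis
  proof cases
    case 1 then show ?thesis by (rule main)
  next
    case 2 from main[OF this] show ?thesis by simp
  qed
qed

section \<open>Clifford operators and the spin representation on coefficient functions\<close>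

abbreviation Z :: "nat set set" where "Z \<equiv> Pow {1..n}"

lemma Z_finite: "J \<in> Z ==> finite J" using finite_subset[of J "{1..n}"] by simp

definition mo :: "(nat set => nat set => complex) => (nat set => complex) => nat set => complex"
  where "mo P f I = (if I \<in> Z then \<Sum>J\<in>Z. P I J * f J else 0)"

text \<open>Coefficient functions are defined on all sets of numbers. Cutting them down to subsets
  of \<open>{1..n}\<close> takes the place of the identity of S in the operator identities
  below.\<close>

definition rz :: "(nat set => complex) => nat set => complex"
  where "rz f I = (if I \<in> Z then f I else 0)"

lemma clin_mo: "clin (mo P)"
  by (rule clinI) (auto simp: mo_def fun_eq_iff sum.distrib sum_distrib_left algebra_simps)

lemma rz_mo [simp]: "rz (mo P f) = mo P f" by (simp add: rz_def mo_def fun_eq_iff)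
lemma mo_rz [simp]: "mo P (rz f) = mo P f"
proof -
  have "(\<Sum>J\<in>Z. P I J * rz f J) = (\<Sum>J\<in>Z. P I J * f J)" for I
    by (intro sum.cong refl) (auto simp: rz_def)
  then show ?thesis by (simp only: mo_def fun_eq_iff) simp
qed

lemma clin_rz: "clin rz" by (rule clinI) (auto simp: rz_def fun_eq_iff)

lemma mo_mult: "mo (mat_mult P Q) f = mo P (mo Q f)"
proof
  fix I
  have "(\<Sum>J\<in>Z. mat_mult P Q I J * f J) = (\<Sum>J\<in>Z. \<Sum>K\<in>Z. P I K * (Q K J * f J))"
    by (simp add: mat_mult_def sum_distrib_right mult.assoc)
  also have "\<dots> = (\<Sum>K\<in>Z. \<Sum>J\<in>Z. P I K * (Q K J * f J))" by (rule sum.swap)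
  also have "\<dots> = (\<Sum>K\<in>Z. P I K * mo Q f K)"
    by (intro sum.cong refl) (simp add: mo_def sum_distrib_left)
  finally show "mo (mat_mult P Q) f I = mo P (mo Q f) I" by (simp add: mo_def)
qed

abbreviation del :: "nat set => nat set => complex" where "del J \<equiv> (\<lambda>I. if I = J then 1 else 0)"

lemma mo_del: "I \<in> Z ==> J \<in> Z ==> mo P (del J) I = P I J"
  by (simp add: mo_def if_distrib cong: if_cong)

definition EE :: "nat => (nat set => complex) => nat set => complex"
  where "EE k = mo (e_mat k)"

lemma clin_EE: "clin (EE k)" by (simp add: EE_def clin_mo)

lemma rz_EE [simp]: "rz (EE k f) = EE k f" "EE k (rz f) = EE k f" by (simp_all add: EE_def)

lemma EE_apply:
  assumes "k \<in> {1..N}" "I \<in> Z"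
  shows "EE k f I = eta k (tg k I) * f (tg k I)"
proof -
  have t: "tg k I \<in> Z" using tg_Z[OF assms(1)] assms(2) by blast
  have "EE k f I = (\<Sum>J\<in>Z. if J = tg k I then eta k J * f J else 0)"
    unfolding EE_def mo_def if_P[OF assms(2)]
    by (rule sum.cong[OF refl]) (simp add: e_mat_eta tg_eq_iff[of I])
  also have "\<dots> = eta k (tg k I) * f (tg k I)" using t by (subst sum.delta) auto
  finally show ?thesis .
qed

lemma EE_clifford:
  assumes k: "k \<in> {1..N}" and l: "l \<in> {1..N}"
  shows "EE k (EE l f) = (if k = l then 2 else 0) *\<^sub>c rz f - EE l (EE k f)"
proof
  fix I
  show "EE k (EE l f) I = ((if k = l then 2 else 0) *\<^sub>c rz f - EE l (EE k f)) I"
  proof (cases "I \<in> Z")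
    case True
    have fin: "finite I" using Z_finite True by blast
    have t: "tg k I \<in> Z" "tg l I \<in> Z" using tg_Z[OF k] tg_Z[OF l] True by blast+
    show ?thesis
    proof (cases "k = l")
      case True
      have "EE k (EE k f) I = (eta k (tg k I) * eta k I) * f I"
        using EE_apply[OF k \<open>I \<in> Z\<close>] EE_apply[OF k t(1)] by simp
      then have "EE k (EE k f) I = f I" by (simp add: eta_sq[OF fin])
      then show ?thesis using True \<open>I \<in> Z\<close> by (simp add: rz_def)
    next
      case False
      have "EE k (EE l f) I = (eta k (tg k I) * eta l (tg l (tg k I))) * f (tg l (tg k I))"
        using EE_apply[OF k \<open>I \<in> Z\<close>] EE_apply[OF l t(1)] by simp
      also have "\<dots> = - (eta l (tg l I) * eta k (tg l (tg k I))) * f (tg l (tg k I))"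
        using eta_anti[of "tg l (tg k I)" k l] fin False by (simp add: tg_commute[of k l])
      also have "\<dots> = - EE l (EE k f) I"
        using EE_apply[OF l \<open>I \<in> Z\<close>, of "EE k f"] EE_apply[OF k t(2), of f] by (simp add: tg_commute[of k l])
      finally show ?thesis using False by simp
    qed
  qed (simp add: rz_def EE_def mo_def)
qed

lemmas mo_simps = clin_simps[OF clin_mo]
lemmas EE_simps = clin_simps[OF clin_EE]

text \<open>The entries of \<open>A\<close> are antisymmetric, so the commutator summed over i < j
  equals half of its sum over all pairs, and its two halves coincide after renaming indices. The
  formula without commutators is what later computations use.\<close>

lemma mo_spin_rep:
  assumes A: "A \<in> so"
  shows "mo (spin_rep A) f = (\<Sum>i=1..N. \<Sum>j=1..N. (ent A i j / 4) *\<^sub>c EE i (EE j f))"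
proof -
  have "mo (spin_rep A) f = (\<Sum>(i, j)\<in>upper_pairs. (ent A i j / 4) *\<^sub>c (EE i (EE j f) - EE j (EE i f)))"
  proof
    fix I
    have "mo (spin_rep A) f I = (\<Sum>(i, j)\<in>upper_pairs. (ent A i j / 4) * (mo (mat_mult (e_mat i) (e_mat j)) f I - mo (mat_mult (e_mat j) (e_mat i)) f I))"
    proof (cases "I \<in> Z")
      case True
      have "mo (spin_rep A) f I = (\<Sum>J\<in>Z. \<Sum>p\<in>upper_pairs. (case p of (i, j) =>
          (ent A i j / 4) * (mat_mult (e_mat i) (e_mat j) I J * f J - mat_mult (e_mat j) (e_mat i) I J * f J)))"
        unfolding mo_def if_P[OF True] spin_rep_def sum_distrib_right
        by (intro sum.cong refl) (auto simp: algebra_simps diff_divide_distrib)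
      also have "\<dots> = (\<Sum>p\<in>upper_pairs. \<Sum>J\<in>Z. (case p of (i, j) =>
          (ent A i j / 4) * (mat_mult (e_mat i) (e_mat j) I J * f J - mat_mult (e_mat j) (e_mat i) I J * f J)))"
        by (rule sum.swap)
      finally show ?thesis unfolding mo_def if_P[OF True]
        by (simp add: case_prod_unfold sum_distrib_left sum_subtractf[symmetric])
    qed (simp add: mo_def case_prod_unfold)
    then show "mo (spin_rep A) f I = (\<Sum>(i, j)\<in>upper_pairs. (ent A i j / 4) *\<^sub>c (EE i (EE j f) - EE j (EE i f))) I"
      by (simp add: case_prod_unfold mo_mult EE_def)
  qed
  also have "\<dots> = (1/2) *\<^sub>c (\<Sum>i=1..N. \<Sum>j=1..N. (ent A i j / 4) *\<^sub>c (EE i (EE j f) - EE j (EE i f)))"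
  proof (rule sum_upper_pairs)
    fix i j
    have "(ent A j i / 4) = - (ent A i j / 4)" using ent_antisym[OF A, of j i] by simp
    then show "(ent A j i / 4) *\<^sub>c (EE j (EE i f) - EE i (EE j f)) = (ent A i j / 4) *\<^sub>c (EE i (EE j f) - EE j (EE i f))"
      by (simp only: cvec.scale_minus_left cvec.scale_right_diff_distrib) simp
  qed simp
  also have "(\<Sum>i=1..N. \<Sum>j=1..N. (ent A i j / 4) *\<^sub>c (EE i (EE j f) - EE j (EE i f)))
    = (\<Sum>i=1..N. \<Sum>j=1..N. (ent A i j / 4) *\<^sub>c EE i (EE j f)) - (\<Sum>i=1..N. \<Sum>j=1..N. (ent A i j / 4) *\<^sub>c EE j (EE i f))"
    by (simp add: cscale_diff_right sum_subtractf)
  also have "(\<Sum>i=1..N. \<Sum>j=1..N. (ent A i j / 4) *\<^sub>c EE j (EE i f)) = (\<Sum>j=1..N. \<Sum>i=1..N. (ent A i j / 4) *\<^sub>c EE j (EE i f))"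
    by (rule sum.swap)
  also have "\<dots> = (\<Sum>j=1..N. \<Sum>i=1..N. - ((ent A j i / 4) *\<^sub>c EE j (EE i f)))"
  proof (intro sum.cong refl)
    fix i j
    have "(ent A i j / 4) = - (ent A j i / 4)" using ent_antisym[OF A, of i j] by simp
    then show "(ent A i j / 4) *\<^sub>c EE j (EE i f) = - ((ent A j i / 4) *\<^sub>c EE j (EE i f))"
      by (simp only: cvec.scale_minus_left)
  qed
  also have "(1/2) *\<^sub>c ((\<Sum>i=1..N. \<Sum>j=1..N. (ent A i j / 4) *\<^sub>c EE i (EE j f)) -
     (\<Sum>j=1..N. \<Sum>i=1..N. - ((ent A j i / 4) *\<^sub>c EE j (EE i f))))
     = (\<Sum>i=1..N. \<Sum>j=1..N. (ent A i j / 4) *\<^sub>c EE i (EE j f))" (is "_ *\<^sub>c (?S - _) = _")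
  proof -
    have "(1/2) *\<^sub>c (?S + ?S) = (1/2) *\<^sub>c (2 *\<^sub>c ?S)" using cscale_add_left[of 1 1 ?S] by (simp only: cscale_one one_add_one)
    then show ?thesis by (simp add: sum_negf)
  qed
  finally show ?thesis .
qed

text \<open>The commutator of the spin action of \<open>A\<close> with Clifford multiplication by
  \<open>e k\<close> is multiplication by \<open>A (e k)\<close>. Carrying \<open>EE k\<close>
  through a product of two generators by the Clifford relation leaves two terms, equal by
  antisymmetry of the entries.\<close>

lemma spin_rep_EE:
  assumes A: "A \<in> so" and k: "k \<in> {1..N}"
  shows "mo (spin_rep A) (EE k f) = EE k (mo (spin_rep A) f) + (\<Sum>i=1..N. ent A i k *\<^sub>c EE i f)"
proof -
  have E3: "EE i (EE j (EE k f)) = (if j = k then 2 *\<^sub>c EE i f else 0) - (if i = k then 2 *\<^sub>c EE j f else 0) + EE k (EE i (EE j f))"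
    if "i \<in> {1..N}" "j \<in> {1..N}" for i j
    unfolding EE_clifford[OF that(2) k] EE_simps EE_clifford[OF that(1) k, of "EE j f"] rz_EE by simp
  have "mo (spin_rep A) (EE k f) = (\<Sum>i=1..N. \<Sum>j=1..N. (ent A i j / 4) *\<^sub>c
     ((if j = k then 2 *\<^sub>c EE i f else 0) - (if i = k then 2 *\<^sub>c EE j f else 0) + EE k (EE i (EE j f))))"
    unfolding mo_spin_rep[OF A] by (intro sum.cong refl) (simp only: E3)
  also have "\<dots> = (\<Sum>i=1..N. \<Sum>j=1..N. if j = k then (ent A i j / 2) *\<^sub>c EE i f else 0)
    - (\<Sum>i=1..N. \<Sum>j=1..N. if i = k then (ent A i j / 2) *\<^sub>c EE j f else 0)
    + EE k (mo (spin_rep A) f)"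
    unfolding mo_spin_rep[OF A] EE_simps sum_subtractf[symmetric] sum.distrib[symmetric]
    by (intro sum.cong refl) (simp add: cscale_add_right cscale_diff_right)
  also have "(\<Sum>i=1..N. \<Sum>j=1..N. if j = k then (ent A i j / 2) *\<^sub>c EE i f else 0) = (\<Sum>i=1..N. (ent A i k / 2) *\<^sub>c EE i f)"
    using k by simp
  also have "(\<Sum>i=1..N. \<Sum>j=1..N. if i = k then (ent A i j / 2) *\<^sub>c EE j f else 0)
     = (\<Sum>j=1..N. \<Sum>i=1..N. if i = k then (ent A i j / 2) *\<^sub>c EE j f else 0)" by (rule sum.swap)
  also have "\<dots> = (\<Sum>j=1..N. (ent A k j / 2) *\<^sub>c EE j f)" using k by simp
  also have "\<dots> = (\<Sum>j=1..N. - ((ent A j k / 2) *\<^sub>c EE j f))"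
  proof (intro sum.cong refl)
    fix j
    have "ent A k j / 2 = - (ent A j k / 2)" using ent_antisym[OF A, of k j] by simp
    then show "(ent A k j / 2) *\<^sub>c EE j f = - ((ent A j k / 2) *\<^sub>c EE j f)" by (simp only: cvec.scale_minus_left)
  qed
  also have "(\<Sum>i=1..N. (ent A i k / 2) *\<^sub>c EE i f) - (\<Sum>j=1..N. - ((ent A j k / 2) *\<^sub>c EE j f)) = (\<Sum>i=1..N. ent A i k *\<^sub>c EE i f)"
    unfolding sum_subtractf[symmetric] diff_minus_eq_add cscale_add_left[symmetric] by simp
  finally show ?thesis by (simp only: add.commute)
qed

text \<open>Writing the action of \<open>B\<close> as a quadratic expression in Clifford generators
  and moving \<open>A\<close> through both generators by \<open>spin_rep_EE\<close> produces the
  matrix commutator in the coefficients.\<close>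

lemma spin_rep_bracket:
  assumes A: "A \<in> so" and B: "B \<in> so"
  shows "mo (spin_rep (\<lambda>v. A (B v) - B (A v))) f
    = mo (spin_rep A) (mo (spin_rep B) f) - mo (spin_rep B) (mo (spin_rep A) f)"
proof -
  define F where "F i j = EE i (EE j f)" for i j
  have 1: "mo (spin_rep A) (EE i (EE j f)) = EE i (EE j (mo (spin_rep A) f)) +
     ((\<Sum>k=1..N. ent A k j *\<^sub>c F i k) + (\<Sum>k=1..N. ent A k i *\<^sub>c F k j))"
    if "i \<in> {1..N}" "j \<in> {1..N}" for i j
    unfolding spin_rep_EE[OF A that(1)] spin_rep_EE[OF A that(2)] EE_simps F_def by (simp add: add.assoc)
  have "mo (spin_rep A) (mo (spin_rep B) f) = (\<Sum>i=1..N. \<Sum>j=1..N. (ent B i j / 4) *\<^sub>c (EE i (EE j (mo (spin_rep A) f)) +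
     ((\<Sum>k=1..N. ent A k j *\<^sub>c F i k) + (\<Sum>k=1..N. ent A k i *\<^sub>c F k j))))"
    unfolding mo_spin_rep[OF B, of f] mo_simps by (intro sum.cong refl) (simp only: 1)
  also have "\<dots> = mo (spin_rep B) (mo (spin_rep A) f) +
     ((\<Sum>i=1..N. \<Sum>j=1..N. \<Sum>k=1..N. (ent B i j * ent A k j / 4) *\<^sub>c F i k)
     + (\<Sum>i=1..N. \<Sum>j=1..N. \<Sum>k=1..N. (ent B i j * ent A k i / 4) *\<^sub>c F k j))"
    unfolding mo_spin_rep[OF B, of "mo (spin_rep A) f"] sum.distrib[symmetric]
    by (intro sum.cong refl) (simp add: cscale_add_right cscale_sum_right)
  also have "(\<Sum>i=1..N. \<Sum>j=1..N. \<Sum>k=1..N. (ent B i j * ent A k j / 4) *\<^sub>c F i k)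
    = (\<Sum>i=1..N. \<Sum>k=1..N. \<Sum>j=1..N. (ent B i j * ent A k j / 4) *\<^sub>c F i k)"
    by (rule sum.cong[OF refl], rule sum.swap)
  also have "(\<Sum>i=1..N. \<Sum>j=1..N. \<Sum>k=1..N. (ent B i j * ent A k i / 4) *\<^sub>c F k j)
    = (\<Sum>j=1..N. \<Sum>i=1..N. \<Sum>k=1..N. (ent B i j * ent A k i / 4) *\<^sub>c F k j)"
    by (rule sum.swap)
  also have "\<dots> = (\<Sum>j=1..N. \<Sum>k=1..N. \<Sum>i=1..N. (ent B i j * ent A k i / 4) *\<^sub>c F k j)"
    by (rule sum.cong[OF refl], rule sum.swap)
  also have "\<dots> = (\<Sum>k=1..N. \<Sum>j=1..N. \<Sum>i=1..N. (ent B i j * ent A k i / 4) *\<^sub>c F k j)"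
    by (rule sum.swap)
  also have "(\<Sum>i=1..N. \<Sum>k=1..N. \<Sum>j=1..N. (ent B i j * ent A k j / 4) *\<^sub>c F i k) +
      (\<Sum>k=1..N. \<Sum>j=1..N. \<Sum>i=1..N. (ent B i j * ent A k i / 4) *\<^sub>c F k j)
    = mo (spin_rep (\<lambda>v. A (B v) - B (A v))) f"
    unfolding mo_spin_rep[OF so_bracket[OF A B], of f] sum.distrib[symmetric]
  proof (intro sum.cong refl)
    fix i k
    have "(ent B i j * ent A k j / 4) *\<^sub>c F i k + (ent B j k * ent A i j / 4) *\<^sub>c F i k
      = ((ent A i j * ent B j k - ent B i j * ent A j k) / 4) *\<^sub>c F i k" for j
      using ent_antisym[OF A, of k j] unfolding cscale_add_left[symmetric] by (intro arg_cong2[where f = cscale] refl) (simp add: algebra_simps diff_divide_distrib)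
    then show "(\<Sum>j=1..N. (ent B i j * ent A k j / 4) *\<^sub>c F i k + (ent B j k * ent A i j / 4) *\<^sub>c F i k)
      = (ent (\<lambda>v. A (B v) - B (A v)) i k / 4) *\<^sub>c EE i (EE k f)"
      unfolding ent_bracket[OF A B] F_def[symmetric] by (simp only: cscale_sum_left[symmetric] sum_divide_distrib)
  qed
  finally show ?thesis by (simp only: add_diff_cancel_left')
qed

subsection \<open>The form on the spin module\<close>

abbreviation comp :: "nat set => nat set" where "comp I \<equiv> {1..n} - I"

text \<open>The sign of the form on S at \<open>I\<close> and its complement. By
  \<open>card_inversions\<close> the exponent in its definition is a sum over the elements of
  \<open>I\<close>, which makes the effect of inserting or removing one element visible.\<close>

definition weight :: "nat set => complex"
  where "weight I = (\<Prod>i\<in>I. (-1) ^ (n * N + (i - 1)))"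

end

lemma card_descending_pairs:
  fixes I :: "nat set"
  assumes "finite I" shows "card {(i, j). i \<in> I \<and> j \<in> I \<and> i > j} = card I choose 2"
  using assms
proof (induction I rule: finite_linorder_max_induct)
  case (insert b A)
  have bA: "b \<notin> A" using insert.hyps by auto
  have "{(i, j). i \<in> insert b A \<and> j \<in> insert b A \<and> i > j} = {(i, j). i \<in> A \<and> j \<in> A \<and> i > j} \<union> Pair b ` A"
    using insert.hyps(2) by auto
  moreover have "finite {(i, j). i \<in> A \<and> j \<in> A \<and> i > j}"
    by (rule finite_subset[of _ "A \<times> A"]) (use insert.hyps in auto)
  moreover have "{(i, j). i \<in> A \<and> j \<in> A \<and> i > j} \<inter> Pair b ` A = {}" using bA by auto
  ultimately have "card {(i, j). i \<in> insert b A \<and> j \<in> insert b A \<and> i > j} = (card A choose 2) + card A"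
    using insert by (simp add: card_Un_disjoint card_image inj_on_def)
  then show ?case using insert.hyps bA by (simp add: numeral_2_eq_2)
qed simp

text \<open>For each i in \<open>I\<close> the i - 1 smaller positive numbers are divided into those
  inside \<open>I\<close> and those outside.\<close>

lemma card_inversions:
  fixes I :: "nat set"
  assumes "I \<subseteq> {1..n}"
  shows "(card I choose 2) + card {(i, j). i \<in> I \<and> j \<in> {1..n} - I \<and> i > j} = (\<Sum>i\<in>I. i - 1)"
proof -
  have fin: "finite I" using assms finite_subset by blast
  let ?A = "{(i, j). i \<in> I \<and> j \<in> I \<and> i > j}" and ?B = "{(i, j). i \<in> I \<and> j \<in> {1..n} - I \<and> i > j}"
  have sub: "?A \<subseteq> I \<times> {1..n}" "?B \<subseteq> I \<times> {1..n}" using assms by auto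
  have finAB: "finite ?A" "finite ?B"
    by (rule finite_subset[OF sub(1)], use fin in simp, rule finite_subset[OF sub(2)], use fin in simp)
  have "(SIGMA i:I. {1..<i}) = ?A \<union> ?B"
  proof (intro equalityI subsetI)
    fix p assume "p \<in> (SIGMA i:I. {1..<i})"
    then obtain i j where "p = (i, j)" "i \<in> I" "1 \<le> j" "j < i" by auto
    moreover from this have "i \<le> n" using assms by auto
    ultimately show "p \<in> ?A \<union> ?B" by auto
  next
    fix p assume "p \<in> ?A \<union> ?B"
    then obtain i j where "p = (i, j)" "i \<in> I" "j \<in> I \<or> j \<in> {1..n} - I" "j < i" by auto
    moreover from this have "1 \<le> j" using assms by auto
    ultimately show "p \<in> (SIGMA i:I. {1..<i})" by auto
  qed
  then have "card (SIGMA i:I. {1..<i}) = card (?A \<union> ?B)" by (rule arg_cong)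
  also have "\<dots> = card ?A + card ?B" by (rule card_Un_disjoint[OF finAB]) auto
  finally show ?thesis using fin by (simp add: card_descending_pairs card_SigmaI)
qed

context spin_setting
begin

lemma form_Spin:
  assumes "I \<in> Z"
  shows "form Spin (XI I) (XI J) = (if J = comp I then weight I else 0)"
proof -
  have fin: "finite I" using assms Z_finite by blast
  have "(card I choose 2) + n * N * card I + card {(i, j). i \<in> I \<and> j \<in> comp I \<and> i > j}
    = n * N * card I + ((card I choose 2) + card {(i, j). i \<in> I \<and> j \<in> comp I \<and> i > j})" by simp
  also have "\<dots> = (\<Sum>i\<in>I. n * N + (i - 1))"
    unfolding sum.distrib using assms by (subst card_inversions) auto
  finally show ?thesis by (simp add: weight_def power_sum)
qed

lemma weight_sq [simp]: "weight I * weight I = 1"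
  by (simp add: weight_def prod.distrib[symmetric] power_add[symmetric] mult_2[symmetric] power_mult)

lemma weight_flip:
  assumes "finite I"
  shows "weight (flip j I) = weight I * (-1) ^ (n * N + (j - 1))"
proof (cases "j \<in> I")
  case True
  have "weight I = (-1) ^ (n * N + (j - 1)) * weight (I - {j})"
    unfolding weight_def by (rule prod.remove[OF assms True])
  moreover have "(c::complex) = c * ((-1) ^ k * (-1) ^ k)" for c k
    by (simp add: power_add[symmetric] mult_2[symmetric] power_mult)
  ultimately show ?thesis using True by (simp add: flip_def mult_ac)
next
  case False
  then show ?thesis using assms by (simp add: flip_def weight_def)
qed

lemma comp_Z [simp]: "comp I \<in> Z" by auto

lemma comp_comp: "I \<in> Z ==> comp (comp I) = I" by auto

lemma ksign_comp:
  assumes "I \<in> Z" "j \<in> {1..n}"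
  shows "ksign j I * ksign j (comp I) = (-1) ^ (j - 1)"
proof -
  have "{1..<j} = {i \<in> I. i < j} \<union> {i \<in> comp I. i < j}"
    using assms by auto
  then have "card {1..<j} = card ({i \<in> I. i < j} \<union> {i \<in> comp I. i < j})" by (rule arg_cong)
  also have "\<dots> = card {i \<in> I. i < j} + card {i \<in> comp I. i < j}"
    by (rule card_Un_disjoint) auto
  finally show ?thesis by (simp add: ksign_def power_add[symmetric])
qed

lemma kappa_sq [simp]: "kappa N * kappa N = 1"
  by (simp add: kappa_def minus_one_power_iff)

lemma comp_tg:
  assumes "k \<in> {1..N}" "I \<in> Z" shows "comp (tg k I) = tg k (comp I)"
proof (cases "odd N \<and> k = N")
  case False
  then have "(k + 1) div 2 \<in> {1..n}" using assms(1) unfolding n_def by (auto; presburger)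
  then show ?thesis unfolding eta_normal[OF False] by (auto simp: flip_def)
qed (simp add: eta_special)

text \<open>Entrywise self-adjointness of \<open>e k\<close> up to \<open>kappa N\<close>. For a
  fermionic mode j the change of weight supplies (-1)^(nN + j - 1), and (-1)^(j - 1) is the product
  of the two order signs of \<open>I\<close> and its complement. For the diagonal operator the
  parities of \<open>I\<close> and its complement differ by (-1)^n, which is \<open>kappa N\<close>
  for odd \<open>N\<close>.\<close>

lemma weight_eta:
  assumes k: "k \<in> {1..N}" and I: "I \<in> Z"
  shows "weight (tg k I) * eta k I = kappa N * (weight I * eta k (tg k (comp I)))"
proof (cases "odd N \<and> k = N")
  case True
  have fin: "finite I" using I Z_finite by blast
  have "card (comp I) + card I = n" using I by (simp add: card_Diff_subset fin card_mono[of "{1..n}" I, simplified])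
  then have "(-1 :: complex) ^ n = (-1) ^ card (comp I) * (-1) ^ card I" by (metis power_add)
  moreover have "kappa N = (-1) ^ n" using True by (auto simp: kappa_def n_def[symmetric] minus_one_power_iff)
  ultimately have "kappa N * (-1) ^ card (comp I) = ((-1 :: complex) ^ card (comp I) * (-1) ^ card (comp I)) * (-1) ^ card I"
    by (simp only: mult_ac)
  then have "kappa N * (-1) ^ card (comp I) = (-1 :: complex) ^ card I"
    by (simp add: power_add[symmetric] mult_2[symmetric] power_mult)
  then show ?thesis unfolding eta_special[OF True] by (simp add: mult_ac)
next
  case False
  define j where "j = (k + 1) div 2"
  have j: "j \<in> {1..n}" using assms(1) False unfolding n_def j_def by (auto; presburger)
  have fin: "finite I" using I Z_finite by blast
  have "j \<notin> comp I \<longleftrightarrow> j \<in> I" using j by auto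
  moreover have "(-1) ^ (n * N + (j - 1)) * ksign j I = kappa N * ksign j (comp I)"
  proof -
    have "(-1) ^ (n * N + (j - 1)) * ksign j I = kappa N * (ksign j I * ksign j (comp I)) * ksign j I"
      using ksign_comp[OF I j] by (simp add: power_add kappa_def n_def)
    also have "\<dots> = kappa N * ksign j (comp I) * (ksign j I * ksign j I)" by (simp only: mult_ac)
    finally show ?thesis by simp
  qed
  ultimately show ?thesis
    unfolding eta_normal[OF False] j_def[symmetric] weight_flip[OF fin] ksign_flip[OF finite_Diff[OF finite_atLeastAtMost]] in_flip
    by (simp only: if_True less_irrefl if_False simp_thms) (simp add: mult_ac)
qed

text \<open>The weights of a set and of its complement multiply to the weight of
  \<open>{1..n}\<close>, whose exponent n * (nN) + (n choose 2) has the parity of the exponent in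
  \<open>sigma N\<close>.\<close>

lemma sigma_weight: assumes "I \<in> Z" shows "weight (comp I) * sigma N = weight I"
proof -
  have fin: "finite I" using assms Z_finite by blast
  have "weight (comp I) * weight I = weight {1..n}"
    unfolding weight_def using assms by (subst prod.union_disjoint[symmetric]) (auto simp: fin intro!: prod.cong)
  also have "\<dots> = (-1) ^ (\<Sum>i\<in>{1..n}. n * N + (i - 1))" by (simp add: weight_def power_sum)
  also have "(\<Sum>i\<in>{1..n}. n * N + (i - 1)) = n * (n * N) + (n choose 2)"
  proof -
    have "{(i, j). i \<in> {1..n} \<and> j \<in> {1..n} - {1..n} \<and> j < i} = {}" by auto
    then have "(n choose 2) = (\<Sum>i\<in>{1..n}. i - 1)" using card_inversions[of "{1..n}" n] by simp
    then show ?thesis unfolding sum.distrib by simp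
  qed
  also have "(-1 :: complex) ^ (n * (n * N) + (n choose 2)) = sigma N"
    by (auto simp: sigma_def n_def[symmetric] minus_one_power_iff)
  finally have "weight (comp I) * weight I = sigma N" .
  then have "weight (comp I) * sigma N = (weight (comp I) * weight (comp I)) * weight I" by (simp only: mult.assoc)
  then show ?thesis by (simp only: weight_sq mult_1)
qed

definition fm :: "(nat set => complex) => (nat set => complex) => complex"
  where "fm f g = (\<Sum>I\<in>Z. weight I * (f I * g (comp I)))"

lemma clin_fm: "clin (fm f)" "clin (\<lambda>f. fm f g)"
  by (auto intro!: clinI simp: fm_def algebra_simps sum.distrib sum_distrib_left)

lemmas fm_simps = clin_simps[OF clin_fm(1)] clin_simps[OF clin_fm(2)]

lemma fm_del:
  assumes "J \<in> Z"
  shows "fm f (del J) = (\<Sum>K\<in>Z. f K * form Spin (XI K) (XI J))"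
    and "fm (del J) f = (\<Sum>K\<in>Z. form Spin (XI J) (XI K) * f K)"
proof -
  show "fm f (del J) = (\<Sum>K\<in>Z. f K * form Spin (XI K) (XI J))"
    unfolding fm_def by (intro sum.cong refl) (simp only: form_Spin, auto)
  have "fm (del J) f = (\<Sum>I\<in>Z. if I = J then weight J * f (comp J) else 0)"
    unfolding fm_def by (intro sum.cong refl) auto
  also have "\<dots> = weight J * f (comp J)" using assms by (subst sum.delta) auto
  also have "\<dots> = (\<Sum>K\<in>Z. if K = comp J then weight J * f K else 0)" by (subst sum.delta) auto
  also have "\<dots> = (\<Sum>K\<in>Z. form Spin (XI J) (XI K) * f K)"
    by (intro sum.cong refl) (simp only: form_Spin[OF assms], auto)
  finally show "fm (del J) f = (\<Sum>K\<in>Z. form Spin (XI J) (XI K) * f K)" .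
qed

lemma fm_EE:
  assumes k: "k \<in> {1..N}" shows "fm (EE k f) g = kappa N * fm f (EE k g)"
proof -
  have "fm (EE k f) g = (\<Sum>I\<in>Z. weight I * (eta k (tg k I) * f (tg k I) * g (comp I)))"
    unfolding fm_def by (intro sum.cong refl) (simp only: EE_apply[OF k])
  also have "\<dots> = (\<Sum>I\<in>Z. weight (tg k I) * (eta k I * f I * g (tg k (comp I))))"
    by (rule sum.reindex_bij_witness[of _ "tg k" "tg k"]) (use tg_Z[OF k] comp_tg[OF k] in auto)
  also have "\<dots> = (\<Sum>I\<in>Z. kappa N * (weight I * (f I * (eta k (tg k (comp I)) * g (tg k (comp I))))))"
  proof (intro sum.cong refl)
    fix I assume I: "I \<in> Z"
    have "weight (tg k I) * (eta k I * f I * g (tg k (comp I))) = (weight (tg k I) * eta k I) * (f I * g (tg k (comp I)))"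
      by (simp only: mult_ac)
    then show "weight (tg k I) * (eta k I * f I * g (tg k (comp I))) = kappa N * (weight I * (f I * (eta k (tg k (comp I)) * g (tg k (comp I)))))"
      unfolding weight_eta[OF k I] by (simp only: mult_ac)
  qed
  also have "\<dots> = kappa N * fm f (EE k g)"
    unfolding fm_def sum_distrib_left by (intro sum.cong refl) (simp only: EE_apply[OF k comp_Z])
  finally show ?thesis .
qed

text \<open>Two Clifford factors cross the form at the cost of \<open>kappa N\<close> squared, which
  is 1, and in reversed order; antisymmetry of the entries turns the reversal into a minus
  sign.\<close>

lemma fm_spin_rep:
  assumes A: "A \<in> so" shows "fm (mo (spin_rep A) f) g = - fm f (mo (spin_rep A) g)"
proof -
  have "fm (mo (spin_rep A) f) g = (\<Sum>i=1..N. \<Sum>j=1..N. ent A i j / 4 * fm f (EE j (EE i g)))"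
    unfolding mo_spin_rep[OF A] fm_simps cscale_complex
  proof (intro sum.cong refl)
    fix i j assume "i \<in> {1..N}" "j \<in> {1..N}"
    then have "fm (EE i (EE j f)) g = (kappa N * kappa N) * fm f (EE j (EE i g))" by (simp only: fm_EE mult.assoc)
    then show "ent A i j / 4 * fm (EE i (EE j f)) g = ent A i j / 4 * fm f (EE j (EE i g))" by simp
  qed
  also have "\<dots> = (\<Sum>j=1..N. \<Sum>i=1..N. ent A i j / 4 * fm f (EE j (EE i g)))" by (rule sum.swap)
  also have "\<dots> = (\<Sum>j=1..N. \<Sum>i=1..N. - (ent A j i / 4 * fm f (EE j (EE i g))))"
  proof (intro sum.cong refl)
    fix i j show "ent A i j / 4 * fm f (EE j (EE i g)) = - (ent A j i / 4 * fm f (EE j (EE i g)))"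
      using ent_antisym[OF A, of i j] by simp
  qed
  also have "\<dots> = - fm f (mo (spin_rep A) g)"
    unfolding mo_spin_rep[OF A] fm_simps cscale_complex sum_negf ..
  finally show ?thesis .
qed

subsection \<open>Structure constants\<close>

declare One_nat_def [simp del]

lemma sum_basis:
  "(\<Sum>x\<in>BS. f x) = (\<Sum>I\<in>Z. f (XI I))"
  "(\<Sum>x\<in>BV. f x) = (\<Sum>i=1..N. f (EI i))"
  by (simp_all add: sum.reindex inj_on_def)

lemma finite_basis [simp]: "finite (bas X)" by (cases X) simp_all

lemma basis_SpinE: assumes "x \<in> BS" obtains I where "x = XI I" "I \<in> Z"
  using assms by auto

lemma basis_VectE: assumes "x \<in> BV" obtains i where "x = EI i" "i \<in> {1..N}"
  using assms by auto

lemma rep_add: "rep X (\<lambda>v. A v + B v) x y = rep X A x y + rep X B x y"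
  by (cases X; cases x; cases y)
    (auto simp: form_add_right spin_rep_def sum.distrib[symmetric] case_prod_unfold
      algebra_simps add_divide_distrib diff_divide_distrib intro!: sum.cong)

lemma rep_scale: "rep X (\<lambda>v. scale c (A v)) x y = c * rep X A x y"
  by (cases X; cases x; cases y)
    (simp_all add: form_scale_right spin_rep_def sum_distrib_left case_prod_unfold mult.assoc)

lemma EE_del: "I \<in> Z ==> J \<in> Z ==> EE k (del J) I = e_mat k I J"
  by (simp only: EE_def mo_del)

lemma rep_bracket:
  assumes A: "A \<in> so" and B: "B \<in> so" and xy: "x \<in> bas X" "y \<in> bas X"
  shows "rep X (\<lambda>v. A (B v) - B (A v)) x y
    = (\<Sum>z\<in>bas X. rep X A x z * rep X B z y) - (\<Sum>z\<in>bas X. rep X B x z * rep X A z y)"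
proof (cases X)
  case Vect
  with xy obtain i j where "x = EI i" "y = EI j" by auto
  then show ?thesis unfolding Vect by (simp only: sum_basis rep.simps ent_bracket[OF A B] sum_subtractf)
next
  case Spin
  obtain I J where IJ: "x = XI I" "y = XI J" "I \<in> Z" "J \<in> Z" using xy Spin by (auto elim!: basis_SpinE)
  have 1: "mo (spin_rep C) (mo (spin_rep D) (del J)) I = (\<Sum>K\<in>Z. spin_rep C I K * spin_rep D K J)" for C D
    unfolding mo_def[of "spin_rep C"] if_P[OF IJ(3)] by (intro sum.cong refl) (simp only: mo_del IJ)
  have "spin_rep (\<lambda>v. A (B v) - B (A v)) I J = mo (spin_rep (\<lambda>v. A (B v) - B (A v))) (del J) I"
    by (simp only: mo_del IJ)
  then show ?thesis unfolding spin_rep_bracket[OF A B] Spin IJ(1,2) sum_basis by (simp only: fun_diff_def rep.simps 1)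
qed

lemma form_inv:
  assumes A: "A \<in> so" and xy: "x \<in> bas X" "y \<in> bas X"
  shows "(\<Sum>z\<in>bas X. rep X A z x * form X z y) = - (\<Sum>z\<in>bas X. form X x z * rep X A z y)"
proof (cases X)
  case Vect
  with xy obtain i j where ij: "x = EI i" "y = EI j" "i \<in> {1..N}" "j \<in> {1..N}" by (auto elim!: basis_VectE)
  have "(\<Sum>z=1..N. ent A z i * \<Phi> (e z) (e j)) = (\<Sum>z=1..N. if z = j then ent A j i else 0)"
    by (intro sum.cong refl) (simp only: orthonormal ij, auto)
  moreover have "(\<Sum>z=1..N. \<Phi> (e i) (e z) * ent A z j) = (\<Sum>z=1..N. if z = i then ent A i j else 0)"
    by (intro sum.cong refl) (simp only: orthonormal ij, auto)
  ultimately show ?thesis unfolding Vect ij(1,2) sum_basis using ij ent_antisym[OF A, of j i] by simp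
next
  case Spin
  obtain I J where IJ: "x = XI I" "y = XI J" "I \<in> Z" "J \<in> Z" using xy Spin by (auto elim!: basis_SpinE)
  have "(\<Sum>K\<in>Z. spin_rep A K I * form Spin (XI K) (XI J)) = fm (mo (spin_rep A) (del I)) (del J)"
    unfolding fm_del(1)[OF IJ(4)] by (intro sum.cong refl) (simp only: mo_del IJ)
  also have "\<dots> = - fm (del I) (mo (spin_rep A) (del J))" by (rule fm_spin_rep[OF A])
  also have "fm (del I) (mo (spin_rep A) (del J)) = (\<Sum>K\<in>Z. form Spin (XI I) (XI K) * spin_rep A K J)"
    unfolding fm_del(2)[OF IJ(3)] by (intro sum.cong refl) (simp only: mo_del IJ)
  finally show ?thesis unfolding Spin IJ(1,2) sum_basis rep.simps .
qed

definition sg :: "gob => gob => complex"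
  where "sg X Y = (if X = Spin \<and> Y = Spin then sigma N else 1)"

lemma form_swap:
  assumes "x \<in> bas X" "y \<in> bas X" shows "sg X X * form X y x = form X x y"
proof (cases X)
  case Vect
  then show ?thesis using assms by (auto simp: sg_def form_sym)
next
  case Spin
  obtain I J where IJ: "x = XI I" "y = XI J" "I \<in> Z" "J \<in> Z" using assms Spin by (auto elim!: basis_SpinE)
  have "J = comp I \<longleftrightarrow> I = comp J" using IJ by auto
  then show ?thesis unfolding Spin IJ(1,2) form_Spin[OF IJ(3)] form_Spin[OF IJ(4)]
    using sigma_weight[OF IJ(3)] by (auto simp: sg_def mult.commute)
qed

text \<open>The definite description is pinned down by an inverse matrix \<open>h\<close> of the
  form: multiplying the defining equations by \<open>h\<close> determines every coordinate.\<close>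

lemma dual_coord_eqI:
  assumes b: "b \<in> bas X"
    and g0: "\<And>c. c \<notin> bas X ==> g c = 0"
    and g: "\<And>y. y \<in> bas X ==> (\<Sum>c\<in>bas X. g c * form X c y) = (if b = y then 1 else 0)"
    and inv: "\<And>c c'. c \<in> bas X ==> c' \<in> bas X ==> (\<Sum>y\<in>bas X. form X c y * h y c') = (if c = c' then 1 else 0)"
  shows "dual_coord X b = g"
  unfolding dual_coord_def
proof (rule the_equality)
  have uniq: "f c' = (\<Sum>y\<in>bas X. (if b = y then 1 else 0) * h y c')"
    if f: "\<forall>y\<in>bas X. (\<Sum>c\<in>bas X. f c * form X c y) = (if b = y then 1 else 0)" and c': "c' \<in> bas X"
    for f c'
  proof -
    have "f c' = (\<Sum>c\<in>bas X. f c * (if c = c' then 1 else 0))"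
      using c' by (simp add: if_distrib cong: if_cong)
    also have "\<dots> = (\<Sum>c\<in>bas X. \<Sum>y\<in>bas X. f c * form X c y * h y c')"
      by (intro sum.cong refl) (simp only: inv c' sum_distrib_left[symmetric] mult.assoc)
    also have "\<dots> = (\<Sum>y\<in>bas X. \<Sum>c\<in>bas X. f c * form X c y * h y c')" by (rule sum.swap)
    also have "\<dots> = (\<Sum>y\<in>bas X. (if b = y then 1 else 0) * h y c')"
      by (intro sum.cong refl) (simp only: sum_distrib_right[symmetric] f)
    finally show ?thesis .
  qed
  show "(\<forall>c. c \<notin> bas X \<longrightarrow> g c = 0) \<and> (\<forall>y\<in>bas X. (\<Sum>c\<in>bas X. g c * form X c y) = (if b = y then 1 else 0))"
    using g0 g by blast
  fix f assume f: "(\<forall>c. c \<notin> bas X \<longrightarrow> f c = 0) \<and> (\<forall>y\<in>bas X. (\<Sum>c\<in>bas X. f c * form X c y) = (if b = y then 1 else 0))"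
  show "f = g"
  proof
    fix c show "f c = g c"
    proof (cases "c \<in> bas X")
      case True
      have g': "\<forall>y\<in>bas X. (\<Sum>c\<in>bas X. g c * form X c y) = (if b = y then 1 else 0)"
        using g by blast
      show ?thesis by (rule trans[OF uniq[OF conjunct2[OF f] True] uniq[OF g' True, symmetric]])
    qed (use f g0 in auto)
  qed
qed

lemma sum_form_Spin: "I \<in> Z ==> (\<Sum>K\<in>Z. form Spin (XI I) (XI K) * f K) = weight I * f (comp I)"
proof -
  assume I: "I \<in> Z"
  have "(\<Sum>K\<in>Z. form Spin (XI I) (XI K) * f K) = (\<Sum>K\<in>Z. if K = comp I then weight I * f K else 0)"
    by (intro sum.cong refl) (simp only: form_Spin[OF I], auto)
  also have "\<dots> = weight I * f (comp I)" by (subst sum.delta) auto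
  finally show ?thesis .
qed

lemma dual_Spin:
  assumes I: "I \<in> Z"
  shows "dual_coord Spin (XI I) = (\<lambda>c. if c = XI (comp I) then weight (comp I) else 0)"
proof (rule dual_coord_eqI[where h = "\<lambda>y c. if c = XI (comp (case y of XI J => J)) then weight (comp (case y of XI J => J)) else 0"])
  show "XI I \<in> BS" using I by simp
  show "(if c = XI (comp I) then weight (comp I) else 0) = 0" if "c \<notin> BS" for c
    using that by auto
  show "(\<Sum>c\<in>BS. (if c = XI (comp I) then weight (comp I) else 0) * form Spin c y) = (if XI I = y then 1 else 0)"
    if y: "y \<in> BS" for y
  proof -
    obtain J where J: "y = XI J" "J \<in> Z" using y by (rule basis_SpinE)
    have "(\<Sum>K\<in>Z. (if XI K = XI (comp I) then weight (comp I) else 0) * form Spin (XI K) (XI J))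
      = (\<Sum>K\<in>Z. if K = comp I then weight (comp I) * form Spin (XI (comp I)) (XI J) else 0)"
      by (intro sum.cong refl) auto
    also have "\<dots> = weight (comp I) * form Spin (XI (comp I)) (XI J)" by (subst sum.delta) auto
    also have "\<dots> = (if J = I then 1 else 0)"
      unfolding form_Spin[OF comp_Z] comp_comp[OF I] by (cases "J = I") (simp_all only: if_True if_False weight_sq mult_zero_right simp_thms)
    finally show ?thesis unfolding J sum_basis by (simp only: label.inject eq_commute[of I J])
  qed
  show "(\<Sum>y\<in>BS. form Spin c y * (if c' = XI (comp (case y of XI J => J)) then weight (comp (case y of XI J => J)) else 0)) = (if c = c' then 1 else 0)"
    if cc: "c \<in> BS" "c' \<in> BS" for c c'
  proof -
    obtain I J where IJ: "c = XI I" "c' = XI J" "I \<in> Z" "J \<in> Z" using cc by (auto elim!: basis_SpinE)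
    show ?thesis
      unfolding IJ(1,2) sum_basis label.case sum_form_Spin[OF IJ(3)] comp_comp[OF IJ(3)] label.inject
      by (cases "I = J") (simp_all only: if_True if_False weight_sq mult_zero_right eq_commute[of J] simp_thms)
  qed
qed

lemma dual_Vect:
  assumes i: "i \<in> {1..N}"
  shows "dual_coord Vect (EI i) = (\<lambda>c. if c = EI i then 1 else 0)"
proof (rule dual_coord_eqI[where h = "\<lambda>y c. if c = y then 1 else 0"])
  show "(\<Sum>c\<in>BV. (if c = EI i then 1 else 0) * form Vect c y) = (if EI i = y then 1 else 0)"
    if y: "y \<in> BV" for y
  proof -
    obtain j where j: "y = EI j" "j \<in> {1..N}" using y by (rule basis_VectE)
    have "(\<Sum>k=1..N. (if EI k = EI i then 1 else 0) * form Vect (EI k) (EI j))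
      = (\<Sum>k=1..N. if k = i then form Vect (EI i) (EI j) else 0)" by (intro sum.cong refl) auto
    then show ?thesis unfolding j sum_basis using i j by (simp add: orthonormal)
  qed
  show "(\<Sum>y\<in>BV. form Vect c y * (if c' = y then 1 else 0)) = (if c = c' then 1 else 0)"
    if cc: "c \<in> BV" "c' \<in> BV" for c c'
  proof -
    obtain j k where j: "c = EI j" "c' = EI k" "j \<in> {1..N}" "k \<in> {1..N}" using cc by (auto elim!: basis_VectE)
    have "(\<Sum>l=1..N. form Vect (EI j) (EI l) * (if EI k = EI l then 1 else 0))
      = (\<Sum>l=1..N. if l = k then form Vect (EI j) (EI k) else 0)" by (intro sum.cong refl) auto
    then show ?thesis unfolding j(1,2) sum_basis using j by (simp add: orthonormal)
  qed
qed (use i in auto)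

lemma dual_form:
  assumes "x \<in> bas X" "y \<in> bas X"
  shows "(\<Sum>z\<in>bas X. dual_coord X x z * form X z y) = (if x = y then 1 else 0)"
proof (cases X)
  case Vect
  obtain j k where j: "x = EI j" "y = EI k" "j \<in> {1..N}" "k \<in> {1..N}" using assms Vect by (auto elim!: basis_VectE)
  have "(\<Sum>l=1..N. (if EI l = EI j then 1 else 0) * form Vect (EI l) (EI k))
      = (\<Sum>l=1..N. if l = j then form Vect (EI j) (EI k) else 0)" by (intro sum.cong refl) auto
  then show ?thesis unfolding Vect j(1,2) sum_basis dual_Vect[OF j(3)] using j by (simp add: orthonormal)
next
  case Spin
  obtain I J where IJ: "x = XI I" "y = XI J" "I \<in> Z" "J \<in> Z" using assms Spin by (auto elim!: basis_SpinE)
  have "(\<Sum>K\<in>Z. (if XI K = XI (comp I) then weight (comp I) else 0) * form Spin (XI K) (XI J))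
      = (\<Sum>K\<in>Z. if K = comp I then weight (comp I) * form Spin (XI (comp I)) (XI J) else 0)"
    by (intro sum.cong refl) auto
  also have "\<dots> = weight (comp I) * form Spin (XI (comp I)) (XI J)" by (subst sum.delta) auto
  also have "\<dots> = (if J = I then 1 else 0)"
    unfolding form_Spin[OF comp_Z] comp_comp[OF IJ(3)] by (cases "J = I") (simp_all only: if_True if_False weight_sq mult_zero_right simp_thms)
  finally show ?thesis unfolding Spin IJ(1,2) sum_basis dual_Spin[OF IJ(3)] by (simp only: label.inject eq_commute[of I J])
qed

lemma form_dual:
  assumes "x \<in> bas X" "y \<in> bas X"
  shows "(\<Sum>z\<in>bas X. form X x z * dual_coord X z y) = (if x = y then 1 else 0)"
proof (cases X)
  case Vect
  obtain j k where j: "x = EI j" "y = EI k" "j \<in> {1..N}" "k \<in> {1..N}" using assms Vect by (auto elim!: basis_VectE)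
  have "(\<Sum>l=1..N. form Vect (EI j) (EI l) * dual_coord Vect (EI l) (EI k))
      = (\<Sum>l=1..N. if l = k then form Vect (EI j) (EI k) else 0)" by (intro sum.cong refl) (auto simp: dual_Vect)
  then show ?thesis unfolding Vect j(1,2) sum_basis using j by (simp add: orthonormal)
next
  case Spin
  obtain I J where IJ: "x = XI I" "y = XI J" "I \<in> Z" "J \<in> Z" using assms Spin by (auto elim!: basis_SpinE)
  show ?thesis unfolding Spin IJ(1,2) sum_basis sum_form_Spin[OF IJ(3)] dual_Spin[OF comp_Z] comp_comp[OF IJ(3)] label.inject
    by (cases "I = J") (simp_all only: if_True if_False weight_sq mult_zero_right eq_commute[of J] simp_thms)
qed

lemma mu_rep:
  assumes A: "A \<in> so" and z: "z \<in> BS" and x: "x \<in> BV" and y: "y \<in> BS"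
  shows "(\<Sum>z'\<in>BS. rep Spin A z z' * mu z' x y)
    = (\<Sum>x'\<in>BV. mu z x' y * rep Vect A x' x) + (\<Sum>y'\<in>BS. mu z x y' * rep Spin A y' y)"
proof -
  obtain I J where IJ: "z = XI I" "y = XI J" "I \<in> Z" "J \<in> Z" using y z by (auto elim!: basis_SpinE)
  obtain k where k: "x = EI k" "k \<in> {1..N}" using x by (rule basis_VectE)
  have 1: "mo (spin_rep A) (EE k (del J)) I = (\<Sum>K\<in>Z. spin_rep A I K * e_mat k K J)"
    unfolding mo_def if_P[OF IJ(3)] by (intro sum.cong refl) (simp only: EE_del IJ)
  have 2: "EE k (mo (spin_rep A) (del J)) I = (\<Sum>K\<in>Z. e_mat k I K * spin_rep A K J)"
    unfolding EE_def mo_def[of "e_mat k"] if_P[OF IJ(3)] by (intro sum.cong refl) (simp only: mo_del IJ)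
  have 3: "(\<Sum>i=1..N. ent A i k *\<^sub>c EE i (del J)) I = (\<Sum>i=1..N. e_mat i I J * ent A i k)"
    unfolding sum_fun_apply by (intro sum.cong refl) (simp only: cscale_fun_apply cscale_complex EE_del IJ mult.commute)
  show ?thesis
    using fun_cong[OF spin_rep_EE[OF A k(2), of "del J"], of I]
    unfolding plus_fun_apply 1 2 3 unfolding IJ(1,2) k(1) sum_basis rep.simps mu_coeff.simps by (simp only: add.commute)
qed

lemma mu_clifford:
  assumes z: "z \<in> BS" and x: "x \<in> BV" "x' \<in> BV" and y: "y \<in> BS"
  shows "(\<Sum>w\<in>BS. mu z x w * mu w x' y)
    = (if x = x' \<and> z = y then 2 else 0) - (\<Sum>w\<in>BS. mu z x' w * mu w x y)"
proof -
  obtain I J where IJ: "z = XI I" "y = XI J" "I \<in> Z" "J \<in> Z" using y z by (auto elim!: basis_SpinE)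
  obtain k l where k: "x = EI k" "k \<in> {1..N}" "x' = EI l" "l \<in> {1..N}" using x by (auto elim!: basis_VectE)
  have 1: "EE k (EE l (del J)) I = (\<Sum>K\<in>Z. e_mat k I K * e_mat l K J)" for k l
    unfolding EE_def[of k] mo_def if_P[OF IJ(3)] by (intro sum.cong refl) (simp only: EE_del IJ)
  show ?thesis
    using fun_cong[OF EE_clifford[OF k(2,4), of "del J"], of I]
    unfolding fun_diff_def 1 unfolding IJ(1,2) k(1,3) sum_basis mu_coeff.simps
    using IJ by (simp add: rz_def)
qed

lemma mu_form:
  assumes z: "z \<in> BS" and x: "x \<in> BV" and y: "y \<in> BS"
  shows "(\<Sum>w\<in>BS. mu w x z * form Spin w y)
    = kappa N * (\<Sum>w\<in>BS. form Spin z w * mu w x y)"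
proof -
  obtain I J where IJ: "z = XI I" "y = XI J" "I \<in> Z" "J \<in> Z" using y z by (auto elim!: basis_SpinE)
  obtain k where k: "x = EI k" "k \<in> {1..N}" using x by (rule basis_VectE)
  have "(\<Sum>K\<in>Z. e_mat k K I * form Spin (XI K) (XI J)) = fm (EE k (del I)) (del J)"
    unfolding fm_del(1)[OF IJ(4)] by (intro sum.cong refl) (simp only: EE_del IJ)
  also have "\<dots> = kappa N * fm (del I) (EE k (del J))" by (rule fm_EE[OF k(2)])
  also have "fm (del I) (EE k (del J)) = (\<Sum>K\<in>Z. form Spin (XI I) (XI K) * e_mat k K J)"
    unfolding fm_del(2)[OF IJ(3)] by (intro sum.cong refl) (simp only: EE_del IJ)
  finally show ?thesis unfolding IJ(1,2) k(1) sum_basis mu_coeff.simps .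
qed

end

declare sum_fun_apply [simp del]

context spin_setting
begin

subsection \<open>Bilinear functions of the Casimir tensor\<close>

abbreviation MM :: "nat => nat => 'v => 'v" where "MM i j \<equiv> M_op (e i) (e j)"

text \<open>Bilinearity is demanded on \<open>so\<close> only, since the functions to which it is
  applied are meaningful only there.\<close>

definition bil :: "(('v => 'v) => ('v => 'v) => 'b::cvec) => bool"
  where "bil \<beta> \<longleftrightarrow> (\<forall>A\<in>so. \<forall>B\<in>so. \<forall>C\<in>so. \<beta> (\<lambda>v. A v + B v) C = \<beta> A C + \<beta> B C \<and> \<beta> C (\<lambda>v. A v + B v) = \<beta> C A + \<beta> C B)
    \<and> (\<forall>c. \<forall>A\<in>so. \<forall>B\<in>so. \<beta> (\<lambda>v. scale c (A v)) B = c *\<^sub>c \<beta> A B \<and> \<beta> B (\<lambda>v. scale c (A v)) = c *\<^sub>c \<beta> B A)"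

lemma bil_scale:
  assumes "bil \<beta>" "A \<in> so" "B \<in> so"
  shows "\<beta> (\<lambda>v. scale c (A v)) B = c *\<^sub>c \<beta> A B" "\<beta> B (\<lambda>v. scale c (A v)) = c *\<^sub>c \<beta> B A"
  using assms unfolding bil_def by blast+

lemma bil_add:
  assumes "bil \<beta>" "A \<in> so" "B \<in> so" "C \<in> so"
  shows "\<beta> (\<lambda>v. A v + B v) C = \<beta> A C + \<beta> B C" "\<beta> C (\<lambda>v. A v + B v) = \<beta> C A + \<beta> C B"
  using assms unfolding bil_def by blast+

lemma bil_sum:
  assumes \<beta>: "bil \<beta>" and "finite I" and "\<And>i. i \<in> I ==> A i \<in> so" and C: "C \<in> so"
  shows "\<beta> (\<lambda>v. \<Sum>i\<in>I. scale (c i) (A i v)) C = (\<Sum>i\<in>I. c i *\<^sub>c \<beta> (A i) C)"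
    and "\<beta> C (\<lambda>v. \<Sum>i\<in>I. scale (c i) (A i v)) = (\<Sum>i\<in>I. c i *\<^sub>c \<beta> C (A i))"
proof -
  have "\<beta> (\<lambda>v. \<Sum>i\<in>I. scale (c i) (A i v)) C = (\<Sum>i\<in>I. c i *\<^sub>c \<beta> (A i) C)
     \<and> \<beta> C (\<lambda>v. \<Sum>i\<in>I. scale (c i) (A i v)) = (\<Sum>i\<in>I. c i *\<^sub>c \<beta> C (A i))"
    using assms(2,3)
  proof (induction I rule: finite_induct)
    case empty
    have "\<beta> (\<lambda>v. scale 0 (0::'v)) C = 0 *\<^sub>c \<beta> (\<lambda>v. 0) C" "\<beta> C (\<lambda>v. scale 0 (0::'v)) = 0 *\<^sub>c \<beta> C (\<lambda>v. 0)"
      by (rule bil_scale[OF \<beta> so_zero C])+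
    then show ?case by simp
  next
    case (insert i I)
    have 1: "(\<lambda>v. scale (c i) (A i v)) \<in> so" by (rule so_scale) (use insert in auto)
    have 2: "(\<lambda>v. \<Sum>i\<in>I. scale (c i) (A i v)) \<in> so" by (rule so_sum) (use insert so_scale in auto)
    have "\<beta> (\<lambda>v. scale (c i) (A i v) + (\<Sum>i\<in>I. scale (c i) (A i v))) C = \<beta> (\<lambda>v. scale (c i) (A i v)) C + \<beta> (\<lambda>v. \<Sum>i\<in>I. scale (c i) (A i v)) C"
      "\<beta> C (\<lambda>v. scale (c i) (A i v) + (\<Sum>i\<in>I. scale (c i) (A i v))) = \<beta> C (\<lambda>v. scale (c i) (A i v)) + \<beta> C (\<lambda>v. \<Sum>i\<in>I. scale (c i) (A i v))"
      by (rule bil_add[OF \<beta> 1 2 C])+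
    moreover have "\<beta> (\<lambda>v. scale (c i) (A i v)) C = c i *\<^sub>c \<beta> (A i) C" "\<beta> C (\<lambda>v. scale (c i) (A i v)) = c i *\<^sub>c \<beta> C (A i)"
      using bil_scale[OF \<beta> _ C, of "A i"] insert.prems[of i] by simp_all
    ultimately show ?case using insert by simp
  qed
  then show "\<beta> (\<lambda>v. \<Sum>i\<in>I. scale (c i) (A i v)) C = (\<Sum>i\<in>I. c i *\<^sub>c \<beta> (A i) C)"
    "\<beta> C (\<lambda>v. \<Sum>i\<in>I. scale (c i) (A i v)) = (\<Sum>i\<in>I. c i *\<^sub>c \<beta> C (A i))" by auto
qed

lemma M_op_expand:
  "M_op u w = (\<lambda>v. \<Sum>k=1..N. scale (\<Phi> (e k) u) (M_op (e k) w v))"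
  "M_op w u = (\<lambda>v. \<Sum>k=1..N. scale (\<Phi> (e k) u) (M_op w (e k) v))"
proof -
  have 1: "M_op u w v = (\<Sum>k=1..N. scale (\<Phi> (e k) u) (M_op (e k) w v))" for v
  proof -
    have "M_op (\<Sum>k=1..N. scale (\<Phi> (e k) u) (e k)) w v = (\<Sum>k=1..N. scale (\<Phi> (e k) u) (M_op (e k) w v))"
      unfolding M_op_def form_sum_left form_scale_left scale_sum_left scale_sum_right sum_subtractf[symmetric] scale_right_diff_distrib
      by (simp add: mult.commute)
    then show ?thesis unfolding expand[of u, symmetric] .
  qed
  then show "M_op u w = (\<lambda>v. \<Sum>k=1..N. scale (\<Phi> (e k) u) (M_op (e k) w v))" by (simp add: fun_eq_iff)
  have 2: "M_op w u v = - M_op u w v" for w u v by (simp add: M_op_def)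
  show "M_op w u = (\<lambda>v. \<Sum>k=1..N. scale (\<Phi> (e k) u) (M_op w (e k) v))"
    unfolding fun_eq_iff 2[of w] 1 by (simp add: sum_negf)
qed

lemma bracket_M:
  assumes "A \<in> so"
  shows "(\<lambda>v. A (M_op u w v) - M_op u w (A v)) = (\<lambda>v. M_op (A u) w v + M_op u (A w) v)"
  by (simp add: fun_eq_iff M_op_def so_diff[OF assms] so_lin(2)[OF assms] so_form[OF assms])

lemma bil_M:
  assumes "bil \<beta>" "C \<in> so"
  shows "\<beta> (M_op u w) C = (\<Sum>k=1..N. \<Phi> (e k) u *\<^sub>c \<beta> (M_op (e k) w) C)"
    "\<beta> (M_op w u) C = (\<Sum>k=1..N. \<Phi> (e k) u *\<^sub>c \<beta> (M_op w (e k)) C)"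
    "\<beta> C (M_op u w) = (\<Sum>k=1..N. \<Phi> (e k) u *\<^sub>c \<beta> C (M_op (e k) w))"
    "\<beta> C (M_op w u) = (\<Sum>k=1..N. \<Phi> (e k) u *\<^sub>c \<beta> C (M_op w (e k)))"
proof -
  note S = bil_sum[OF assms(1) finite_atLeastAtMost _ assms(2), where c = "\<lambda>k. \<Phi> (e k) u"]
  show "\<beta> (M_op u w) C = (\<Sum>k=1..N. \<Phi> (e k) u *\<^sub>c \<beta> (M_op (e k) w) C)"
    unfolding S(1)[where A = "\<lambda>k. M_op (e k) w", OF so_M, symmetric] M_op_expand(1)[symmetric] ..
  show "\<beta> (M_op w u) C = (\<Sum>k=1..N. \<Phi> (e k) u *\<^sub>c \<beta> (M_op w (e k)) C)"
    unfolding S(1)[where A = "\<lambda>k. M_op w (e k)", OF so_M, symmetric] M_op_expand(2)[symmetric] ..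
  show "\<beta> C (M_op u w) = (\<Sum>k=1..N. \<Phi> (e k) u *\<^sub>c \<beta> C (M_op (e k) w))"
    unfolding S(2)[where A = "\<lambda>k. M_op (e k) w", OF so_M, symmetric] M_op_expand(1)[symmetric] ..
  show "\<beta> C (M_op w u) = (\<Sum>k=1..N. \<Phi> (e k) u *\<^sub>c \<beta> C (M_op w (e k)))"
    unfolding S(2)[where A = "\<lambda>k. M_op w (e k)", OF so_M, symmetric] M_op_expand(2)[symmetric] ..
qed

text \<open>Bracketing with \<open>A\<close> replaces one index at a time with coefficients
  \<open>ent A\<close>. The four resulting sums cancel in two pairs after exchanging the summation
  indices, because \<open>ent A\<close> is antisymmetric.\<close>

lemma casimir_invariant:
  fixes \<beta> :: "('v => 'v) => ('v => 'v) => 'b::cvec"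
  assumes \<beta>: "bil \<beta>" and A: "A \<in> so"
  shows "(\<Sum>i=1..N. \<Sum>j=1..N. \<beta> (\<lambda>v. A (MM i j v) - MM i j (A v)) (MM j i) + \<beta> (MM i j) (\<lambda>v. A (MM j i v) - MM j i (A v))) = 0"
proof -
  have 1: "\<beta> (\<lambda>v. A (MM i j v) - MM i j (A v)) (MM j i) + \<beta> (MM i j) (\<lambda>v. A (MM j i v) - MM j i (A v))
    = ((\<Sum>k=1..N. ent A k i *\<^sub>c \<beta> (MM k j) (MM j i)) + (\<Sum>k=1..N. ent A k i *\<^sub>c \<beta> (MM i j) (MM j k)))
    + ((\<Sum>k=1..N. ent A k j *\<^sub>c \<beta> (MM i k) (MM j i)) + (\<Sum>k=1..N. ent A k j *\<^sub>c \<beta> (MM i j) (MM k i)))" for i j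
    unfolding bracket_M[OF A] bil_add[OF \<beta> so_M so_M so_M] bil_M(1)[OF \<beta> so_M, where u = "A (e i)"] bil_M(2)[OF \<beta> so_M, where u = "A (e j)"]
       bil_M(3)[OF \<beta> so_M, where u = "A (e j)"] bil_M(4)[OF \<beta> so_M, where u = "A (e i)"] by (simp only: add_ac)
  have neg: "ent A i j *\<^sub>c x = - (ent A j i *\<^sub>c x)" for i j and x :: 'b
    using ent_antisym[OF A, of i j] by (simp only: cvec.scale_minus_left)
  have a: "(\<Sum>i=1..N. \<Sum>j=1..N. \<Sum>k=1..N. ent A k i *\<^sub>c \<beta> (MM i j) (MM j k))
     = - (\<Sum>i=1..N. \<Sum>j=1..N. \<Sum>k=1..N. ent A k i *\<^sub>c \<beta> (MM k j) (MM j i))"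
  proof -
    have "(\<Sum>i=1..N. \<Sum>j=1..N. \<Sum>k=1..N. ent A k i *\<^sub>c \<beta> (MM i j) (MM j k))
      = (\<Sum>j=1..N. \<Sum>i=1..N. \<Sum>k=1..N. ent A k i *\<^sub>c \<beta> (MM i j) (MM j k))" by (rule sum.swap)
    also have "\<dots> = (\<Sum>j=1..N. \<Sum>k=1..N. \<Sum>i=1..N. ent A k i *\<^sub>c \<beta> (MM i j) (MM j k))"
      by (rule sum.cong[OF refl], rule sum.swap)
    also have "\<dots> = (\<Sum>k=1..N. \<Sum>j=1..N. \<Sum>i=1..N. ent A k i *\<^sub>c \<beta> (MM i j) (MM j k))" by (rule sum.swap)
    also have "\<dots> = (\<Sum>k=1..N. \<Sum>j=1..N. \<Sum>i=1..N. - (ent A i k *\<^sub>c \<beta> (MM i j) (MM j k)))"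
      by (intro sum.cong refl) (rule neg)
    finally show ?thesis by (simp only: sum_negf)
  qed
  have b: "(\<Sum>i=1..N. \<Sum>j=1..N. \<Sum>k=1..N. ent A k j *\<^sub>c \<beta> (MM i j) (MM k i))
     = - (\<Sum>i=1..N. \<Sum>j=1..N. \<Sum>k=1..N. ent A k j *\<^sub>c \<beta> (MM i k) (MM j i))"
  proof -
    have "(\<Sum>i=1..N. \<Sum>j=1..N. \<Sum>k=1..N. ent A k j *\<^sub>c \<beta> (MM i j) (MM k i))
      = (\<Sum>i=1..N. \<Sum>k=1..N. \<Sum>j=1..N. ent A k j *\<^sub>c \<beta> (MM i j) (MM k i))"
      by (rule sum.cong[OF refl], rule sum.swap)
    also have "\<dots> = (\<Sum>i=1..N. \<Sum>k=1..N. \<Sum>j=1..N. - (ent A j k *\<^sub>c \<beta> (MM i j) (MM k i)))"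
      by (intro sum.cong refl) (rule neg)
    finally show ?thesis by (simp only: sum_negf)
  qed
  show ?thesis unfolding 1 sum.distrib a b by (simp only: right_minus add_0_left)
qed

text \<open>The Casimir tensor does not depend on the orthonormal frame; the hypothesis says that
  the coordinates of \<open>f\<close> have orthonormal rows. It is applied to the image of the basis
  under an isometry.\<close>

lemma casimir_frame:
  fixes \<beta> :: "('v => 'v) => ('v => 'v) => 'b::cvec"
  assumes \<beta>: "bil \<beta>"
    and f: "\<And>k l. k \<in> {1..N} ==> l \<in> {1..N} ==> (\<Sum>i=1..N. \<Phi> (e k) (f i) * \<Phi> (e l) (f i)) = (if k = l then 1 else 0)"
  shows "(\<Sum>i=1..N. \<Sum>j=1..N. \<beta> (M_op (f i) (f j)) (M_op (f j) (f i)))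
    = (\<Sum>k=1..N. \<Sum>l=1..N. \<beta> (MM k l) (MM l k))"
proof -
  \<comment> \<open>One index is changed at a time: for a bilinear \<open>\<gamma>\<close> the trace
    over a frame is the trace over the basis.\<close>
  have half: "(\<Sum>i=1..N. \<gamma> (f i) (f i)) = (\<Sum>k=1..N. \<gamma> (e k) (e k))"
    if \<gamma>: "\<And>u w. \<gamma> u w = (\<Sum>k=1..N. \<Phi> (e k) u *\<^sub>c \<gamma> (e k) w)" "\<And>u w. \<gamma> w u = (\<Sum>k=1..N. \<Phi> (e k) u *\<^sub>c \<gamma> w (e k))"
    for \<gamma> :: "'v => 'v => 'b"
  proof -
    have "(\<Sum>i=1..N. \<gamma> (f i) (f i)) = (\<Sum>i=1..N. \<Sum>k=1..N. \<Sum>l=1..N. (\<Phi> (e k) (f i) * \<Phi> (e l) (f i)) *\<^sub>c \<gamma> (e k) (e l))"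
    proof (rule sum.cong[OF refl])
      fix i
      have "\<gamma> (f i) (f i) = (\<Sum>k=1..N. \<Phi> (e k) (f i) *\<^sub>c (\<Sum>l=1..N. \<Phi> (e l) (f i) *\<^sub>c \<gamma> (e k) (e l)))"
        by (subst \<gamma>(1)) (intro sum.cong refl arg_cong2[where f = cscale] \<gamma>(2))
      then show "\<gamma> (f i) (f i) = (\<Sum>k=1..N. \<Sum>l=1..N. (\<Phi> (e k) (f i) * \<Phi> (e l) (f i)) *\<^sub>c \<gamma> (e k) (e l))"
        by (simp only: cscale_sum_right cscale_cscale)
    qed
    also have "\<dots> = (\<Sum>k=1..N. \<Sum>i=1..N. \<Sum>l=1..N. (\<Phi> (e k) (f i) * \<Phi> (e l) (f i)) *\<^sub>c \<gamma> (e k) (e l))"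
      by (rule sum.swap)
    also have "\<dots> = (\<Sum>k=1..N. \<Sum>l=1..N. \<Sum>i=1..N. (\<Phi> (e k) (f i) * \<Phi> (e l) (f i)) *\<^sub>c \<gamma> (e k) (e l))"
      by (rule sum.cong[OF refl], rule sum.swap)
    also have "\<dots> = (\<Sum>k=1..N. \<Sum>l=1..N. (if k = l then 1 else 0) *\<^sub>c \<gamma> (e k) (e l))"
      by (intro sum.cong refl) (simp only: cscale_sum_left[symmetric] f)
    also have "\<dots> = (\<Sum>k=1..N. \<Sum>l=1..N. if l = k then \<gamma> (e k) (e k) else 0)"
      by (intro sum.cong refl) auto
    finally show ?thesis by simp
  qed
  have "(\<Sum>i=1..N. \<Sum>j=1..N. \<beta> (M_op (f i) (f j)) (M_op (f j) (f i)))
     = (\<Sum>i=1..N. \<Sum>j=1..N. \<beta> (M_op (f i) (e j)) (M_op (e j) (f i)))"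
    by (rule sum.cong[OF refl], rule half) (rule bil_M[OF \<beta> so_M])+
  also have "\<dots> = (\<Sum>j=1..N. \<Sum>i=1..N. \<beta> (M_op (f i) (e j)) (M_op (e j) (f i)))" by (rule sum.swap)
  also have "\<dots> = (\<Sum>j=1..N. \<Sum>i=1..N. \<beta> (MM i j) (MM j i))"
    by (rule sum.cong[OF refl], rule half) (rule bil_M[OF \<beta> so_M])+
  also have "\<dots> = (\<Sum>i=1..N. \<Sum>j=1..N. \<beta> (MM i j) (MM j i))" by (rule sum.swap)
  finally show ?thesis .
qed

subsection \<open>Tensor words over a module\<close>

text \<open>
  An element of a tensor word with coefficients in a vector space is a function on label lists.
  Labels outside the basis carry the value \<open>0\<close>, so that all identities below hold on the
  whole function space.
\<close>

definition sl :: "label => (label list => 'm) => label list => 'm"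
  where "sl x t = (\<lambda>r. t (x # r))"

definition mk :: "gob => (label => label list => 'm::cvec) => label list => 'm"
  where "mk X f = (\<lambda>l. case l of [] => 0 | x # r => if x \<in> bas X then f x r else 0)"

lemma mk_Nil [simp]: "mk X f [] = 0" by (simp add: mk_def)
lemma sl_mk: "sl x (mk X f) = (if x \<in> bas X then f x else 0)" by (auto simp: sl_def mk_def)
lemma sl_mk_in [simp]: "x \<in> bas X ==> sl x (mk X f) = f x" by (simp add: sl_mk)

lemma sl_linear [simp]:
  fixes t u :: "label list => 'm::cvec"
  shows "sl x (t + u) = sl x t + sl x u" "sl x (c *\<^sub>c t) = c *\<^sub>c sl x t" "sl x 0 = (0 :: label list => 'm)"
    "sl x (t - u) = sl x t - sl x u" "sl x (- t) = - sl x t"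
  by (auto simp: sl_def)

lemma sl_sum [simp]: "sl x (\<Sum>i\<in>I. t i) = (\<Sum>i\<in>I. sl x (t i :: label list => 'm::cvec))"
  by (simp add: sl_def fun_eq_iff sum_fun_apply)

lemma mk_cong [cong]: "X = Y ==> (\<And>x. x \<in> bas Y ==> f x = g x) ==> mk X f = mk Y g"
  by (auto simp: mk_def fun_eq_iff split: list.split)

lemma mk_eqI: "(\<And>x. x \<in> bas X ==> f x = g x) ==> mk X f = mk X g"
  by (rule mk_cong) auto

lemma mk_linear:
  "mk X (\<lambda>x. f x + g x) = mk X f + mk X g" "mk X (\<lambda>x. c *\<^sub>c f x) = c *\<^sub>c mk X f"
  "mk X (\<lambda>x. f x - g x) = mk X f - mk X g" "mk X (\<lambda>x. 0) = 0" "mk X (\<lambda>x. - f x) = - mk X f"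
  by (auto simp: mk_def fun_eq_iff split: list.split)

lemma mk_sum: "mk X (\<lambda>x. \<Sum>i\<in>I. f i x) = (\<Sum>i\<in>I. mk X (f i))"
  by (auto simp: mk_def fun_eq_iff sum_fun_apply split: list.split)

text \<open>The operator \<open>K\<close> tensor \<open>h\<close>, with the matrix \<open>K\<close>
  on the first factor and \<open>h\<close> on the rest. With the identity matrix it becomes
  \<open>lst\<close>, with the identity map and a representation matrix it becomes
  \<open>rp\<close>.\<close>

definition tw :: "gob => (label => label => complex) => ((label list => 'm) => label list => 'm')
    => (label list => 'm::cvec) => label list => 'm'::cvec"
  where "tw X K h t = mk X (\<lambda>x. \<Sum>y\<in>bas X. K x y *\<^sub>c h (sl y t))"

definition lst :: "gob => ((label list => 'm) => label list => 'm') => (label list => 'm::cvec) => label list => 'm'::cvec"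
  where "lst X h t = mk X (\<lambda>x. h (sl x t))"

abbreviation rp :: "gob => ('v => 'v) => (label list => 'm::cvec) => label list => 'm"
  where "rp X A \<equiv> tw X (rep X A) (\<lambda>t. t)"

definition ten :: "gob => (('v => 'v) => (label list => 'm) => label list => 'm) => ('v => 'v) => (label list => 'm::cvec) => label list => 'm"
  where "ten X \<rho> A t = rp X A t + lst X (\<rho> A) t"

primrec lsts :: "gob list => ((label list => 'm::cvec) => label list => 'm) => (label list => 'm) => label list => 'm" where
  "lsts [] h = h"
| "lsts (X # a) h = lst X (lsts a h)"

primrec tens :: "gob list => (('v => 'v) => (label list => 'm) => label list => 'm) => ('v => 'v) => (label list => 'm::cvec) => label list => 'm" where
  "tens [] \<rho> = \<rho>"
| "tens (X # a) \<rho> = ten X (tens a \<rho>)"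

primrec tws :: "(gob => label => label => complex) => gob list => ((label list => 'm::cvec) => label list => 'm) => (label list => 'm) => label list => 'm" where
  "tws \<gamma> [] h = h"
| "tws \<gamma> (X # a) h = tw X (\<gamma> X) (tws \<gamma> a h)"

lemma append_simps [simp]:
  "lsts (a @ b) h = lsts a (lsts b h)" "tens (a @ b) \<rho> = tens a (tens b \<rho>)" "tws \<gamma> (a @ b) h = tws \<gamma> a (tws \<gamma> b h)"
  by (induction a) simp_all

lemma lst_tw: "lst X h = tw X (\<lambda>x y. if x = y then 1 else 0) h"
proof
  fix t
  have "(\<Sum>y\<in>bas X. (if x = y then 1 else 0) *\<^sub>c h (sl y t)) = h (sl x t)" if x: "x \<in> bas X" for x
  proof -
    have "(\<Sum>y\<in>bas X. (if x = y then 1 else 0) *\<^sub>c h (sl y t)) = (\<Sum>y\<in>bas X. if y = x then h (sl x t) else 0)"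
      by (intro sum.cong refl) auto
    then show ?thesis using x by simp
  qed
  then show "lst X h t = tw X (\<lambda>x y. if x = y then 1 else 0) h t" unfolding lst_def tw_def by (intro mk_eqI) simp
qed

lemma clin_tw:
  assumes h: "clin h" shows "clin (tw X K h)"
proof (rule clinI)
  fix t u c
  show "tw X K h (t + u) = tw X K h t + tw X K h u"
    unfolding tw_def mk_linear[symmetric] sum.distrib[symmetric] sl_linear clin_add[OF h] cscale_add_right ..
  show "tw X K h (c *\<^sub>c t) = c *\<^sub>c tw X K h t"
    unfolding tw_def mk_linear[symmetric] cscale_sum_right sl_linear clin_scale[OF h] cscale_cscale by (simp only: mult.commute)
qed

lemma clin_lst: "clin h ==> clin (lst X h)" unfolding lst_tw by (rule clin_tw)

lemma clin_lsts: "clin h ==> clin (lsts a h)" by (induction a) (simp_all add: clin_lst)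

lemma clin_tws: "clin h ==> clin (tws \<gamma> a h)" by (induction a) (simp_all add: clin_tw)

lemma tw_tw:
  assumes h: "clin h"
  shows "tw X K h (tw X L k t) = tw X (\<lambda>x y. \<Sum>z\<in>bas X. K x z * L z y) (\<lambda>u. h (k u)) t"
proof -
  have "(\<Sum>y\<in>bas X. K x y *\<^sub>c h (\<Sum>z\<in>bas X. L y z *\<^sub>c k (sl z t)))
    = (\<Sum>z\<in>bas X. (\<Sum>y\<in>bas X. K x y * L y z) *\<^sub>c h (k (sl z t)))" for x
  proof -
    have "(\<Sum>y\<in>bas X. K x y *\<^sub>c h (\<Sum>z\<in>bas X. L y z *\<^sub>c k (sl z t)))
      = (\<Sum>y\<in>bas X. \<Sum>z\<in>bas X. (K x y * L y z) *\<^sub>c h (k (sl z t)))"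
      by (simp only: clin_sum[OF h] clin_scale[OF h] cscale_sum_right cscale_cscale)
    also have "\<dots> = (\<Sum>z\<in>bas X. \<Sum>y\<in>bas X. (K x y * L y z) *\<^sub>c h (k (sl z t)))" by (rule sum.swap)
    finally show ?thesis by (simp only: cscale_sum_left)
  qed
  moreover have "tw X K h (tw X L k t) = mk X (\<lambda>x. \<Sum>y\<in>bas X. K x y *\<^sub>c h (\<Sum>z\<in>bas X. L y z *\<^sub>c k (sl z t)))"
    unfolding tw_def by (intro mk_eqI sum.cong refl) (simp only: sl_mk_in)
  ultimately show ?thesis by (simp only: tw_def)
qed

lemma tw_cong:
  assumes "\<And>x y. x \<in> bas X ==> y \<in> bas X ==> K x y = L x y" "\<And>u. h u = k u"
  shows "tw X K h t = tw X L k t"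
  unfolding tw_def by (intro mk_eqI sum.cong refl) (simp add: assms)

lemma tw_add_matrix: "tw X (\<lambda>x y. K x y + L x y) h t = tw X K h t + tw X L h t"
  unfolding tw_def mk_linear[symmetric] cscale_add_left sum.distrib ..

lemma tw_scale_matrix: "tw X (\<lambda>x y. c * K x y) h t = c *\<^sub>c tw X K h t"
  unfolding tw_def mk_linear[symmetric] cscale_sum_right cscale_cscale ..

lemma tw_diff_matrix: "tw X (\<lambda>x y. K x y - L x y) h t = tw X K h t - tw X L h t"
  unfolding tw_def mk_linear[symmetric] cscale_diff_left sum_subtractf ..

lemma lst_linear: "lst X (\<lambda>u. h u + k u) t = lst X h t + lst X k t" "lst X (\<lambda>u. c *\<^sub>c h u) t = c *\<^sub>c lst X h t"
  "lst X (\<lambda>u. h u - k u) t = lst X h t - lst X k t"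
  unfolding lst_def mk_linear by (rule refl)+

lemma lst_cong: "(\<And>u. h u = k u) ==> lst X h t = lst X k t"
  unfolding lst_def by (rule mk_eqI) simp

lemma lst_lst: "lst X h (lst X k t) = lst X (\<lambda>u. h (k u)) t"
  unfolding lst_def by (rule mk_eqI) simp

lemma lst_tw_eq: "lst X h (tw X K k t) = tw X K (\<lambda>u. h (k u)) t" if "clin h"
  unfolding lst_def tw_def by (rule mk_eqI) (simp add: clin_sum[OF that] clin_scale[OF that])

lemma tw_lst: "tw X K h (lst X k t) = tw X K (\<lambda>u. h (k u)) t"
  unfolding lst_def tw_def by (intro mk_eqI sum.cong refl) simp

lemma lsts_lsts: "lsts a h (lsts a k t) = lsts a (\<lambda>u. h (k u)) t"
proof (induction a arbitrary: h k t)
  case (Cons X a)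
  have "(\<lambda>u. lsts a h (lsts a k u)) = lsts a (\<lambda>u. h (k u))" using Cons by (simp add: fun_eq_iff)
  then show ?case by (simp add: lst_lst)
qed simp

lemma lsts_tws: "clin h ==> lsts a h (tws \<gamma> a k t) = tws \<gamma> a (\<lambda>u. h (k u)) t"
proof (induction a arbitrary: h k t)
  case (Cons X a)
  have "(\<lambda>u. lsts a h (tws \<gamma> a k u)) = tws \<gamma> a (\<lambda>u. h (k u))" using Cons by (simp add: fun_eq_iff)
  then show ?case using Cons.prems by (simp add: lst_tw_eq clin_lsts)
qed simp

lemma tws_lsts: "tws \<gamma> a h (lsts a k t) = tws \<gamma> a (\<lambda>u. h (k u)) t"
proof (induction a arbitrary: h k t)
  case (Cons X a)
  have "(\<lambda>u. tws \<gamma> a h (lsts a k u)) = tws \<gamma> a (\<lambda>u. h (k u))" using Cons by (simp add: fun_eq_iff)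
  then show ?case by (simp add: tw_lst)
qed simp

lemma tws_identity: "tws (\<lambda>X x y. if x = y then 1 else 0) a h = lsts a h"
  by (induction a) (simp_all add: lst_tw)

subsection \<open>Modules and the action on tensor words\<close>

definition gmod :: "(('v => 'v) => (label list => 'm) => label list => 'm::cvec) => bool"
  where "gmod \<rho> \<longleftrightarrow> (\<forall>A\<in>so. clin (\<rho> A) \<and> (\<forall>c t. \<rho> (\<lambda>v. scale c (A v)) t = c *\<^sub>c \<rho> A t)
    \<and> (\<forall>B\<in>so. \<forall>t. \<rho> (\<lambda>v. A v + B v) t = \<rho> A t + \<rho> B t \<and> \<rho> (\<lambda>v. A (B v) - B (A v)) t = \<rho> A (\<rho> B t) - \<rho> B (\<rho> A t)))"

lemma gmodD:
  assumes "gmod \<rho>" "A \<in> so"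
  shows "clin (\<rho> A)" "\<rho> (\<lambda>v. scale c (A v)) t = c *\<^sub>c \<rho> A t"
    "B \<in> so ==> \<rho> (\<lambda>v. A v + B v) t = \<rho> A t + \<rho> B t"
    "B \<in> so ==> \<rho> (\<lambda>v. A (B v) - B (A v)) t = \<rho> A (\<rho> B t) - \<rho> B (\<rho> A t)"
  using assms unfolding gmod_def by blast+

lemma rp_bracket:
  assumes "A \<in> so" "B \<in> so"
  shows "rp X (\<lambda>v. A (B v) - B (A v)) t = rp X A (rp X B t) - rp X B (rp X A t)"
  unfolding tw_tw[OF clin_id] tw_diff_matrix[symmetric] by (rule tw_cong) (simp_all add: rep_bracket[OF assms])

lemma rp_add: "rp X (\<lambda>v. A v + B v) t = rp X A t + rp X B t"
  unfolding tw_add_matrix[symmetric] by (rule tw_cong) (simp_all add: rep_add)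

lemma rp_scale: "rp X (\<lambda>v. scale c (A v)) t = c *\<^sub>c rp X A t"
  unfolding tw_scale_matrix[symmetric] by (rule tw_cong) (simp_all add: rep_scale)

lemma clin_rp: "clin (rp X A)" by (rule clin_tw[OF clin_id])

lemma lst_rp: "clin h ==> lst X h (rp X A t) = rp X A (lst X h t)"
  by (simp add: lst_tw_eq tw_lst)

lemma lst_gmod:
  assumes "gmod \<rho>" "A \<in> so"
  shows "lst X (\<rho> (\<lambda>v. scale c (A v))) t = c *\<^sub>c lst X (\<rho> A) t"
    "B \<in> so ==> lst X (\<rho> (\<lambda>v. A v + B v)) t = lst X (\<rho> A) t + lst X (\<rho> B) t"
proof -
  show "lst X (\<rho> (\<lambda>v. scale c (A v))) t = c *\<^sub>c lst X (\<rho> A) t"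
    unfolding lst_linear[symmetric] by (rule lst_cong, rule gmodD(2)[OF assms])
  show "lst X (\<rho> (\<lambda>v. A v + B v)) t = lst X (\<rho> A) t + lst X (\<rho> B) t" if "B \<in> so"
    unfolding lst_linear[symmetric] by (rule lst_cong, rule gmodD(3)[OF assms that])
qed

lemma clin_ten: "gmod \<rho> ==> A \<in> so ==> clin (ten X \<rho> A)"
  by (rule clinI) (simp_all add: ten_def clin_simps[OF clin_rp] clin_simps[OF clin_lst[OF gmodD(1)]] cscale_add_right add_ac)

lemma ten_rp:
  assumes "gmod \<rho>" "A \<in> so" "B \<in> so"
  shows "ten X \<rho> A (rp X B t) = rp X B (ten X \<rho> A t) + rp X (\<lambda>v. A (B v) - B (A v)) t"
  by (simp add: ten_def rp_bracket[OF assms(2,3)] lst_rp[OF gmodD(1)[OF assms(1,2)]] clin_add[OF clin_rp])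

lemma ten_lst:
  assumes "gmod \<rho>" "A \<in> so" "B \<in> so"
  shows "ten X \<rho> A (lst X (\<rho> B) t) = lst X (\<rho> B) (ten X \<rho> A t) + lst X (\<rho> (\<lambda>v. A (B v) - B (A v))) t"
proof -
  have "lst X (\<rho> (\<lambda>v. A (B v) - B (A v))) t = lst X (\<rho> A) (lst X (\<rho> B) t) - lst X (\<rho> B) (lst X (\<rho> A) t)"
    unfolding lst_lst lst_linear[symmetric] by (rule lst_cong, rule gmodD(4)[OF assms])
  then show ?thesis
    by (simp add: ten_def lst_rp[OF gmodD(1)[OF assms(1,3)]] clin_add[OF clin_lst[OF gmodD(1)[OF assms(1,3)]]])
qed

lemma gmod_ten:
  assumes "gmod \<rho>" shows "gmod (ten X \<rho>)"
  unfolding gmod_def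
proof (intro ballI conjI allI)
  fix A c t assume A: "A \<in> so"
  show "clin (ten X \<rho> A)" by (rule clin_ten[OF assms A])
  show "ten X \<rho> (\<lambda>v. scale c (A v)) t = c *\<^sub>c ten X \<rho> A t"
    by (simp add: ten_def rp_scale lst_gmod(1)[OF assms A] cscale_add_right)
next
  fix A B t assume A: "A \<in> so" and B: "B \<in> so"
  show "ten X \<rho> (\<lambda>v. A v + B v) t = ten X \<rho> A t + ten X \<rho> B t"
    by (simp add: ten_def rp_add lst_gmod(2)[OF assms A B] add_ac)
  have "ten X \<rho> A (ten X \<rho> B t) = ten X \<rho> A (rp X B t) + ten X \<rho> A (lst X (\<rho> B) t)"
    unfolding ten_def[of X \<rho> B] by (rule clin_add[OF clin_ten[OF assms A]])
  also have "\<dots> = (rp X B (ten X \<rho> A t) + lst X (\<rho> B) (ten X \<rho> A t)) + (rp X (\<lambda>v. A (B v) - B (A v)) t + lst X (\<rho> (\<lambda>v. A (B v) - B (A v))) t)"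
    unfolding ten_rp[OF assms A B] ten_lst[OF assms A B] by (simp only: add_ac)
  also have "\<dots> = ten X \<rho> B (ten X \<rho> A t) + ten X \<rho> (\<lambda>v. A (B v) - B (A v)) t"
    unfolding ten_def[of X \<rho> B] ten_def[of X \<rho> "\<lambda>v. A (B v) - B (A v)"] ..
  finally show "ten X \<rho> (\<lambda>v. A (B v) - B (A v)) t = ten X \<rho> A (ten X \<rho> B t) - ten X \<rho> B (ten X \<rho> A t)"
    by (simp only: add_diff_cancel_left')
qed

lemma gmod_tens: "gmod \<rho> ==> gmod (tens a \<rho>)" by (induction a) (simp_all add: gmod_ten)

end

declare cscale_fun_apply [simp del] plus_fun_apply [simp del] zero_fun_apply [simp del]

context spin_setting
begin

definition Om :: "gob => (('v => 'v) => (label list => 'm) => label list => 'm) => (label list => 'm::cvec) => label list => 'm"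
  where "Om X \<rho> t = 2 *\<^sub>c (\<Sum>(i, j)\<in>upper_pairs. rp X (MM i j) (lst X (\<rho> (MM j i)) t))
    + (\<Sum>(i, j)\<in>upper_pairs. rp X (MM i j) (rp X (MM j i) t))"

text \<open>The identity morphism acts as the truncation \<open>lsts a\<close> of the identity map
  and not as the identity of the function space. Hence all morphisms produce families that vanish
  off the basis labels, and the unit laws hold on every family, truncated or not.\<close>

primrec G :: "mor => (('v => 'v) => (label list => 'm) => label list => 'm) => (label list => 'm::cvec) => label list => 'm" where
  "G (Cap X) = (\<lambda>\<rho> t. \<Sum>x\<in>bas X. \<Sum>y\<in>bas X. form X x y *\<^sub>c sl y (sl x t))"
| "G (Cup X) = (\<lambda>\<rho> t. mk X (\<lambda>x. mk X (\<lambda>y. dual_coord X x y *\<^sub>c t)))"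
| "G (Swap X Y) = (\<lambda>\<rho> t. mk Y (\<lambda>y. mk X (\<lambda>x. sg X Y *\<^sub>c sl y (sl x t))))"
| "G Mu = (\<lambda>\<rho> t. mk Spin (\<lambda>z. \<Sum>x\<in>BV. \<Sum>y\<in>BS. mu z x y *\<^sub>c sl y (sl x t)))"
| "G (Dot X) = Om X"
| "G (Idm a) = (\<lambda>\<rho>. lsts a (\<lambda>t. t))"
| "G (g \<bullet> f) = (\<lambda>\<rho> t. G g \<rho> (G f \<rho> t))"
| "G (f \<boxtimes> g) = (\<lambda>\<rho> t. G f (tens (tgt g) \<rho>) (lsts (src f) (G g \<rho>) t))"
| "G (Zero a b) = (\<lambda>\<rho> t. 0)"
| "G (f \<boxplus> g) = (\<lambda>\<rho> t. G f \<rho> t + G g \<rho> t)"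
| "G (c \<star> f) = (\<lambda>\<rho> t. c *\<^sub>c G f \<rho> t)"

lemma MM_swap: "MM j i = (\<lambda>v. scale (-1) (MM i j v))" by (simp add: M_op_def fun_eq_iff)

lemma rp_MM_swap: "rp X (MM j i) t = - rp X (MM i j) t"
  by (subst MM_swap, subst rp_scale) simp

lemma gmod_MM_swap: "gmod \<rho> ==> \<rho> (MM j i) t = - \<rho> (MM i j) t"
  by (subst MM_swap, subst gmodD(2)[OF _ so_M]) simp_all

lemma rp_MM_diag: "rp X (MM i i) t = 0"
proof -
  have "MM i i = (\<lambda>v. scale 0 (MM i i v))" by (simp add: M_op_def fun_eq_iff)
  then show ?thesis by (metis rp_scale cvec.scale_zero_left)
qed

text \<open>Passing to all ordered pairs halves both sums. The factor 2 in the definition of the dot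
  therefore disappears from the mixed term, and the Casimir term keeps 1/2.\<close>

lemma Om_full:
  assumes \<rho>: "gmod \<rho>"
  shows "Om X \<rho> t = (\<Sum>i=1..N. \<Sum>j=1..N. rp X (MM i j) (lst X (\<rho> (MM j i)) t))
    + (1/2) *\<^sub>c (\<Sum>i=1..N. \<Sum>j=1..N. rp X (MM i j) (rp X (MM j i) t))"
proof -
  have lsw: "lst X (\<rho> (MM j i)) t = - lst X (\<rho> (MM i j)) t" for i j t
    unfolding lst_def mk_linear[symmetric] by (rule mk_eqI) (rule gmod_MM_swap[OF \<rho>])
  have 1: "(\<Sum>(i, j)\<in>upper_pairs. rp X (MM i j) (lst X (\<rho> (MM j i)) t)) = (1/2) *\<^sub>c (\<Sum>i=1..N. \<Sum>j=1..N. rp X (MM i j) (lst X (\<rho> (MM j i)) t))"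
  proof (rule sum_upper_pairs)
    fix i j show "rp X (MM j i) (lst X (\<rho> (MM i j)) t) = rp X (MM i j) (lst X (\<rho> (MM j i)) t)"
      unfolding rp_MM_swap[of X j i] lsw[of j i] clin_minus[OF clin_rp] by simp
  qed (rule rp_MM_diag)
  have 2: "(\<Sum>(i, j)\<in>upper_pairs. rp X (MM i j) (rp X (MM j i) t)) = (1/2) *\<^sub>c (\<Sum>i=1..N. \<Sum>j=1..N. rp X (MM i j) (rp X (MM j i) t))"
  proof (rule sum_upper_pairs)
    fix i j show "rp X (MM j i) (rp X (MM i j) t) = rp X (MM i j) (rp X (MM j i) t)"
      unfolding rp_MM_swap[of X j i] clin_minus[OF clin_rp] by simp
  qed (rule rp_MM_diag)
  show ?thesis unfolding Om_def 1 2 by simp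
qed

lemma bil_rp_lst: assumes \<rho>: "gmod \<rho>" shows "bil (\<lambda>A B. rp X A (lst X (\<rho> B) t))"
  unfolding bil_def
  by (auto simp: rp_add rp_scale lst_gmod[OF \<rho>] clin_add[OF clin_rp] clin_scale[OF clin_rp])

lemma bil_rp_rp: "bil (\<lambda>A B. rp X A (rp X B t))"
  unfolding bil_def
  by (auto simp: rp_add rp_scale clin_add[OF clin_rp] clin_scale[OF clin_rp])

lemma Om_equivariant:
  assumes \<rho>: "gmod \<rho>" and A: "A \<in> so"
  shows "Om X \<rho> (ten X \<rho> A t) = ten X \<rho> A (Om X \<rho> t)"
proof -
  note L = clin_ten[OF \<rho> A]
  note R = clin_rp[of X]
  let ?c = "\<lambda>i j. (\<lambda>v. A (MM i j v) - MM i j (A v))"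
  have 1: "ten X \<rho> A (rp X (MM i j) (lst X (\<rho> (MM j i)) t)) = rp X (MM i j) (lst X (\<rho> (MM j i)) (ten X \<rho> A t))
    + (rp X (?c i j) (lst X (\<rho> (MM j i)) t) + rp X (MM i j) (lst X (\<rho> (?c j i)) t))" for i j
    unfolding ten_rp[OF \<rho> A so_M] ten_lst[OF \<rho> A so_M] clin_add[OF R] by (simp only: add_ac)
  have 2: "ten X \<rho> A (rp X (MM i j) (rp X (MM j i) t)) = rp X (MM i j) (rp X (MM j i) (ten X \<rho> A t))
    + (rp X (?c i j) (rp X (MM j i) t) + rp X (MM i j) (rp X (?c j i) t))" for i j
    unfolding ten_rp[OF \<rho> A so_M] clin_add[OF R] by (simp only: add_ac)
  have split: "(\<Sum>i=1..N. \<Sum>j=1..N. f i j + g i j) = (\<Sum>i=1..N. \<Sum>j=1..N. f i j) + (\<Sum>i=1..N. \<Sum>j=1..N. g i j)"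
    for f g :: "nat => nat => label list => 'a"
    by (simp only: sum.distrib)
  show ?thesis
    unfolding Om_full[OF \<rho>] clin_simps[OF L] 1 2
      split[of "\<lambda>i j. rp X (MM i j) (lst X (\<rho> (MM j i)) (ten X \<rho> A t))"]
      split[of "\<lambda>i j. rp X (MM i j) (rp X (MM j i) (ten X \<rho> A t))"]
      casimir_invariant[OF bil_rp_lst[OF \<rho>] A] casimir_invariant[OF bil_rp_rp A]
    by (simp only: add_0_right)
qed

lemma clin_Om: assumes "gmod \<rho>" shows "clin (Om X \<rho>)"
proof -
  have 1: "clin (\<lambda>t. rp X (MM i j) (lst X (\<rho> (MM j i)) t))" for i j
    by (rule clin_comp[OF clin_rp clin_lst[OF gmodD(1)[OF assms so_M]]])
  have 2: "clin (\<lambda>t. rp X (MM i j) (rp X (MM j i) t))" for i j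
    by (rule clin_comp[OF clin_rp clin_rp])
  show ?thesis
  proof (rule clinI)
    fix t u c
    show "Om X \<rho> (t + u) = Om X \<rho> t + Om X \<rho> u"
      unfolding Om_full[OF assms] clin_add[OF 1] clin_add[OF 2] sum.distrib cscale_add_right by (simp only: add_ac)
    show "Om X \<rho> (c *\<^sub>c t) = c *\<^sub>c Om X \<rho> t"
      unfolding Om_full[OF assms] clin_scale[OF 1] clin_scale[OF 2] cscale_sum_right[symmetric] cscale_add_right cscale_cscale
      by (simp only: mult.commute)
  qed
qed

lemma clin_G: "gmod \<rho> ==> clin (G f \<rho>)"
proof (induction f arbitrary: \<rho>)
  case (Cap X)
  show ?case
    by (rule clinI) (simp_all only: G.simps sl_linear sum.distrib cscale_add_right cscale_sum_right cscale_cscale mult.commute)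
next
  case (Cup X)
  show ?case
    by (rule clinI) (simp_all only: G.simps cscale_add_right mk_linear[symmetric] cscale_cscale mult.commute)
next
  case (Swap X Y)
  show ?case
    by (rule clinI) (simp_all only: G.simps sl_linear cscale_add_right mk_linear[symmetric] cscale_cscale mult.commute)
next
  case Mu
  show ?case
    by (rule clinI) (simp_all only: G.simps sl_linear cscale_add_right mk_linear[symmetric] sum.distrib cscale_sum_right cscale_cscale mult.commute)
next
  case (Dot X) then show ?case by (simp add: clin_Om)
next
  case (Idm a) then show ?case by (simp add: clin_lsts clin_id)
next
  case (Comp g f) then show ?case by (simp add: clin_comp)
next
  case (Tens f g) then show ?case by (simp add: clin_comp[OF _ clin_lsts] gmod_tens)
next
  case (Zero a b) show ?case by (rule clinI) (simp_all only: G.simps cvec.scale_zero_right add_0_right)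
next
  case (Plus f g) then show ?case by (simp add: clin_def cscale_add_right add_ac)
next
  case (Scal c f) then show ?case by (simp add: clin_def cscale_add_right mult.commute)
qed

subsection \<open>Naturality twisted by a symmetry\<close>

text \<open>A simultaneous symmetry of all structure constants: matrices on S and V that intertwine
  the action of \<open>A\<close> with that of \<open>\<theta> A\<close>, preserve forms, duals and
  Clifford multiplication, and move the Casimir tensor to another orthonormal frame. The identity
  gives naturality, an element of G(V) gives its invariance.\<close>

definition twist :: "(gob => label => label => complex) => (('v => 'v) => 'v => 'v) => bool"
  where "twist \<gamma> \<theta> \<longleftrightarrow> (\<forall>A\<in>so. \<theta> A \<in> so)
    \<and> (\<forall>X. \<forall>A\<in>so. \<forall>x\<in>bas X. \<forall>y\<in>bas X.
        (\<Sum>z\<in>bas X. \<gamma> X x z * rep X A z y) = (\<Sum>z\<in>bas X. rep X (\<theta> A) x z * \<gamma> X z y))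
    \<and> (\<forall>X. \<forall>x'\<in>bas X. \<forall>y'\<in>bas X. (\<Sum>x\<in>bas X. \<Sum>y\<in>bas X. form X x y * (\<gamma> X x x' * \<gamma> X y y')) = form X x' y')
    \<and> (\<forall>X. \<forall>x\<in>bas X. \<forall>y\<in>bas X. (\<Sum>x'\<in>bas X. \<Sum>y'\<in>bas X. \<gamma> X x x' * \<gamma> X y y' * dual_coord X x' y') = dual_coord X x y)
    \<and> (\<forall>z\<in>BS. \<forall>x'\<in>BV. \<forall>y'\<in>BS.
        (\<Sum>x\<in>BV. \<Sum>y\<in>BS. mu z x y * (\<gamma> Vect x x' * \<gamma> Spin y y')) = (\<Sum>z'\<in>BS. \<gamma> Spin z z' * mu z' x' y'))
    \<and> (\<exists>f. (\<forall>i\<in>{1..N}. \<forall>j\<in>{1..N}. \<theta> (MM i j) = M_op (f i) (f j))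
        \<and> (\<forall>k\<in>{1..N}. \<forall>l\<in>{1..N}. (\<Sum>i=1..N. \<Phi> (e k) (f i) * \<Phi> (e l) (f i)) = (if k = l then 1 else 0)))"

lemma twistD:
  assumes "twist \<gamma> \<theta>"
  shows "\<And>A. A \<in> so ==> \<theta> A \<in> so"
    and "\<And>X A x y. A \<in> so ==> x \<in> bas X ==> y \<in> bas X ==>
        (\<Sum>z\<in>bas X. \<gamma> X x z * rep X A z y) = (\<Sum>z\<in>bas X. rep X (\<theta> A) x z * \<gamma> X z y)"
    and "\<And>X x' y'. x' \<in> bas X ==> y' \<in> bas X ==>
        (\<Sum>x\<in>bas X. \<Sum>y\<in>bas X. form X x y * (\<gamma> X x x' * \<gamma> X y y')) = form X x' y'"
    and "\<And>X x y. x \<in> bas X ==> y \<in> bas X ==>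
        (\<Sum>x'\<in>bas X. \<Sum>y'\<in>bas X. \<gamma> X x x' * \<gamma> X y y' * dual_coord X x' y') = dual_coord X x y"
    and "\<And>z x' y'. z \<in> BS ==> x' \<in> BV ==> y' \<in> BS ==>
        (\<Sum>x\<in>BV. \<Sum>y\<in>BS. mu z x y * (\<gamma> Vect x x' * \<gamma> Spin y y')) = (\<Sum>z'\<in>BS. \<gamma> Spin z z' * mu z' x' y')"
    and "\<exists>f. (\<forall>i\<in>{1..N}. \<forall>j\<in>{1..N}. \<theta> (MM i j) = M_op (f i) (f j))
        \<and> (\<forall>k\<in>{1..N}. \<forall>l\<in>{1..N}. (\<Sum>i=1..N. \<Phi> (e k) (f i) * \<Phi> (e l) (f i)) = (if k = l then 1 else 0))"
  using assms unfolding twist_def by blast+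

lemma sum4_swap:
  "(\<Sum>x\<in>A. \<Sum>y\<in>B. \<Sum>x'\<in>C. \<Sum>y'\<in>D. f x y x' y') = (\<Sum>x'\<in>C. \<Sum>y'\<in>D. \<Sum>x\<in>A. \<Sum>y\<in>B. f x y x' y' :: 'z::comm_monoid_add)"
proof -
  have "(\<Sum>x\<in>A. \<Sum>y\<in>B. \<Sum>x'\<in>C. \<Sum>y'\<in>D. f x y x' y') = (\<Sum>x\<in>A. \<Sum>x'\<in>C. \<Sum>y\<in>B. \<Sum>y'\<in>D. f x y x' y')"
    by (rule sum.cong[OF refl], rule sum.swap)
  also have "\<dots> = (\<Sum>x'\<in>C. \<Sum>x\<in>A. \<Sum>y\<in>B. \<Sum>y'\<in>D. f x y x' y')" by (rule sum.swap)
  also have "\<dots> = (\<Sum>x'\<in>C. \<Sum>x\<in>A. \<Sum>y'\<in>D. \<Sum>y\<in>B. f x y x' y')"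
    by (rule sum.cong[OF refl], rule sum.cong[OF refl], rule sum.swap)
  also have "\<dots> = (\<Sum>x'\<in>C. \<Sum>y'\<in>D. \<Sum>x\<in>A. \<Sum>y\<in>B. f x y x' y')"
    by (rule sum.cong[OF refl], rule sum.swap)
  finally show ?thesis .
qed

lemma double_sum_collect:
  fixes u :: "'x => 'y => 'z::cvec"
  shows "(\<Sum>x\<in>A. \<Sum>y\<in>B. a x y *\<^sub>c (\<Sum>x'\<in>C. \<Sum>y'\<in>D. b x y x' y' *\<^sub>c u x' y'))
    = (\<Sum>x'\<in>C. \<Sum>y'\<in>D. (\<Sum>x\<in>A. \<Sum>y\<in>B. a x y * b x y x' y') *\<^sub>c u x' y')"
  unfolding cscale_sum_right cscale_sum_left cscale_cscale by (rule sum4_swap)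

lemma sl_tw: "x \<in> bas X ==> sl x (tw X K h t) = (\<Sum>y\<in>bas X. K x y *\<^sub>c h (sl y t))"
  unfolding tw_def by (rule sl_mk_in)

lemma sl_lst: "x \<in> bas X ==> sl x (lst X h t) = h (sl x t)"
  unfolding lst_def by (rule sl_mk_in)

lemma sl_sl_tw:
  assumes "x \<in> bas X" "y \<in> bas Y"
  shows "sl y (sl x (tw X K (tw Y L h) t)) = (\<Sum>x'\<in>bas X. \<Sum>y'\<in>bas Y. (K x x' * L y y') *\<^sub>c h (sl y' (sl x' t)))"
  by (simp only: sl_tw[OF assms(1)] sl_tw[OF assms(2)] sl_sum sl_linear cscale_sum_right cscale_cscale)

lemma tw_tw_mk: "tw X K (tw Y L h) t = mk X (\<lambda>x. mk Y (\<lambda>y. sl y (sl x (tw X K (tw Y L h) t))))"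
  unfolding tw_def by (rule mk_eqI) (simp only: sl_mk_in sl_sum sl_linear mk_linear[symmetric] mk_sum[symmetric] cong: mk_cong)

lemma tw_rp_twist:
  assumes "twist \<gamma> \<theta>" "clin h" "A \<in> so"
  shows "tw X (\<gamma> X) h (rp X A t) = rp X (\<theta> A) (tw X (\<gamma> X) h t)"
  unfolding tw_tw[OF assms(2)] tw_tw[OF clin_id] by (rule tw_cong) (simp_all only: twistD(2)[OF assms(1,3)])

lemma tw_lst_twist:
  assumes "clin (\<rho>' B')" "\<And>t. h (\<rho> B t) = \<rho>' B' (h t)"
  shows "tw X K h (lst X (\<rho> B) t) = lst X (\<rho>' B') (tw X K h t)"
  unfolding tw_lst lst_tw_eq[OF assms(1)] by (rule tw_cong) (simp_all only: assms(2))

lemma tws_twist: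
  assumes tw: "twist \<gamma> \<theta>" and h: "clin h" and \<rho>: "gmod \<rho>" "gmod \<rho>'"
    and eq: "\<And>A t. A \<in> so ==> h (\<rho> A t) = \<rho>' (\<theta> A) (h t)" and A: "A \<in> so"
  shows "tws \<gamma> a h (tens a \<rho> A t) = tens a \<rho>' (\<theta> A) (tws \<gamma> a h t)"
proof (induction a arbitrary: t)
  case (Cons X a)
  have c: "clin (tws \<gamma> a h)" by (rule clin_tws[OF h])
  have "tw X (\<gamma> X) (tws \<gamma> a h) (ten X (tens a \<rho>) A t)
    = rp X (\<theta> A) (tw X (\<gamma> X) (tws \<gamma> a h) t) + lst X (tens a \<rho>' (\<theta> A)) (tw X (\<gamma> X) (tws \<gamma> a h) t)"
    unfolding ten_def clin_add[OF clin_tw[OF c]] tw_rp_twist[OF tw c A]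
    using tw_lst_twist[where \<rho> = "tens a \<rho>" and B = A and \<rho>' = "tens a \<rho>'" and B' = "\<theta> A" and h = "tws \<gamma> a h", OF gmodD(1)[OF gmod_tens[OF \<rho>(2)] twistD(1)[OF tw A]] Cons.IH]
    by simp
  then show ?case by (simp only: tws.simps tens.simps ten_def)
qed (simp add: eq A)

text \<open>A twist carries the Casimir tensor of the basis into that of the frame \<open>f\<close>,
  and \<open>casimir_frame\<close> identifies the two.\<close>

lemma Om_twist:
  assumes tw: "twist \<gamma> \<theta>" and h: "clin h" and \<rho>: "gmod \<rho>" "gmod \<rho>'"
    and eq: "\<And>A t. A \<in> so ==> h (\<rho> A t) = \<rho>' (\<theta> A) (h t)"
  shows "Om X \<rho>' (tw X (\<gamma> X) h t) = tw X (\<gamma> X) h (Om X \<rho> t)"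
proof -
  obtain f where f: "\<And>i j. i \<in> {1..N} ==> j \<in> {1..N} ==> \<theta> (MM i j) = M_op (f i) (f j)"
    "\<And>k l. k \<in> {1..N} ==> l \<in> {1..N} ==> (\<Sum>i=1..N. \<Phi> (e k) (f i) * \<Phi> (e l) (f i)) = (if k = l then 1 else 0)"
    using twistD(6)[OF tw] by blast
  let ?T = "tw X (\<gamma> X) h"
  have 1: "?T (rp X (MM i j) (lst X (\<rho> (MM j i)) t)) = rp X (M_op (f i) (f j)) (lst X (\<rho>' (M_op (f j) (f i))) (?T t))"
    if ij: "i \<in> {1..N}" "j \<in> {1..N}" for i j
    unfolding tw_rp_twist[OF tw h so_M] f(1)[OF ij, symmetric] f(1)[OF ij(2,1), symmetric]
    by (rule arg_cong[where f = "rp X _"], rule tw_lst_twist)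
       (rule gmodD(1)[OF \<rho>(2) twistD(1)[OF tw so_M]], rule eq[OF so_M])
  have 2: "?T (rp X (MM i j) (rp X (MM j i) t)) = rp X (M_op (f i) (f j)) (rp X (M_op (f j) (f i)) (?T t))"
    if ij: "i \<in> {1..N}" "j \<in> {1..N}" for i j
    unfolding tw_rp_twist[OF tw h so_M] f(1)[OF ij, symmetric] f(1)[OF ij(2,1), symmetric] by (rule refl)
  have "?T (Om X \<rho> t) = (\<Sum>i=1..N. \<Sum>j=1..N. rp X (M_op (f i) (f j)) (lst X (\<rho>' (M_op (f j) (f i))) (?T t)))
    + (1/2) *\<^sub>c (\<Sum>i=1..N. \<Sum>j=1..N. rp X (M_op (f i) (f j)) (rp X (M_op (f j) (f i)) (?T t)))"
    unfolding Om_full[OF \<rho>(1)] clin_add[OF clin_tw[OF h]] clin_scale[OF clin_tw[OF h]] clin_sum[OF clin_tw[OF h]]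
    by (intro arg_cong2[where f = "(+)"] arg_cong2[where f = cscale] sum.cong refl) (simp_all only: 1 2)
  also have "\<dots> = Om X \<rho>' (?T t)"
    using casimir_frame[OF bil_rp_lst[OF \<rho>(2), of X "?T t"], where f = f, OF f(2)]
      casimir_frame[OF bil_rp_rp[of X "?T t"], where f = f, OF f(2)]
    by (simp only: Om_full[OF \<rho>(2)])
  finally show ?thesis ..
qed

text \<open>One induction proves naturality in the module and compatibility with the group. The map
  \<open>h\<close> is only required to be semilinear over \<open>\<theta>\<close>; in the case of a
  tensor product the induction hypothesis is used for \<open>h\<close> extended over the target word
  of the right factor, which is why \<open>h\<close> and the modules are arbitrary.\<close>

lemma twisted_naturality:
  assumes tw: "twist \<gamma> \<theta>"
  shows "gmod \<rho> ==> gmod \<rho>' ==> clin h ==> (\<And>A t. A \<in> so ==> h (\<rho> A t) = \<rho>' (\<theta> A) (h t)) ==> wf_mor f ==>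
    G f \<rho>' (tws \<gamma> (src f) h t) = tws \<gamma> (tgt f) h (G f \<rho> t)"
proof (induction f arbitrary: \<rho> \<rho>' h t)
  case (Cap X)
  note h = Cap.prems(3)
  have "G (Cap X) \<rho>' (tws \<gamma> [X, X] h t) = (\<Sum>x\<in>bas X. \<Sum>y\<in>bas X. form X x y *\<^sub>c
      (\<Sum>x'\<in>bas X. \<Sum>y'\<in>bas X. (\<gamma> X x x' * \<gamma> X y y') *\<^sub>c h (sl y' (sl x' t))))"
    unfolding G.simps tws.simps by (intro sum.cong refl) (simp only: sl_sl_tw)
  also have "\<dots> = (\<Sum>x'\<in>bas X. \<Sum>y'\<in>bas X. form X x' y' *\<^sub>c h (sl y' (sl x' t)))"
    unfolding double_sum_collect by (intro sum.cong refl) (simp only: twistD(3)[OF tw])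
  also have "\<dots> = h (G (Cap X) \<rho> t)" by (simp only: G.simps clin_sum[OF h] clin_scale[OF h])
  finally show ?case by simp
next
  case (Cup X)
  note h = Cup.prems(3)
  have "tws \<gamma> [X, X] h (G (Cup X) \<rho> t) = mk X (\<lambda>x. mk X (\<lambda>y. sl y (sl x (tw X (\<gamma> X) (tw X (\<gamma> X) h) (G (Cup X) \<rho> t)))))"
    unfolding tws.simps by (rule tw_tw_mk)
  also have "\<dots> = mk X (\<lambda>x. mk X (\<lambda>y. dual_coord X x y *\<^sub>c h t))"
  proof (intro mk_eqI)
    fix x y assume xy: "x \<in> bas X" "y \<in> bas X"
    have "sl y (sl x (tw X (\<gamma> X) (tw X (\<gamma> X) h) (G (Cup X) \<rho> t)))
      = (\<Sum>x'\<in>bas X. \<Sum>y'\<in>bas X. (\<gamma> X x x' * \<gamma> X y y') *\<^sub>c h (dual_coord X x' y' *\<^sub>c t))"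
      unfolding sl_sl_tw[OF xy] by (intro sum.cong refl) simp
    also have "\<dots> = dual_coord X x y *\<^sub>c h t"
      unfolding twistD(4)[OF tw xy, symmetric] clin_scale[OF h] cscale_cscale cscale_sum_left ..
    finally show "sl y (sl x (tw X (\<gamma> X) (tw X (\<gamma> X) h) (G (Cup X) \<rho> t))) = dual_coord X x y *\<^sub>c h t" .
  qed
  finally show ?case by simp
next
  case (Swap X Y)
  note h = Swap.prems(3)
  have "tws \<gamma> [Y, X] h (G (Swap X Y) \<rho> t) = mk Y (\<lambda>y. mk X (\<lambda>x. sl x (sl y (tw Y (\<gamma> Y) (tw X (\<gamma> X) h) (G (Swap X Y) \<rho> t)))))"
    unfolding tws.simps by (rule tw_tw_mk)
  also have "\<dots> = mk Y (\<lambda>y. mk X (\<lambda>x. sg X Y *\<^sub>c sl y (sl x (tws \<gamma> [X, Y] h t))))"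
  proof (intro mk_eqI)
    fix x y assume xy: "y \<in> bas Y" "x \<in> bas X"
    have "sl x (sl y (tw Y (\<gamma> Y) (tw X (\<gamma> X) h) (G (Swap X Y) \<rho> t)))
      = (\<Sum>y'\<in>bas Y. \<Sum>x'\<in>bas X. (\<gamma> Y y y' * \<gamma> X x x') *\<^sub>c h (sg X Y *\<^sub>c sl y' (sl x' t)))"
      unfolding sl_sl_tw[OF xy] by (intro sum.cong refl) simp
    also have "\<dots> = (\<Sum>x'\<in>bas X. \<Sum>y'\<in>bas Y. (\<gamma> Y y y' * \<gamma> X x x') *\<^sub>c h (sg X Y *\<^sub>c sl y' (sl x' t)))"
      by (rule sum.swap)
    also have "\<dots> = sg X Y *\<^sub>c sl y (sl x (tws \<gamma> [X, Y] h t))"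
      unfolding tws.simps sl_sl_tw[OF xy(2,1)] clin_scale[OF h] cscale_cscale cscale_sum_right by (simp only: mult_ac)
    finally show "sl x (sl y (tw Y (\<gamma> Y) (tw X (\<gamma> X) h) (G (Swap X Y) \<rho> t))) = sg X Y *\<^sub>c sl y (sl x (tws \<gamma> [X, Y] h t))" .
  qed
  finally show ?case by simp
next
  case Mu
  note h = Mu.prems(3)
  have "G Mu \<rho>' (tws \<gamma> [Vect, Spin] h t) = tws \<gamma> [Spin] h (G Mu \<rho> t)"
    unfolding G.simps(4) tws.simps tw_def[of Spin _ h "mk Spin _"]
  proof (rule mk_eqI)
    fix z assume z: "z \<in> BS"
    have "(\<Sum>x\<in>BV. \<Sum>y\<in>BS. mu z x y *\<^sub>c sl y (sl x (tw Vect (\<gamma> Vect) (tw Spin (\<gamma> Spin) h) t)))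
      = (\<Sum>x\<in>BV. \<Sum>y\<in>BS. mu z x y *\<^sub>c
          (\<Sum>x'\<in>BV. \<Sum>y'\<in>BS. (\<gamma> Vect x x' * \<gamma> Spin y y') *\<^sub>c h (sl y' (sl x' t))))"
      by (intro sum.cong refl) (simp only: sl_sl_tw)
    also have "\<dots> = (\<Sum>x'\<in>BV. \<Sum>y'\<in>BS. (\<Sum>z'\<in>BS. \<gamma> Spin z z' * mu z' x' y') *\<^sub>c h (sl y' (sl x' t)))"
      unfolding double_sum_collect by (intro sum.cong refl) (simp only: twistD(5)[OF tw] z)
    also have "\<dots> = (\<Sum>x'\<in>BV. \<Sum>z'\<in>BS. \<Sum>y'\<in>BS. (\<gamma> Spin z z' * mu z' x' y') *\<^sub>c h (sl y' (sl x' t)))"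
      unfolding cscale_sum_left by (rule sum.cong[OF refl], rule sum.swap)
    also have "\<dots> = (\<Sum>z'\<in>BS. \<Sum>x'\<in>BV. \<Sum>y'\<in>BS. (\<gamma> Spin z z' * mu z' x' y') *\<^sub>c h (sl y' (sl x' t)))"
      by (rule sum.swap)
    also have "\<dots> = (\<Sum>z'\<in>BS. \<gamma> Spin z z' *\<^sub>c h (sl z' (mk Spin (\<lambda>z. \<Sum>x\<in>BV. \<Sum>y\<in>BS. mu z x y *\<^sub>c sl y (sl x t)))))"
      by (intro sum.cong refl) (simp only: sl_mk_in clin_sum[OF h] clin_scale[OF h] cscale_sum_right cscale_cscale)
    finally show "(\<Sum>x\<in>BV. \<Sum>y\<in>BS. mu z x y *\<^sub>c sl y (sl x (tw Vect (\<gamma> Vect) (tw Spin (\<gamma> Spin) h) t)))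
      = (\<Sum>z'\<in>BS. \<gamma> Spin z z' *\<^sub>c h (sl z' (mk Spin (\<lambda>z. \<Sum>x\<in>BV. \<Sum>y\<in>BS. mu z x y *\<^sub>c sl y (sl x t)))))" .
  qed
  then show ?case by simp
next
  case (Dot X)
  have "Om X \<rho>' (tw X (\<gamma> X) h t) = tw X (\<gamma> X) h (Om X \<rho> t)"
    by (rule Om_twist[where h = h and \<rho> = \<rho> and \<rho>' = \<rho>' and \<theta> = \<theta>, OF tw Dot.prems(3,1,2)]) (rule Dot.prems(4))
  then show ?case by simp
next
  case (Idm a)
  have "lsts a (\<lambda>t. t) (tws \<gamma> a h t) = tws \<gamma> a h (lsts a (\<lambda>t. t) t)"
    by (simp add: lsts_tws[OF clin_id] tws_lsts)
  then show ?case by simp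
next
  case (Comp g f)
  have "src g = tgt f" "wf_mor g" "wf_mor f" using Comp.prems by auto
  then show ?case using Comp.IH(1)[of \<rho> \<rho>' h, OF Comp.prems(1-4)] Comp.IH(2)[of \<rho> \<rho>' h, OF Comp.prems(1-4)] by simp
next
  case (Tens f g)
  have wf: "wf_mor f" "wf_mor g" using Tens.prems by auto
  have 1: "G g \<rho>' (tws \<gamma> (src g) h u) = tws \<gamma> (tgt g) h (G g \<rho> u)" for u
    by (rule Tens.IH(2)[of \<rho> \<rho>' h, OF Tens.prems(1-4) wf(2)])
  have 3: "tws \<gamma> (tgt g) h (tens (tgt g) \<rho> A u) = tens (tgt g) \<rho>' (\<theta> A) (tws \<gamma> (tgt g) h u)" if "A \<in> so" for A u
    by (rule tws_twist[where \<rho> = \<rho> and \<rho>' = \<rho>' and h = h and \<theta> = \<theta>, OF tw Tens.prems(3,1,2) _ that]) (rule Tens.prems(4))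
  have 2: "G f (tens (tgt g) \<rho>') (tws \<gamma> (src f) (tws \<gamma> (tgt g) h) u) = tws \<gamma> (tgt f) (tws \<gamma> (tgt g) h) (G f (tens (tgt g) \<rho>) u)" for u
    by (rule Tens.IH(1)[of "tens (tgt g) \<rho>" "tens (tgt g) \<rho>'" "tws \<gamma> (tgt g) h",
          OF gmod_tens[OF Tens.prems(1)] gmod_tens[OF Tens.prems(2)] clin_tws[OF Tens.prems(3)] _ wf(1)]) (rule 3)
  have "lsts (src f) (G g \<rho>') (tws \<gamma> (src f) (tws \<gamma> (src g) h) t) = tws \<gamma> (src f) (tws \<gamma> (tgt g) h) (lsts (src f) (G g \<rho>) t)"
    unfolding lsts_tws[OF clin_G[OF Tens.prems(2)]] tws_lsts 1 ..
  then show ?case by (simp only: G.simps src.simps tgt.simps append_simps 2)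
next
  case (Zero a b) then show ?case by (simp add: clin_0[OF clin_tws])
next
  case (Plus f g)
  have "src g = src f" "tgt g = tgt f" "wf_mor g" "wf_mor f" using Plus.prems by auto
  then show ?case using Plus.IH(1)[of \<rho> \<rho>' h, OF Plus.prems(1-4)] Plus.IH(2)[of \<rho> \<rho>' h, OF Plus.prems(1-4)] by (simp add: clin_add[OF clin_tws[OF Plus.prems(3)]])
next
  case (Scal c f)
  have "wf_mor f" using Scal.prems by simp
  then show ?case using Scal.IH[of \<rho> \<rho>' h, OF Scal.prems(1-4)] by (simp add: clin_scale[OF clin_tws[OF Scal.prems(3)]])
qed

lemma sum_delta_mult:
  fixes f :: "'x => complex"
  assumes "finite S" "x \<in> S"
  shows "(\<Sum>z\<in>S. (if x = z then 1 else 0) * f z) = f x" "(\<Sum>z\<in>S. f z * (if z = x then 1 else 0)) = f x"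
proof -
  have "(\<Sum>z\<in>S. (if x = z then 1 else 0) * f z) = (\<Sum>z\<in>S. if z = x then f z else 0)"
    by (intro sum.cong refl) auto
  then show "(\<Sum>z\<in>S. (if x = z then 1 else 0) * f z) = f x" using assms by simp
  have "(\<Sum>z\<in>S. f z * (if z = x then 1 else 0)) = (\<Sum>z\<in>S. if z = x then f z else 0)"
    by (intro sum.cong refl) auto
  then show "(\<Sum>z\<in>S. f z * (if z = x then 1 else 0)) = f x" using assms by simp
qed

lemma twist_identity: "twist (\<lambda>X x y. if x = y then 1 else 0) (\<lambda>A. A)"
proof -
  have 1: "(\<Sum>x\<in>bas X. \<Sum>y\<in>bas Y. c x y * ((if x = x' then 1 else 0) * (if y = y' then 1 else 0))) = c x' y'"
    if "x' \<in> bas X" "y' \<in> bas Y" for X Y x' y' and c :: "label => label => complex"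
    using that by (simp only: mult.assoc[symmetric] sum_delta_mult finite_basis)
  have 2: "(\<Sum>x'\<in>bas X. \<Sum>y'\<in>bas X. (if x = x' then 1 else 0) * (if y = y' then 1 else 0) * dual_coord X x' y') = dual_coord X x y"
    if "x \<in> bas X" "y \<in> bas X" for X x y
    using that by (simp only: mult.assoc sum_distrib_left[symmetric] sum_delta_mult(1) finite_basis)
  have "(\<Sum>i=1..N. \<Phi> (e k) (e i) * \<Phi> (e l) (e i)) = (if k = l then 1 else 0)" if "k \<in> {1..N}" "l \<in> {1..N}" for k l
  proof -
    have "(\<Sum>i=1..N. \<Phi> (e k) (e i) * \<Phi> (e l) (e i)) = (\<Sum>i=1..N. (if k = i then 1 else 0) * (if l = i then 1 else 0))"
      by (intro sum.cong refl) (simp only: orthonormal that)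
    also have "\<dots> = (if l = k then 1 else 0)" by (rule sum_delta_mult) (use that in auto)
    finally show ?thesis by auto
  qed
  then have 3: "\<exists>f. (\<forall>i\<in>{1..N}. \<forall>j\<in>{1..N}. MM i j = M_op (f i) (f j))
        \<and> (\<forall>k\<in>{1..N}. \<forall>l\<in>{1..N}. (\<Sum>i=1..N. \<Phi> (e k) (f i) * \<Phi> (e l) (f i)) = (if k = l then 1 else 0))"
    by blast
  show ?thesis
    unfolding twist_def
  proof (intro conjI ballI allI)
    fix X A x y assume "A \<in> so" "x \<in> bas X" "y \<in> bas X"
    then show "(\<Sum>z\<in>bas X. (if x = z then 1 else 0) * rep X A z y) = (\<Sum>z\<in>bas X. rep X A x z * (if z = y then 1 else 0))"
      by (simp only: sum_delta_mult finite_basis)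
  next
    fix z x' y' assume "z \<in> BS" "x' \<in> BV" "y' \<in> BS"
    then show "(\<Sum>x\<in>BV. \<Sum>y\<in>BS. mu z x y * ((if x = x' then 1 else 0) * (if y = y' then 1 else 0)))
      = (\<Sum>z'\<in>BS. (if z = z' then 1 else 0) * mu z' x' y')"
      by (simp only: 1 sum_delta_mult finite_basis)
  qed (simp_all only: 1 2 3)
qed

lemma naturality:
  assumes "gmod \<rho>" "gmod \<rho>'" "clin h" "\<And>A t. A \<in> so ==> h (\<rho> A t) = \<rho>' A (h t)" "wf_mor f"
  shows "G f \<rho>' (lsts (src f) h t) = lsts (tgt f) h (G f \<rho> t)"
  using twisted_naturality[where h = h and \<rho> = \<rho> and \<rho>' = \<rho>', OF twist_identity assms(1-3) _ assms(5)] assms(4)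
  unfolding tws_identity by blast

text \<open>No generator reads a family at labels outside the basis, so truncating the input changes
  nothing.\<close>

lemma G_in_clean: "wf_mor f ==> G f \<rho> (lsts (src f) (\<lambda>t. t) t) = G f \<rho> t"
proof (induction f arbitrary: \<rho> t)
  case (Cap X)
  show ?case by (simp add: sl_lst)
next
  case (Swap X Y)
  show ?case by (simp add: sl_lst cong: mk_cong)
next
  case Mu
  show ?case by (simp add: sl_lst cong: mk_cong)
next
  case (Dot X)
  have 1: "rp X A (lst X (\<lambda>t. t) t) = rp X A t" for A t by (simp add: tw_lst)
  have 2: "lst X h (lst X (\<lambda>t. t) t) = lst X h t" for h t by (simp add: lst_lst)
  show ?case by (simp add: Om_def 1 2)
next
  case (Idm a) show ?case by (simp add: lsts_lsts)
next
  case (Tens f g)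
  then have "(\<lambda>u. G g \<rho> (lsts (src g) (\<lambda>t. t) u)) = G g \<rho>" by auto
  then show ?case by (simp add: lsts_lsts)
qed simp_all

lemma clean_equivariant:
  assumes "gmod \<rho>" "A \<in> so"
  shows "lsts a (\<lambda>t. t) (tens a \<rho> A t) = tens a \<rho> A (lsts a (\<lambda>t. t) t)"
  using tws_twist[where h = "\<lambda>t. t" and a = a and t = t, OF twist_identity clin_id assms(1,1) _ assms(2)]
  unfolding tws_identity by simp

lemma G_out_clean:
  assumes "gmod \<rho>" "wf_mor f" shows "lsts (tgt f) (\<lambda>t. t) (G f \<rho> t) = G f \<rho> t"
  using naturality[where h = "\<lambda>t. t" and t = t, OF assms(1,1) clin_id _ assms(2)] by (simp only: G_in_clean[OF assms(2)])

end

declare uminus_apply [simp del] minus_apply [simp del]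

context spin_setting
begin

subsection \<open>Equivariance\<close>

lemma sl_ten:
  assumes "x \<in> bas X"
  shows "sl x (ten X \<rho> A t) = (\<Sum>x'\<in>bas X. rep X A x x' *\<^sub>c sl x' t) + \<rho> A (sl x t)"
  by (simp only: ten_def sl_linear sl_tw[OF assms] sl_lst[OF assms])

lemma sl_sl_ten:
  assumes "gmod \<rho>" "A \<in> so" "x \<in> bas X" "y \<in> bas Y"
  shows "sl y (sl x (ten X (ten Y \<rho>) A t)) = (\<Sum>x'\<in>bas X. rep X A x x' *\<^sub>c sl y (sl x' t))
    + ((\<Sum>y'\<in>bas Y. rep Y A y y' *\<^sub>c sl y' (sl x t)) + \<rho> A (sl y (sl x t)))"
  by (simp only: sl_ten[OF assms(3)] sl_ten[OF assms(4)] sl_linear sl_sum)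

text \<open>Invariance of the cup. The dual coordinates form the inverse matrix of the form, so the
  invariance of the form is multiplied by this inverse from both sides.\<close>

lemma rep_dual:
  assumes A: "A \<in> so" and x: "x \<in> bas X" and y: "y \<in> bas X"
  shows "(\<Sum>z\<in>bas X. rep X A y z * dual_coord X x z) = - (\<Sum>z\<in>bas X. rep X A x z * dual_coord X z y)"
proof -
  let ?B = "bas X" and ?R = "rep X A" and ?D = "dual_coord X" and ?F = "form X"
  have 1: "?R y z = - (\<Sum>w\<in>?B. \<Sum>k\<in>?B. ?F z k * ?R k w * ?D w y)" if z: "z \<in> ?B" for z
  proof -
    have "?R y z = (\<Sum>k\<in>?B. ?R k z * (if k = y then 1 else 0))"
      using y by (simp only: sum_delta_mult finite_basis)
    also have "\<dots> = (\<Sum>k\<in>?B. ?R k z * (\<Sum>w\<in>?B. ?F k w * ?D w y))"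
      by (intro sum.cong refl) (simp only: form_dual y)
    also have "\<dots> = (\<Sum>w\<in>?B. \<Sum>k\<in>?B. ?R k z * ?F k w * ?D w y)"
      unfolding sum_distrib_left mult.assoc by (rule sum.swap)
    also have "\<dots> = (\<Sum>w\<in>?B. - (\<Sum>k\<in>?B. ?F z k * ?R k w) * ?D w y)"
      unfolding sum_distrib_right[symmetric] by (intro sum.cong refl) (simp only: form_inv[OF A z])
    finally show ?thesis by (simp only: sum_distrib_right mult_minus_left sum_negf)
  qed
  have "(\<Sum>z\<in>?B. ?R y z * ?D x z) = (\<Sum>z\<in>?B. - (\<Sum>w\<in>?B. \<Sum>k\<in>?B. ?D x z * ?F z k * (?R k w * ?D w y)))"
  proof (rule sum.cong[OF refl])
    fix z assume "z \<in> ?B"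
    then show "?R y z * ?D x z = - (\<Sum>w\<in>?B. \<Sum>k\<in>?B. ?D x z * ?F z k * (?R k w * ?D w y))"
      by (simp only: 1 mult_minus_left sum_distrib_right) (simp only: mult_ac)
  qed
  also have "\<dots> = - (\<Sum>z\<in>?B. \<Sum>w\<in>?B. \<Sum>k\<in>?B. ?D x z * ?F z k * (?R k w * ?D w y))" by (rule sum_negf)
  also have "(\<Sum>z\<in>?B. \<Sum>w\<in>?B. \<Sum>k\<in>?B. ?D x z * ?F z k * (?R k w * ?D w y))
     = (\<Sum>w\<in>?B. \<Sum>z\<in>?B. \<Sum>k\<in>?B. ?D x z * ?F z k * (?R k w * ?D w y))" by (rule sum.swap)
  also have "\<dots> = (\<Sum>w\<in>?B. \<Sum>k\<in>?B. \<Sum>z\<in>?B. ?D x z * ?F z k * (?R k w * ?D w y))"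
    by (rule sum.cong[OF refl], rule sum.swap)
  also have "\<dots> = (\<Sum>w\<in>?B. \<Sum>k\<in>?B. (if x = k then 1 else 0) * (?R k w * ?D w y))"
    unfolding sum_distrib_right[symmetric] by (intro sum.cong refl) (simp only: dual_form x)
  also have "\<dots> = (\<Sum>w\<in>?B. ?R x w * ?D w y)"
    by (intro sum.cong refl) (simp only: sum_delta_mult finite_basis x)
  finally show ?thesis .
qed

lemma lsts2: "lsts [X, Y] (\<lambda>t. t) u = mk X (\<lambda>x. mk Y (\<lambda>y. sl y (sl x u)))"
  by (simp add: lst_def)

text \<open>Every component is a map of modules. Only with this may a component take the role of
  \<open>h\<close> in \<open>naturality\<close>, which is what the interchange law needs.\<close>

lemma G_equivariant:
  "gmod \<rho> ==> A \<in> so ==> wf_mor f ==> G f \<rho> (tens (src f) \<rho> A t) = tens (tgt f) \<rho> A (G f \<rho> t)"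
proof (induction f arbitrary: \<rho> A t)
  case (Cap X)
  note \<rho> = Cap.prems(1) and A = Cap.prems(2)
  let ?B = "bas X" and ?R = "rep X A" and ?F = "form X"
  have "G (Cap X) \<rho> (tens [X, X] \<rho> A t) = (\<Sum>x\<in>?B. \<Sum>y\<in>?B. ?F x y *\<^sub>c (\<Sum>x'\<in>?B. ?R x x' *\<^sub>c sl y (sl x' t)))
    + ((\<Sum>x\<in>?B. \<Sum>y\<in>?B. ?F x y *\<^sub>c (\<Sum>y'\<in>?B. ?R y y' *\<^sub>c sl y' (sl x t))) + (\<Sum>x\<in>?B. \<Sum>y\<in>?B. ?F x y *\<^sub>c \<rho> A (sl y (sl x t))))"
    unfolding G.simps tens.simps sum.distrib[symmetric] cscale_add_right[symmetric]
    by (intro sum.cong refl) (simp only: sl_sl_ten[OF \<rho> A])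
  also have "(\<Sum>x\<in>?B. \<Sum>y\<in>?B. ?F x y *\<^sub>c (\<Sum>x'\<in>?B. ?R x x' *\<^sub>c sl y (sl x' t)))
    = (\<Sum>x'\<in>?B. \<Sum>y\<in>?B. (\<Sum>x\<in>?B. ?R x x' * ?F x y) *\<^sub>c sl y (sl x' t))"
  proof -
    have "(\<Sum>x\<in>?B. \<Sum>y\<in>?B. ?F x y *\<^sub>c (\<Sum>x'\<in>?B. ?R x x' *\<^sub>c sl y (sl x' t)))
      = (\<Sum>x\<in>?B. \<Sum>y\<in>?B. \<Sum>x'\<in>?B. (?R x x' * ?F x y) *\<^sub>c sl y (sl x' t))"
      by (simp only: cscale_sum_right cscale_cscale mult.commute)
    also have "\<dots> = (\<Sum>x\<in>?B. \<Sum>x'\<in>?B. \<Sum>y\<in>?B. (?R x x' * ?F x y) *\<^sub>c sl y (sl x' t))"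
      by (rule sum.cong[OF refl], rule sum.swap)
    also have "\<dots> = (\<Sum>x'\<in>?B. \<Sum>x\<in>?B. \<Sum>y\<in>?B. (?R x x' * ?F x y) *\<^sub>c sl y (sl x' t))" by (rule sum.swap)
    also have "\<dots> = (\<Sum>x'\<in>?B. \<Sum>y\<in>?B. \<Sum>x\<in>?B. (?R x x' * ?F x y) *\<^sub>c sl y (sl x' t))"
      by (rule sum.cong[OF refl], rule sum.swap)
    finally show ?thesis by (simp only: cscale_sum_left)
  qed
  also have "\<dots> = - (\<Sum>x'\<in>?B. \<Sum>y\<in>?B. (\<Sum>z\<in>?B. ?F x' z * ?R z y) *\<^sub>c sl y (sl x' t))"
  proof -
    have "(\<Sum>x'\<in>?B. \<Sum>y\<in>?B. (\<Sum>x\<in>?B. ?R x x' * ?F x y) *\<^sub>c sl y (sl x' t))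
      = (\<Sum>x'\<in>?B. \<Sum>y\<in>?B. - ((\<Sum>z\<in>?B. ?F x' z * ?R z y) *\<^sub>c sl y (sl x' t)))"
      by (intro sum.cong refl) (simp only: form_inv[OF A] cvec.scale_minus_left)
    then show ?thesis by (simp only: sum_negf)
  qed
  also have "(\<Sum>x\<in>?B. \<Sum>y\<in>?B. ?F x y *\<^sub>c (\<Sum>y'\<in>?B. ?R y y' *\<^sub>c sl y' (sl x t)))
    = (\<Sum>x'\<in>?B. \<Sum>y\<in>?B. (\<Sum>z\<in>?B. ?F x' z * ?R z y) *\<^sub>c sl y (sl x' t))"
    unfolding cscale_sum_left cscale_sum_right cscale_cscale by (rule sum.cong[OF refl], rule sum.swap)
  also have "(\<Sum>x\<in>?B. \<Sum>y\<in>?B. ?F x y *\<^sub>c \<rho> A (sl y (sl x t))) = \<rho> A (G (Cap X) \<rho> t)"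
    by (simp only: G.simps clin_sum[OF gmodD(1)[OF \<rho> A]] clin_scale[OF gmodD(1)[OF \<rho> A]])
  finally show ?case by simp
next
  case (Cup X)
  note \<rho> = Cup.prems(1) and A = Cup.prems(2)
  have "tens [X, X] \<rho> A (G (Cup X) \<rho> t) = tens [X, X] \<rho> A (lsts [X, X] (\<lambda>t. t) (G (Cup X) \<rho> t))"
    using G_out_clean[OF \<rho>, of "Cup X" t] by simp
  also have "\<dots> = lsts [X, X] (\<lambda>t. t) (tens [X, X] \<rho> A (G (Cup X) \<rho> t))" by (rule clean_equivariant[OF \<rho> A, symmetric])
  also have "\<dots> = mk X (\<lambda>x. mk X (\<lambda>y. dual_coord X x y *\<^sub>c \<rho> A t))"
    unfolding lsts2
  proof (intro mk_eqI)
    fix x y assume xy: "x \<in> bas X" "y \<in> bas X"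
    have "sl y (sl x (tens [X, X] \<rho> A (G (Cup X) \<rho> t))) = (\<Sum>x'\<in>bas X. rep X A x x' *\<^sub>c (dual_coord X x' y *\<^sub>c t))
       + ((\<Sum>y'\<in>bas X. rep X A y y' *\<^sub>c (dual_coord X x y' *\<^sub>c t)) + \<rho> A (dual_coord X x y *\<^sub>c t))"
      unfolding tens.simps sl_sl_ten[OF \<rho> A xy] using xy by (simp cong: sum.cong)
    also have "\<dots> = \<rho> A (dual_coord X x y *\<^sub>c t)"
      unfolding cscale_cscale cscale_sum_left[symmetric] rep_dual[OF A xy] by simp
    finally show "sl y (sl x (tens [X, X] \<rho> A (G (Cup X) \<rho> t))) = dual_coord X x y *\<^sub>c \<rho> A t"
      by (simp only: clin_scale[OF gmodD(1)[OF \<rho> A]])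
  qed
  finally show ?case by simp
next
  case (Swap X Y)
  note \<rho> = Swap.prems(1) and A = Swap.prems(2)
  have "tens [Y, X] \<rho> A (G (Swap X Y) \<rho> t) = tens [Y, X] \<rho> A (lsts [Y, X] (\<lambda>t. t) (G (Swap X Y) \<rho> t))"
    using G_out_clean[OF \<rho>, of "Swap X Y" t] by simp
  also have "\<dots> = lsts [Y, X] (\<lambda>t. t) (tens [Y, X] \<rho> A (G (Swap X Y) \<rho> t))" by (rule clean_equivariant[OF \<rho> A, symmetric])
  also have "\<dots> = mk Y (\<lambda>y. mk X (\<lambda>x. sg X Y *\<^sub>c sl y (sl x (tens [X, Y] \<rho> A t))))"
    unfolding lsts2
  proof (intro mk_eqI)
    fix x y assume xy: "y \<in> bas Y" "x \<in> bas X"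
    have "sl x (sl y (tens [Y, X] \<rho> A (G (Swap X Y) \<rho> t))) = (\<Sum>y'\<in>bas Y. rep Y A y y' *\<^sub>c (sg X Y *\<^sub>c sl y' (sl x t)))
       + ((\<Sum>x'\<in>bas X. rep X A x x' *\<^sub>c (sg X Y *\<^sub>c sl y (sl x' t))) + \<rho> A (sg X Y *\<^sub>c sl y (sl x t)))"
      unfolding tens.simps sl_sl_ten[OF \<rho> A xy] using xy by (simp cong: sum.cong)
    also have "\<dots> = sg X Y *\<^sub>c sl y (sl x (tens [X, Y] \<rho> A t))"
      unfolding tens.simps sl_sl_ten[OF \<rho> A xy(2,1)] cscale_add_right cscale_sum_right cscale_cscale
        clin_scale[OF gmodD(1)[OF \<rho> A]] by (simp only: mult.commute add_ac)
    finally show "sl x (sl y (tens [Y, X] \<rho> A (G (Swap X Y) \<rho> t))) = sg X Y *\<^sub>c sl y (sl x (tens [X, Y] \<rho> A t))" .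
  qed
  finally show ?case by simp
next
  case Mu
  note \<rho> = Mu.prems(1) and A = Mu.prems(2)
  let ?V = "BV" and ?S = "BS"
  have "tens [Spin] \<rho> A (G Mu \<rho> t) = tens [Spin] \<rho> A (lsts [Spin] (\<lambda>t. t) (G Mu \<rho> t))"
    using G_out_clean[OF \<rho>, of Mu t] by simp
  also have "\<dots> = lsts [Spin] (\<lambda>t. t) (tens [Spin] \<rho> A (G Mu \<rho> t))" by (rule clean_equivariant[OF \<rho> A, symmetric])
  also have "\<dots> = mk Spin (\<lambda>z. sl z (tens [Spin] \<rho> A (G Mu \<rho> t)))" by (simp add: lst_def)
  also have "\<dots> = mk Spin (\<lambda>z. \<Sum>x\<in>?V. \<Sum>y\<in>?S. mu z x y *\<^sub>c sl y (sl x (tens [Vect, Spin] \<rho> A t)))"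
  proof (rule mk_eqI)
    fix z assume z: "z \<in> ?S"
    have "sl z (tens [Spin] \<rho> A (G Mu \<rho> t)) = (\<Sum>z'\<in>?S. rep Spin A z z' *\<^sub>c (\<Sum>x\<in>?V. \<Sum>y\<in>?S. mu z' x y *\<^sub>c sl y (sl x t)))
       + \<rho> A (\<Sum>x\<in>?V. \<Sum>y\<in>?S. mu z x y *\<^sub>c sl y (sl x t))"
      unfolding tens.simps sl_ten[OF z] using z by (simp cong: sum.cong)
    also have "(\<Sum>z'\<in>?S. rep Spin A z z' *\<^sub>c (\<Sum>x\<in>?V. \<Sum>y\<in>?S. mu z' x y *\<^sub>c sl y (sl x t)))
       = (\<Sum>x\<in>?V. \<Sum>y\<in>?S. (\<Sum>z'\<in>?S. rep Spin A z z' * mu z' x y) *\<^sub>c sl y (sl x t))"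
    proof -
      have "(\<Sum>z'\<in>?S. rep Spin A z z' *\<^sub>c (\<Sum>x\<in>?V. \<Sum>y\<in>?S. mu z' x y *\<^sub>c sl y (sl x t)))
        = (\<Sum>x\<in>?V. \<Sum>z'\<in>?S. \<Sum>y\<in>?S. (rep Spin A z z' * mu z' x y) *\<^sub>c sl y (sl x t))"
        unfolding cscale_sum_right cscale_cscale by (rule sum.swap)
      also have "\<dots> = (\<Sum>x\<in>?V. \<Sum>y\<in>?S. \<Sum>z'\<in>?S. (rep Spin A z z' * mu z' x y) *\<^sub>c sl y (sl x t))"
        by (rule sum.cong[OF refl], rule sum.swap)
      finally show ?thesis by (simp only: cscale_sum_left)
    qed
    also have "\<dots> = (\<Sum>x\<in>?V. \<Sum>y\<in>?S. (\<Sum>x'\<in>?V. mu z x' y * rep Vect A x' x) *\<^sub>c sl y (sl x t))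
       + (\<Sum>x\<in>?V. \<Sum>y\<in>?S. (\<Sum>y'\<in>?S. mu z x y' * rep Spin A y' y) *\<^sub>c sl y (sl x t))"
      unfolding sum.distrib[symmetric] cscale_add_left[symmetric]
      by (intro sum.cong refl) (simp only: mu_rep[OF A z])
    also have "(\<Sum>x\<in>?V. \<Sum>y\<in>?S. (\<Sum>x'\<in>?V. mu z x' y * rep Vect A x' x) *\<^sub>c sl y (sl x t))
       = (\<Sum>x\<in>?V. \<Sum>y\<in>?S. mu z x y *\<^sub>c (\<Sum>x'\<in>?V. rep Vect A x x' *\<^sub>c sl y (sl x' t)))"
    proof -
      have "(\<Sum>x\<in>?V. \<Sum>y\<in>?S. (\<Sum>x'\<in>?V. mu z x' y * rep Vect A x' x) *\<^sub>c sl y (sl x t))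
        = (\<Sum>x\<in>?V. \<Sum>x'\<in>?V. \<Sum>y\<in>?S. (mu z x' y * rep Vect A x' x) *\<^sub>c sl y (sl x t))"
        unfolding cscale_sum_left by (rule sum.cong[OF refl], rule sum.swap)
      also have "\<dots> = (\<Sum>x'\<in>?V. \<Sum>x\<in>?V. \<Sum>y\<in>?S. (mu z x' y * rep Vect A x' x) *\<^sub>c sl y (sl x t))" by (rule sum.swap)
      also have "\<dots> = (\<Sum>x'\<in>?V. \<Sum>y\<in>?S. \<Sum>x\<in>?V. (mu z x' y * rep Vect A x' x) *\<^sub>c sl y (sl x t))"
        by (rule sum.cong[OF refl], rule sum.swap)
      finally show ?thesis by (simp only: cscale_sum_right cscale_cscale)
    qed
    also have "(\<Sum>x\<in>?V. \<Sum>y\<in>?S. (\<Sum>y'\<in>?S. mu z x y' * rep Spin A y' y) *\<^sub>c sl y (sl x t))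
       = (\<Sum>x\<in>?V. \<Sum>y\<in>?S. mu z x y *\<^sub>c (\<Sum>y'\<in>?S. rep Spin A y y' *\<^sub>c sl y' (sl x t)))"
      unfolding cscale_sum_left cscale_sum_right cscale_cscale by (rule sum.cong[OF refl], rule sum.swap)
    also have "\<rho> A (\<Sum>x\<in>?V. \<Sum>y\<in>?S. mu z x y *\<^sub>c sl y (sl x t)) = (\<Sum>x\<in>?V. \<Sum>y\<in>?S. mu z x y *\<^sub>c \<rho> A (sl y (sl x t)))"
      by (simp only: clin_sum[OF gmodD(1)[OF \<rho> A]] clin_scale[OF gmodD(1)[OF \<rho> A]])
    also have "(\<Sum>x\<in>?V. \<Sum>y\<in>?S. mu z x y *\<^sub>c (\<Sum>x'\<in>?V. rep Vect A x x' *\<^sub>c sl y (sl x' t)))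
       + (\<Sum>x\<in>?V. \<Sum>y\<in>?S. mu z x y *\<^sub>c (\<Sum>y'\<in>?S. rep Spin A y y' *\<^sub>c sl y' (sl x t)))
       + (\<Sum>x\<in>?V. \<Sum>y\<in>?S. mu z x y *\<^sub>c \<rho> A (sl y (sl x t)))
      = (\<Sum>x\<in>?V. \<Sum>y\<in>?S. mu z x y *\<^sub>c sl y (sl x (tens [Vect, Spin] \<rho> A t)))"
      unfolding sum.distrib[symmetric] cscale_add_right[symmetric] tens.simps
      by (intro sum.cong refl) (simp only: sl_sl_ten[OF \<rho> A] add.assoc)
    finally show "sl z (tens [Spin] \<rho> A (G Mu \<rho> t)) = (\<Sum>x\<in>?V. \<Sum>y\<in>?S. mu z x y *\<^sub>c sl y (sl x (tens [Vect, Spin] \<rho> A t)))" .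
  qed
  finally show ?case by simp
next
  case (Dot X) then show ?case by (simp add: Om_equivariant)
next
  case (Idm a) then show ?case by (simp add: clean_equivariant)
next
  case (Comp g f)
  then have "src g = tgt f" "wf_mor g" "wf_mor f" by auto
  then show ?case using Comp.IH(1)[OF Comp.prems(1,2)] Comp.IH(2)[OF Comp.prems(1,2)] by simp
next
  case (Tens f g)
  have wf: "wf_mor f" "wf_mor g" using Tens.prems by auto
  have "lsts (src f) (G g \<rho>) (tens (src f) (tens (src g) \<rho>) A t) = tens (src f) (tens (tgt g) \<rho>) A (lsts (src f) (G g \<rho>) t)"
    using tws_twist[where h = "G g \<rho>" and \<rho> = "tens (src g) \<rho>" and \<rho>' = "tens (tgt g) \<rho>" and a = "src f" and t = t and \<theta> = "\<lambda>A. A",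
       OF twist_identity clin_G[OF Tens.prems(1)] gmod_tens[OF Tens.prems(1)] gmod_tens[OF Tens.prems(1)] _ Tens.prems(2)]
      Tens.IH(2)[OF Tens.prems(1) _ wf(2)]
    unfolding tws_identity by simp
  then show ?case using Tens.IH(1)[OF gmod_tens[OF Tens.prems(1)] Tens.prems(2) wf(1)] by simp
next
  case (Zero a b)
  then show ?case using clin_0[OF gmodD(1)[OF gmod_tens[OF Zero.prems(1)] Zero.prems(2)]] by simp
next
  case (Plus f g)
  then have "src g = src f" "tgt g = tgt f" "wf_mor g" "wf_mor f" by auto
  then show ?case using Plus.IH(1)[OF Plus.prems(1,2)] Plus.IH(2)[OF Plus.prems(1,2)] clin_add[OF gmodD(1)[OF gmod_tens[OF Plus.prems(1)] Plus.prems(2)]] by simp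
next
  case (Scal c f)
  then show ?case using clin_scale[OF gmodD(1)[OF gmod_tens[OF Scal.prems(1)] Scal.prems(2)]] by simp
qed

subsection \<open>The generating relations\<close>

declare basis_of.simps [simp del]

lemma clean1: "gmod \<rho> ==> wf_mor f ==> tgt f = [X] ==> G f \<rho> t = mk X (\<lambda>x. sl x (G f \<rho> t))"
  using G_out_clean[of \<rho> f t] by (simp add: lst_def)

lemma clean2: "gmod \<rho> ==> wf_mor f ==> tgt f = [X, Y] ==> G f \<rho> t = mk X (\<lambda>x. mk Y (\<lambda>y. sl y (sl x (G f \<rho> t))))"
  using G_out_clean[of \<rho> f t] by (simp add: lst_def)

lemma clean3: "gmod \<rho> ==> wf_mor f ==> tgt f = [X, Y, W] ==>
    G f \<rho> t = mk X (\<lambda>x. mk Y (\<lambda>y. mk W (\<lambda>w. sl w (sl y (sl x (G f \<rho> t))))))"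
  using G_out_clean[of \<rho> f t] by (simp add: lst_def)

text \<open>Outputs of \<open>G\<close> are truncated, so two of them agree as soon as their slices
  at basis labels agree. The variants for two and three factors reduce each relation to an identity
  of matrices.\<close>

lemma eq1I:
  assumes "gmod \<rho>" "wf_mor f" "wf_mor g" "tgt f = [X]" "tgt g = [X]"
    "\<And>x. x \<in> bas X ==> sl x (G f \<rho> t) = sl x (G g \<rho> t)"
  shows "G f \<rho> t = G g \<rho> t"
  by (rule trans[OF clean1[OF assms(1,2,4)] trans[OF _ clean1[OF assms(1,3,5), symmetric]]]) (intro mk_eqI assms(6))

lemma eq2I:
  assumes "gmod \<rho>" "wf_mor f" "wf_mor g" "tgt f = [X, Y]" "tgt g = [X, Y]"
    "\<And>x y. x \<in> bas X ==> y \<in> bas Y ==> sl y (sl x (G f \<rho> t)) = sl y (sl x (G g \<rho> t))"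
  shows "G f \<rho> t = G g \<rho> t"
  by (rule trans[OF clean2[OF assms(1,2,4)] trans[OF _ clean2[OF assms(1,3,5), symmetric]]]) (intro mk_eqI assms(6))

lemma eq3I:
  assumes "gmod \<rho>" "wf_mor f" "wf_mor g" "tgt f = [X, Y, W]" "tgt g = [X, Y, W]"
    "\<And>x y w. x \<in> bas X ==> y \<in> bas Y ==> w \<in> bas W ==> sl w (sl y (sl x (G f \<rho> t))) = sl w (sl y (sl x (G g \<rho> t)))"
  shows "G f \<rho> t = G g \<rho> t"
  by (rule trans[OF clean3[OF assms(1,2,4)] trans[OF _ clean3[OF assms(1,3,5), symmetric]]]) (intro mk_eqI assms(6))

lemma sum_pick:
  assumes "finite A" "y \<in> A" "\<And>v. v \<in> A ==> v \<noteq> y ==> f v = 0"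
  shows "(\<Sum>v\<in>A. f v) = (f y :: 'z::comm_monoid_add)"
  using assms by (subst sum.remove[of _ y]) (auto intro!: sum.neutral)

lemma sum_delta_cscale:
  assumes "x \<in> bas X"
  shows "(\<Sum>y\<in>bas X. (if x = y then 1 else 0) *\<^sub>c f y) = (f x :: 'z::cvec)"
  using sum_pick[of "bas X" x "\<lambda>y. (if x = y then 1 else 0) *\<^sub>c f y"] assms by simp

lemma dual_Vect_eq: "x \<in> BV ==> dual_coord Vect x y = (if x = y then 1 else 0)"
  by (auto elim!: basis_VectE simp: dual_Vect)

lemma sum_dual_Vect:
  assumes i: "i \<in> BV"
  shows "(\<Sum>v\<in>BV. \<Sum>w\<in>A. c v w *\<^sub>c dual_coord Vect i v *\<^sub>c u w) = (\<Sum>w\<in>A. c i w *\<^sub>c (u w :: 'z::cvec))"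
    "(\<Sum>v\<in>BV. \<Sum>w\<in>A. c v w *\<^sub>c dual_coord Vect v i *\<^sub>c u w) = (\<Sum>w\<in>A. c i w *\<^sub>c u w)"
    "(\<Sum>v\<in>BV. d v *\<^sub>c dual_coord Vect v i *\<^sub>c x) = d i *\<^sub>c (x :: 'z::cvec)"
proof -
  have z: "v \<in> BV ==> v \<noteq> i ==> dual_coord Vect i v = 0" "v \<in> BV ==> v \<noteq> i ==> dual_coord Vect v i = 0" for v
    using i by (simp_all add: dual_Vect_eq)
  have o: "dual_coord Vect i i = 1" using i by (simp add: dual_Vect_eq)
  show "(\<Sum>v\<in>BV. \<Sum>w\<in>A. c v w *\<^sub>c dual_coord Vect i v *\<^sub>c u w) = (\<Sum>w\<in>A. c i w *\<^sub>c (u w :: 'z))"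
    by (rule trans[OF sum_pick[of _ i]]) (simp_all add: i z o)
  show "(\<Sum>v\<in>BV. \<Sum>w\<in>A. c v w *\<^sub>c dual_coord Vect v i *\<^sub>c u w) = (\<Sum>w\<in>A. c i w *\<^sub>c (u w :: 'z))"
    by (rule trans[OF sum_pick[of _ i]]) (simp_all add: i z o)
  show "(\<Sum>v\<in>BV. d v *\<^sub>c dual_coord Vect v i *\<^sub>c x) = d i *\<^sub>c (x :: 'z)"
    by (rule trans[OF sum_pick[of _ i]]) (simp_all add: i z o)
qed

lemma form_Vect_eq: "x \<in> BV ==> y \<in> BV ==> form Vect x y = (if x = y then 1 else 0)"
  by (elim basis_VectE) (simp only: form.simps orthonormal label.inject)

lemma sg_sym: "sg X Y = sg Y X" by (auto simp: sg_def)

lemma sg_simps [simp]: "sg Vect X = 1" "sg X Vect = 1" "sg Spin Spin = sigma N" by (simp_all add: sg_def)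

lemma sigma_sq [simp]: "sigma N * sigma N = 1"
  by (simp add: sigma_def minus_one_power_iff)

lemma sg_sq: "sg X Y * sg Y X = 1" by (simp add: sg_def)

text \<open>Rotating Clifford multiplication through a cap and a cup moves it across the form on S,
  which costs \<open>kappa N\<close>, and then cancels the form against its inverse. The companion
  lemma does the same from the other side, so both sides of the rotation relation have the same
  value.\<close>

lemma mu_form_dual:
  assumes x: "x \<in> BS" and v: "v \<in> BV" and z: "z \<in> BS"
  shows "(\<Sum>y\<in>BS. \<Sum>w\<in>BS. form Spin x y * mu y v w * dual_coord Spin w z) = kappa N * mu z v x"
proof -
  let ?S = "BS"
  have k: "kappa N * (\<Sum>w\<in>?S. mu w v x * form Spin w y) = (\<Sum>w\<in>?S. form Spin x w * mu w v y)" if y: "y \<in> ?S" for y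
    unfolding mu_form[OF x v y] mult.assoc[symmetric] by simp
  have "(\<Sum>y\<in>?S. \<Sum>w\<in>?S. form Spin x y * mu y v w * dual_coord Spin w z)
    = (\<Sum>w\<in>?S. (\<Sum>y\<in>?S. form Spin x y * mu y v w) * dual_coord Spin w z)"
    unfolding sum_distrib_right by (rule sum.swap)
  also have "\<dots> = (\<Sum>w\<in>?S. \<Sum>c\<in>?S. kappa N * (mu c v x * (form Spin c w * dual_coord Spin w z)))"
    by (intro sum.cong refl) (simp only: k[symmetric] sum_distrib_left sum_distrib_right mult.assoc)
  also have "\<dots> = (\<Sum>c\<in>?S. \<Sum>w\<in>?S. kappa N * (mu c v x * (form Spin c w * dual_coord Spin w z)))" by (rule sum.swap)
  also have "\<dots> = (\<Sum>c\<in>?S. kappa N * (mu c v x * (if c = z then 1 else 0)))"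
    by (intro sum.cong refl) (simp only: sum_distrib_left[symmetric] form_dual z)
  also have "\<dots> = kappa N * mu z v x"
    unfolding sum_distrib_left[symmetric] by (simp only: sum_delta_mult(2)[OF finite_basis z])
  finally show ?thesis .
qed

lemma mu_form_dual':
  assumes b: "b \<in> BS" and v: "v \<in> BV" and z: "z \<in> BS"
  shows "(\<Sum>a\<in>BS. \<Sum>w\<in>BS. dual_coord Spin z w * (form Spin a b * mu a v w)) = kappa N * mu z v b"
proof -
  let ?S = "BS"
  have "(\<Sum>a\<in>?S. \<Sum>w\<in>?S. dual_coord Spin z w * (form Spin a b * mu a v w))
    = (\<Sum>w\<in>?S. \<Sum>a\<in>?S. dual_coord Spin z w * (mu a v w * form Spin a b))"
    by (subst sum.swap) (simp only: mult.commute)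
  also have "\<dots> = (\<Sum>w\<in>?S. \<Sum>c\<in>?S. kappa N * ((dual_coord Spin z w * form Spin w c) * mu c v b))"
  proof (rule sum.cong[OF refl])
    fix w assume w: "w \<in> ?S"
    have "(\<Sum>a\<in>?S. dual_coord Spin z w * (mu a v w * form Spin a b)) = dual_coord Spin z w * (\<Sum>a\<in>?S. mu a v w * form Spin a b)"
      by (simp only: sum_distrib_left)
    also have "\<dots> = dual_coord Spin z w * (kappa N * (\<Sum>c\<in>?S. form Spin w c * mu c v b))"
      by (simp only: mu_form[OF w v b])
    also have "\<dots> = (\<Sum>c\<in>?S. kappa N * ((dual_coord Spin z w * form Spin w c) * mu c v b))"
      by (simp only: sum_distrib_left mult_ac)
    finally show "(\<Sum>a\<in>?S. dual_coord Spin z w * (mu a v w * form Spin a b)) = (\<Sum>c\<in>?S. kappa N * ((dual_coord Spin z w * form Spin w c) * mu c v b))" .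
  qed
  also have "\<dots> = (\<Sum>c\<in>?S. \<Sum>w\<in>?S. kappa N * ((dual_coord Spin z w * form Spin w c) * mu c v b))" by (rule sum.swap)
  also have "\<dots> = (\<Sum>c\<in>?S. kappa N * ((if z = c then 1 else 0) * mu c v b))"
    by (intro sum.cong refl) (simp only: sum_distrib_left[symmetric] sum_distrib_right[symmetric] dual_form z)
  also have "\<dots> = kappa N * mu z v b"
    unfolding sum_distrib_left[symmetric] by (simp only: sum_delta_mult(1)[OF finite_basis z])
  finally show ?thesis .
qed

lemma sl_Mu: "z \<in> BS ==> sl z (G Mu \<rho> t) = (\<Sum>x\<in>BV. \<Sum>y\<in>BS. mu z x y *\<^sub>c sl y (sl x t))"
  by simp

lemma sl_Mu':
  assumes z: "z \<in> BS"
  shows "sl z (G Mu' \<rho> t) = (\<Sum>x\<in>BS. \<Sum>v\<in>BV. (kappa N * mu z v x) *\<^sub>c sl v (sl x t))"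
proof -
  let ?S = "BS" and ?V = "BV"
  have "sl z (G Mu' \<rho> t) = (\<Sum>x\<in>?S. \<Sum>y\<in>?S. form Spin x y *\<^sub>c (\<Sum>v\<in>?V. \<Sum>w\<in>?S. mu y v w *\<^sub>c dual_coord Spin w z *\<^sub>c sl v (sl x t)))"
    using z by (simp add: Mu'_def sl_lst cong: sum.cong)
  also have "\<dots> = (\<Sum>x\<in>?S. \<Sum>y\<in>?S. \<Sum>v\<in>?V. \<Sum>w\<in>?S. (form Spin x y * mu y v w * dual_coord Spin w z) *\<^sub>c sl v (sl x t))"
    by (simp only: cscale_sum_right cscale_cscale mult.assoc)
  also have "\<dots> = (\<Sum>x\<in>?S. \<Sum>v\<in>?V. \<Sum>y\<in>?S. \<Sum>w\<in>?S. (form Spin x y * mu y v w * dual_coord Spin w z) *\<^sub>c sl v (sl x t))"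
    by (rule sum.cong[OF refl], rule sum.swap)
  also have "\<dots> = (\<Sum>x\<in>?S. \<Sum>v\<in>?V. (kappa N * mu z v x) *\<^sub>c sl v (sl x t))"
    by (intro sum.cong refl) (simp only: cscale_sum_left[symmetric] mu_form_dual z)
  finally show ?thesis .
qed

lemma sl_Delta:
  assumes "y \<in> BV" "x \<in> BS"
  shows "sl x (sl y (G Delta \<rho> t)) = (\<Sum>w\<in>BS. mu x y w *\<^sub>c sl w t)"
proof -
  let ?S = "BS" and ?V = "BV"
  have "sl x (sl y (G Delta \<rho> t)) = (\<Sum>v\<in>?V. \<Sum>w\<in>?S. mu x v w *\<^sub>c dual_coord Vect y v *\<^sub>c sl w t)"
    using assms by (simp add: Delta_def sl_lst cong: sum.cong)
  also have "\<dots> = (\<Sum>w\<in>?S. mu x y w *\<^sub>c sl w t)" by (rule sum_dual_Vect[OF assms(1)])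
  finally show ?thesis .
qed

lemma sl_Delta':
  assumes "y \<in> BV" "x \<in> BS"
  shows "sl y (sl x (G Delta' \<rho> t)) = (\<Sum>w\<in>BS. (kappa N * mu x y w) *\<^sub>c sl w t)"
proof -
  let ?S = "BS" and ?V = "BV"
  have "sl y (sl x (G Delta' \<rho> t)) = (\<Sum>w\<in>?S. \<Sum>v\<in>?V. (kappa N * mu x v w) *\<^sub>c dual_coord Vect v y *\<^sub>c sl w t)"
    using assms by (simp add: Delta'_def sl_lst sl_Mu' cong: sum.cong)
  also have "\<dots> = (\<Sum>w\<in>?S. (kappa N * mu x y w) *\<^sub>c sl w t)"
    by (rule sum.cong[OF refl], rule sum_dual_Vect[OF assms(1)])
  finally show ?thesis .
qed

lemma sl_Bead:
  assumes "x \<in> BS" "y \<in> BS"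
  shows "sl y (sl x (G Bead \<rho> t)) = (\<Sum>x'\<in>BS. \<Sum>y'\<in>BS.
    (\<Sum>v\<in>BV. kappa N * (mu x v x' * mu y v y')) *\<^sub>c sl y' (sl x' t))"
proof -
  let ?S = "BS" and ?V = "BV"
  have "sl y (sl x (G Bead \<rho> t)) = (\<Sum>x'\<in>?S. \<Sum>v\<in>?V. (kappa N * mu x v x') *\<^sub>c
      (\<Sum>w\<in>?V. \<Sum>y'\<in>?S. mu y w y' *\<^sub>c dual_coord Vect v w *\<^sub>c sl y' (sl x' t)))"
    using assms by (simp add: Bead_def sl_lst sl_Mu' cong: sum.cong)
  also have "\<dots> = (\<Sum>x'\<in>?S. \<Sum>v\<in>?V. (kappa N * mu x v x') *\<^sub>c
      (\<Sum>y'\<in>?S. mu y v y' *\<^sub>c sl y' (sl x' t)))"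
    by (rule sum.cong[OF refl], rule sum.cong[OF refl]) (simp only: sum_dual_Vect)
  also have "\<dots> = (\<Sum>x'\<in>?S. \<Sum>v\<in>?V. \<Sum>y'\<in>?S. (kappa N * (mu x v x' * mu y v y')) *\<^sub>c sl y' (sl x' t))"
    by (simp only: cscale_sum_right cscale_cscale mult.assoc)
  also have "\<dots> = (\<Sum>x'\<in>?S. \<Sum>y'\<in>?S. \<Sum>v\<in>?V. (kappa N * (mu x v x' * mu y v y')) *\<^sub>c sl y' (sl x' t))"
    by (rule sum.cong[OF refl], rule sum.swap)
  finally show ?thesis by (simp only: cscale_sum_left)
qed

lemma card_basis: "card (BV) = N" "card (BS) = 2 ^ n"
  by (simp_all add: basis_of.simps card_image inj_on_def card_Pow)

text \<open>Symmetry of the form turns the closed loop into a trace of the form against its inverse,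
  at the cost of the sign \<open>sg X X\<close>; for S this sign is \<open>sigma N\<close>.\<close>

lemma circle: "G (Cap X \<bullet> Cup X) \<rho> t = (sg X X * of_nat (card (bas X))) *\<^sub>c t"
proof -
  let ?B = "bas X"
  have "G (Cap X \<bullet> Cup X) \<rho> t = (\<Sum>x\<in>?B. \<Sum>y\<in>?B. (form X x y * dual_coord X x y) *\<^sub>c t)"
    by (simp cong: sum.cong)
  also have "\<dots> = (\<Sum>x\<in>?B. \<Sum>y\<in>?B. form X x y * dual_coord X x y) *\<^sub>c t" by (simp only: cscale_sum_left)
  also have "(\<Sum>x\<in>?B. \<Sum>y\<in>?B. form X x y * dual_coord X x y) = (\<Sum>x\<in>?B. sg X X * (\<Sum>y\<in>?B. dual_coord X x y * form X y x))"
    unfolding sum_distrib_left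
  proof (intro sum.cong refl)
    fix x y assume "x \<in> ?B" "y \<in> ?B"
    from form_swap[OF this] have "form X x y = sg X X * form X y x" by (rule sym)
    then show "form X x y * dual_coord X x y = sg X X * (dual_coord X x y * form X y x)"
      by (metis mult.assoc mult.commute)
  qed
  also have "\<dots> = (\<Sum>x\<in>?B. sg X X * 1)" by (intro sum.cong refl) (simp only: dual_form if_True simp_thms)
  finally show ?thesis by (simp add: mult.commute)
qed

lemma SB_sound:
  assumes "SB_relation (of_nat N) (sigma N * 2 ^ (N div 2)) (kappa N) f g" and \<rho>: "gmod \<rho>"
  shows "G f \<rho> t = G g \<rho> t"
  using assms(1)
proof cases
  case (swap_swap Y X)
  show ?thesis unfolding swap_swap
  proof (rule eq2I[OF \<rho>])
    fix x y assume "x \<in> bas X" "y \<in> bas Y"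
    then show "sl y (sl x (G (Swap Y X \<bullet> Swap X Y) \<rho> t)) = sl y (sl x (G (Idm [X, Y]) \<rho> t))"
      by (simp add: sl_lst sg_sq)
  qed simp_all
next
  case (braid Y W X)
  show ?thesis unfolding braid
  proof (rule eq3I[OF \<rho>])
    fix x y w assume "w \<in> bas W" "y \<in> bas Y" "x \<in> bas X"
    then show "sl x (sl y (sl w (G (Swap Y W \<boxtimes> Idm [X] \<bullet> (Idm [Y] \<boxtimes> Swap X W) \<bullet> (Swap X Y \<boxtimes> Idm [W])) \<rho> t)))
      = sl x (sl y (sl w (G (Idm [W] \<boxtimes> Swap X Y \<bullet> (Swap X W \<boxtimes> Idm [Y]) \<bullet> (Idm [X] \<boxtimes> Swap Y W)) \<rho> t)))"
      by (simp add: sl_lst mult_ac)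
  qed simp_all
next
  case (zigzag_left X)
  show ?thesis unfolding zigzag_left
  proof (rule eq1I[OF \<rho>])
    fix x assume x: "x \<in> bas X"
    have "sl x (G ((Idm [X] \<boxtimes> Cap X) \<bullet> (Cup X \<boxtimes> Idm [X])) \<rho> t)
      = (\<Sum>y\<in>bas X. \<Sum>z\<in>bas X. (dual_coord X x y * form X y z) *\<^sub>c sl z t)"
      using x by (simp add: sl_lst mult.commute cong: sum.cong)
    also have "\<dots> = (\<Sum>z\<in>bas X. (\<Sum>y\<in>bas X. dual_coord X x y * form X y z) *\<^sub>c sl z t)"
      unfolding cscale_sum_left by (rule sum.swap)
    also have "\<dots> = (\<Sum>z\<in>bas X. (if x = z then 1 else 0) *\<^sub>c sl z t)"
      by (intro sum.cong refl) (simp only: dual_form x)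
    also have "\<dots> = sl x t" by (rule sum_delta_cscale[OF x])
    finally show "sl x (G ((Idm [X] \<boxtimes> Cap X) \<bullet> (Cup X \<boxtimes> Idm [X])) \<rho> t) = sl x (G (Idm [X]) \<rho> t)"
      using x by (simp add: sl_lst)
  qed simp_all
next
  case (zigzag_right X)
  show ?thesis unfolding zigzag_right
  proof (rule eq1I[OF \<rho>])
    fix z assume z: "z \<in> bas X"
    have "sl z (G ((Cap X \<boxtimes> Idm [X]) \<bullet> (Idm [X] \<boxtimes> Cup X)) \<rho> t)
      = (\<Sum>x\<in>bas X. \<Sum>y\<in>bas X. (form X x y * dual_coord X y z) *\<^sub>c sl x t)"
      using z by (simp add: sl_lst cong: sum.cong)
    also have "\<dots> = (\<Sum>x\<in>bas X. (if z = x then 1 else 0) *\<^sub>c sl x t)"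
      unfolding cscale_sum_left[symmetric] by (intro sum.cong refl) (simp only: form_dual z eq_commute[of z])
    also have "\<dots> = sl z t" by (rule sum_delta_cscale[OF z])
    finally show "sl z (G (Idm [X]) \<rho> t) = sl z (G ((Cap X \<boxtimes> Idm [X]) \<bullet> (Idm [X] \<boxtimes> Cup X)) \<rho> t)"
      using z by (simp add: sl_lst)
  qed simp_all
next
  case (cap_swap X)
  have "G (Cap X \<bullet> Swap X X) \<rho> t = (\<Sum>x\<in>bas X. \<Sum>y\<in>bas X. (sg X X * form X x y) *\<^sub>c sl x (sl y t))"
    by (simp add: mult.commute cong: sum.cong)
  also have "\<dots> = (\<Sum>y\<in>bas X. \<Sum>x\<in>bas X. (sg X X * form X x y) *\<^sub>c sl x (sl y t))" by (rule sum.swap)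
  also have "\<dots> = G (Cap X) \<rho> t" by (simp add: form_swap cong: sum.cong)
  finally show ?thesis unfolding cap_swap .
next
  case (cap_slide Y X)
  show ?thesis unfolding cap_slide
  proof (rule eq1I[OF \<rho>])
    fix y assume "y \<in> bas Y"
    then show "sl y (G ((Idm [Y] \<boxtimes> Cap X) \<bullet> (Swap X Y \<boxtimes> Idm [X])) \<rho> t) = sl y (G ((Cap X \<boxtimes> Idm [Y]) \<bullet> (Idm [X] \<boxtimes> Swap Y X)) \<rho> t)"
      by (simp add: sl_lst sg_sym[of Y X] cong: sum.cong)
  qed simp_all
next
  case (mu_slide X)
  show ?thesis unfolding mu_slide
  proof (rule eq2I[OF \<rho>])
    fix x z assume "x \<in> bas X" "z \<in> BS"
    then show "sl z (sl x (G (Swap Spin X \<bullet> (Mu \<boxtimes> Idm [X])) \<rho> t))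
      = sl z (sl x (G ((Idm [X] \<boxtimes> Mu) \<bullet> (Swap Vect X \<boxtimes> Idm [Spin]) \<bullet> (Idm [Vect] \<boxtimes> Swap Spin X)) \<rho> t))"
      by (simp add: sl_lst cscale_sum_right mult.commute cong: sum.cong)
  qed simp_all
next
  case mu_rotate
  show ?thesis unfolding mu_rotate
  proof (rule eq2I[OF \<rho>])
    fix z i assume z: "z \<in> BS" and i: "i \<in> BV"
    let ?S = "BS" and ?V = "BV"
    have "sl i (sl z (G ((Cap Spin \<boxtimes> Idm [Spin, Vect]) \<bullet> (Idm [Spin] \<boxtimes> Mu \<boxtimes> Idm [Spin, Vect])
      \<bullet> (Idm [Spin, Vect] \<boxtimes> Cup Spin \<boxtimes> Idm [Vect]) \<bullet> (Idm [Spin] \<boxtimes> Cup Vect)) \<rho> t))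
      = (\<Sum>x\<in>?S. \<Sum>y\<in>?S. \<Sum>v\<in>?V. \<Sum>w\<in>?S. (form Spin x y * mu y v w * dual_coord Spin w z) *\<^sub>c dual_coord Vect v i *\<^sub>c sl x t)"
      using z i by (simp add: sl_lst cscale_sum_right mult_ac cong: sum.cong)
    also have "\<dots> = (\<Sum>x\<in>?S. \<Sum>y\<in>?S. \<Sum>w\<in>?S. (form Spin x y * mu y i w * dual_coord Spin w z) *\<^sub>c sl x t)"
      by (rule sum.cong[OF refl], rule sum.cong[OF refl], rule sum_dual_Vect[OF i])
    also have "\<dots> = (\<Sum>x\<in>?S. (kappa N * mu z i x) *\<^sub>c sl x t)"
      by (rule sum.cong[OF refl]) (simp only: cscale_sum_left[symmetric] mu_form_dual z i)
    finally have L: "sl i (sl z (G ((Cap Spin \<boxtimes> Idm [Spin, Vect]) \<bullet> (Idm [Spin] \<boxtimes> Mu \<boxtimes> Idm [Spin, Vect])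
      \<bullet> (Idm [Spin, Vect] \<boxtimes> Cup Spin \<boxtimes> Idm [Vect]) \<bullet> (Idm [Spin] \<boxtimes> Cup Vect)) \<rho> t)) = (\<Sum>x\<in>?S. (kappa N * mu z i x) *\<^sub>c sl x t)" .
    have "sl i (sl z (G ((Idm [Spin, Vect] \<boxtimes> Cap Spin) \<bullet> (Idm [Spin, Vect] \<boxtimes> Mu \<boxtimes> Idm [Spin])
      \<bullet> (Idm [Spin] \<boxtimes> Cup Vect \<boxtimes> Idm [Spin, Spin]) \<bullet> (Cup Spin \<boxtimes> Idm [Spin])) \<rho> t))
      = (\<Sum>a\<in>?S. \<Sum>b\<in>?S. \<Sum>v\<in>?V. \<Sum>w\<in>?S. (dual_coord Spin z w * (form Spin a b * mu a v w)) *\<^sub>c dual_coord Vect i v *\<^sub>c sl b t)"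
      using z i by (simp add: sl_lst cscale_sum_right mult_ac cong: sum.cong)
    also have "\<dots> = (\<Sum>a\<in>?S. \<Sum>b\<in>?S. \<Sum>w\<in>?S. (dual_coord Spin z w * (form Spin a b * mu a i w)) *\<^sub>c sl b t)"
      by (rule sum.cong[OF refl], rule sum.cong[OF refl], rule sum_dual_Vect[OF i])
    also have "\<dots> = (\<Sum>b\<in>?S. \<Sum>a\<in>?S. \<Sum>w\<in>?S. (dual_coord Spin z w * (form Spin a b * mu a i w)) *\<^sub>c sl b t)"
      by (rule sum.swap)
    also have "\<dots> = (\<Sum>x\<in>?S. (kappa N * mu z i x) *\<^sub>c sl x t)"
      by (rule sum.cong[OF refl]) (simp only: cscale_sum_left[symmetric] mu_form_dual' z i)
    finally show "sl i (sl z (G ((Cap Spin \<boxtimes> Idm [Spin, Vect]) \<bullet> (Idm [Spin] \<boxtimes> Mu \<boxtimes> Idm [Spin, Vect])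
      \<bullet> (Idm [Spin, Vect] \<boxtimes> Cup Spin \<boxtimes> Idm [Vect]) \<bullet> (Idm [Spin] \<boxtimes> Cup Vect)) \<rho> t))
      = sl i (sl z (G ((Idm [Spin, Vect] \<boxtimes> Cap Spin) \<bullet> (Idm [Spin, Vect] \<boxtimes> Mu \<boxtimes> Idm [Spin])
      \<bullet> (Idm [Spin] \<boxtimes> Cup Vect \<boxtimes> Idm [Spin, Spin]) \<bullet> (Cup Spin \<boxtimes> Idm [Spin])) \<rho> t))"
      unfolding L by (rule sym)
  qed simp_all
next
  case mu_swap
  show ?thesis unfolding mu_swap
  proof (rule eq1I[OF \<rho>])
    fix z assume z: "z \<in> BS"
    have "sl z (G (Mu \<bullet> Swap Spin Vect) \<rho> t) = (\<Sum>v\<in>BV. \<Sum>x\<in>BS. mu z v x *\<^sub>c sl v (sl x t))"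
      using z by (simp cong: sum.cong)
    also have "\<dots> = (\<Sum>x\<in>BS. \<Sum>v\<in>BV. (kappa N * (kappa N * mu z v x)) *\<^sub>c sl v (sl x t))"
      unfolding mult.assoc[symmetric] kappa_sq mult_1 by (rule sum.swap)
    also have "\<dots> = sl z (G (kappa N \<star> Mu') \<rho> t)"
      by (simp only: G.simps sl_linear sl_Mu'[OF z] cscale_sum_right cscale_cscale)
    finally show "sl z (G (Mu \<bullet> Swap Spin Vect) \<rho> t) = sl z (G (kappa N \<star> Mu') \<rho> t)" .
  qed simp_all
next
  case clifford
  show ?thesis unfolding clifford
  proof (rule eq1I[OF \<rho>])
    fix z assume z: "z \<in> BS"
    let ?S = "BS" and ?V = "BV"
    let ?P = "\<lambda>v v' y. \<Sum>w\<in>?S. mu z v w * mu w v' y"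
    have m: "(\<Sum>v\<in>?V. \<Sum>w\<in>?S. \<Sum>v'\<in>?V. \<Sum>y\<in>?S. (mu z v w * mu w v' y) *\<^sub>c u v v' y)
       = (\<Sum>v\<in>?V. \<Sum>v'\<in>?V. \<Sum>y\<in>?S. ?P v v' y *\<^sub>c u v v' y)" for u :: "label => label => label => label list => 'a"
    proof (rule sum.cong[OF refl])
      fix v
      have "(\<Sum>w\<in>?S. \<Sum>v'\<in>?V. \<Sum>y\<in>?S. (mu z v w * mu w v' y) *\<^sub>c u v v' y)
        = (\<Sum>v'\<in>?V. \<Sum>w\<in>?S. \<Sum>y\<in>?S. (mu z v w * mu w v' y) *\<^sub>c u v v' y)" by (rule sum.swap)
      also have "\<dots> = (\<Sum>v'\<in>?V. \<Sum>y\<in>?S. \<Sum>w\<in>?S. (mu z v w * mu w v' y) *\<^sub>c u v v' y)"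
        by (rule sum.cong[OF refl], rule sum.swap)
      finally show "(\<Sum>w\<in>?S. \<Sum>v'\<in>?V. \<Sum>y\<in>?S. (mu z v w * mu w v' y) *\<^sub>c u v v' y)
        = (\<Sum>v'\<in>?V. \<Sum>y\<in>?S. ?P v v' y *\<^sub>c u v v' y)" by (simp only: cscale_sum_left)
    qed
    have 1: "sl z (G (Mu \<bullet> (Idm [Vect] \<boxtimes> Mu)) \<rho> t) = (\<Sum>v\<in>?V. \<Sum>v'\<in>?V. \<Sum>y\<in>?S. ?P v v' y *\<^sub>c sl y (sl v' (sl v t)))"
      unfolding m[symmetric] using z by (simp add: sl_lst cscale_sum_right cong: sum.cong)
    have "sl z (G (Mu \<bullet> (Idm [Vect] \<boxtimes> Mu) \<bullet> (Swap Vect Vect \<boxtimes> Idm [Spin])) \<rho> t) = (\<Sum>v\<in>?V. \<Sum>v'\<in>?V. \<Sum>y\<in>?S. ?P v v' y *\<^sub>c sl y (sl v (sl v' t)))"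
      unfolding m[symmetric] using z by (simp add: sl_lst cscale_sum_right cong: sum.cong)
    also have "\<dots> = (\<Sum>v\<in>?V. \<Sum>v'\<in>?V. \<Sum>y\<in>?S. ?P v' v y *\<^sub>c sl y (sl v' (sl v t)))" by (rule sum.swap)
    finally have 2: "sl z (G (Mu \<bullet> (Idm [Vect] \<boxtimes> Mu) \<bullet> (Swap Vect Vect \<boxtimes> Idm [Spin])) \<rho> t) = (\<Sum>v\<in>?V. \<Sum>v'\<in>?V. \<Sum>y\<in>?S. ?P v' v y *\<^sub>c sl y (sl v' (sl v t)))" .
    have "sl z (G (Mu \<bullet> (Idm [Vect] \<boxtimes> Mu) \<boxplus> Mu \<bullet> (Idm [Vect] \<boxtimes> Mu) \<bullet> (Swap Vect Vect \<boxtimes> Idm [Spin])) \<rho> t)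
      = (\<Sum>v\<in>?V. \<Sum>v'\<in>?V. \<Sum>y\<in>?S. (?P v v' y + ?P v' v y) *\<^sub>c sl y (sl v' (sl v t)))"
      unfolding G.simps(10) sl_linear 1 2 by (simp only: sum.distrib[symmetric] cscale_add_left[symmetric])
    also have "\<dots> = (\<Sum>v\<in>?V. \<Sum>v'\<in>?V. \<Sum>y\<in>?S. (if v = v' \<and> z = y then 2 else 0) *\<^sub>c sl y (sl v' (sl v t)))"
    proof (intro sum.cong refl)
      fix v v' y assume "v \<in> ?V" "v' \<in> ?V" "y \<in> ?S"
      then show "(?P v v' y + ?P v' v y) *\<^sub>c sl y (sl v' (sl v t)) = (if v = v' \<and> z = y then 2 else 0) *\<^sub>c sl y (sl v' (sl v t))"
        unfolding mu_clifford[OF z \<open>v \<in> ?V\<close> \<open>v' \<in> ?V\<close> \<open>y \<in> ?S\<close>] by simp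
    qed
    also have "\<dots> = (\<Sum>v\<in>?V. \<Sum>v'\<in>?V. (if v = v' then 2 else 0) *\<^sub>c sl z (sl v' (sl v t)))"
    proof (intro sum.cong refl)
      fix v v'
      have "(\<Sum>y\<in>?S. (if v = v' \<and> z = y then 2 else 0) *\<^sub>c sl y (sl v' (sl v t))) = (if v = v' \<and> z = z then 2 else 0) *\<^sub>c sl z (sl v' (sl v t))"
        by (rule sum_pick) (use z in auto)
      then show "(\<Sum>y\<in>?S. (if v = v' \<and> z = y then 2 else 0) *\<^sub>c sl y (sl v' (sl v t))) = (if v = v' then 2 else 0) *\<^sub>c sl z (sl v' (sl v t))" by simp
    qed
    also have "\<dots> = sl z (G (2 \<star> (Cap Vect \<boxtimes> Idm [Spin])) \<rho> t)"
    proof -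
      have "(\<Sum>v\<in>?V. \<Sum>v'\<in>?V. (if v = v' then 2 else 0) *\<^sub>c sl z (sl v' (sl v t))) = (\<Sum>v\<in>?V. \<Sum>v'\<in>?V. (2 * form Vect v v') *\<^sub>c sl z (sl v' (sl v t)))"
        by (intro sum.cong refl) (simp add: form_Vect_eq)
      then show ?thesis using z by (simp add: sl_lst cscale_sum_right cong: sum.cong)
    qed
    finally show "sl z (G (Mu \<bullet> (Idm [Vect] \<boxtimes> Mu) \<boxplus> Mu \<bullet> (Idm [Vect] \<boxtimes> Mu) \<bullet> (Swap Vect Vect \<boxtimes> Idm [Spin])) \<rho> t)
       = sl z (G (2 \<star> (Cap Vect \<boxtimes> Idm [Spin])) \<rho> t)" .
  qed simp_all
next
  case dim_Vect
  show ?thesis unfolding dim_Vect circle card_basis by simp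
next
  case dim_Spin
  show ?thesis unfolding dim_Spin circle card_basis by (simp add: n_def)
qed

subsection \<open>The relations for dots\<close>

text \<open>The mixed Casimir operator of the first two factors. The sum runs over ordered pairs, so
  it already contains the factor 2 of the dot.\<close>

definition Th :: "gob => gob => (label list => 'm) => label list => 'm::cvec"
  where "Th X Y u = (\<Sum>i=1..N. \<Sum>j=1..N. rp X (MM i j) (lst X (rp Y (MM j i)) u))"

definition TT :: "gob => gob => label => label => label => label => complex"
  where "TT X Y x y x' y' = (\<Sum>i=1..N. \<Sum>j=1..N. rep X (MM i j) x x' * rep Y (MM j i) y y')"

lemma sl_Th:
  assumes "x \<in> bas X" "y \<in> bas Y"
  shows "sl y (sl x (Th X Y u)) = (\<Sum>x'\<in>bas X. \<Sum>y'\<in>bas Y. TT X Y x y x' y' *\<^sub>c sl y' (sl x' u))"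
proof -
  have "sl y (sl x (Th X Y u)) = (\<Sum>i=1..N. \<Sum>j=1..N. \<Sum>x'\<in>bas X. \<Sum>y'\<in>bas Y.
      (rep X (MM i j) x x' * rep Y (MM j i) y y') *\<^sub>c sl y' (sl x' u))"
    unfolding Th_def sl_sum tw_lst sl_sl_tw[OF assms] ..
  also have "\<dots> = (\<Sum>x'\<in>bas X. \<Sum>y'\<in>bas Y. \<Sum>i=1..N. \<Sum>j=1..N.
      (rep X (MM i j) x x' * rep Y (MM j i) y y') *\<^sub>c sl y' (sl x' u))"
    by (rule sum4_swap)
  finally show ?thesis by (simp only: TT_def cscale_sum_left)
qed

lemma lst_sum: "lst X (\<lambda>u. \<Sum>i\<in>I. h i u) t = (\<Sum>i\<in>I. lst X (h i) t)"
  unfolding lst_def mk_sum ..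

text \<open>The Lie algebra acts on the tensor product of Y and the module by the Leibniz rule, so
  the mixed part of a dot on X splits into a cross term with Y and a part with the module.\<close>

lemma Om_ten:
  assumes \<rho>: "gmod \<rho>"
  shows "Om X (ten Y \<rho>) u = Th X Y u + ((\<Sum>i=1..N. \<Sum>j=1..N. rp X (MM i j) (lst X (lst Y (\<rho> (MM j i))) u))
    + (1/2) *\<^sub>c (\<Sum>i=1..N. \<Sum>j=1..N. rp X (MM i j) (rp X (MM j i) u)))"
proof -
  have 1: "rp X (MM i j) (lst X (ten Y \<rho> (MM j i)) u) = rp X (MM i j) (lst X (rp Y (MM j i)) u) + rp X (MM i j) (lst X (lst Y (\<rho> (MM j i))) u)" for i j
    unfolding clin_add[OF clin_rp, symmetric] lst_linear[symmetric]
    by (rule arg_cong[where f = "rp X _"], rule lst_cong) (rule ten_def)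
  show ?thesis unfolding Om_full[OF gmod_ten[OF \<rho>]] Th_def 1 sum.distrib by (rule add.assoc)
qed

lemma swap_tw:
  assumes "clin h"
  shows "G (Swap X Y) \<rho> (tw X K (lst Y h) u) = lst Y (tw X K h) (G (Swap X Y) \<rho> u)"
  unfolding G.simps(3) lst_def[of Y "tw X K h"] tw_def[of X K h]
proof (intro mk_eqI)
  fix x y assume xy: "y \<in> bas Y" "x \<in> bas X"
  have "sg X Y *\<^sub>c sl y (sl x (tw X K (lst Y h) u)) = (\<Sum>x'\<in>bas X. (sg X Y * K x x') *\<^sub>c h (sl y (sl x' u)))"
    by (simp only: sl_tw[OF xy(2)] sl_sum sl_linear sl_lst[OF xy(1)] cscale_sum_right cscale_cscale)
  also have "\<dots> = (\<Sum>x'\<in>bas X. K x x' *\<^sub>c h (sl x' (sl y (mk Y (\<lambda>y. mk X (\<lambda>x. sg X Y *\<^sub>c sl y (sl x u)))))))"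
    by (intro sum.cong refl) (simp only: sl_mk_in xy clin_scale[OF assms] cscale_cscale mult.commute)
  finally show "sg X Y *\<^sub>c sl y (sl x (tw X K (lst Y h) u)) = (\<Sum>x'\<in>bas X. K x x' *\<^sub>c h (sl x' (sl y (mk Y (\<lambda>y. mk X (\<lambda>x. sg X Y *\<^sub>c sl y (sl x u)))))))" .
qed

lemma swap_rp: "G (Swap X Y) \<rho> (rp X A u) = lst Y (rp X A) (G (Swap X Y) \<rho> u)"
proof -
  have "G (Swap X Y) \<rho> (rp X A u) = G (Swap X Y) \<rho> (tw X (rep X A) (lst Y (\<lambda>t. t)) u)"
    unfolding G.simps(3) by (intro mk_eqI) (simp only: sl_tw sl_sum sl_linear sl_lst)
  then show ?thesis by (simp only: swap_tw[OF clin_id])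
qed

text \<open>The Casimir part and the part with the module pass the crossing unchanged; only the
  cross term between the two strands is left behind.\<close>

lemma dot_swap:
  assumes \<rho>: "gmod \<rho>"
  shows "G (Swap X Y) \<rho> (Om X (ten Y \<rho>) u) = lst Y (Om X \<rho>) (G (Swap X Y) \<rho> u) + G (Swap X Y) \<rho> (Th X Y u)"
proof -
  let ?S = "G (Swap X Y) \<rho>"
  note S = clin_G[OF \<rho>, of "Swap X Y"]
  have 1: "?S (rp X (MM i j) (lst X (lst Y (\<rho> (MM j i))) u)) = lst Y (\<lambda>u. rp X (MM i j) (lst X (\<rho> (MM j i)) u)) (?S u)" for i j
    unfolding tw_lst by (rule swap_tw[OF gmodD(1)[OF \<rho> so_M]])
  have 2: "?S (rp X (MM i j) (rp X (MM j i) u)) = lst Y (\<lambda>u. rp X (MM i j) (rp X (MM j i) u)) (?S u)" for i j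
    unfolding swap_rp lst_lst ..
  have "lst Y (Om X \<rho>) (?S u) = lst Y (\<lambda>u. (\<Sum>i=1..N. \<Sum>j=1..N. rp X (MM i j) (lst X (\<rho> (MM j i)) u))
    + (1/2) *\<^sub>c (\<Sum>i=1..N. \<Sum>j=1..N. rp X (MM i j) (rp X (MM j i) u))) (?S u)"
    by (rule lst_cong) (rule Om_full[OF \<rho>])
  also have "\<dots> = (\<Sum>i=1..N. \<Sum>j=1..N. ?S (rp X (MM i j) (lst X (lst Y (\<rho> (MM j i))) u)))
    + (1/2) *\<^sub>c (\<Sum>i=1..N. \<Sum>j=1..N. ?S (rp X (MM i j) (rp X (MM j i) u)))"
    unfolding 1 2 by (simp only: lst_linear(1,2) lst_sum)
  finally show ?thesis unfolding Om_ten[OF \<rho>] clin_simps[OF S] by (simp only: add.commute)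
qed

text \<open>All four sliding relations have this left-hand side. What remains for each of them is to
  compute the matrix \<open>TT\<close>.\<close>

lemma dot_lhs:
  assumes \<rho>: "gmod \<rho>"
  shows "G (Swap X Y \<bullet> (Dot X \<boxtimes> Idm [Y]) \<boxminus> (Idm [Y] \<boxtimes> Dot X) \<bullet> Swap X Y) \<rho> t
    = mk Y (\<lambda>y. mk X (\<lambda>x. \<Sum>x'\<in>bas X. \<Sum>y'\<in>bas Y. (sg X Y * TT X Y x y x' y') *\<^sub>c sl y' (sl x' t)))"
proof -
  let ?S = "G (Swap X Y) \<rho>"
  let ?t = "lsts [X] (lsts [Y] (\<lambda>t. t)) t"
  have c: "?S ?t = ?S t" using G_in_clean[of "Swap X Y" \<rho> t] by simp
  have "G (Swap X Y \<bullet> (Dot X \<boxtimes> Idm [Y]) \<boxminus> (Idm [Y] \<boxtimes> Dot X) \<bullet> Swap X Y) \<rho> t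
     = ?S (Om X (ten Y \<rho>) ?t) - lsts [Y] (\<lambda>t. t) (lsts [Y] (Om X \<rho>) (?S t))" by simp
  also have "lsts [Y] (\<lambda>t. t) (lsts [Y] (Om X \<rho>) (?S t)) = lst Y (Om X \<rho>) (?S ?t)"
    unfolding c by (simp add: lst_lst)
  also have "?S (Om X (ten Y \<rho>) ?t) - \<dots> = ?S (Th X Y ?t)" unfolding dot_swap[OF \<rho>] by simp
  also have "\<dots> = mk Y (\<lambda>y. mk X (\<lambda>x. \<Sum>x'\<in>bas X. \<Sum>y'\<in>bas Y. (sg X Y * TT X Y x y x' y') *\<^sub>c sl y' (sl x' t)))"
    unfolding G.simps(3)
  proof (intro mk_eqI)
    fix x y assume xy: "y \<in> bas Y" "x \<in> bas X"
    show "sg X Y *\<^sub>c sl y (sl x (Th X Y ?t)) = (\<Sum>x'\<in>bas X. \<Sum>y'\<in>bas Y. (sg X Y * TT X Y x y x' y') *\<^sub>c sl y' (sl x' t))"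
      unfolding sl_Th[OF xy(2,1)] by (simp add: sl_lst cscale_sum_right cong: sum.cong)
  qed
  finally show ?thesis .
qed

lemma sum_delta2:
  assumes "x \<in> bas X" "y \<in> bas Y"
  shows "(\<Sum>x'\<in>bas X. \<Sum>y'\<in>bas Y. (if x = x' \<and> y = y' then c else 0) *\<^sub>c u x' y') = c *\<^sub>c (u x y :: 'z::cvec)"
proof -
  have "(\<Sum>x'\<in>bas X. \<Sum>y'\<in>bas Y. (if x = x' \<and> y = y' then c else 0) *\<^sub>c u x' y')
    = (\<Sum>y'\<in>bas Y. (if x = x \<and> y = y' then c else 0) *\<^sub>c u x y')"
    by (rule sum_pick) (use assms in \<open>auto intro!: sum.neutral\<close>)
  also have "\<dots> = (if x = x \<and> y = y then c else 0) *\<^sub>c u x y"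
    by (rule sum_pick) (use assms in auto)
  finally show ?thesis by simp
qed

lemma if_diff_mult:
  fixes a :: complex
  assumes "P ==> a = b" "Q ==> a = c"
  shows "a * ((if P then 1 else 0) - (if Q then 1 else 0)) = (if P then b else 0) - (if Q then c else 0)"
proof -
  have "a * (if P then 1 else 0) = (if P then b else 0)" using assms(1) by (cases P) simp_all
  moreover have "a * (if Q then 1 else 0) = (if Q then c else 0)" using assms(2) by (cases Q) simp_all
  ultimately show ?thesis by (simp only: right_diff_distrib)
qed

text \<open>On V the matrix of \<open>MM j i\<close> is a difference of two matrix units, so the
  double sum collapses to two terms; these agree because \<open>MM\<close> is antisymmetric in its
  indices.\<close>

lemma TT_Vect:
  assumes "k \<in> {1..N}" "l \<in> {1..N}"
  shows "TT X Vect x (EI k) x' (EI l) = 2 * rep X (MM l k) x x'"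
proof -
  have "TT X Vect x (EI k) x' (EI l) = (\<Sum>i=1..N. \<Sum>j=1..N. (if i = l \<and> j = k then rep X (MM l k) x x' else 0) - (if i = k \<and> j = l then rep X (MM k l) x x' else 0))"
    unfolding TT_def
  proof (intro sum.cong refl)
    fix i j assume ij: "i \<in> {1..N}" "j \<in> {1..N}"
    have E: "rep Vect (MM j i) (EI k) (EI l) = (if i = l \<and> j = k then 1 else 0) - (if j = l \<and> i = k then 1 else 0)"
      unfolding rep.simps by (rule ent_M[OF ij(2,1) assms])
    show "rep X (MM i j) x x' * rep Vect (MM j i) (EI k) (EI l)
      = (if i = l \<and> j = k then rep X (MM l k) x x' else 0) - (if i = k \<and> j = l then rep X (MM k l) x x' else 0)"
      unfolding E conj_commute[of "j = l"] by (rule if_diff_mult) (elim conjE, hypsubst, rule HOL.refl)+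
  qed
  also have "\<dots> = (\<Sum>i=1..N. \<Sum>j=1..N. if i = l \<and> j = k then rep X (MM l k) x x' else 0) - (\<Sum>i=1..N. \<Sum>j=1..N. if i = k \<and> j = l then rep X (MM k l) x x' else 0)"
    by (simp only: sum_subtractf)
  also have "\<dots> = rep X (MM l k) x x' - rep X (MM k l) x x'"
  proof -
    have "(\<Sum>i=1..N. \<Sum>j=1..N. if i = p \<and> j = q then c else 0) = (c :: complex)" if "p \<in> {1..N}" "q \<in> {1..N}" for p q c
    proof -
      have "(\<Sum>i=1..N. \<Sum>j=1..N. if i = p \<and> j = q then c else 0) = (\<Sum>j=1..N. if p = p \<and> j = q then c else 0)"
        by (rule sum_pick) (use that in auto)
      then show ?thesis using that by simp
    qed
    then show ?thesis using assms by simp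
  qed
  also have "rep X (MM k l) x x' = - rep X (MM l k) x x'" by (subst MM_swap, subst rep_scale) simp
  finally show ?thesis by simp
qed

lemma TT_swap: "TT X Y x y x' y' = TT Y X y x y' x'"
  unfolding TT_def by (subst sum.swap) (simp only: mult.commute)

abbreviation PP :: "label => label => label => label => complex"
  where "PP v v' x x' \<equiv> \<Sum>w\<in>BS. mu x v w * mu w v' x'"

text \<open>Quadratic form of the action: (uv - vu)/4 for two basis vectors becomes (uv - \<Phi> u
  v)/2 by the Clifford relation.\<close>

lemma rep_Spin_M:
  assumes k: "k \<in> {1..N}" and l: "l \<in> {1..N}" and x: "x \<in> BS" "x' \<in> BS"
  shows "2 * rep Spin (MM k l) x x' = PP (EI k) (EI l) x x' - (if k = l \<and> x = x' then 1 else 0)"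
proof -
  obtain I J where IJ: "x = XI I" "x' = XI J" "I \<in> Z" "J \<in> Z" using x by (auto elim!: basis_SpinE)
  have E: "EE i (EE j (del J)) I = (\<Sum>K\<in>Z. e_mat i I K * e_mat j K J)" for i j
    unfolding EE_def[of i] mo_def if_P[OF IJ(3)] by (intro sum.cong refl) (simp only: EE_del IJ)
  have q: "x / 4 * y = y / 4 * (x :: complex)" for x y by simp
  have "spin_rep (MM k l) I J = mo (spin_rep (MM k l)) (del J) I" by (simp only: mo_del IJ)
  also have "\<dots> = (\<Sum>i=1..N. \<Sum>j=1..N. ent (MM k l) i j / 4 * EE i (EE j (del J)) I)"
    unfolding mo_spin_rep[OF so_M] by (simp only: sum_fun_apply cscale_fun_apply cscale_complex)
  also have "\<dots> = (\<Sum>i=1..N. \<Sum>j=1..N. (if l = j \<and> k = i then EE k (EE l (del J)) I / 4 else 0) - (if k = j \<and> l = i then EE l (EE k (del J)) I / 4 else 0))"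
  proof (intro sum.cong refl)
    fix i j assume ij: "i \<in> {1..N}" "j \<in> {1..N}"
    show "ent (MM k l) i j / 4 * EE i (EE j (del J)) I
      = (if l = j \<and> k = i then EE k (EE l (del J)) I / 4 else 0) - (if k = j \<and> l = i then EE l (EE k (del J)) I / 4 else 0)"
      unfolding ent_M[OF k l ij] by (rule trans[OF q if_diff_mult]) (elim conjE, hypsubst, rule HOL.refl)+
  qed
  also have "\<dots> = EE k (EE l (del J)) I / 4 - EE l (EE k (del J)) I / 4"
  proof -
    have "(\<Sum>i=1..N. \<Sum>j=1..N. if q = j \<and> p = i then c else 0) = (c :: complex)" if "p \<in> {1..N}" "q \<in> {1..N}" for p q c
    proof -
      have "(\<Sum>i=1..N. \<Sum>j=1..N. if q = j \<and> p = i then c else 0) = (\<Sum>j=1..N. if q = j \<and> p = p then c else 0)"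
        by (rule sum_pick) (use that in auto)
      then show ?thesis using that by simp
    qed
    then show ?thesis using k l by (simp only: sum_subtractf)
  qed
  finally have 1: "4 * spin_rep (MM k l) I J = EE k (EE l (del J)) I - EE l (EE k (del J)) I" by (simp add: field_simps)
  have 2: "EE l (EE k (del J)) I = (if k = l then 2 else 0) * (if I = J then 1 else 0) - EE k (EE l (del J)) I"
    using fun_cong[OF EE_clifford[OF l k, of "del J"], of I] IJ
    by (auto simp: rz_def fun_diff_def cscale_fun_apply)
  have "2 * spin_rep (MM k l) I J = EE k (EE l (del J)) I - (if k = l \<and> I = J then 1 else 0)"
  proof -
    have "2 * spin_rep (MM k l) I J = (4 * spin_rep (MM k l) I J) / 2" by simp
    also have "\<dots> = EE k (EE l (del J)) I - (if k = l then 2 else 0) * (if I = J then 1 else 0) / 2"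
      unfolding 1 unfolding 2 by (simp add: diff_divide_distrib)
    also have "(if k = l then 2 else 0) * (if I = J then 1 else 0) / 2 = (if k = l \<and> I = J then 1 else (0 :: complex))" by simp
    finally show ?thesis .
  qed
  then show ?thesis unfolding IJ(1,2) sum_basis E by simp
qed

lemma PP_clifford:
  assumes "v \<in> BV" "v' \<in> BV" "x \<in> BS" "x' \<in> BS"
  shows "PP v v' x x' = (if v = v' \<and> x = x' then 2 else 0) - PP v' v x x'"
  by (rule mu_clifford[OF assms(3,1,2,4)])

lemma TT_Spin_Vect:
  assumes "x \<in> BS" "x' \<in> BS" "y \<in> BV" "y' \<in> BV"
  shows "TT Spin Vect x y x' y' = (if x = x' \<and> y = y' then 1 else 0) - PP y y' x x'"
proof -
  obtain k l where kl: "y = EI k" "k \<in> {1..N}" "y' = EI l" "l \<in> {1..N}" using assms by (auto elim!: basis_VectE)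
  have "TT Spin Vect x y x' y' = PP (EI l) (EI k) x x' - (if l = k \<and> x = x' then 1 else 0)"
    unfolding kl TT_Vect[OF kl(2,4)] by (rule rep_Spin_M[OF kl(4,2) assms(1,2)])
  then show ?thesis using PP_clifford[OF assms(4,3,1,2)] unfolding kl by auto
qed

lemma TT_Vect_Vect:
  assumes "x \<in> BV" "x' \<in> BV" "y \<in> BV" "y' \<in> BV"
  shows "TT Vect Vect x y x' y' = 2 * ((if y = x' \<and> x = y' then 1 else 0) - dual_coord Vect y x * form Vect x' y')"
proof -
  obtain k l where kl: "y = EI k" "k \<in> {1..N}" "y' = EI l" "l \<in> {1..N}" using assms by (auto elim!: basis_VectE)
  obtain p q where pq: "x = EI p" "p \<in> {1..N}" "x' = EI q" "q \<in> {1..N}" using assms by (auto elim!: basis_VectE)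
  have "TT Vect Vect x y x' y' = 2 * ((if k = q \<and> l = p then 1 else 0) - (if l = q \<and> k = p then 1 else 0))"
    unfolding kl pq TT_Vect[OF kl(2,4)] rep.simps ent_M[OF kl(4,2) pq(2,4)] ..
  moreover have "dual_coord Vect y x * form Vect x' y' = (if l = q \<and> k = p then 1 else 0)"
    unfolding dual_Vect_eq[OF assms(3)] form_Vect_eq[OF assms(2,4)] unfolding kl pq by auto
  moreover have "(y = x' \<and> x = y') = (k = q \<and> l = p)" unfolding kl pq by auto
  ultimately show ?thesis by (simp only:)
qed

text \<open>Expanding the product of two factors of the form in \<open>rep_Spin_M\<close>, the
  corrections occur only on the diagonal v = w, where a product of equal generators is the identity;
  they add up to N. The second identity reverses one product by the Clifford relation.\<close>

lemma PP_sum: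
  assumes "x \<in> BS" "x' \<in> BS" "y \<in> BS" "y' \<in> BS"
  shows "4 * TT Spin Spin x y x' y' = (\<Sum>v\<in>BV. \<Sum>w\<in>BV. PP v w x x' * PP w v y y') - of_nat N * (if x = x' \<and> y = y' then 1 else 0)"
    and "(\<Sum>v\<in>BV. \<Sum>w\<in>BV. PP v w x x' * PP v w y y')
      = 2 * (of_nat N * (if x = x' \<and> y = y' then 1 else 0)) - (\<Sum>v\<in>BV. \<Sum>w\<in>BV. PP v w x x' * PP w v y y')"
proof -
  let ?V = "BV"
  define d :: complex where "d = (if x = x' then 1 else 0)"
  define d' :: complex where "d' = (if y = y' then 1 else 0)"
  have dd: "(if x = x' \<and> y = y' then 1 else 0) = d * d'" by (simp add: d_def d'_def)
  have diag: "PP v v x x' = d" "PP v v y y' = d'" if "v \<in> ?V" for v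
    using PP_clifford[OF that that assms(1,2)] PP_clifford[OF that that assms(3,4)] by (auto simp: d_def d'_def)
  have dsum: "(\<Sum>v\<in>?V. \<Sum>w\<in>?V. (if v = w then 1 else 0) * c v w) = (\<Sum>v\<in>?V. c v v)" for c :: "label => label => complex"
    by (rule sum.cong[OF refl]) (simp only: sum_delta_mult finite_basis)
  have "4 * TT Spin Spin x y x' y' = (\<Sum>i=1..N. \<Sum>j=1..N. (2 * rep Spin (MM i j) x x') * (2 * rep Spin (MM j i) y y'))"
    unfolding TT_def sum_distrib_left by (simp only: mult_ac numeral_times_numeral) simp
  also have "\<dots> = (\<Sum>i=1..N. \<Sum>j=1..N. (PP (EI i) (EI j) x x' - (if EI i = EI j then 1 else 0) * d) * (PP (EI j) (EI i) y y' - (if EI i = EI j then 1 else 0) * d'))"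
    by (intro sum.cong refl) (auto simp: rep_Spin_M assms d_def d'_def simp del: atLeastAtMost_iff)
  also have "\<dots> = (\<Sum>v\<in>?V. \<Sum>w\<in>?V. (PP v w x x' - (if v = w then 1 else 0) * d) * (PP w v y y' - (if v = w then 1 else 0) * d'))"
    unfolding sum_basis(2) ..
  also have "\<dots> = (\<Sum>v\<in>?V. \<Sum>w\<in>?V. PP v w x x' * PP w v y y' - (if v = w then 1 else 0) * (d * PP w v y y' + d' * PP v w x x' - d * d'))"
    by (intro sum.cong refl) (auto simp: algebra_simps)
  also have "\<dots> = (\<Sum>v\<in>?V. \<Sum>w\<in>?V. PP v w x x' * PP w v y y') - (\<Sum>v\<in>?V. d * PP v v y y' + d' * PP v v x x' - d * d')"
    unfolding sum_subtractf dsum ..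
  also have "(\<Sum>v\<in>?V. d * PP v v y y' + d' * PP v v x x' - d * d') = (\<Sum>v\<in>?V. d * d')"
  proof (rule sum.cong[OF refl])
    fix v assume v: "v \<in> ?V"
    show "d * PP v v y y' + d' * PP v v x x' - d * d' = d * d'" unfolding diag[OF v] by simp
  qed
  finally show "4 * TT Spin Spin x y x' y' = (\<Sum>v\<in>?V. \<Sum>w\<in>?V. PP v w x x' * PP w v y y') - of_nat N * (if x = x' \<and> y = y' then 1 else 0)"
    by (simp add: dd card_basis)
  have "(\<Sum>v\<in>?V. \<Sum>w\<in>?V. PP v w x x' * PP v w y y') = (\<Sum>v\<in>?V. \<Sum>w\<in>?V. (if v = w then 1 else 0) * (2 * (PP v w x x' * d')) - PP v w x x' * PP w v y y')"
  proof (intro sum.cong refl)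
    fix v w assume "v \<in> ?V" "w \<in> ?V"
    from PP_clifford[OF this assms(3,4)] have "PP v w y y' = (if v = w then 1 else 0) * (2 * d') - PP w v y y'" by (simp add: d'_def)
    then show "PP v w x x' * PP v w y y' = (if v = w then 1 else 0) * (2 * (PP v w x x' * d')) - PP v w x x' * PP w v y y'"
      by (simp only:) (simp add: algebra_simps)
  qed
  also have "\<dots> = (\<Sum>v\<in>?V. 2 * (PP v v x x' * d')) - (\<Sum>v\<in>?V. \<Sum>w\<in>?V. PP v w x x' * PP w v y y')"
    unfolding sum_subtractf dsum ..
  also have "(\<Sum>v\<in>?V. 2 * (PP v v x x' * d')) = (\<Sum>v\<in>?V. 2 * (d * d'))"
    by (rule sum.cong[OF refl]) (simp only: diag)
  finally show "(\<Sum>v\<in>?V. \<Sum>w\<in>?V. PP v w x x' * PP v w y y')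
      = 2 * (of_nat N * (if x = x' \<and> y = y' then 1 else 0)) - (\<Sum>v\<in>?V. \<Sum>w\<in>?V. PP v w x x' * PP w v y y')"
    by (simp add: dd card_basis)
qed

lemma dot_eqI:
  assumes \<rho>: "gmod \<rho>" and g: "wf_mor g" "tgt g = [Y, X]"
    and eq: "\<And>x y. x \<in> bas X ==> y \<in> bas Y ==>
      sl x (sl y (G g \<rho> t)) = (\<Sum>x'\<in>bas X. \<Sum>y'\<in>bas Y. (sg X Y * TT X Y x y x' y') *\<^sub>c sl y' (sl x' t))"
  shows "G (Swap X Y \<bullet> (Dot X \<boxtimes> Idm [Y]) \<boxminus> (Idm [Y] \<boxtimes> Dot X) \<bullet> Swap X Y) \<rho> t = G g \<rho> t"
  unfolding dot_lhs[OF \<rho>]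
  by (rule trans[OF _ clean2[OF \<rho> g, symmetric]]) (intro mk_eqI, simp only: eq)

lemma sum3_rotate: "(\<Sum>b\<in>B. \<Sum>a\<in>A. \<Sum>w\<in>W. f b a w) = (\<Sum>w\<in>W. \<Sum>b\<in>B. \<Sum>a\<in>A. f b a w :: complex)"
proof -
  have "(\<Sum>b\<in>B. \<Sum>a\<in>A. \<Sum>w\<in>W. f b a w) = (\<Sum>b\<in>B. \<Sum>w\<in>W. \<Sum>a\<in>A. f b a w)"
    by (rule sum.cong[OF refl], rule sum.swap)
  then show ?thesis by (rule trans) (rule sum.swap)
qed

text \<open>The strand ending at \<open>x\<close> multiplies by \<open>w\<close> and then
  \<open>v\<close>, the one ending at \<open>y\<close> by \<open>v\<close> and then
  \<open>w\<close>; in \<open>sl_BSB\<close> both use the same order. Each diagram contains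
  \<open>kappa N\<close> twice, hence without effect.\<close>

lemma sl_mid:
  assumes "x \<in> BS" "y \<in> BS"
  shows "sl y (sl x (G ((Mu \<boxtimes> Mu') \<bullet> (Idm [Vect] \<boxtimes> Swap Spin Spin \<boxtimes> Idm [Vect]) \<bullet> (Delta \<boxtimes> Delta')) \<rho> t))
    = (\<Sum>x'\<in>BS. \<Sum>y'\<in>BS. (sigma N * (\<Sum>v\<in>BV. \<Sum>w\<in>BV. PP v w x y' * PP w v y x')) *\<^sub>c sl y' (sl x' t))"
proof -
  let ?S = "BS" and ?V = "BV"
  let ?k = "kappa N" and ?s = "sigma N"
  have 1: "sl y (sl x (G (Mu \<boxtimes> Mu') \<rho> u)) = (\<Sum>v\<in>?V. \<Sum>b\<in>?S. mu x v b *\<^sub>c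
      (\<Sum>a\<in>?S. \<Sum>w\<in>?V. (?k * mu y w a) *\<^sub>c sl w (sl a (sl b (sl v u)))))" for u
    using assms by (simp add: sl_lst sl_Mu' cong: sum.cong)
  have 2: "sl w (sl a (sl b (sl v (G (Idm [Vect] \<boxtimes> Swap Spin Spin \<boxtimes> Idm [Vect]) \<rho> u)))) = ?s *\<^sub>c sl w (sl b (sl a (sl v u)))"
    if "v \<in> ?V" "b \<in> ?S" "a \<in> ?S" "w \<in> ?V" for v a b w u
    using that by (simp add: sl_lst cong: sum.cong)
  have 3: "sl w (sl b (sl a (sl v (G (Delta \<boxtimes> Delta') \<rho> t)))) = (\<Sum>x'\<in>?S. \<Sum>y'\<in>?S. (mu a v x' * (?k * mu b w y')) *\<^sub>c sl y' (sl x' t))"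
    if "v \<in> ?V" "b \<in> ?S" "a \<in> ?S" "w \<in> ?V" for v a b w
    using that by (simp add: sl_lst sl_Delta sl_Delta' cscale_sum_right cong: sum.cong)
  let ?c = "\<lambda>v b x' y'. \<Sum>a\<in>?S. \<Sum>w\<in>?V. ?k * mu y w a * ?s * (mu a v x' * (?k * mu b w y'))"
  have "sl y (sl x (G ((Mu \<boxtimes> Mu') \<bullet> (Idm [Vect] \<boxtimes> Swap Spin Spin \<boxtimes> Idm [Vect]) \<bullet> (Delta \<boxtimes> Delta')) \<rho> t))
    = (\<Sum>v\<in>?V. \<Sum>b\<in>?S. mu x v b *\<^sub>c (\<Sum>a\<in>?S. \<Sum>w\<in>?V. (?k * mu y w a) *\<^sub>c ?s *\<^sub>c sl w (sl b (sl a (sl v (G (Delta \<boxtimes> Delta') \<rho> t))))))"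
    unfolding G.simps(7) 1 by (simp only: 2 cong: sum.cong)
  also have "\<dots> = (\<Sum>v\<in>?V. \<Sum>b\<in>?S. mu x v b *\<^sub>c (\<Sum>a\<in>?S. \<Sum>w\<in>?V. (?k * mu y w a * ?s) *\<^sub>c (\<Sum>x'\<in>?S. \<Sum>y'\<in>?S. (mu a v x' * (?k * mu b w y')) *\<^sub>c sl y' (sl x' t))))"
    by (simp only: 3 cscale_cscale cong: sum.cong)
  also have "\<dots> = (\<Sum>v\<in>?V. \<Sum>b\<in>?S. mu x v b *\<^sub>c (\<Sum>x'\<in>?S. \<Sum>y'\<in>?S. ?c v b x' y' *\<^sub>c sl y' (sl x' t)))"
    unfolding double_sum_collect ..
  also have "\<dots> = (\<Sum>x'\<in>?S. \<Sum>y'\<in>?S. (\<Sum>v\<in>?V. \<Sum>b\<in>?S. mu x v b * ?c v b x' y') *\<^sub>c sl y' (sl x' t))"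
    by (rule double_sum_collect)
  also have "(\<lambda>x' y'. \<Sum>v\<in>?V. \<Sum>b\<in>?S. mu x v b * ?c v b x' y') = (\<lambda>x' y'. ?s * (\<Sum>v\<in>?V. \<Sum>w\<in>?V. PP v w x y' * PP w v y x'))"
  proof (intro ext)
    fix x' y'
    have "(\<Sum>v\<in>?V. \<Sum>b\<in>?S. mu x v b * ?c v b x' y')
      = (\<Sum>v\<in>?V. \<Sum>w\<in>?V. \<Sum>b\<in>?S. \<Sum>a\<in>?S. mu x v b * (?k * mu y w a * ?s * (mu a v x' * (?k * mu b w y'))))"
      unfolding sum_distrib_left by (rule sum.cong[OF refl], rule sum3_rotate)
    also have "\<dots> = (\<Sum>v\<in>?V. \<Sum>w\<in>?V. \<Sum>b\<in>?S. \<Sum>a\<in>?S. ?s * ((mu x v b * mu b w y') * (mu y w a * mu a v x')))"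
    proof ((rule sum.cong[OF refl])+)
      fix v w b a
      have "mu x v b * (?k * mu y w a * ?s * (mu a v x' * (?k * mu b w y')))
        = (?k * ?k) * (?s * ((mu x v b * mu b w y') * (mu y w a * mu a v x')))"
        by (simp only: mult_ac)
      then show "mu x v b * (?k * mu y w a * ?s * (mu a v x' * (?k * mu b w y')))
        = ?s * ((mu x v b * mu b w y') * (mu y w a * mu a v x'))" by simp
    qed
    also have "\<dots> = ?s * (\<Sum>v\<in>?V. \<Sum>w\<in>?V. PP v w x y' * PP w v y x')"
      by (simp only: sum_distrib_left[symmetric] sum_product)
    finally show "(\<Sum>v\<in>?V. \<Sum>b\<in>?S. mu x v b * ?c v b x' y') = ?s * (\<Sum>v\<in>?V. \<Sum>w\<in>?V. PP v w x y' * PP w v y x')" .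
  qed
  finally show ?thesis .
qed

lemma sl_BSB:
  assumes "x \<in> BS" "y \<in> BS"
  shows "sl y (sl x (G (Bead \<bullet> Swap Spin Spin \<bullet> Bead) \<rho> t))
    = (\<Sum>x'\<in>BS. \<Sum>y'\<in>BS. (sigma N * (\<Sum>v\<in>BV. \<Sum>w\<in>BV. PP v w x y' * PP v w y x')) *\<^sub>c sl y' (sl x' t))"
proof -
  let ?S = "BS" and ?V = "BV"
  let ?k = "kappa N" and ?s = "sigma N"
  let ?B = "\<lambda>x y x' y'. \<Sum>v\<in>?V. ?k * (mu x v x' * mu y v y')"
  have "sl y (sl x (G (Bead \<bullet> Swap Spin Spin \<bullet> Bead) \<rho> t)) = (\<Sum>a\<in>?S. \<Sum>b\<in>?S. ?B x y a b *\<^sub>c ?s *\<^sub>c sl a (sl b (G Bead \<rho> t)))"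
    unfolding G.simps(7) sl_Bead[OF assms] by (simp cong: sum.cong)
  also have "\<dots> = (\<Sum>a\<in>?S. \<Sum>b\<in>?S. (?B x y a b * ?s) *\<^sub>c (\<Sum>x'\<in>?S. \<Sum>y'\<in>?S. ?B b a x' y' *\<^sub>c sl y' (sl x' t)))"
    by (simp only: sl_Bead cscale_cscale cong: sum.cong)
  also have "\<dots> = (\<Sum>x'\<in>?S. \<Sum>y'\<in>?S. (\<Sum>a\<in>?S. \<Sum>b\<in>?S. ?B x y a b * ?s * ?B b a x' y') *\<^sub>c sl y' (sl x' t))"
    by (rule double_sum_collect)
  also have "(\<lambda>x' y'. \<Sum>a\<in>?S. \<Sum>b\<in>?S. ?B x y a b * ?s * ?B b a x' y') = (\<lambda>x' y'. ?s * (\<Sum>v\<in>?V. \<Sum>w\<in>?V. PP v w x y' * PP v w y x'))"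
  proof (intro ext)
    fix x' y'
    have "(\<Sum>a\<in>?S. \<Sum>b\<in>?S. ?B x y a b * ?s * ?B b a x' y')
      = (\<Sum>a\<in>?S. \<Sum>b\<in>?S. \<Sum>v\<in>?V. \<Sum>w\<in>?V. ?s * ((mu x v a * mu a w y') * (mu y v b * mu b w x')))"
    proof (rule sum.cong[OF refl], rule sum.cong[OF refl])
      fix a b
      have "?B x y a b * ?s * ?B b a x' y' = ?s * (?B x y a b * ?B b a x' y')" by (simp only: mult_ac)
      also have "\<dots> = (\<Sum>v\<in>?V. \<Sum>w\<in>?V. ?s * ((?k * (mu x v a * mu y v b)) * (?k * (mu b w x' * mu a w y'))))"
        unfolding sum_product unfolding sum_distrib_left ..
      also have "\<dots> = (\<Sum>v\<in>?V. \<Sum>w\<in>?V. ?s * ((mu x v a * mu a w y') * (mu y v b * mu b w x')))"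
      proof ((rule sum.cong[OF refl])+)
        fix v w
        have "?s * ((?k * (mu x v a * mu y v b)) * (?k * (mu b w x' * mu a w y')))
          = (?k * ?k) * (?s * ((mu x v a * mu a w y') * (mu y v b * mu b w x')))" by (simp only: mult_ac)
        then show "?s * ((?k * (mu x v a * mu y v b)) * (?k * (mu b w x' * mu a w y')))
          = ?s * ((mu x v a * mu a w y') * (mu y v b * mu b w x'))" by simp
      qed
      finally show "?B x y a b * ?s * ?B b a x' y' = (\<Sum>v\<in>?V. \<Sum>w\<in>?V. ?s * ((mu x v a * mu a w y') * (mu y v b * mu b w x')))" .
    qed
    also have "\<dots> = (\<Sum>v\<in>?V. \<Sum>w\<in>?V. \<Sum>a\<in>?S. \<Sum>b\<in>?S. ?s * ((mu x v a * mu a w y') * (mu y v b * mu b w x')))"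
      by (rule sum4_swap)
    also have "\<dots> = ?s * (\<Sum>v\<in>?V. \<Sum>w\<in>?V. PP v w x y' * PP v w y x')"
      by (simp only: sum_distrib_left[symmetric] sum_product)
    finally show "(\<Sum>a\<in>?S. \<Sum>b\<in>?S. ?B x y a b * ?s * ?B b a x' y') = ?s * (\<Sum>v\<in>?V. \<Sum>w\<in>?V. PP v w x y' * PP v w y x')" .
  qed
  finally show ?thesis .
qed

text \<open>This explains the coefficient 1/8. Let T and R be the two quadratic sums from the
  diagrams and d the identity matrix entry times N. By \<open>PP_sum\<close>, T - d is 4 times the
  cross term and R = 2d - T, so T - R is 8 times the cross term.\<close>

lemma dot_SS_sound:
  assumes "gmod \<rho>"
  shows "G (Swap Spin Spin \<bullet> (Dot Spin \<boxtimes> Idm [Spin]) \<boxminus> (Idm [Spin] \<boxtimes> Dot Spin) \<bullet> Swap Spin Spin) \<rho> t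
    = G ((1/8) \<star> ((Mu \<boxtimes> Mu') \<bullet> (Idm [Vect] \<boxtimes> Swap Spin Spin \<boxtimes> Idm [Vect]) \<bullet> (Delta \<boxtimes> Delta')
      \<boxminus> Bead \<bullet> Swap Spin Spin \<bullet> Bead)) \<rho> t"
proof (rule dot_eqI[OF assms])
  fix x y assume xy: "x \<in> BS" "y \<in> BS"
  let ?S = "BS" and ?V = "BV"
  let ?T = "\<lambda>x' y'. \<Sum>v\<in>?V. \<Sum>w\<in>?V. PP v w y y' * PP w v x x'"
  let ?R = "\<lambda>x' y'. \<Sum>v\<in>?V. \<Sum>w\<in>?V. PP v w y y' * PP v w x x'"
  have lin: "sl x (sl y (G ((1/8) \<star> (f \<boxminus> g)) \<rho> t)) = (1/8) *\<^sub>c (sl x (sl y (G f \<rho> t)) - sl x (sl y (G g \<rho> t)))" for f g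
    by simp
  have "(1/8) * (sigma N * ?T x' y' - sigma N * ?R x' y') = sg Spin Spin * TT Spin Spin x y x' y'"
    if "x' \<in> ?S" "y' \<in> ?S" for x' y'
  proof -
    let ?d = "of_nat N * (if x = x' \<and> y = y' then 1 else (0 :: complex))"
    have T: "?T x' y' = (\<Sum>v\<in>?V. \<Sum>w\<in>?V. PP v w x x' * PP w v y y')" 
      by (subst sum.swap) (simp only: mult.commute)
    have R: "?R x' y' = (\<Sum>v\<in>?V. \<Sum>w\<in>?V. PP v w x x' * PP v w y y')" by (simp only: mult.commute)
    have 1: "4 * TT Spin Spin x y x' y' = ?T x' y' - ?d" unfolding T by (rule PP_sum(1)[OF xy(1) that(1) xy(2) that(2)])
    have 2: "?R x' y' = 2 * ?d - ?T x' y'" unfolding T R by (rule PP_sum(2)[OF xy(1) that(1) xy(2) that(2)])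
    have "(1/8) * (sigma N * ?T x' y' - sigma N * ?R x' y') = sigma N * ((?T x' y' - ?d) / 4)"
      unfolding 2 by (simp add: field_simps)
    also have "\<dots> = sigma N * TT Spin Spin x y x' y'" unfolding 1[symmetric] by simp
    finally show ?thesis by simp
  qed
  then show "sl x (sl y (G ((1/8) \<star> ((Mu \<boxtimes> Mu') \<bullet> (Idm [Vect] \<boxtimes> Swap Spin Spin \<boxtimes> Idm [Vect]) \<bullet> (Delta \<boxtimes> Delta')
      \<boxminus> Bead \<bullet> Swap Spin Spin \<bullet> Bead)) \<rho> t)) = (\<Sum>x'\<in>?S. \<Sum>y'\<in>?S. (sg Spin Spin * TT Spin Spin x y x' y') *\<^sub>c sl y' (sl x' t))"
    unfolding lin sl_mid[OF xy(2,1)] sl_BSB[OF xy(2,1)]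
    by (simp only: sum_subtractf[symmetric] cscale_sum_right cscale_diff_left[symmetric] cscale_cscale cong: sum.cong)
qed simp_all

lemma dot_VV_sound:
  assumes "gmod \<rho>"
  shows "G (Swap Vect Vect \<bullet> (Dot Vect \<boxtimes> Idm [Vect]) \<boxminus> (Idm [Vect] \<boxtimes> Dot Vect) \<bullet> Swap Vect Vect) \<rho> t
    = G (2 \<star> (Idm [Vect, Vect] \<boxminus> Cup Vect \<bullet> Cap Vect)) \<rho> t"
proof (rule dot_eqI[OF assms])
  fix x y assume xy: "x \<in> BV" "y \<in> BV"
  let ?V = "BV"
  have "sl x (sl y (G (2 \<star> (Idm [Vect, Vect] \<boxminus> Cup Vect \<bullet> Cap Vect)) \<rho> t))
    = 2 *\<^sub>c (1 *\<^sub>c sl x (sl y t) - (\<Sum>x'\<in>?V. \<Sum>y'\<in>?V. (dual_coord Vect y x * form Vect x' y') *\<^sub>c sl y' (sl x' t)))"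
    using xy by (simp add: sl_lst cscale_sum_right)
  also have "1 *\<^sub>c sl x (sl y t) = (\<Sum>x'\<in>?V. \<Sum>y'\<in>?V. (if y = x' \<and> x = y' then 1 else 0) *\<^sub>c sl y' (sl x' t))"
    by (rule sum_delta2[OF xy(2,1), symmetric])
  also have "2 *\<^sub>c (\<dots> - (\<Sum>x'\<in>?V. \<Sum>y'\<in>?V. (dual_coord Vect y x * form Vect x' y') *\<^sub>c sl y' (sl x' t)))
    = (\<Sum>x'\<in>?V. \<Sum>y'\<in>?V. (sg Vect Vect * TT Vect Vect x y x' y') *\<^sub>c sl y' (sl x' t))"
    unfolding sum_subtractf[symmetric] cscale_sum_right cscale_diff_left[symmetric] cscale_cscale
    by (intro sum.cong refl) (simp only: TT_Vect_Vect xy sg_simps mult_1)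
  finally show "sl x (sl y (G (2 \<star> (Idm [Vect, Vect] \<boxminus> Cup Vect \<bullet> Cap Vect)) \<rho> t))
    = (\<Sum>x'\<in>?V. \<Sum>y'\<in>?V. (sg Vect Vect * TT Vect Vect x y x' y') *\<^sub>c sl y' (sl x' t))" .
qed simp_all

lemma dot_SV_sound:
  assumes "gmod \<rho>"
  shows "G (Swap Spin Vect \<bullet> (Dot Spin \<boxtimes> Idm [Vect]) \<boxminus> (Idm [Vect] \<boxtimes> Dot Spin) \<bullet> Swap Spin Vect) \<rho> t
    = G (Swap Spin Vect \<boxminus> kappa N \<star> (Delta \<bullet> Mu')) \<rho> t"
proof (rule dot_eqI[OF assms])
  fix x y assume xy: "x \<in> BS" "y \<in> BV"
  let ?V = "BV" and ?S = "BS"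
  have "kappa N *\<^sub>c sl x (sl y (G Delta \<rho> (G Mu' \<rho> t)))
    = (\<Sum>w\<in>?S. mu x y w *\<^sub>c (\<Sum>x'\<in>?S. \<Sum>v\<in>?V. mu w v x' *\<^sub>c sl v (sl x' t)))"
    unfolding sl_Delta[OF xy(2,1)] cscale_sum_right
    by (intro sum.cong refl) (simp only: sl_Mu' cscale_sum_right cscale_cscale mult.left_commute[of "mu _ _ _"], simp only: mult.assoc[symmetric] kappa_sq mult_1)
  also have "\<dots> = (\<Sum>x'\<in>?S. \<Sum>v\<in>?V. PP y v x x' *\<^sub>c sl v (sl x' t))"
    using double_sum_collect[of "\<lambda>w _. mu x y w" "\<lambda>w _ x' v. mu w v x'" "\<lambda>x' v. sl v (sl x' t)" ?V ?S "{()}" ?S] by simp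
  finally have 1: "kappa N *\<^sub>c sl x (sl y (G Delta \<rho> (G Mu' \<rho> t))) = (\<Sum>x'\<in>?S. \<Sum>v\<in>?V. PP y v x x' *\<^sub>c sl v (sl x' t))" .
  have "sl x (sl y (G (Swap Spin Vect \<boxminus> kappa N \<star> (Delta \<bullet> Mu')) \<rho> t))
    = 1 *\<^sub>c sl y (sl x t) - kappa N *\<^sub>c sl x (sl y (G Delta \<rho> (G Mu' \<rho> t)))"
    using xy by simp
  also have "1 *\<^sub>c sl y (sl x t) = (\<Sum>x'\<in>?S. \<Sum>y'\<in>?V. (if x = x' \<and> y = y' then 1 else 0) *\<^sub>c sl y' (sl x' t))"
    by (rule sum_delta2[OF xy, symmetric])
  finally show "sl x (sl y (G (Swap Spin Vect \<boxminus> kappa N \<star> (Delta \<bullet> Mu')) \<rho> t))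
    = (\<Sum>x'\<in>?S. \<Sum>y'\<in>?V. (sg Spin Vect * TT Spin Vect x y x' y') *\<^sub>c sl y' (sl x' t))"
    unfolding 1 sum_subtractf[symmetric] cscale_diff_left[symmetric]
    using xy by (simp add: TT_Spin_Vect cong: sum.cong)
qed simp_all

lemma dot_VS_sound:
  assumes "gmod \<rho>"
  shows "G (Swap Vect Spin \<bullet> (Dot Vect \<boxtimes> Idm [Spin]) \<boxminus> (Idm [Spin] \<boxtimes> Dot Vect) \<bullet> Swap Vect Spin) \<rho> t
    = G (Swap Vect Spin \<boxminus> kappa N \<star> (Delta' \<bullet> Mu)) \<rho> t"
proof (rule dot_eqI[OF assms])
  fix x y assume xy: "x \<in> BV" "y \<in> BS"
  let ?V = "BV" and ?S = "BS"
  have "kappa N *\<^sub>c sl x (sl y (G Delta' \<rho> (G Mu \<rho> t)))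
    = (\<Sum>w\<in>?S. mu y x w *\<^sub>c (\<Sum>x'\<in>?V. \<Sum>v\<in>?S. mu w x' v *\<^sub>c sl v (sl x' t)))"
    unfolding sl_Delta'[OF xy] cscale_sum_right
    by (intro sum.cong refl) (simp only: sl_Mu cscale_sum_right cscale_cscale mult.assoc[symmetric] kappa_sq mult_1)
  also have "\<dots> = (\<Sum>x'\<in>?V. \<Sum>v\<in>?S. PP x x' y v *\<^sub>c sl v (sl x' t))"
    using double_sum_collect[of "\<lambda>w _. mu y x w" "\<lambda>w _ x' v. mu w x' v" "\<lambda>x' v. sl v (sl x' t)" ?S ?V "{()}" ?S] by simp
  finally have 1: "kappa N *\<^sub>c sl x (sl y (G Delta' \<rho> (G Mu \<rho> t))) = (\<Sum>x'\<in>?V. \<Sum>v\<in>?S. PP x x' y v *\<^sub>c sl v (sl x' t))" .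
  have "sl x (sl y (G (Swap Vect Spin \<boxminus> kappa N \<star> (Delta' \<bullet> Mu)) \<rho> t))
    = 1 *\<^sub>c sl y (sl x t) - kappa N *\<^sub>c sl x (sl y (G Delta' \<rho> (G Mu \<rho> t)))"
    using xy by simp
  also have "1 *\<^sub>c sl y (sl x t) = (\<Sum>x'\<in>?V. \<Sum>y'\<in>?S. (if x = x' \<and> y = y' then 1 else 0) *\<^sub>c sl y' (sl x' t))"
    by (rule sum_delta2[OF xy, symmetric])
  finally show "sl x (sl y (G (Swap Vect Spin \<boxminus> kappa N \<star> (Delta' \<bullet> Mu)) \<rho> t))
    = (\<Sum>x'\<in>?V. \<Sum>y'\<in>?S. (sg Vect Spin * TT Vect Spin x y x' y') *\<^sub>c sl y' (sl x' t))"
    unfolding 1 sum_subtractf[symmetric] cscale_diff_left[symmetric]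
    using xy by (simp add: TT_swap[of Vect Spin] TT_Spin_Vect conj_commute cong: sum.cong)
qed simp_all

lemma cap_rp: "G (Cap X) \<rho> (rp X A u) = - G (Cap X) \<rho> (lst X (rp X A) u)" if A: "A \<in> so"
proof -
  let ?B = "bas X"
  have "G (Cap X) \<rho> (rp X A u) = (\<Sum>x\<in>?B. \<Sum>y\<in>?B. \<Sum>z\<in>?B. (rep X A x z * form X x y) *\<^sub>c sl y (sl z u))"
    by (simp add: sl_tw cscale_sum_right mult.commute cong: sum.cong)
  also have "\<dots> = (\<Sum>y\<in>?B. \<Sum>z\<in>?B. \<Sum>x\<in>?B. (rep X A x z * form X x y) *\<^sub>c sl y (sl z u))"
    by (subst sum.swap, rule sum.cong[OF refl], rule sum.swap)
  also have "\<dots> = (\<Sum>y\<in>?B. \<Sum>z\<in>?B. \<Sum>x\<in>?B. - ((form X z x * rep X A x y) *\<^sub>c sl y (sl z u)))"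
    by (simp only: cscale_sum_left[symmetric] form_inv[OF A] sum_negf cvec.scale_minus_left cong: sum.cong)
  also have "\<dots> = - (\<Sum>y\<in>?B. \<Sum>z\<in>?B. \<Sum>x\<in>?B. (form X z x * rep X A x y) *\<^sub>c sl y (sl z u))"
    by (simp only: sum_negf)
  also have "(\<Sum>y\<in>?B. \<Sum>z\<in>?B. \<Sum>x\<in>?B. (form X z x * rep X A x y) *\<^sub>c sl y (sl z u))
    = (\<Sum>z\<in>?B. \<Sum>x\<in>?B. \<Sum>y\<in>?B. (form X z x * rep X A x y) *\<^sub>c sl y (sl z u))"
    by (subst sum.swap, rule sum.cong[OF refl], rule sum.swap)
  also have "\<dots> = G (Cap X) \<rho> (lst X (rp X A) u)"
    by (simp add: sl_tw sl_lst cscale_sum_right cong: sum.cong)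
  finally show ?thesis .
qed

text \<open>Let \<open>a\<close> be the Casimir contribution and \<open>b\<close> the mixed one of a
  dot on the second strand, so that this dot gives b + a/2. Under the cap, operators move from the
  first strand to the second with a sign: for a dot on the first strand the cross term gives -a, the
  mixed part -b and the Casimir part a/2, altogether the negative.\<close>

lemma dot_cap_sound:
  assumes \<rho>: "gmod \<rho>"
  shows "G (Cap X \<bullet> (Dot X \<boxtimes> Idm [X])) \<rho> t = G ((-1) \<star> (Cap X \<bullet> (Idm [X] \<boxtimes> Dot X))) \<rho> t"
proof -
  let ?c = "G (Cap X) \<rho>"
  let ?t = "lst X (lst X (\<lambda>t. t)) t"
  note c = clin_G[OF \<rho>, of "Cap X"]
  have clean: "?c (lst X (Om X \<rho>) ?t) = ?c (lst X (Om X \<rho>) t)"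
    unfolding lst_lst using G_in_clean[of "Dot X" \<rho>] by simp
  have 1: "?c (rp X (MM i j) (lst X h ?t)) = - ?c (lst X (\<lambda>u. rp X (MM i j) (h u)) ?t)" for h :: "(label list => 'a) => label list => 'a" and i j
    unfolding cap_rp[OF so_M] lst_lst ..
  have 2: "?c (rp X (MM i j) (rp X (MM j i) ?t)) = ?c (lst X (\<lambda>u. rp X (MM j i) (rp X (MM i j) u)) ?t)" for i j
  proof -
    have "?c (rp X (MM i j) (rp X (MM j i) ?t)) = - ?c (rp X (MM j i) (lst X (rp X (MM i j)) ?t))"
      unfolding cap_rp[OF so_M[of "e i" "e j"]] lst_rp[OF clin_rp] ..
    then show ?thesis unfolding 1 by simp
  qed
  have O: "lst X (Om X \<rho>) ?t = (\<Sum>i=1..N. \<Sum>j=1..N. lst X (\<lambda>u. rp X (MM i j) (lst X (\<rho> (MM j i)) u)) ?t)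
    + (1/2) *\<^sub>c (\<Sum>i=1..N. \<Sum>j=1..N. lst X (\<lambda>u. rp X (MM i j) (rp X (MM j i) u)) ?t)"
  proof -
    have "lst X (Om X \<rho>) ?t = lst X (\<lambda>u. (\<Sum>i=1..N. \<Sum>j=1..N. rp X (MM i j) (lst X (\<rho> (MM j i)) u))
      + (1/2) *\<^sub>c (\<Sum>i=1..N. \<Sum>j=1..N. rp X (MM i j) (rp X (MM j i) u))) ?t"
      by (rule lst_cong) (rule Om_full[OF \<rho>])
    then show ?thesis by (simp only: lst_linear(1,2) lst_sum)
  qed
  define a where "a = (\<Sum>i=1..N. \<Sum>j=1..N. ?c (lst X (\<lambda>u. rp X (MM i j) (rp X (MM j i) u)) ?t))"
  define b where "b = (\<Sum>i=1..N. \<Sum>j=1..N. ?c (lst X (\<lambda>u. rp X (MM i j) (lst X (\<rho> (MM j i)) u)) ?t))"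
  have 3: "?c (lst X (Om X \<rho>) ?t) = b + (1/2) *\<^sub>c a" unfolding O clin_simps[OF c] a_def b_def ..
  have 4: "?c (Om X (ten X \<rho>) ?t) = - a + (- b + (1/2) *\<^sub>c a)"
  proof -
    have T: "?c (Th X X ?t) = - a" unfolding Th_def clin_simps[OF c] 1 a_def sum_negf ..
    have B: "(\<Sum>i=1..N. \<Sum>j=1..N. ?c (rp X (MM i j) (lst X (lst X (\<rho> (MM j i))) ?t))) = - b"
      unfolding 1 b_def sum_negf ..
    have A: "(\<Sum>i=1..N. \<Sum>j=1..N. ?c (rp X (MM i j) (rp X (MM j i) ?t))) = a"
      unfolding 2 a_def by (rule sum.swap)
    show ?thesis unfolding Om_ten[OF \<rho>] clin_add[OF c] clin_scale[OF c] clin_sum[OF c] T A B ..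
  qed
  have h: "a = (1/2) *\<^sub>c a + (1/2) *\<^sub>c a" unfolding cscale_add_left[symmetric] by simp
  have 5: "- a + (- b + (1/2) *\<^sub>c a) = - (b + (1/2) *\<^sub>c a)" by (subst h) (simp add: algebra_simps)
  have "G (Cap X \<bullet> (Dot X \<boxtimes> Idm [X])) \<rho> t = ?c (Om X (ten X \<rho>) ?t)" by simp
  also have "\<dots> = - ?c (lst X (Om X \<rho>) t)" unfolding 4 5 3[symmetric] clean ..
  also have "\<dots> = G ((-1) \<star> (Cap X \<bullet> (Idm [X] \<boxtimes> Dot X))) \<rho> t"
    by (simp add: lst_lst)
  finally show ?thesis .
qed

lemma mu_rp: "rp Spin A (G Mu \<rho> u) = G Mu \<rho> (rp Vect A u) + G Mu \<rho> (lst Vect (rp Spin A) u)" if A: "A \<in> so"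
proof -
  have "rp Spin A (G Mu \<rho> u) = mk Spin (\<lambda>z. \<Sum>y\<in>BS. rep Spin A z y *\<^sub>c
      sl y (mk Spin (\<lambda>z. \<Sum>x\<in>BV. \<Sum>y\<in>BS. mu z x y *\<^sub>c sl y (sl x u))))"
    unfolding tw_def G.simps(4) ..
  also have "\<dots> = G Mu \<rho> (rp Vect A u) + G Mu \<rho> (lst Vect (rp Spin A) u)"
    unfolding G.simps(4) mk_linear(1)[symmetric]
  proof (rule mk_eqI)
  fix z assume z: "z \<in> BS"
  let ?S = "BS" and ?V = "BV"
  have "(\<Sum>y\<in>?S. rep Spin A z y *\<^sub>c sl y (mk Spin (\<lambda>z. \<Sum>x\<in>?V. \<Sum>y\<in>?S. mu z x y *\<^sub>c sl y (sl x u))))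
    = (\<Sum>w\<in>?S. rep Spin A z w *\<^sub>c (\<Sum>x\<in>?V. \<Sum>y\<in>?S. mu w x y *\<^sub>c sl y (sl x u)))"
    by (simp cong: sum.cong)
  also have "\<dots> = (\<Sum>x\<in>?V. \<Sum>y\<in>?S. (\<Sum>w\<in>?S. rep Spin A z w * mu w x y) *\<^sub>c sl y (sl x u))"
    using double_sum_collect[of "\<lambda>w _. rep Spin A z w" "\<lambda>w _ x y. mu w x y" "\<lambda>x y. sl y (sl x u)" ?S ?V "{()}" ?S] by simp
  also have "\<dots> = (\<Sum>x\<in>?V. \<Sum>y\<in>?S. (\<Sum>x'\<in>?V. mu z x' y * rep Vect A x' x) *\<^sub>c sl y (sl x u))
    + (\<Sum>x\<in>?V. \<Sum>y\<in>?S. (\<Sum>y'\<in>?S. mu z x y' * rep Spin A y' y) *\<^sub>c sl y (sl x u))"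
    unfolding sum.distrib[symmetric] cscale_add_left[symmetric]
    by (rule sum.cong[OF refl], rule sum.cong[OF refl]) (simp only: mu_rep[OF A z])
  also have "(\<Sum>x\<in>?V. \<Sum>y\<in>?S. (\<Sum>x'\<in>?V. mu z x' y * rep Vect A x' x) *\<^sub>c sl y (sl x u))
    = (\<Sum>x'\<in>?V. \<Sum>y\<in>?S. mu z x' y *\<^sub>c sl y (sl x' (rp Vect A u)))"
  proof -
    have "(\<Sum>x\<in>?V. \<Sum>y\<in>?S. (\<Sum>x'\<in>?V. mu z x' y * rep Vect A x' x) *\<^sub>c sl y (sl x u))
      = (\<Sum>x\<in>?V. \<Sum>x'\<in>?V. \<Sum>y\<in>?S. (mu z x' y * rep Vect A x' x) *\<^sub>c sl y (sl x u))"
      unfolding cscale_sum_left by (rule sum.cong[OF refl], rule sum.swap)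
    also have "\<dots> = (\<Sum>x'\<in>?V. \<Sum>x\<in>?V. \<Sum>y\<in>?S. (mu z x' y * rep Vect A x' x) *\<^sub>c sl y (sl x u))"
      by (rule sum.swap)
    also have "\<dots> = (\<Sum>x'\<in>?V. \<Sum>y\<in>?S. \<Sum>x\<in>?V. (mu z x' y * rep Vect A x' x) *\<^sub>c sl y (sl x u))"
      by (rule sum.cong[OF refl], rule sum.swap)
    also have "\<dots> = (\<Sum>x'\<in>?V. \<Sum>y\<in>?S. mu z x' y *\<^sub>c sl y (sl x' (rp Vect A u)))"
      by (simp add: sl_tw cscale_sum_right cong: sum.cong)
    finally show ?thesis .
  qed
  also have "(\<Sum>x\<in>?V. \<Sum>y\<in>?S. (\<Sum>y'\<in>?S. mu z x y' * rep Spin A y' y) *\<^sub>c sl y (sl x u))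
    = (\<Sum>x\<in>?V. \<Sum>y'\<in>?S. mu z x y' *\<^sub>c sl y' (sl x (lst Vect (rp Spin A) u)))"
  proof -
    have "(\<Sum>x\<in>?V. \<Sum>y\<in>?S. (\<Sum>y'\<in>?S. mu z x y' * rep Spin A y' y) *\<^sub>c sl y (sl x u))
      = (\<Sum>x\<in>?V. \<Sum>y'\<in>?S. \<Sum>y\<in>?S. (mu z x y' * rep Spin A y' y) *\<^sub>c sl y (sl x u))"
      unfolding cscale_sum_left by (rule sum.cong[OF refl], rule sum.swap)
    then show ?thesis by (simp add: sl_tw sl_lst cscale_sum_right cong: sum.cong)
  qed
  finally show "(\<Sum>y\<in>?S. rep Spin A z y *\<^sub>c sl y (mk Spin (\<lambda>z. \<Sum>x\<in>?V. \<Sum>y\<in>?S. mu z x y *\<^sub>c sl y (sl x u))))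
    = (\<Sum>x\<in>?V. \<Sum>y\<in>?S. mu z x y *\<^sub>c sl y (sl x (rp Vect A u))) + (\<Sum>x\<in>?V. \<Sum>y\<in>?S. mu z x y *\<^sub>c sl y (sl x (lst Vect (rp Spin A) u)))" .
  qed
  finally show ?thesis .
qed

lemma mu_lst: "clin h ==> lst Spin h (G Mu \<rho> u) = G Mu \<rho> (lst Vect (lst Spin h) u)"
  unfolding lst_def[of Spin h] G.simps(4)
  by (rule mk_eqI) (simp add: sl_lst lst_def[symmetric] clin_simps cong: sum.cong)

text \<open>Since Clifford multiplication is equivariant, the Casimir on its result expands into the
  Casimirs \<open>c\<close> and \<open>f\<close> of V and S and twice the cross term
  \<open>d\<close>. Half of this contains \<open>d\<close> once, which is the cross term that
  \<open>Om_ten\<close> gives to the dot on the left strand.\<close>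

lemma dot_mu_sound:
  assumes \<rho>: "gmod \<rho>"
  shows "G (Dot Spin \<bullet> Mu) \<rho> t = G (Mu \<bullet> (Dot Vect \<boxtimes> Idm [Spin]) \<boxplus> Mu \<bullet> (Idm [Vect] \<boxtimes> Dot Spin)) \<rho> t"
proof -
  let ?m = "G Mu \<rho>"
  let ?t = "lst Vect (lst Spin (\<lambda>t. t)) t"
  note m = clin_G[OF \<rho>, of Mu]
  have clean: "?m ?t = ?m t" using G_in_clean[of Mu \<rho> t] by simp
  have clean': "?m (lst Vect (Om Spin \<rho>) ?t) = ?m (lst Vect (Om Spin \<rho>) t)"
    unfolding lst_lst using G_in_clean[of "Dot Spin" \<rho>] by simp
  let ?R = "\<lambda>i j. rp Vect (MM i j)" and ?Q = "\<lambda>i j. lst Vect (rp Spin (MM i j))"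
    and ?L = "\<lambda>i j. lst Vect (lst Spin (\<rho> (MM i j)))"
  let ?SS = "\<lambda>f. \<Sum>i=1..N. \<Sum>j=1..N. f i j"
  define a where "a = ?SS (\<lambda>i j. ?m (?R i j (?L j i ?t)))"
  define b where "b = ?SS (\<lambda>i j. ?m (?Q i j (?L j i ?t)))"
  define c where "c = ?SS (\<lambda>i j. ?m (?R i j (?R j i ?t)))"
  define d where "d = ?SS (\<lambda>i j. ?m (?R i j (?Q j i ?t)))"
  define f where "f = ?SS (\<lambda>i j. ?m (?Q i j (?Q j i ?t)))"
  have d': "?SS (\<lambda>i j. ?m (?Q i j (?R j i ?t))) = d"
    unfolding d_def lst_rp[OF clin_rp] by (rule sum.swap)
  have 1: "Om Spin \<rho> (?m ?t) = (a + b) + (1/2) *\<^sub>c ((c + d) + (d + f))"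
  proof -
    have A: "?SS (\<lambda>i j. rp Spin (MM i j) (lst Spin (\<rho> (MM j i)) (?m ?t))) = a + b"
      by (simp only: mu_lst[OF gmodD(1)[OF \<rho> so_M]] mu_rp[OF so_M] sum.distrib a_def b_def)
    have B: "?SS (\<lambda>i j. rp Spin (MM i j) (rp Spin (MM j i) (?m ?t))) = (c + d) + (d + f)"
      by (simp only: mu_rp[OF so_M] clin_add[OF clin_rp] sum.distrib d') (simp only: c_def d_def f_def)
    show ?thesis unfolding Om_full[OF \<rho>] A B ..
  qed
  have 2: "?m (Om Vect (ten Spin \<rho>) ?t) = d + (a + (1/2) *\<^sub>c c)"
    unfolding Om_ten[OF \<rho>] Th_def clin_simps[OF m] a_def c_def d_def ..
  have q: "?Q i j (lst Vect h ?t) = lst Vect (\<lambda>u. rp Spin (MM i j) (h u)) ?t" for i j h by (rule lst_lst)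
  have 3: "?m (lst Vect (Om Spin \<rho>) ?t) = b + (1/2) *\<^sub>c f"
  proof -
    have "lst Vect (Om Spin \<rho>) ?t = lst Vect (\<lambda>u. (\<Sum>i=1..N. \<Sum>j=1..N. rp Spin (MM i j) (lst Spin (\<rho> (MM j i)) u))
      + (1/2) *\<^sub>c (\<Sum>i=1..N. \<Sum>j=1..N. rp Spin (MM i j) (rp Spin (MM j i) u))) ?t"
      by (rule lst_cong) (rule Om_full[OF \<rho>])
    also have "\<dots> = ?SS (\<lambda>i j. ?Q i j (?L j i ?t)) + (1/2) *\<^sub>c ?SS (\<lambda>i j. ?Q i j (?Q j i ?t))"
      unfolding q by (simp only: lst_linear(1,2) lst_sum)
    finally show ?thesis by (simp only: clin_simps[OF m] b_def f_def)
  qed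
  have h: "d = (1/2) *\<^sub>c d + (1/2) *\<^sub>c d" unfolding cscale_add_left[symmetric] by simp
  have 4: "(a + b) + (1/2) *\<^sub>c ((c + d) + (d + f)) = (d + (a + (1/2) *\<^sub>c c)) + (b + (1/2) *\<^sub>c f)"
    \<comment> \<open>Only one occurrence of \<open>d\<close>, the one standing undivided, is split
      into halves.\<close>
    by (subst (3) h) (simp add: cscale_add_right add_ac)
  have "G (Dot Spin \<bullet> Mu) \<rho> t = Om Spin \<rho> (?m ?t)" unfolding clean by simp
  also have "\<dots> = ?m (Om Vect (ten Spin \<rho>) ?t) + ?m (lst Vect (Om Spin \<rho>) t)" unfolding 1 4 2[symmetric] 3[symmetric] clean' ..
  also have "\<dots> = G (Mu \<bullet> (Dot Vect \<boxtimes> Idm [Spin]) \<boxplus> Mu \<bullet> (Idm [Vect] \<boxtimes> Dot Spin)) \<rho> t"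
    by (simp add: lst_lst)
  finally show ?thesis .
qed

lemma dot_sound: "dot_relation (kappa N) f g ==> gmod \<rho> ==> G f \<rho> t = G g \<rho> t"
  by (erule dot_relation.cases)
    (simp_all only: dot_VV_sound dot_SS_sound dot_SV_sound dot_VS_sound dot_cap_sound dot_mu_sound)

lemma lsts_linear:
  "lsts a (\<lambda>u. h u + k u) t = lsts a h t + lsts a k t"
  "lsts a (\<lambda>u. c *\<^sub>c h u) t = c *\<^sub>c lsts a h t"
proof -
  show "lsts a (\<lambda>u. h u + k u) t = lsts a h t + lsts a k t"
  proof (induction a arbitrary: t)
    case (Cons X a)
    then show ?case unfolding lsts.simps lst_linear(1)[symmetric] by (rule lst_cong)
  qed simp
  show "lsts a (\<lambda>u. c *\<^sub>c h u) t = c *\<^sub>c lsts a h t"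
  proof (induction a arbitrary: t)
    case (Cons X a)
    then show ?case unfolding lsts.simps lst_linear(2)[symmetric] by (rule lst_cong)
  qed simp
qed

text \<open>This makes the functor well defined on classes of expressions. Besides the generating
  relations, the law with content is interchange; congruence and linearity follow from linearity of
  the components.\<close>

theorem ASB_sound:
  assumes "ASB_eq (of_nat N) (sigma N * 2 ^ (N div 2)) (kappa N) f g" "gmod \<rho>"
  shows "G f \<rho> t = G g \<rho> t"
  using assms
proof (induction arbitrary: \<rho> t rule: ASB_eq.induct)
  case (SB f g) then show ?case by (rule SB_sound)
next
  case (dot f g) then show ?case by (rule dot_sound)
next
  case (sym f g) from sym.IH[OF sym.prems] show ?case by (rule HOL.sym)
next
  case (trans f g h) from trans.IH(1)[OF trans.prems] trans.IH(2)[OF trans.prems] show ?case by (rule HOL.trans)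
next
  case (cong_tens f f' g g')
  have "src f = src f'" "tgt g = tgt g'" using ASB_eq_wf cong_tens.hyps by blast+
  moreover have "G g \<rho> = G g' \<rho>" by (rule ext) (rule cong_tens.IH(2)[OF cong_tens.prems])
  ultimately show ?case by (simp only: G.simps cong_tens.IH(1)[OF gmod_tens[OF cong_tens.prems]])
next
  case (comp_id_left f) then show ?case by (simp add: G_out_clean)
next
  case (comp_id_right f) then show ?case by (simp add: G_in_clean)
next
  case (tens_id a b) show ?case by (simp add: lsts_lsts)
next
  case (interchange g f g' f')
  then have wf: "wf_mor g" "wf_mor f" "src g = tgt f" "wf_mor g'" "src g' = tgt f'" by simp_all
  have eq: "G g' \<rho> (tens (tgt f') \<rho> A u) = tens (tgt g') \<rho> A (G g' \<rho> u)" if "A \<in> so" for A u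
    using G_equivariant[OF interchange.prems that wf(4), of u] unfolding wf(5) .
  \<comment> \<open>Interchange is naturality of \<open>f\<close> with respect to the module map
    given by \<open>g'\<close>.\<close>
  have "lsts (tgt f) (G g' \<rho>) (G f (tens (tgt f') \<rho>) u) = G f (tens (tgt g') \<rho>) (lsts (src f) (G g' \<rho>) u)" for u
    using naturality[where \<rho> = "tens (tgt f') \<rho>" and \<rho>' = "tens (tgt g') \<rho>" and h = "G g' \<rho>" and t = u,
      OF gmod_tens[OF interchange.prems] gmod_tens[OF interchange.prems] clin_G[OF interchange.prems] eq wf(2)] by (rule HOL.sym)
  then show ?case by (simp add: wf lsts_lsts)
next
  case (tens_assoc f g h) show ?case by (simp add: lsts_lsts)
next
  case (tens_unit_right f) then show ?case using G_in_clean[of f \<rho> t] by simp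
next
  case (comp_plus_right g f f') then show ?case by (simp add: clin_simps[OF clin_G])
next
  case (comp_scal_right g f c) then show ?case by (simp add: clin_simps[OF clin_G])
next
  case (tens_plus_right f g g')
  then show ?case by (simp add: lsts_linear clin_simps[OF clin_G[OF gmod_tens]])
next
  case (tens_scal_right f g c)
  then show ?case by (simp add: lsts_linear clin_simps[OF clin_G[OF gmod_tens]])
qed (simp_all add: cscale_add_left cscale_add_right add_ac)

subsection \<open>Comparison with the incarnation functor\<close>

text \<open>A module record is computed through a linear surjection \<open>J\<close> from label
  families onto its carrier. Injectivity is not part of the notion, so \<open>J\<close> may forget
  both values off the basis and the difference between representatives of a coset.\<close>

definition linked :: "((label list => 'm::cvec) => 'a tens) => (('v => 'v) => (label list => 'm) => label list => 'm)
    => ('v => 'v, 'a tens) lie_module => bool"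
  where "linked J \<rho> M \<longleftrightarrow> carrier M = range J \<and> \<zero>\<^bsub>M\<^esub> = J 0 \<and> (\<forall>t u. J t \<oplus>\<^bsub>M\<^esub> J u = J (t + u))
    \<and> (\<forall>c t. c \<odot>\<^bsub>M\<^esub> J t = J (c *\<^sub>c t)) \<and> (\<forall>A\<in>so. \<forall>t. act M A (J t) = J (\<rho> A t))"

lemma linkedD:
  assumes "linked J \<rho> M"
  shows "carrier M = range J" "\<zero>\<^bsub>M\<^esub> = J 0" "J t \<oplus>\<^bsub>M\<^esub> J u = J (t + u)" "c \<odot>\<^bsub>M\<^esub> J t = J (c *\<^sub>c t)"
    "A \<in> so ==> act M A (J t) = J (\<rho> A t)"
  using assms unfolding linked_def by auto

lemma linked_abelian_monoid:
  assumes "linked J \<rho> M" shows "abelian_monoid M"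
  by (rule abelian_monoidI) (auto simp: linkedD[OF assms] add_ac)

lemma linked_finsum:
  assumes "linked J \<rho> M" "finite A" "\<And>p. p \<in> A ==> f p = J (u p)"
  shows "finsum M f A = J (\<Sum>p\<in>A. u p)"
  using assms(2,3)
proof (induction A rule: finite_induct)
  case empty
  then show ?case using abelian_monoid.finsum_empty[OF linked_abelian_monoid[OF assms(1)]] linkedD(2)[OF assms(1)] by simp
next
  case (insert p A)
  have "f \<in> A \<rightarrow> carrier M" "f p \<in> carrier M" using insert.prems by (auto simp: linkedD(1)[OF assms(1)])
  then have "finsum M f (insert p A) = f p \<oplus>\<^bsub>M\<^esub> finsum M f A"
    by (intro abelian_monoid.finsum_insert[OF linked_abelian_monoid[OF assms(1)]] insert.hyps) auto
  also have "\<dots> = J (u p) \<oplus>\<^bsub>M\<^esub> J (\<Sum>p\<in>A. u p)" using insert by simp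
  finally show ?case using insert.hyps by (simp add: linkedD(3)[OF assms(1)])
qed

definition JX :: "gob => ((label list => 'm::cvec) => 'a tens) => (label list => 'm) => 'a tens"
  where "JX X J t = Tensor (\<lambda>b\<in>bas X. J (sl b t))"

primrec Jw :: "gob list => ((label list => 'm::cvec) => 'a tens) => (label list => 'm) => 'a tens" where
  "Jw [] J = J"
| "Jw (X # a) J = JX X (Jw a J)"

primrec slw :: "label list => (label list => 'm) => label list => 'm" where
  "slw [] t = t"
| "slw (b # l) t = slw l (sl b t)"

primrec mkw :: "gob list => (label list => label list => 'm) => label list => 'm::cvec" where
  "mkw [] u = u []"
| "mkw (X # a) u = mk X (\<lambda>x. mkw a (\<lambda>l. u (x # l)))"

lemma Jw_append [simp]: "Jw (a @ b) J = Jw a (Jw b J)" by (induction a) simp_all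

lemma Cons_in_listset [simp]: "b # l \<in> listset (map bas (X # a)) \<longleftrightarrow> b \<in> bas X \<and> l \<in> listset (map bas a)"
  by (auto simp: set_Cons_def)

lemma coord_Jw: "l \<in> listset (map bas a) ==> coord l (Jw a J t) = J (slw l t)"
proof (induction a arbitrary: l t)
  case (Cons X a)
  then obtain b l' where "l = b # l'" "b \<in> bas X" "l' \<in> listset (map bas a)" by (auto simp: set_Cons_def)
  then show ?case using Cons.IH[of l' "sl b t"] by (simp add: JX_def)
qed simp

lemma array_Jw:
  "(\<And>l. l \<in> listset (map bas a) ==> f l = J (u l)) ==> array a f = Jw a J (mkw a u)"
proof (induction a arbitrary: f u)
  case (Cons X a)
  have "array a (\<lambda>l. f (b # l)) = Jw a J (mkw a (\<lambda>l. u (b # l)))" if "b \<in> bas X" for b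
    by (rule Cons.IH, rule Cons.prems) (use that in \<open>simp only: Cons_in_listset\<close>)
  then show ?case by (simp add: JX_def cong: restrict_cong)
qed simp

lemma mkw_slw: "mkw a (\<lambda>l. h (slw l t)) = lsts a h t"
  by (induction a arbitrary: t) (simp_all add: lst_def)

lemma Jw_clean: "Jw a J (lsts a (\<lambda>t. t) t) = Jw a J t"
  by (induction a arbitrary: t) (simp_all add: JX_def sl_lst cong: restrict_cong)

lemma last_op_Jw:
  assumes "\<And>t. h (J t) = J' (g t)" shows "last_op a h (Jw a J t) = Jw a J' (lsts a g t)"
  unfolding last_op_def mkw_slw[symmetric] by (rule array_Jw) (simp add: coord_Jw assms)

lemma listset_Cons: "listset (map bas (X # a)) = (\<lambda>(x, l). x # l) ` (bas X \<times> listset (map bas a))"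
  by (auto simp: set_Cons_def)

lemma finite_listset_basis: "finite (listset (map bas a))"
proof (induction a)
  case (Cons X a)
  then show ?case unfolding listset_Cons by simp
qed simp

lemma sum_listset_Cons:
  "(\<Sum>l\<in>listset (map bas (X # a)). f l) = (\<Sum>x\<in>bas X. \<Sum>l\<in>listset (map bas a). f (x # l))"
proof -
  have "inj_on (\<lambda>(x, l). x # l) (bas X \<times> listset (map bas a))" by (auto simp: inj_on_def)
  then have "(\<Sum>l\<in>listset (map bas (X # a)). f l) = (\<Sum>p\<in>bas X \<times> listset (map bas a). f (fst p # snd p))"
    by (simp only: listset_Cons sum.reindex) (simp add: case_prod_unfold)
  also have "\<dots> = (\<Sum>x\<in>bas X. \<Sum>l\<in>listset (map bas a). f (x # l))"
    by (simp add: sum.cartesian_product case_prod_unfold)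
  finally show ?thesis .
qed

lemma first_op_Jw:
  assumes "linked J \<rho> M"
  shows "first_op a b K M (Jw a J t) = Jw b J (mkw b (\<lambda>l'. \<Sum>l\<in>listset (map bas a). K l' l *\<^sub>c slw l t))"
  unfolding first_op_def
proof (rule array_Jw)
  fix l'
  show "(\<Oplus>\<^bsub>M\<^esub>l\<in>listset (map bas a). K l' l \<odot>\<^bsub>M\<^esub> coord l (Jw a J t)) = J (\<Sum>l\<in>listset (map bas a). K l' l *\<^sub>c slw l t)"
    by (rule linked_finsum[OF assms finite_listset_basis]) (simp only: coord_Jw linkedD(4)[OF assms])
qed

lemma sum_listset_Nil: "(\<Sum>l\<in>listset (map bas []). f l) = f []" by simp

lemma rep_op_JX:
  assumes "linked J \<rho> M" shows "rep_op X A M (JX X J t) = JX X J (rp X A t)"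
proof -
  have "rep_op X A M (Jw [X] J t) = Jw [X] J (rp X A t)"
    unfolding rep_op_def first_op_Jw[OF assms] sum_listset_Cons sum_listset_Nil by (simp add: tw_def)
  then show ?thesis by simp
qed

lemma last_op_JX:
  assumes "linked J \<rho> M" "A \<in> so" shows "last_op [X] (act M A) (JX X J t) = JX X J (lst X (\<rho> A) t)"
  using last_op_Jw[of "act M A" J J "\<rho> A" "[X]" t] linkedD(5)[OF assms] by simp

lemma array_eq_JX:
  assumes "\<And>b. b \<in> bas X ==> f [b] = J (sl b t)" shows "array [X] f = JX X J t"
  by (simp add: JX_def assms cong: restrict_cong)

lemma coord_JX: "b \<in> bas X ==> coord [b] (JX X J t) = J (sl b t)" by (simp add: JX_def)

lemma linked_tensor:
  assumes l: "linked J \<rho> M" shows "linked (JX X J) (ten X \<rho>) (tensor_module X M)"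
  unfolding linked_def
proof (intro conjI allI ballI)
  have "s \<in> range (JX X J)" if s: "s \<in> Tensor ` (bas X \<rightarrow>\<^sub>E range J)" for s
  proof -
    obtain F where F: "s = Tensor F" "F \<in> bas X \<rightarrow>\<^sub>E range J" using s by auto
    have "\<exists>u. F b = J u" if "b \<in> bas X" for b using PiE_mem[OF F(2) that] by auto
    then obtain u where u: "\<And>b. b \<in> bas X ==> F b = J (u b)" by metis
    have "F = (\<lambda>b\<in>bas X. J (sl b (mk X u)))"
    proof
      fix b show "F b = (\<lambda>b\<in>bas X. J (sl b (mk X u))) b"
        using u[of b] PiE_arb[OF F(2), of b] by (cases "b \<in> bas X") simp_all
    qed
    then have "s = JX X J (mk X u)" unfolding JX_def F(1) by simp
    then show ?thesis by simp
  qed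
  then show "carrier (tensor_module X M) = range (JX X J)"
    by (auto simp: tensor_module_def linkedD(1)[OF l] JX_def)
  show "\<zero>\<^bsub>tensor_module X M\<^esub> = JX X J 0"
    unfolding tensor_module_def by (simp add: JX_def linkedD(2)[OF l])
  fix t u :: "label list => 'a"
  show "JX X J t \<oplus>\<^bsub>tensor_module X M\<^esub> JX X J u = JX X J (t + u)"
    unfolding tensor_module_def ring_record_simps
    by (rule array_eq_JX) (simp only: coord_JX linkedD(3)[OF l] sl_linear)
  show "c \<odot>\<^bsub>tensor_module X M\<^esub> JX X J t = JX X J (c *\<^sub>c t)" for c
    unfolding tensor_module_def module.simps
    by (rule array_eq_JX) (simp only: coord_JX linkedD(4)[OF l] sl_linear)
  show "act (tensor_module X M) A (JX X J t) = JX X J (ten X \<rho> A t)" if "A \<in> so" for A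
    unfolding tensor_module_def lie_module.simps rep_op_JX[OF l] last_op_JX[OF l that] ten_def
    by (rule array_eq_JX) (simp only: coord_JX linkedD(3)[OF l] sl_linear)
qed

lemma linked_F_ob: "linked J \<rho> M ==> linked (Jw a J) (tens a \<rho>) (F_ob a M)"
  by (induction a) (simp_all add: F_ob_def linked_tensor)

lemma Omega_tilde_JX:
  assumes l: "linked J \<rho> M"
  shows "Omega_tilde X M (JX X J t) = JX X J (Om X \<rho> t)"
proof -
  note lX = linked_tensor[OF l, of X]
  have 1: "finsum (tensor_module X M) (\<lambda>(i, j). rep_op X (MM i j) M (last_op [X] (act M (MM j i)) (JX X J t))) upper_pairs
    = JX X J (\<Sum>(i, j)\<in>upper_pairs. rp X (MM i j) (lst X (\<rho> (MM j i)) t))"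
    by (rule linked_finsum[OF lX finite_upper_pairs]) (auto simp: last_op_JX[OF l so_M] rep_op_JX[OF l])
  have 2: "finsum (tensor_module X M) (\<lambda>(i, j). rep_op X (MM i j) M (rep_op X (MM j i) M (JX X J t))) upper_pairs
    = JX X J (\<Sum>(i, j)\<in>upper_pairs. rp X (MM i j) (rp X (MM j i) t))"
    by (rule linked_finsum[OF lX finite_upper_pairs]) (auto simp: rep_op_JX[OF l])
  show ?thesis unfolding Omega_tilde_def 1 2 linkedD(3,4)[OF lX] Om_def ..
qed

text \<open>The functor as defined on module records and the operator calculus \<open>G\<close>
  agree through the presentation \<open>Jw\<close>. From here on all computations take place in
  \<open>G\<close>.\<close>

theorem F_mor_Jw:
  "wf_mor f ==> linked J \<rho> M ==> F_mor f M (Jw (src f) J t) = Jw (tgt f) J (G f \<rho> t)"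
proof (induction f arbitrary: M J \<rho> t)
  case (Cap X)
  then show ?case by (simp only: F_mor.simps src.simps tgt.simps first_op_Jw sum_listset_Cons sum_listset_Nil) simp
next
  case (Cup X)
  then show ?case by (simp only: F_mor.simps src.simps tgt.simps first_op_Jw sum_listset_Nil) simp
next
  case (Swap X Y)
  have "(\<Sum>x'\<in>bas X. \<Sum>y'\<in>bas Y. (if [y, x] = rev [x', y'] then if X = Spin \<and> Y = Spin then sigma N else 1 else 0) *\<^sub>c sl y' (sl x' t))
    = sg X Y *\<^sub>c sl y (sl x t)" if "x \<in> bas X" "y \<in> bas Y" for x y
  proof -
    have "(if [y, x] = rev [x', y'] then if X = Spin \<and> Y = Spin then sigma N else 1 else 0) = (if x = x' \<and> y = y' then sg X Y else 0)" for x' y'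
      unfolding sg_def by auto
    then show ?thesis by (simp only: sum_delta2[OF that])
  qed
  with Swap show ?case by (simp only: F_mor.simps src.simps tgt.simps first_op_Jw sum_listset_Cons sum_listset_Nil) (simp cong: mk_cong)
next
  case Mu
  then show ?case by (simp only: F_mor.simps src.simps tgt.simps first_op_Jw sum_listset_Cons sum_listset_Nil) simp
next
  case (Dot X)
  then show ?case by (simp add: Omega_tilde_JX)
next
  case (Idm a)
  show ?case by (simp add: Jw_clean)
next
  case (Comp g f)
  then have wf: "wf_mor g" "wf_mor f" "src g = tgt f" by simp_all
  show ?case using Comp.IH(2)[OF wf(2) Comp.prems(2), of t] Comp.IH(1)[OF wf(1) Comp.prems(2), of "G f \<rho> t"] wf(3) by simp
next
  case (Tens f g)
  then have wf: "wf_mor f" "wf_mor g" by simp_all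
  have "last_op (src f) (F_mor g M) (Jw (src f) (Jw (src g) J) t) = Jw (src f) (Jw (tgt g) J) (lsts (src f) (G g \<rho>) t)"
    by (rule last_op_Jw) (rule Tens.IH(2)[OF wf(2) Tens.prems(2)])
  then show ?case using Tens.IH(1)[OF wf(1) linked_F_ob[OF Tens.prems(2)]] by simp
next
  case (Zero a b)
  then show ?case using linkedD(2)[OF linked_F_ob] by auto
next
  case (Plus f g)
  then show ?case using Plus.IH(1)[OF _ Plus.prems(2)] Plus.IH(2)[OF _ Plus.prems(2)]
    by (simp add: linkedD(3)[OF linked_F_ob[OF Plus.prems(2)]])
next
  case (Scal c f)
  then show ?case using Scal.IH[OF _ Scal.prems(2)] by (simp add: linkedD(4)[OF linked_F_ob[OF Scal.prems(2)]])
qed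

end

section \<open>Quotients of free algebras\<close>

text \<open>A linear section of the quotient map from \<open>T\<close> to \<open>T\<close> modulo
  \<open>K\<close>, written as an endomorphism of the ambient space.\<close>

lemma linear_projection_modulo:
  fixes K T :: "'a::cvec set"
  assumes K: "cvec.subspace K" and T: "cvec.subspace T" and KT: "K \<subseteq> T"
  shows "\<exists>h. clin h \<and> (\<forall>p. h p \<in> T) \<and> (\<forall>p\<in>T. p - h p \<in> K) \<and> (\<forall>p\<in>K. h p = 0)"
proof -
  interpret pair: vector_space_pair "cscale :: complex => 'a => 'a" "cscale :: complex => 'a => 'a" ..
  obtain B where B: "B \<subseteq> K" "cvec.independent B" "K \<subseteq> cvec.span B"
    using cvec.maximal_independent_subset[of K] by metis
  obtain C where C: "B \<subseteq> C" "C \<subseteq> T" "cvec.independent C" "T \<subseteq> cvec.span C"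
    using cvec.maximal_independent_subset_extend[of B T] B KT by (metis subset_trans)
  obtain D where D: "C \<subseteq> D" "cvec.independent D" "UNIV \<subseteq> cvec.span D"
    using cvec.maximal_independent_subset_extend[of C UNIV] C by (metis subset_UNIV)
  \<comment> \<open>The basis vectors that complement \<open>K\<close> inside \<open>T\<close> are
    kept; those of \<open>K\<close> and those added outside \<open>T\<close> are sent to 0.\<close>
  obtain h where h: "Vector_Spaces.linear cscale cscale h" "\<And>x. x \<in> D ==> h x = (if x \<in> C - B then x else 0)"
    using pair.linear_independent_extend[OF D(2), of "\<lambda>x. if x \<in> C - B then x else 0"] by metis
  interpret h: Vector_Spaces.linear "cscale :: complex => 'a => 'a" "cscale :: complex => 'a => 'a" h by (rule h(1))
  have "clin h" by (rule clinI) (rule h.add h.scale)+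
  moreover have "h p \<in> T" for p
  proof -
    have "p \<in> cvec.span D" using D by auto
    then show ?thesis
      by (induction rule: cvec.span_induct_alt)
        (use C h(2) in \<open>auto simp: h.add h.scale h.zero cvec.subspace_0[OF T] intro!: cvec.subspace_add[OF T] cvec.subspace_scale[OF T]\<close>)
  qed
  moreover have "p - h p \<in> K" if "p \<in> T" for p
  proof -
    have 1: "x - h x \<in> K" if "x \<in> C" for x
      using h(2)[OF subsetD[OF D(1) that]] that B(1) cvec.subspace_0[OF K] by (cases "x \<in> B") auto
    have "p \<in> cvec.span C" using C that by auto
    then show ?thesis
    proof (induction rule: cvec.span_induct_alt)
      case base show ?case using cvec.subspace_0[OF K] by (simp add: h.zero)
    next
      case (step c x y)
      have "c *\<^sub>c x + y - h (c *\<^sub>c x + y) = c *\<^sub>c (x - h x) + (y - h y)"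
        by (simp add: h.add h.scale cscale_diff_right)
      then show ?case using cvec.subspace_add[OF K cvec.subspace_scale[OF K 1[OF step(1)]] step(2)] by metis
    qed
  qed
  moreover have "h p = 0" if "p \<in> K" for p
  proof -
    have 1: "h x = 0" if "x \<in> B" for x using h(2)[of x] that B C D by auto
    have "p \<in> cvec.span B" using B that by auto
    then show ?thesis by (induction rule: cvec.span_induct_alt) (simp_all add: h.add h.scale h.zero 1)
  qed
  ultimately show ?thesis by blast
qed

section \<open>Words, linear extension and multiplication in the free algebra\<close>

instantiation poly_mapping :: (type, cvec) cvec
begin
lift_definition cscale_poly_mapping :: "complex => ('a \<Rightarrow>\<^sub>0 'b) => 'a \<Rightarrow>\<^sub>0 'b" is "\<lambda>c f x. c *\<^sub>c f x"
  by (rule finite_subset[rotated]) auto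
instance by standard (transfer, simp add: fun_eq_iff cscale_add_right cscale_add_left)+
end

lemma lookup_cscale: "Poly_Mapping.lookup (c *\<^sub>c p) w = c *\<^sub>c Poly_Mapping.lookup p w"
  by transfer simp

definition monw :: "'a list => 'a nc_poly" where "monw w = Poly_Mapping.single w 1"

lemma single_mon: "Poly_Mapping.single w c = c *\<^sub>c monw w"
  by (rule poly_mapping_eqI) (simp add: lookup_cscale monw_def lookup_single when_def)

lemma const_eq: "const c = c *\<^sub>c monw []" by (simp add: const_def single_mon)

lemma monw_mult: "monw u * monw v = monw (u @ v)" by (simp add: monw_def mult_single plus_list_def)

lemma monw_Nil: "monw [] = 1" by (simp add: monw_def zero_list_def[symmetric])

lemma letter_monw: "letter x = monw [x]" by (simp add: letter_def monw_def)

lemma poly_expand: "p = (\<Sum>w\<in>Poly_Mapping.keys p. Poly_Mapping.lookup p w *\<^sub>c monw w)" for p :: "'a nc_poly"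
proof (rule poly_mapping_eqI)
  fix w
  have "Poly_Mapping.lookup (\<Sum>w\<in>Poly_Mapping.keys p. Poly_Mapping.lookup p w *\<^sub>c monw w) w
    = (\<Sum>v\<in>Poly_Mapping.keys p. if v = w then Poly_Mapping.lookup p v else 0)"
    unfolding lookup_sum by (rule sum.cong[OF refl]) (simp add: lookup_cscale monw_def lookup_single when_def)
  also have "\<dots> = Poly_Mapping.lookup p w" by (simp add: in_keys_iff)
  finally show "Poly_Mapping.lookup p w = Poly_Mapping.lookup (\<Sum>w\<in>Poly_Mapping.keys p. Poly_Mapping.lookup p w *\<^sub>c monw w) w" ..
qed

lemma const_mult: "const c * p = c *\<^sub>c p"
proof -
  have "const c * p = (\<Sum>w\<in>Poly_Mapping.keys p. const c * Poly_Mapping.single w (Poly_Mapping.lookup p w))"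
    by (subst poly_expand[of p]) (simp only: sum_distrib_left single_mon)
  also have "\<dots> = (\<Sum>w\<in>Poly_Mapping.keys p. (c * Poly_Mapping.lookup p w) *\<^sub>c monw w)"
    by (simp add: const_def mult_single plus_list_def single_mon[symmetric])
  also have "\<dots> = c *\<^sub>c p" unfolding cscale_cscale[symmetric] cscale_sum_right[symmetric] by (subst poly_expand[of p]) (rule HOL.refl)
  finally show ?thesis .
qed

lemma mult_const: "p * const c = c *\<^sub>c p"
proof -
  have "p * const c = (\<Sum>w\<in>Poly_Mapping.keys p. Poly_Mapping.single w (Poly_Mapping.lookup p w) * const c)"
    by (subst poly_expand[of p]) (simp only: sum_distrib_right single_mon)
  also have "\<dots> = (\<Sum>w\<in>Poly_Mapping.keys p. (c * Poly_Mapping.lookup p w) *\<^sub>c monw w)"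
    by (simp add: const_def mult_single plus_list_def single_mon[symmetric] mult.commute)
  also have "\<dots> = c *\<^sub>c p" unfolding cscale_cscale[symmetric] cscale_sum_right[symmetric] by (subst poly_expand[of p]) (rule HOL.refl)
  finally show ?thesis .
qed

lemma scale_mult: "(c *\<^sub>c p) * q = c *\<^sub>c (p * q)" "p * (c *\<^sub>c q) = c *\<^sub>c (p * q)" for p q :: "'a nc_poly"
proof -
  show 1: "(c *\<^sub>c p) * q = c *\<^sub>c (p * q)" for p :: "'a nc_poly" by (simp only: const_mult[symmetric] mult.assoc)
  have "p * (c *\<^sub>c q) = (p * const c) * q" by (simp only: const_mult[symmetric] mult.assoc)
  then show "p * (c *\<^sub>c q) = c *\<^sub>c (p * q)" unfolding mult_const 1 .
qed

definition FA :: "'a set => 'a nc_poly set" where "FA A = carrier (free_alg A)"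

lemma FA_iff: "p \<in> FA A \<longleftrightarrow> (\<forall>w\<in>Poly_Mapping.keys p. set w \<subseteq> A)" by (simp add: FA_def free_alg_def)

lemma FA_UNIV [simp]: "FA UNIV = UNIV" by (auto simp: FA_iff)

lemma FA_monw [simp]: "monw w \<in> FA A \<longleftrightarrow> set w \<subseteq> A" by (simp add: FA_iff monw_def)

lemma FA_closed [simp]:
  "0 \<in> FA A" "1 \<in> FA A" "p \<in> FA A ==> q \<in> FA A ==> p + q \<in> FA A"
  "p \<in> FA A ==> q \<in> FA A ==> p * q \<in> FA A" "p \<in> FA A ==> c *\<^sub>c p \<in> FA A"
  "p \<in> FA A ==> - p \<in> FA A"
proof -
  show "0 \<in> FA A" by (simp add: FA_iff)
  show "1 \<in> FA A" unfolding monw_Nil[symmetric] by simp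
  show "p + q \<in> FA A" if "p \<in> FA A" "q \<in> FA A" using that keys_add[of p q] unfolding FA_iff by blast
  show "p * q \<in> FA A" if "p \<in> FA A" "q \<in> FA A"
  proof -
    have "set (u + v) \<subseteq> A" if "u \<in> Poly_Mapping.keys p" "v \<in> Poly_Mapping.keys q" for u v
      using that \<open>p \<in> FA A\<close> \<open>q \<in> FA A\<close> unfolding FA_iff plus_list_def by auto
    then show ?thesis using keys_mult[of p q] unfolding FA_iff by blast
  qed
  show s: "c *\<^sub>c p \<in> FA A" if "p \<in> FA A" for c and p :: "'a nc_poly"
    using that unfolding FA_iff by (auto simp: in_keys_iff lookup_cscale)
  show "- p \<in> FA A" if "p \<in> FA A" using s[OF that, of "-1"] by simp
qed

lemma FA_diff [simp]: "p \<in> FA A ==> q \<in> FA A ==> p - q \<in> FA A"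
  using FA_closed(3)[of p A "- q"] by simp

lemma FA_letter [simp]: "x \<in> A ==> letter x \<in> FA A" by (simp add: letter_monw)

lemma FA_const [simp]: "const c \<in> FA A" by (simp add: const_eq)

lemma ring_free_alg: "ring (free_alg A)"
proof (intro ringI abelian_groupI monoidI; simp only: FA_def[symmetric], (simp add: free_alg_def algebra_simps; fail)?)
  fix p assume "p \<in> FA A"
  then show "\<exists>q\<in>FA A. q \<oplus>\<^bsub>free_alg A\<^esub> p = \<zero>\<^bsub>free_alg A\<^esub>"
    by (intro bexI[of _ "- p"]) (simp_all add: free_alg_def)
qed

lemma nc_linear_eqI:
  assumes "clin h" "clin k" "p \<in> FA A" "\<And>w. set w \<subseteq> A ==> h (monw w) = k (monw w)"
  shows "h p = k p"
proof -
  have "h (\<Sum>w\<in>Poly_Mapping.keys p. Poly_Mapping.lookup p w *\<^sub>c monw w) = k (\<Sum>w\<in>Poly_Mapping.keys p. Poly_Mapping.lookup p w *\<^sub>c monw w)"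
    unfolding clin_simps[OF assms(1)] clin_simps[OF assms(2)]
    by (rule sum.cong[OF refl]) (use assms(3,4) in \<open>simp add: FA_iff\<close>)
  then show ?thesis by (simp only: poly_expand[symmetric])
qed

text \<open>The linear extension of a function on words. Renaming letters, reversing words and the
  action of the Clifford algebra are all of this kind, so that multiplicativity needs to be checked
  on words only.\<close>

definition ev :: "('a list => 'b::cvec) => 'a nc_poly => 'b"
  where "ev f p = (\<Sum>w\<in>Poly_Mapping.keys p. Poly_Mapping.lookup p w *\<^sub>c f w)"

lemma ev_superset:
  assumes "finite S" "Poly_Mapping.keys p \<subseteq> S"
  shows "ev f p = (\<Sum>w\<in>S. Poly_Mapping.lookup p w *\<^sub>c f w)"
  unfolding ev_def by (rule sum.mono_neutral_left) (use assms in \<open>auto simp: in_keys_iff\<close>)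

lemma clin_ev: "clin (ev f)"
proof (rule clinI)
  fix p q :: "'a nc_poly" and c
  let ?S = "Poly_Mapping.keys p \<union> Poly_Mapping.keys q"
  show "ev f (p + q) = ev f p + ev f q"
    using ev_superset[of ?S "p + q" f] ev_superset[of ?S p f] ev_superset[of ?S q f] keys_add[of p q]
    by (simp add: lookup_add cscale_add_left sum.distrib)
  have "Poly_Mapping.keys (c *\<^sub>c p) \<subseteq> Poly_Mapping.keys p" by (auto simp: in_keys_iff lookup_cscale)
  then show "ev f (c *\<^sub>c p) = c *\<^sub>c ev f p"
    using ev_superset[of "Poly_Mapping.keys p" "c *\<^sub>c p" f] by (simp add: ev_def lookup_cscale cscale_sum_right)
qed

lemma ev_monw [simp]: "ev f (monw w) = f w" by (simp add: ev_def monw_def)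

lemma clin_mult: "clin (\<lambda>q. p * q)" "clin (\<lambda>p. p * q)" for p q :: "'a nc_poly"
  by (rule clinI; simp add: scale_mult distrib_left distrib_right)+

lemma map_letters_ev: "map_letters f = ev (\<lambda>w. monw (map f w))"
  by (rule ext) (simp add: map_letters_def ev_def single_mon)

lemma reverse_words_ev: "reverse_words = ev (\<lambda>w. monw (rev w))"
  by (rule ext) (simp add: reverse_words_def ev_def single_mon)

lemma ev_mult:
  fixes f :: "'a list => 'b nc_poly"
  assumes "\<And>u v. f (u @ v) = f u * f v"
  shows "ev f (p * q) = ev f p * ev f q"
proof -
  have *: "ev f (monw u * q) = ev f (monw u) * ev f q" for u
    by (rule nc_linear_eqI[where A = UNIV, OF clin_comp[OF clin_ev clin_mult(1)] clin_comp[OF clin_mult(1) clin_ev]])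
      (simp_all add: monw_mult assms)
  show ?thesis
    by (rule nc_linear_eqI[where A = UNIV, OF clin_comp[OF clin_ev clin_mult(2)] clin_comp[OF clin_mult(2) clin_ev]])
      (simp_all only: * FA_UNIV UNIV_I)
qed

lemma ev_antimult:
  fixes f :: "'a list => 'b nc_poly"
  assumes "\<And>u v. f (u @ v) = f v * f u"
  shows "ev f (p * q) = ev f q * ev f p"
proof -
  have *: "ev f (monw u * q) = ev f q * ev f (monw u)" for u
    by (rule nc_linear_eqI[where A = UNIV, OF clin_comp[OF clin_ev clin_mult(1)] clin_comp[OF clin_mult(2) clin_ev]])
      (simp_all add: monw_mult assms)
  show ?thesis
    by (rule nc_linear_eqI[where A = UNIV, OF clin_comp[OF clin_ev clin_mult(2)] clin_comp[OF clin_mult(1) clin_ev]])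
      (simp_all only: * FA_UNIV UNIV_I)
qed

lemma map_letters_mult: "map_letters f (p * q) = map_letters f p * map_letters f q"
  unfolding map_letters_ev by (rule ev_mult) (simp add: monw_mult)

lemma reverse_words_mult: "reverse_words (p * q) = reverse_words q * reverse_words p"
  unfolding reverse_words_ev by (rule ev_antimult) (simp add: monw_mult)

text \<open>The common frame for the enveloping algebra and the Clifford algebra, both of which are
  quotients of a free algebra by a generated ideal.\<close>

locale presented_algebra =
  fixes A :: "'a set" and S K :: "'a nc_poly set"
  assumes K_def: "K = Idl\<^bsub>free_alg A\<^esub> S" and S: "S \<subseteq> FA A"
begin

sublocale free: ring "free_alg A" by (rule ring_free_alg)

sublocale ideal: ideal K "free_alg A"
  unfolding K_def by (rule free.genideal_ideal) (use S in \<open>simp add: FA_def\<close>)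

lemma K_FA: "p \<in> K ==> p \<in> FA A" using ideal.Icarr by (simp add: FA_def)

lemma gen_K: "p \<in> S ==> p \<in> K"
  unfolding K_def using free.genideal_self[of S] S by (auto simp: FA_def)

lemma K_add: "p \<in> K ==> q \<in> K ==> p + q \<in> K"
  using ideal.a_closed[of p q] by (simp add: free_alg_def)

lemma K_mult: "p \<in> K ==> q \<in> FA A ==> q * p \<in> K" "p \<in> K ==> q \<in> FA A ==> p * q \<in> K"
  using ideal.I_l_closed[of p q] ideal.I_r_closed[of p q] by (simp_all add: FA_def) (simp_all add: free_alg_def)

lemma K_0: "0 \<in> K" using ideal.zero_closed by (simp add: free_alg_def)

lemma K_scale: "p \<in> K ==> c *\<^sub>c p \<in> K" using K_mult(1)[of p "const c"] by (simp add: const_mult)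

lemma K_minus: "p \<in> K ==> - p \<in> K" using K_scale[of p "-1"] by simp

lemma K_diff: "p \<in> K ==> q \<in> K ==> p - q \<in> K" using K_add[of p "- q"] K_minus by simp

text \<open>An induction rule for the generated ideal: the members of \<open>FA A\<close> with the
  property form an ideal containing the generators. Additive inverses come from multiplication by
  the constant -1.\<close>

lemma K_least:
  assumes "p \<in> K" and "P 0" and "\<And>p q. P p ==> P q ==> P (p + q)"
    and "\<And>p q. P p ==> q \<in> FA A ==> P (q * p)" and "\<And>p q. P p ==> q \<in> FA A ==> P (p * q)"
    and "\<And>p. p \<in> S ==> P p"
  shows "P p"
proof -
  let ?I = "{p \<in> FA A. P p}"
  have "subgroup ?I (add_monoid (free_alg A))"
  proof (rule group.subgroupI[OF free.a_group])
    show "?I \<noteq> {}" using assms(2) FA_closed(1) by blast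
  next
    fix a assume a: "a \<in> ?I"
    have "inv\<^bsub>add_monoid (free_alg A)\<^esub> a = - a"
      by (rule group.inv_equality[OF free.a_group]) (use a FA_closed(6)[of a] in \<open>simp_all add: free_alg_def FA_iff\<close>)
    moreover have "P (const (-1) * a)" by (rule assms(4)) (use a in auto)
    ultimately show "inv\<^bsub>add_monoid (free_alg A)\<^esub> a \<in> ?I" using a by (simp add: const_mult)
  qed (use assms FA_closed(1) in \<open>auto simp: free_alg_def FA_def[symmetric]\<close>, auto simp: FA_iff free_alg_def)
  then have "ideal ?I (free_alg A)"
    by (rule idealI[OF ring_free_alg]) (use assms(4,5) in \<open>auto simp: FA_def[symmetric]\<close>, auto simp: free_alg_def)
  moreover have "S \<subseteq> ?I" using S assms(6) by auto
  ultimately have "K \<subseteq> ?I" unfolding K_def by (rule free.genideal_minimal)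
  then show ?thesis using assms(1) by auto
qed

abbreviation cs :: "'a nc_poly => 'a nc_poly set" where "cs p \<equiv> K +>\<^bsub>free_alg A\<^esub> p"

abbreviation Q where "Q \<equiv> free_alg A Quot K"

lemma cs_eq: "cs p = {q. q - p \<in> K}"
proof -
  have "cs p = (\<lambda>k. k + p) ` K" by (auto simp: free_alg_def a_r_coset_def r_coset_def)
  also have "(\<lambda>k. k + p) ` K = {q. q - p \<in> K}"
  proof (intro Set.set_eqI iffI)
    fix q assume "q \<in> {q. q - p \<in> K}"
    then show "q \<in> (\<lambda>k. k + p) ` K" by (intro image_eqI[of _ _ "q - p"]) auto
  qed auto
  finally show ?thesis .
qed

lemma cs_eq_iff: "cs p = cs q \<longleftrightarrow> p - q \<in> K"
proof
  assume "cs p = cs q"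
  then have "p \<in> cs q" using K_0 unfolding cs_eq by auto
  then show "p - q \<in> K" by (simp add: cs_eq)
next
  assume pq: "p - q \<in> K"
  show "cs p = cs q" unfolding cs_eq
  proof (intro Collect_cong iffI)
    fix r
    show "r - q \<in> K" if "r - p \<in> K" using K_add[OF that pq] by simp
    show "r - p \<in> K" if "r - q \<in> K" using K_diff[OF that pq] by simp
  qed
qed

lemma carrier_Q: "carrier Q = cs ` FA A"
  by (auto simp: FactRing_def A_RCOSETS_def' FA_def)

lemma mult_Q: "p \<in> FA A ==> q \<in> FA A ==> cs p \<otimes>\<^bsub>Q\<^esub> cs q = cs (p * q)"
  using ideal.rcoset_mult_add[of p q] by (simp add: FactRing_def FA_def) (simp add: free_alg_def)

lemma add_Q: "p \<in> FA A ==> q \<in> FA A ==> cs p \<oplus>\<^bsub>Q\<^esub> cs q = cs (p + q)"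
  using ideal.a_rcos_sum[of p q] by (simp add: FactRing_def FA_def) (simp add: free_alg_def)

lemma one_Q: "\<one>\<^bsub>Q\<^esub> = cs 1" by (simp add: FactRing_def free_alg_def)

lemma zero_Q: "\<zero>\<^bsub>Q\<^esub> = cs 0" by (simp add: FactRing_def cs_eq)

lemma ring_Q: "ring Q" by (rule ideal.quotient_is_ring)

lemma projection_exists: "\<exists>h. clin h \<and> (\<forall>p. h p \<in> FA A) \<and> (\<forall>p\<in>FA A. p - h p \<in> K) \<and> (\<forall>p\<in>K. h p = 0)"
  by (rule linear_projection_modulo) (auto simp: cvec.subspace_def K_0 K_add K_scale K_FA)

text \<open>A linear choice of representatives of cosets. The quotient itself is a set of sets
  without the structure of \<open>cvec\<close>; its representatives lie in the free algebra, which
  has it, and so the regular module can be handled by the calculus of label families.\<close>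

definition nf :: "'a nc_poly => 'a nc_poly"
  where "nf = (SOME h. clin h \<and> (\<forall>p. h p \<in> FA A) \<and> (\<forall>p\<in>FA A. p - h p \<in> K) \<and> (\<forall>p\<in>K. h p = 0))"

lemma nf: "clin nf" "nf p \<in> FA A" "p \<in> FA A ==> p - nf p \<in> K" "p \<in> K ==> nf p = 0"
  using someI_ex[OF projection_exists] unfolding nf_def[symmetric] by blast+

lemma nf_cong: "p - q \<in> K ==> nf p = nf q"
  using nf(4)[of "p - q"] by (simp add: clin_diff[OF nf(1)])

lemma nf_nf: "p \<in> FA A ==> nf (nf p) = nf p" by (rule nf_cong[symmetric]) (rule nf(3))

lemma nf_mult_nf: "q \<in> FA A ==> p \<in> FA A ==> nf (q * nf p) = nf (q * p)" "q \<in> FA A ==> p \<in> FA A ==> nf (nf p * q) = nf (p * q)"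
  using K_mult[OF nf(3)[of p], of q] by (auto intro!: nf_cong[symmetric] simp: algebra_simps)

lemma cs_nf: "p \<in> FA A ==> cs (nf p) = cs p" using K_minus[OF nf(3)] unfolding cs_eq_iff by simp

end

context spin_setting
begin

section \<open>The enveloping algebra, its regular module and the values of closed diagrams\<close>

abbreviation (input) br :: "('v => 'v) => ('v => 'v) => 'v => 'v" where "br A B \<equiv> \<lambda>v. A (B v) - B (A v)"

definition U_rel :: "('v => 'v) nc_poly set"
  where "U_rel = linear_relations so (\<lambda>A B v. A v + B v) (\<lambda>c A v. scale c (A v))
    \<union> {letter A * letter B - letter B * letter A - letter (\<lambda>v. A (B v) - B (A v)) | A B. A \<in> so \<and> B \<in> so}"

sublocale U: presented_algebra so U_rel U_ideal
proof
  show "U_ideal = Idl\<^bsub>free_alg so\<^esub> U_rel" unfolding U_ideal_def U_rel_def ..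
  show "U_rel \<subseteq> FA so"
    unfolding U_rel_def linear_relations_def by (auto simp: so_add so_scale so_bracket)
qed

lemma U_rels:
  "A \<in> so ==> B \<in> so ==> letter (\<lambda>v. A v + B v) - (letter A + letter B) \<in> U_ideal"
  "A \<in> so ==> letter (\<lambda>v. scale c (A v)) - c *\<^sub>c letter A \<in> U_ideal"
  "A \<in> so ==> B \<in> so ==> letter (br A B) - (letter A * letter B - letter B * letter A) \<in> U_ideal"
proof -
  show "letter (\<lambda>v. A v + B v) - (letter A + letter B) \<in> U_ideal" if "A \<in> so" "B \<in> so"
    by (rule U.gen_K) (use that in \<open>auto simp: U_rel_def linear_relations_def diff_diff_eq\<close>)
  show "letter (\<lambda>v. scale c (A v)) - c *\<^sub>c letter A \<in> U_ideal" if "A \<in> so"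
    by (rule U.gen_K) (use that in \<open>auto simp: U_rel_def linear_relations_def const_mult\<close>)
  have "letter A * letter B - letter B * letter A - letter (br A B) \<in> U_ideal" if "A \<in> so" "B \<in> so"
    by (rule U.gen_K) (use that in \<open>auto simp: U_rel_def\<close>)
  from U.K_minus[OF this] show "letter (br A B) - (letter A * letter B - letter B * letter A) \<in> U_ideal" if "A \<in> so" "B \<in> so"
    using that by simp
qed

text \<open>The regular module as families supported at the empty label list. The inner
  \<open>nf\<close> moves arbitrary values into \<open>FA so\<close>, the outer one makes relations
  of the enveloping algebra hold as equations.\<close>

definition reg :: "('v => 'v) => (label list => ('v => 'v) nc_poly) => label list => ('v => 'v) nc_poly"
  where "reg A t = (\<lambda>l. if l = [] then U.nf (letter A * U.nf (t [])) else 0)"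

lemma nf_letter_cong: "p - q \<in> U_ideal ==> U.nf (p * U.nf r) = U.nf (q * U.nf r)"
  using U.K_mult(2)[of "p - q" "U.nf r"] by (intro U.nf_cong) (simp add: left_diff_distrib U.nf)

lemma gmod_reg: "gmod reg"
  unfolding gmod_def
proof (intro ballI allI conjI)
  fix A assume A: "A \<in> so"
  note lin = clin_simps[OF U.nf(1)]
  show "clin (reg A)"
    by (rule clinI; rule ext) (simp_all add: reg_def plus_fun_apply cscale_fun_apply lin distrib_left scale_mult)
  show "reg (\<lambda>v. scale c (A v)) t = c *\<^sub>c reg A t" for c t
    using nf_letter_cong[OF U_rels(2)[OF A, of c], of "t []"]
    by (intro ext) (simp add: reg_def cscale_fun_apply lin scale_mult)
  fix B t assume B: "B \<in> so"
  show "reg (\<lambda>v. A v + B v) t = reg A t + reg B t"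
    using nf_letter_cong[OF U_rels(1)[OF A B], of "t []"]
    by (intro ext) (simp add: reg_def plus_fun_apply lin distrib_right)
  show "reg (br A B) t = reg A (reg B t) - reg B (reg A t)"
    using nf_letter_cong[OF U_rels(3)[OF A B], of "t []"] A B
    by (intro ext) (simp add: reg_def minus_apply lin left_diff_distrib U.nf_nf U.nf_mult_nf U.nf mult.assoc)
qed

definition Jr :: "(label list => ('v => 'v) nc_poly) => ('v => 'v) nc_poly set tens"
  where "Jr t = Pure (U.cs (U.nf (t [])))"

lemma linked_reg: "linked Jr reg U_regular"
  unfolding linked_def
proof (intro conjI allI ballI)
  have "Pure (U.cs p) \<in> range Jr" if "p \<in> FA so" for p
    using U.cs_nf[OF that] by (intro image_eqI[of _ _ "\<lambda>_. p"]) (simp_all add: Jr_def)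
  then show "carrier U_regular = range Jr"
    by (auto simp: U_regular_def Ug_def U.carrier_Q Jr_def U.nf)
  show "\<zero>\<^bsub>U_regular\<^esub> = Jr 0"
    by (simp add: U_regular_def Ug_def U.zero_Q Jr_def zero_fun_apply clin_0[OF U.nf(1)])
  fix t u
  show "Jr t \<oplus>\<^bsub>U_regular\<^esub> Jr u = Jr (t + u)"
    by (simp add: U_regular_def Ug_def Jr_def U.add_Q U.nf plus_fun_apply clin_add[OF U.nf(1)])
  show "c \<odot>\<^bsub>U_regular\<^esub> Jr t = Jr (c *\<^sub>c t)" for c
    by (simp add: U_regular_def Ug_def Jr_def U.mult_Q U.nf cscale_fun_apply clin_scale[OF U.nf(1)] const_mult)
  show "act U_regular A (Jr t) = Jr (reg A t)" if "A \<in> so" for A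
    using that by (simp add: U_regular_def Ug_def Jr_def U.mult_Q U.nf reg_def U.nf_nf U.cs_nf)
qed

definition vac :: "label list => ('v => 'v) nc_poly" where "vac = (\<lambda>l. if l = [] then 1 else 0)"

text \<open>The recorded facts make \<open>nf\<close> idempotent on \<open>FA so\<close> only. The
  inner application brings the value into that set, the outer one makes it a fixed point of
  \<open>nf\<close>.\<close>

definition val :: "mor => ('v => 'v) nc_poly" where "val f = U.nf (U.nf (G f reg vac []))"

lemma F_mor_val:
  assumes "f \<in> arrows [] []" shows "unpure (F_mor f U_regular (Pure \<one>\<^bsub>Ug\<^esub>)) = U.cs (val f)"
proof -
  have "Pure \<one>\<^bsub>Ug\<^esub> = Jr vac" by (simp add: Ug_def U.one_Q Jr_def vac_def U.cs_nf)
  then show ?thesis using assms F_mor_Jw[OF _ linked_reg, of f vac] by (simp add: arrows_def val_def Jr_def U.cs_nf U.nf)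
qed

text \<open>By \<open>ASB_sound\<close> the value is constant on the class, so
  \<open>the_elem\<close> is applied to a singleton.\<close>

lemma chi_class:
  assumes "f \<in> arrows [] []"
  shows "chi ({(f, g). ASB_eq (of_nat N) (sigma N * 2 ^ (N div 2)) (kappa N) f g} `` {f}) = U.cs (val f)"
proof -
  let ?c = "{(f, g). ASB_eq (of_nat N) (sigma N * 2 ^ (N div 2)) (kappa N) f g} `` {f}"
  have "unpure (F_mor g U_regular (Pure \<one>\<^bsub>Ug\<^esub>)) = U.cs (val f)" if "g \<in> ?c" for g
  proof -
    have eq: "ASB_eq (of_nat N) (sigma N * 2 ^ (N div 2)) (kappa N) f g" using that by simp
    have "g \<in> arrows [] []" using assms ASB_eq_wf[OF eq] by (simp add: arrows_def)
    then show ?thesis using ASB_sound[OF eq gmod_reg, of vac] by (simp add: F_mor_val val_def)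
  qed
  moreover have "f \<in> ?c" using assms ASB_eq.refl by (simp add: arrows_def)
  ultimately have "(\<lambda>f. unpure (F_mor f U_regular (Pure \<one>\<^bsub>Ug\<^esub>))) ` ?c = {U.cs (val f)}" by blast
  then show ?thesis unfolding chi_def by simp
qed

lemma chi_image:
  "chi ` ASB_hom (of_nat N) (sigma N * 2 ^ (N div 2)) (kappa N) [] [] = (\<lambda>f. U.cs (val f)) ` arrows [] []"
proof -
  have "ASB_hom (of_nat N) (sigma N * 2 ^ (N div 2)) (kappa N) [] []
    = (\<lambda>f. {(f, g). ASB_eq (of_nat N) (sigma N * 2 ^ (N div 2)) (kappa N) f g} `` {f}) ` arrows [] []"
    unfolding ASB_hom_def quotient_def by auto
  then show ?thesis unfolding image_image by (simp only: image_image) (rule image_cong[OF refl], rule chi_class)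
qed

subsection \<open>The Clifford algebra acting on the spin module\<close>

definition Cl_rel :: "'v nc_poly set"
  where "Cl_rel = linear_relations UNIV (+) scale \<union> {letter v * letter w + letter w * letter v - const (2 * \<Phi> v w) | v w. True}"

sublocale C: presented_algebra UNIV Cl_rel Cl_ideal
proof
  show "Cl_ideal = Idl\<^bsub>free_alg UNIV\<^esub> Cl_rel" unfolding Cl_ideal_def Cl_rel_def ..
qed simp

definition cl :: "'v => (nat set => complex) => nat set => complex"
  where "cl v f = (\<Sum>k=1..N. \<Phi> (e k) v *\<^sub>c EE k f)"

lemma clin_cl: "clin (cl v)"
  by (rule clinI) (simp_all only: cl_def EE_simps cscale_add_right sum.distrib cscale_sum_right cscale_cscale mult.commute)

lemma cl_linear: "cl (v + w) f = cl v f + cl w f" "cl (scale c v) f = c *\<^sub>c cl v f"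
  by (simp_all only: cl_def form_simps cscale_add_left sum.distrib cscale_sum_right cscale_cscale)

lemma cl_e: "k \<in> {1..N} ==> cl (e k) f = EE k f"
proof -
  assume k: "k \<in> {1..N}"
  have "cl (e k) f = (\<Sum>l=1..N. (if k = l then 1 else 0) *\<^sub>c EE l f)"
    unfolding cl_def by (rule sum.cong[OF refl]) (simp only: orthonormal[OF _ k] eq_commute[of _ k])
  also have "\<dots> = (if k = k then 1 else 0) *\<^sub>c EE k f" by (rule sum_pick) (use k in auto)
  finally show ?thesis by simp
qed

lemma rz_cl [simp]: "rz (cl v f) = cl v f" "cl v (rz f) = cl v f"
  by (simp_all only: cl_def clin_simps[OF clin_rz] rz_EE)

lemma parseval: "\<Phi> v w = (\<Sum>k=1..N. \<Phi> (e k) v * \<Phi> (e k) w)"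
proof -
  have "\<Phi> v w = \<Phi> v (\<Sum>k=1..N. scale (\<Phi> (e k) w) (e k))" by (simp only: expand[symmetric])
  also have "\<dots> = (\<Sum>k=1..N. \<Phi> (e k) v * \<Phi> (e k) w)"
    by (simp only: form_simps) (rule sum.cong[OF refl], simp only: form_sym[of v] mult.commute)
  finally show ?thesis .
qed

lemma cl_clifford: "cl v (cl w f) + cl w (cl v f) = (2 * \<Phi> v w) *\<^sub>c rz f"
proof -
  have 1: "cl v (cl w f) = (\<Sum>k=1..N. \<Sum>l=1..N. (\<Phi> (e k) v * \<Phi> (e l) w) *\<^sub>c EE k (EE l f))" for v w
    unfolding cl_def[of v] cl_def[of w] EE_simps cscale_sum_right cscale_cscale ..
  have "cl w (cl v f) = (\<Sum>k=1..N. \<Sum>l=1..N. (\<Phi> (e k) v * \<Phi> (e l) w) *\<^sub>c EE l (EE k f))"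
    unfolding 1 by (subst sum.swap) (simp only: mult.commute)
  then have "cl v (cl w f) + cl w (cl v f) = (\<Sum>k=1..N. \<Sum>l=1..N. (\<Phi> (e k) v * \<Phi> (e l) w) *\<^sub>c (EE k (EE l f) + EE l (EE k f)))"
    unfolding 1[of v w] by (simp only: sum.distrib cscale_add_right)
  also have "\<dots> = (\<Sum>k=1..N. \<Sum>l=1..N. (\<Phi> (e k) v * \<Phi> (e l) w * (if k = l then 2 else 0)) *\<^sub>c rz f)"
  proof (rule sum.cong[OF refl], rule sum.cong[OF refl])
    fix k l assume kl: "k \<in> {1..N}" "l \<in> {1..N}"
    have "EE k (EE l f) + EE l (EE k f) = (if k = l then 2 else 0) *\<^sub>c rz f" using EE_clifford[OF kl, of f] by simp
    then show "(\<Phi> (e k) v * \<Phi> (e l) w) *\<^sub>c (EE k (EE l f) + EE l (EE k f)) = (\<Phi> (e k) v * \<Phi> (e l) w * (if k = l then 2 else 0)) *\<^sub>c rz f"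
      by simp
  qed
  also have "\<dots> = (\<Sum>k=1..N. \<Sum>l=1..N. \<Phi> (e k) v * \<Phi> (e l) w * (if k = l then 2 else 0)) *\<^sub>c rz f"
    by (simp only: cscale_sum_left)
  also have "(\<Sum>k=1..N. \<Sum>l=1..N. \<Phi> (e k) v * \<Phi> (e l) w * (if k = l then 2 else 0)) = (\<Sum>k=1..N. \<Phi> (e k) v * \<Phi> (e k) w * 2)"
  proof (rule sum.cong[OF refl])
    fix k assume k: "k \<in> {1..N}"
    have "(\<Sum>l=1..N. \<Phi> (e k) v * \<Phi> (e l) w * (if k = l then 2 else 0)) = \<Phi> (e k) v * \<Phi> (e k) w * (if k = k then 2 else 0)"
      by (rule sum_pick) (use k in auto)
    then show "(\<Sum>l=1..N. \<Phi> (e k) v * \<Phi> (e l) w * (if k = l then 2 else 0)) = \<Phi> (e k) v * \<Phi> (e k) w * 2" by simp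
  qed
  also have "\<dots> = 2 * \<Phi> v w" unfolding parseval[of v w] sum_distrib_right[symmetric] by (rule mult.commute)
  finally show ?thesis .
qed

text \<open>The spin representation of the free algebra. The empty word acts as \<open>rz\<close>,
  so the unit is represented by the identity of S inside the larger space of functions.\<close>

definition R :: "'v nc_poly => (nat set => complex) => nat set => complex"
  where "R p f = ev (\<lambda>w. foldr cl w (rz f)) p"

lemma clin_foldr_cl: "clin (\<lambda>f. foldr cl w (rz f))"
  by (induction w) (auto intro: clin_comp[OF clin_cl] clin_rz)

lemma clin_R: "clin (R p)"
  by (rule clinI) (simp_all only: R_def ev_def clin_simps[OF clin_foldr_cl] cscale_add_right sum.distrib cscale_sum_right cscale_cscale mult.commute)

lemma clin_R': "clin (\<lambda>p. R p f)" unfolding R_def by (rule clin_ev)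

lemma R_monw: "R (monw w) f = foldr cl w (rz f)" by (simp add: R_def)

lemma rz_rz: "rz (rz f) = rz f" by (rule ext) (simp add: rz_def)

lemma rz_foldr: "rz (foldr cl w (rz f)) = foldr cl w (rz f)" by (cases w) (simp_all add: rz_rz)

lemma R_monw_mult: "R (monw u * q) f = R (monw u) (R q f)"
  by (rule nc_linear_eqI[where A = UNIV and h = "\<lambda>q. R (monw u * q) f" and k = "\<lambda>q. R (monw u) (R q f)", OF clin_comp[OF clin_R' clin_mult(1)] clin_comp[OF clin_R clin_R']])
    (simp_all add: monw_mult R_monw rz_foldr)

lemma R_mult: "R (p * q) f = R p (R q f)"
  by (rule nc_linear_eqI[where A = UNIV and h = "\<lambda>p. R (p * q) f" and k = "\<lambda>p. R p (R q f)", OF clin_comp[OF clin_R' clin_mult(2)] clin_R'])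
    (simp_all add: R_monw_mult)

lemma R_letter: "R (letter v) f = cl v f" by (simp add: letter_monw R_monw)

lemma R_const: "R (const c) f = c *\<^sub>c rz f" by (simp add: const_eq clin_scale[OF clin_R'] R_monw)

lemma rz_R: "rz (R p f) = R p f" "R p (rz f) = R p f"
  by (simp_all only: R_def ev_def clin_simps[OF clin_rz] rz_foldr rz_rz)

lemma R_ideal: "p \<in> Cl_ideal ==> R p f = 0"
proof -
  assume "p \<in> Cl_ideal"
  then have "\<forall>f. R p f = 0"
  proof (rule C.K_least)
    note lin = clin_simps[OF clin_R']
    show "\<forall>f. R 0 f = 0" by (simp add: lin)
    show "\<forall>f. R (p + q) f = 0" if "\<forall>f. R p f = 0" "\<forall>f. R q f = 0" for p q using that by (simp add: lin)
    show "\<forall>f. R (q * p) f = 0" if "\<forall>f. R p f = 0" for p q using that by (simp add: R_mult clin_0[OF clin_R])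
    show "\<forall>f. R (p * q) f = 0" if "\<forall>f. R p f = 0" for p q using that by (simp add: R_mult)
    show "\<forall>f. R p f = 0" if "p \<in> Cl_rel" for p
      using that unfolding Cl_rel_def linear_relations_def
      by (auto simp: lin R_letter cl_linear R_mult R_const cl_clifford const_mult)
  qed
  then show ?thesis by simp
qed

lemma R_cong: "p - q \<in> Cl_ideal ==> R p f = R q f"
  using R_ideal[of "p - q" f] by (simp add: clin_diff[OF clin_R'])

lemma R_cs: "C.cs p = C.cs q ==> R p f = R q f" unfolding C.cs_eq_iff by (rule R_cong)

lemma rz_cscale_inj: "(\<And>f. c *\<^sub>c rz f = d *\<^sub>c rz f) ==> c = d"
proof -
  assume "\<And>f. c *\<^sub>c rz f = d *\<^sub>c rz f"
  from fun_cong[OF this[of "\<lambda>_. 1"], of "{}"] show ?thesis by (simp add: cscale_fun_apply rz_def)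
qed

text \<open>The anticommutator with the operator of \<open>e i\<close> is twice the i-th coordinate
  times the identity of S, and S is not zero. So V embeds into the operators on S.\<close>

lemma cl_inj: assumes "\<And>f. cl v f = cl w f" shows "v = w"
proof (rule eq_by_basis)
  fix i assume "i \<in> {1..N}"
  have "(2 * \<Phi> (e i) v) *\<^sub>c rz f = (2 * \<Phi> (e i) w) *\<^sub>c rz f" for f
    unfolding cl_clifford[symmetric] assms ..
  then show "\<Phi> (e i) v = \<Phi> (e i) w" using rz_cscale_inj[of "2 * \<Phi> (e i) v" "2 * \<Phi> (e i) w"] by simp
qed

text \<open>Injectivity of V into the Clifford algebra, read off from the spin module; it makes the
  description in \<open>vec_act\<close> unique.\<close>

lemma Cl_vec_inj: "Cl_vec v = Cl_vec w ==> v = w"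
  using R_cs[of "letter v" "letter w"] by (intro cl_inj) (simp add: Cl_vec_def R_letter)

lemma reverse_words_ideal: assumes "p \<in> Cl_ideal" shows "reverse_words p \<in> Cl_ideal"
  using assms
proof (rule C.K_least[where P = "\<lambda>p. reverse_words p \<in> Cl_ideal"])
  note cl = clin_ev[of "\<lambda>w :: 'v list. monw (rev w)", folded reverse_words_ev]
  show "reverse_words 0 \<in> Cl_ideal" using clin_0[OF cl] C.K_0 by simp
  show "reverse_words (p + q) \<in> Cl_ideal" if "reverse_words p \<in> Cl_ideal" "reverse_words q \<in> Cl_ideal" for p q
    using that by (simp add: clin_add[OF cl] C.K_add)
  show "reverse_words (q * p) \<in> Cl_ideal" "reverse_words (p * q) \<in> Cl_ideal" if "reverse_words p \<in> Cl_ideal" for p q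
    using that by (simp_all add: reverse_words_mult C.K_mult)
  have l: "reverse_words (letter v) = letter v" for v by (simp add: reverse_words_ev letter_monw)
  have c: "reverse_words (const c) = const c" for c by (simp add: reverse_words_ev const_eq clin_scale[OF clin_ev])
  fix p assume p: "p \<in> Cl_rel"
  then have "reverse_words p \<in> Cl_rel"
    unfolding Cl_rel_def linear_relations_def
  proof (elim UnE CollectE exE conjE)
    fix v w assume p: "p = letter v * letter w + letter w * letter v - const (2 * \<Phi> v w)"
    have "reverse_words p = letter w * letter v + letter v * letter w - const (2 * \<Phi> w v)"
      unfolding p clin_diff[OF cl] clin_add[OF cl] reverse_words_mult l c by (simp only: form_sym)
    then show "reverse_words p \<in> {letter (x + y) - letter x - letter y |x y. x \<in> UNIV \<and> y \<in> UNIV} \<union>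
       {letter (scale c x) - const c * letter x |c x. x \<in> UNIV} \<union>
       {letter v * letter w + letter w * letter v - const (2 * \<Phi> v w) |v w. True}" by blast
  qed (auto simp: clin_diff[OF cl] l clin_scale[OF cl] const_mult)
  then show "reverse_words p \<in> Cl_ideal" by (rule C.gen_K)
qed

lemma reverse_reverse: "reverse_words (reverse_words p) = p"
proof -
  have "ev (\<lambda>w. monw (rev w)) (ev (\<lambda>w. monw (rev w)) p) = p"
    by (rule nc_linear_eqI[where A = UNIV and h = "\<lambda>p. ev (\<lambda>w. monw (rev w)) (ev (\<lambda>w. monw (rev w)) p)" and k = "\<lambda>p. p", OF clin_comp[OF clin_ev clin_ev] clin_id])
      simp_all
  then show ?thesis unfolding reverse_words_ev .
qed

lemma Cl_rev_cs: "Cl_rev (C.cs p) = C.cs (reverse_words p)"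
proof -
  note cl = clin_ev[of "\<lambda>w :: 'v list. monw (rev w)", folded reverse_words_ev]
  have 1: "reverse_words q \<in> C.cs (reverse_words p)" if "q \<in> C.cs p" for p q
    using reverse_words_ideal[of "q - p"] that by (simp add: C.cs_eq clin_diff[OF cl])
  show ?thesis unfolding Cl_rev_def
  proof (intro Set.equalityI subsetI)
    fix q assume "q \<in> C.cs (reverse_words p)"
    then have "reverse_words q \<in> C.cs p" using 1[of q "reverse_words p"] by (simp add: reverse_reverse)
    then show "q \<in> reverse_words ` C.cs p" by (intro image_eqI[of _ _ "reverse_words q"]) (simp_all add: reverse_reverse)
  qed (use 1 in auto)
qed

lemma ring_Cl: "ring Cl" unfolding Cl_def by (rule C.ring_Q)

lemma Cl_mult: "C.cs p \<otimes>\<^bsub>Cl\<^esub> C.cs q = C.cs (p * q)" unfolding Cl_def by (rule C.mult_Q) simp_all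

text \<open>Everything about an element \<open>g\<close> of the group is read off from the operators on the spin
  module that represent \<open>g\<close> and its inverse.\<close>

definition implements :: "'v nc_poly => ('v => 'v) => ('v => 'v) => bool"
  where "implements p a b \<longleftrightarrow> (\<forall>f. R p (R (reverse_words p) f) = rz f) \<and> (\<forall>f. R (reverse_words p) (R p f) = rz f)
    \<and> (\<forall>v f. R p (cl v (R (reverse_words p) f)) = cl (a v) f) \<and> (\<forall>v f. R (reverse_words p) (cl v (R p f)) = cl (b v) f)
    \<and> (odd N \<longrightarrow> (\<forall>w\<in>Poly_Mapping.keys p. even (length w)))"

text \<open>A representative \<open>p\<close> of the group element is chosen, by even words if
  \<open>N\<close> is odd. All equations in the Clifford algebra are then transported to operators
  on S.\<close>

lemma GV_implements:
  assumes g: "g \<in> GV"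
  shows "\<exists>p. implements p (vec_act g) (vec_act (inv\<^bsub>Cl\<^esub> g))"
proof -
  interpret Cl: ring Cl by (rule ring_Cl)
  have pin: "g \<in> Pin" and even: "odd N ==> g \<in> Cl_even" using g by (auto simp: GV_def SpinGroup_def split: if_splits)
  have unit: "g \<in> Units Cl" and conj: "(\<lambda>x. g \<otimes>\<^bsub>Cl\<^esub> x \<otimes>\<^bsub>Cl\<^esub> inv\<^bsub>Cl\<^esub> g) ` range Cl_vec = range Cl_vec"
    and norm: "g \<otimes>\<^bsub>Cl\<^esub> Cl_rev g = \<one>\<^bsub>Cl\<^esub>" using pin unfolding Pin_def by auto
  have "g \<in> carrier Cl" using unit by (rule Cl.Units_closed)
  then obtain p0 where p0: "g = C.cs p0" unfolding Cl_def C.carrier_Q by auto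
  obtain p where p: "g = C.cs p" "odd N ==> \<forall>w\<in>Poly_Mapping.keys p. Parity.even (length w)"
  proof (cases "odd N")
    case True
    then obtain p where "g = C.cs p" "\<forall>w\<in>Poly_Mapping.keys p. Parity.even (length w)" using even unfolding Cl_even_def by auto
    then show ?thesis using that by blast
  qed (use that p0 in blast)
  let ?q = "reverse_words p"
  \<comment> \<open>The norm condition says that the reversed representative is a right inverse,
    hence the inverse of the unit.\<close>
  have inv: "inv\<^bsub>Cl\<^esub> g = C.cs ?q"
  proof -
    have car: "C.cs ?q \<in> carrier Cl" unfolding Cl_def C.carrier_Q by simp
    have "g \<otimes>\<^bsub>Cl\<^esub> C.cs ?q = \<one>\<^bsub>Cl\<^esub>" using norm unfolding p(1) Cl_rev_cs .
    then have "inv\<^bsub>Cl\<^esub> g \<otimes>\<^bsub>Cl\<^esub> (g \<otimes>\<^bsub>Cl\<^esub> C.cs ?q) = inv\<^bsub>Cl\<^esub> g" using unit by simp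
    then show ?thesis using unit car by (simp add: Cl.m_assoc[symmetric] Cl.Units_closed)
  qed
  have one: "\<one>\<^bsub>Cl\<^esub> = C.cs 1" unfolding Cl_def by (rule C.one_Q)
  have r1: "R 1 f = rz f" for f using R_const[of 1 f] by (simp add: const_eq monw_Nil)
  have pq: "C.cs (p * ?q) = C.cs 1" "C.cs (?q * p) = C.cs 1"
    using Cl.Units_r_inv[OF unit] Cl.Units_l_inv[OF unit] unfolding inv one unfolding p(1) Cl_mult by simp_all
  have act: "Cl_vec (vec_act g v) = g \<otimes>\<^bsub>Cl\<^esub> Cl_vec v \<otimes>\<^bsub>Cl\<^esub> inv\<^bsub>Cl\<^esub> g" for v
  proof -
    have "g \<otimes>\<^bsub>Cl\<^esub> Cl_vec v \<otimes>\<^bsub>Cl\<^esub> inv\<^bsub>Cl\<^esub> g \<in> (\<lambda>x. g \<otimes>\<^bsub>Cl\<^esub> x \<otimes>\<^bsub>Cl\<^esub> inv\<^bsub>Cl\<^esub> g) ` range Cl_vec"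
      by (rule imageI) (rule rangeI)
    then have "g \<otimes>\<^bsub>Cl\<^esub> Cl_vec v \<otimes>\<^bsub>Cl\<^esub> inv\<^bsub>Cl\<^esub> g \<in> range Cl_vec" by (simp only: conj)
    then obtain w where w: "Cl_vec w = g \<otimes>\<^bsub>Cl\<^esub> Cl_vec v \<otimes>\<^bsub>Cl\<^esub> inv\<^bsub>Cl\<^esub> g" by auto
    have "vec_act g v = w" unfolding vec_act_def w[symmetric] by (rule the_equality[OF HOL.refl Cl_vec_inj])
    then show ?thesis using w by simp
  qed
  have inv_inv: "inv\<^bsub>Cl\<^esub> (inv\<^bsub>Cl\<^esub> g) = g" using unit by simp
  \<comment> \<open>Conjugation maps V onto V, so each vector is the conjugate of some
    \<open>w\<close>; conjugating back shows that the inverse also preserves V.\<close>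
  have act': "Cl_vec (vec_act (inv\<^bsub>Cl\<^esub> g) v) = inv\<^bsub>Cl\<^esub> g \<otimes>\<^bsub>Cl\<^esub> Cl_vec v \<otimes>\<^bsub>Cl\<^esub> g" for v
  proof -
    have vc: "Cl_vec w \<in> carrier Cl" for w unfolding Cl_vec_def Cl_def C.carrier_Q by simp
    have "Cl_vec v \<in> (\<lambda>x. g \<otimes>\<^bsub>Cl\<^esub> x \<otimes>\<^bsub>Cl\<^esub> inv\<^bsub>Cl\<^esub> g) ` range Cl_vec" unfolding conj by simp
    then obtain w where "Cl_vec v = g \<otimes>\<^bsub>Cl\<^esub> Cl_vec w \<otimes>\<^bsub>Cl\<^esub> inv\<^bsub>Cl\<^esub> g" by auto
    then have "inv\<^bsub>Cl\<^esub> g \<otimes>\<^bsub>Cl\<^esub> Cl_vec v \<otimes>\<^bsub>Cl\<^esub> g = inv\<^bsub>Cl\<^esub> g \<otimes>\<^bsub>Cl\<^esub> (g \<otimes>\<^bsub>Cl\<^esub> Cl_vec w \<otimes>\<^bsub>Cl\<^esub> inv\<^bsub>Cl\<^esub> g) \<otimes>\<^bsub>Cl\<^esub> g" by simp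
    also have "\<dots> = (inv\<^bsub>Cl\<^esub> g \<otimes>\<^bsub>Cl\<^esub> g) \<otimes>\<^bsub>Cl\<^esub> Cl_vec w \<otimes>\<^bsub>Cl\<^esub> (inv\<^bsub>Cl\<^esub> g \<otimes>\<^bsub>Cl\<^esub> g)"
      by (simp only: Cl.m_assoc Cl.m_closed Cl.Units_closed[OF unit] Cl.Units_inv_closed[OF unit] vc)
    also have "\<dots> = Cl_vec w" using unit vc[of w] by simp
    finally have w: "Cl_vec w = inv\<^bsub>Cl\<^esub> g \<otimes>\<^bsub>Cl\<^esub> Cl_vec v \<otimes>\<^bsub>Cl\<^esub> g" by simp
    have "vec_act (inv\<^bsub>Cl\<^esub> g) v = w" unfolding vec_act_def inv_inv w[symmetric] by (rule the_equality[OF HOL.refl Cl_vec_inj])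
    then show ?thesis using w by simp
  qed
  have "R p (R ?q f) = rz f" "R ?q (R p f) = rz f" for f
    using R_cs[OF pq(1), of f] R_cs[OF pq(2), of f] by (simp_all add: R_mult r1)
  moreover have "R p (cl v (R ?q f)) = cl (vec_act g v) f" for v f
    using act[of v] R_cs[of "letter (vec_act g v)" "p * letter v * ?q" f] unfolding inv
    unfolding p(1) Cl_vec_def Cl_mult by (simp add: R_mult R_letter)
  moreover have "R ?q (cl v (R p f)) = cl (vec_act (inv\<^bsub>Cl\<^esub> g) v) f" for v f
    using act'[of v] R_cs[of "letter (vec_act (inv\<^bsub>Cl\<^esub> g) v)" "?q * letter v * p" f] unfolding inv
    unfolding p(1) Cl_vec_def Cl_mult by (simp add: R_mult R_letter)
  ultimately show ?thesis unfolding implements_def using p(2) by blast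
qed

section \<open>Group elements as symmetries of the structure constants\<close>

definition isometry :: "('v => 'v) => ('v => 'v) => bool"
  where "isometry a b \<longleftrightarrow> (\<forall>v w. a (v + w) = a v + a w) \<and> (\<forall>c v. a (scale c v) = scale c (a v))
    \<and> (\<forall>v w. \<Phi> (a v) (a w) = \<Phi> v w) \<and> (\<forall>v. a (b v) = v) \<and> (\<forall>v. b (a v) = v)"

lemma isometryD:
  assumes "isometry a b"
  shows "a (v + w) = a v + a w" "a (scale c v) = scale c (a v)" "\<Phi> (a v) (a w) = \<Phi> v w" "a (b v) = v" "b (a v) = v"
    "\<Phi> (a v) w = \<Phi> v (b w)"
proof -
  show 1: "\<Phi> (a v) (a w) = \<Phi> v w" "a (b v) = v" for v w using assms by (auto simp: isometry_def)
  show "\<Phi> (a v) w = \<Phi> v (b w)" using 1(1)[of v "b w"] 1(2)[of w] by simp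
qed (use assms in \<open>auto simp: isometry_def\<close>)

lemma isometry_sym: assumes "isometry a b" shows "isometry b a"
  unfolding isometry_def
proof (intro conjI allI)
  note a = isometryD[OF assms]
  have inj: "v = w" if "a v = a w" for v w using arg_cong[OF that, of b] by (simp only: a(5))
  show "b (v + w) = b v + b w" for v w by (rule inj) (simp only: a)
  show "b (scale c v) = scale c (b v)" for c v by (rule inj) (simp only: a)
  show "\<Phi> (b v) (b w) = \<Phi> v w" for v w using a(3)[of "b v" "b w"] by (simp only: a(4))
  show "b (a v) = v" "a (b v) = v" for v by (rule a)+
qed

text \<open>Conjugation preserves anticommutators, and these are scalars given by the form.
  Injectivity of \<open>cl\<close> turns identities between operators into identities between
  vectors.\<close>

lemma implements_isometry:
  assumes "implements p a b" shows "isometry a b"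
proof -
  let ?q = "reverse_words p"
  have i: "R p (R ?q f) = rz f" "R ?q (R p f) = rz f" "cl (a v) f = R p (cl v (R ?q f))" "cl (b v) f = R ?q (cl v (R p f))" for f v
    using assms unfolding implements_def by auto
  note RR = clin_simps[OF clin_R]
  show ?thesis unfolding isometry_def
  proof (intro conjI allI)
    show "a (v + w) = a v + a w" for v w by (rule cl_inj) (simp only: i(3) cl_linear RR)
    show "a (scale c v) = scale c (a v)" for c v by (rule cl_inj) (simp only: i(3) cl_linear RR)
    show "a (b v) = v" for v by (rule cl_inj) (simp only: i(3,4) i(1) rz_R rz_cl)
    show "b (a v) = v" for v by (rule cl_inj) (simp only: i(3,4) i(2) rz_R rz_cl)
    fix v w
    have "(2 * \<Phi> (a v) (a w)) *\<^sub>c rz f = (2 * \<Phi> v w) *\<^sub>c rz f" for f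
    proof -
      have "(2 * \<Phi> (a v) (a w)) *\<^sub>c rz f = R p (cl v (cl w (R ?q f)) + cl w (cl v (R ?q f)))"
        unfolding cl_clifford[symmetric] by (simp only: i(3) i(2) rz_cl RR)
      also have "\<dots> = (2 * \<Phi> v w) *\<^sub>c rz f" unfolding cl_clifford by (simp only: RR rz_R i(1))
      finally show ?thesis .
    qed
    then show "\<Phi> (a v) (a w) = \<Phi> v w" using rz_cscale_inj[of "2 * \<Phi> (a v) (a w)" "2 * \<Phi> v w"] by simp
  qed
qed

lemma sum_swap_mult: "(\<Sum>z\<in>B. (\<Sum>w\<in>B. f w z) * g z) = (\<Sum>w\<in>B. \<Sum>z\<in>B. f w z * (g z :: complex))"
  unfolding sum_distrib_right by (rule sum.swap)

text \<open>If \<open>\<gamma>\<close> is invertible and preserves the form \<open>F\<close>, it preserves the inverse matrix \<open>D\<close>.\<close>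

lemma dual_form_invariant:
  fixes F D \<gamma> \<delta> :: "'x => 'x => complex"
  assumes fin: "finite B"
    and DF: "\<And>x y. x \<in> B ==> y \<in> B ==> (\<Sum>z\<in>B. D x z * F z y) = (if x = y then 1 else 0)"
    and FD: "\<And>x y. x \<in> B ==> y \<in> B ==> (\<Sum>z\<in>B. F x z * D z y) = (if x = y then 1 else 0)"
    and inv: "\<And>x y. x \<in> B ==> y \<in> B ==> (\<Sum>z\<in>B. \<gamma> x z * \<delta> z y) = (if x = y then 1 else 0)"
    and F: "\<And>x' y'. x' \<in> B ==> y' \<in> B ==> (\<Sum>x\<in>B. \<Sum>y\<in>B. F x y * (\<gamma> x x' * \<gamma> y y')) = F x' y'"
    and xy: "x \<in> B" "y \<in> B"
  shows "(\<Sum>x'\<in>B. \<Sum>y'\<in>B. \<gamma> x x' * \<gamma> y y' * D x' y') = D x y"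
proof -
  \<comment> \<open>Products truncated to \<open>B\<close>, so that associativity and the unit laws
    become equations between functions and the argument can run as plain matrix algebra.\<close>
  define mm where "mm P Q x y = (if x \<in> B \<and> y \<in> B then \<Sum>z\<in>B. P x z * (Q z y :: complex) else 0)" for P Q :: "'x => 'x => complex" and x y
  define one where "one x y = (if x \<in> B \<and> x = y then 1 else (0::complex))" for x y
  define cl where "cl P x y = (if x \<in> B \<and> y \<in> B then P x y else (0::complex))" for P x y
  have assoc: "mm (mm P Q) R = mm P (mm Q R)" for P Q R
  proof (intro ext)
    fix x y
    have "(\<Sum>z\<in>B. (\<Sum>w\<in>B. P x w * Q w z) * R z y) = (\<Sum>w\<in>B. P x w * (\<Sum>z\<in>B. Q w z * R z y))"
      unfolding sum_swap_mult sum_distrib_left by (simp only: mult.assoc)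
    then show "mm (mm P Q) R x y = mm P (mm Q R) x y" by (simp add: mm_def cong: sum.cong)
  qed
  have l1: "mm one P = cl P" and r1: "mm P one = cl P" for P
  proof -
    have "(\<Sum>z\<in>B. one x z * P z y) = P x y" if "x \<in> B" for x y
      using sum_delta_mult(1)[OF fin that, of "\<lambda>z. P z y"] that by (simp add: one_def cong: sum.cong)
    moreover have "(\<Sum>z\<in>B. P x z * one z y) = P x y" if "y \<in> B" for x y
      using sum_delta_mult(2)[OF fin that, of "\<lambda>z. P x z"] that by (simp add: one_def cong: sum.cong)
    ultimately show "mm one P = cl P" "mm P one = cl P" by (auto simp: mm_def cl_def fun_eq_iff)
  qed
  have clr: "mm (cl P) Q = mm P Q" "mm P (cl Q) = mm P Q" "cl (mm P Q) = mm P Q" for P Q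
    by (auto simp: mm_def cl_def fun_eq_iff intro!: sum.cong)
  define T where "T x y = \<gamma> y x" for x y
  have 1: "mm D F = one" "mm F D = one" "mm \<gamma> \<delta> = one"
    using DF FD inv by (auto simp: mm_def one_def fun_eq_iff)
  have 2: "mm T (mm F \<gamma>) = cl F"
  proof (intro ext)
    fix x' y'
    have "(\<Sum>x\<in>B. T x' x * (\<Sum>y\<in>B. F x y * \<gamma> y y')) = (\<Sum>x\<in>B. \<Sum>y\<in>B. F x y * (\<gamma> x x' * \<gamma> y y'))"
      unfolding T_def sum_distrib_left by (intro sum.cong HOL.refl) (simp only: mult_ac)
    then show "mm T (mm F \<gamma>) x' y' = cl F x' y'" using F[of x' y'] by (simp add: mm_def cl_def cong: sum.cong)
  qed
  \<comment> \<open>With T the transpose of \<open>\<gamma>\<close>, invariance of the form reads T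
    F \<gamma> = F. Multiplying by \<gamma> D on the left yields \<gamma>, and the rightmost
    \<gamma> is then cancelled by \<open>\<delta>\<close>.\<close>
  have 3: "mm (mm \<gamma> (mm D (mm T F))) \<gamma> = cl \<gamma>"
    by (simp only: assoc 2 clr 1 r1)
  have 4: "mm \<gamma> (mm D (mm T F)) = one"
  proof -
    have "mm (mm (mm \<gamma> (mm D (mm T F))) \<gamma>) \<delta> = one" unfolding 3 clr by (rule 1)
    then show ?thesis by (simp only: assoc 1 r1 clr)
  qed
  have "mm (mm \<gamma> (mm D (mm T F))) D = mm one D" unfolding 4 ..
  then have "mm \<gamma> (mm D T) = cl D" by (simp only: assoc 1 r1 l1 clr)
  then have "mm \<gamma> (mm D T) x y = D x y" using xy by (simp add: cl_def)
  moreover have "mm \<gamma> (mm D T) x y = (\<Sum>x'\<in>B. \<gamma> x x' * (\<Sum>y'\<in>B. D x' y' * \<gamma> y y'))"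
    using xy by (simp add: mm_def T_def cong: sum.cong)
  moreover have "(\<Sum>x'\<in>B. \<gamma> x x' * (\<Sum>y'\<in>B. D x' y' * \<gamma> y y')) = (\<Sum>x'\<in>B. \<Sum>y'\<in>B. \<gamma> x x' * \<gamma> y y' * D x' y')"
    unfolding sum_distrib_left by (intro sum.cong HOL.refl) (simp only: mult_ac)
  ultimately show ?thesis by simp
qed

lemma isometry_so: assumes "isometry a b" "A \<in> so" shows "a \<circ> A \<circ> b \<in> so"
proof (rule soI)
  note a = isometryD[OF assms(1)] and b = isometryD[OF isometry_sym[OF assms(1)]]
  show "(a \<circ> A \<circ> b) (v + w) = (a \<circ> A \<circ> b) v + (a \<circ> A \<circ> b) w" for v w by (simp add: a(1) b(1) so_lin[OF assms(2)])
  show "(a \<circ> A \<circ> b) (scale c v) = scale c ((a \<circ> A \<circ> b) v)" for c v by (simp add: a(2) b(2) so_lin[OF assms(2)])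
  show "\<Phi> ((a \<circ> A \<circ> b) v) w = - \<Phi> v ((a \<circ> A \<circ> b) w)" for v w
    using so_form[OF assms(2), of "b v" "b w"] b(6)[of v "A (b w)"] by (simp add: a(6))
qed

fun gam :: "('v => 'v) => 'v nc_poly => gob => label => label => complex" where
  "gam a p Spin (XI I) (XI J) = R p (del J) I"
| "gam a p Vect (EI i) (EI j) = \<Phi> (e i) (a (e j))"
| "gam a p _ _ _ = 0"

lemma rz_expand: "rz f = (\<Sum>J\<in>Z. f J *\<^sub>c del J)"
proof
  fix I
  have "(\<Sum>J\<in>Z. f J * (if I = J then 1 else 0)) = (if I \<in> Z then f I else 0)"
  proof (cases "I \<in> Z")
    case True
    have "(\<Sum>J\<in>Z. f J * (if I = J then 1 else 0)) = f I * (if I = I then 1 else 0)" by (rule sum_pick) (use True in auto)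
    then show ?thesis using True by simp
  qed (auto intro!: sum.neutral)
  then show "rz f I = (\<Sum>J\<in>Z. f J *\<^sub>c del J) I" by (simp add: rz_def sum_fun_apply cscale_fun_apply)
qed

lemma R_expand: "R p f I = (\<Sum>J\<in>Z. R p (del J) I * f J)"
proof -
  have "R p f I = R p (\<Sum>J\<in>Z. f J *\<^sub>c del J) I" unfolding rz_expand[symmetric] rz_R ..
  then show ?thesis by (simp only: clin_simps[OF clin_R] sum_fun_apply cscale_fun_apply cscale_complex mult.commute)
qed

text \<open>Clifford generators cross the form one by one, each at the cost of
  \<open>kappa N\<close>; the last to act crosses first, which reverses the word.\<close>

lemma R_foldr_kappa: "fm (foldr cl w (rz f)) g = kappa N ^ length w * fm f (foldr cl (rev w) (rz g))"
proof (induction w arbitrary: g)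
  case Nil
  have "fm (rz f) g = fm f (rz g)"
    unfolding fm_def by (rule sum.cong[OF refl]) (simp add: rz_def)
  then show ?case by simp
next
  case (Cons u w)
  have clu: "fm (cl u f) g = kappa N * fm f (cl u g)" for f g
    unfolding cl_def fm_simps cscale_complex sum_distrib_left
    by (rule sum.cong[OF refl]) (simp only: fm_EE mult.left_commute)
  have "fm (foldr cl (u # w) (rz f)) g = kappa N * fm (foldr cl w (rz f)) (cl u g)" by (simp add: clu)
  also have "\<dots> = kappa N ^ length (u # w) * fm f (foldr cl (rev w) (rz (cl u g)))" unfolding Cons.IH by simp
  finally show ?case by simp
qed

text \<open>The power of \<open>kappa N\<close> is 1: for even \<open>N\<close> because
  \<open>kappa N\<close> is 1, for odd \<open>N\<close> because the words have even length. This is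
  where the choice between Pin and Spin enters the invariance of the form on S.\<close>

lemma fm_R:
  assumes "odd N \<longrightarrow> (\<forall>w\<in>Poly_Mapping.keys p. even (length w))"
  shows "fm (R p f) g = fm f (R (reverse_words p) g)"
proof -
  have k: "kappa N ^ length w = 1" if "w \<in> Poly_Mapping.keys p" for w
  proof (cases "odd N")
    case True
    then have "even (length w)" using assms that by blast
    then obtain m where "length w = 2 * m" by (rule evenE)
    then show ?thesis by (simp add: power_mult power2_eq_square)
  qed (simp add: kappa_def)
  have lin: "clin (\<lambda>p. fm f (R p g))" by (rule clin_comp[OF clin_fm(1) clin_R'])
  have "fm (R p f) g = (\<Sum>w\<in>Poly_Mapping.keys p. Poly_Mapping.lookup p w * fm (foldr cl w (rz f)) g)"
    unfolding R_def ev_def fm_simps by simp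
  also have "\<dots> = (\<Sum>w\<in>Poly_Mapping.keys p. Poly_Mapping.lookup p w * fm f (R (monw (rev w)) g))"
    by (rule sum.cong[OF refl]) (simp only: R_foldr_kappa k R_monw mult_1)
  also have "\<dots> = fm f (R (reverse_words p) g)"
    unfolding reverse_words_ev ev_def clin_simps[OF lin] by simp
  finally show ?thesis .
qed

text \<open>Everything rests on \<open>R p (cl v f) = cl (a v) (R p f)\<close>: it gives the
  compatibility with Clifford multiplication and, through quadratic expressions, with the spin
  action. The form on S is preserved by \<open>fm_R\<close>, the duals follow by inversion, and the
  new frame consists of the vectors \<open>a (e i)\<close>.\<close>

lemma implements_twist:
  assumes imp: "implements p a b"
  shows "twist (gam a p) (\<lambda>A. a \<circ> A \<circ> b)"
proof -
  let ?q = "reverse_words p"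
  have i: "R p (R ?q f) = rz f" "R ?q (R p f) = rz f" "R p (cl v (R ?q f)) = cl (a v) f" for f v
    using imp unfolding implements_def by auto
  have parity: "odd N \<longrightarrow> (\<forall>w\<in>Poly_Mapping.keys p. even (length w))"
    using imp unfolding implements_def by auto
  note iso = implements_isometry[OF imp]
  note a = isometryD[OF iso] and b = isometryD[OF isometry_sym[OF iso]]
  have Rcl: "R p (cl v f) = cl (a v) (R p f)" for v f
    using i(3)[of v "R p f"] by (simp only: i(2) rz_cl)
  have a_sum: "a (\<Sum>i\<in>I. v i) = (\<Sum>i\<in>I. a (v i))" if "finite I" for I :: "nat set" and v
    using that
  proof (induction I rule: finite_induct)
    case empty show ?case using a(2)[of 0 0] by simp
  qed (simp add: a(1))
  have a_diff: "a (v - w) = a v - a w" for v w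
    using a(1)[of v "scale (-1) w"] a(2)[of "-1" w] by simp
  have T2V: "(\<Sum>z\<in>BV. gam a p Vect x z * rep Vect A z y) = (\<Sum>z\<in>BV. rep Vect (a \<circ> A \<circ> b) x z * gam a p Vect z y)"
    if A: "A \<in> so" and xy: "x \<in> BV" "y \<in> BV" for A x y
  proof -
    obtain k l where kl: "x = EI k" "y = EI l" using xy by (auto elim!: basis_VectE)
    have L: "(\<Sum>z=1..N. \<Phi> (e k) (a (e z)) * \<Phi> (e z) (A (e l))) = \<Phi> (e k) (a (A (e l)))"
    proof -
      have "\<Phi> (e k) (a (A (e l))) = \<Phi> (e k) (a (\<Sum>z=1..N. scale (\<Phi> (e z) (A (e l))) (e z)))" by (simp only: expand[symmetric])
      also have "\<dots> = (\<Sum>z=1..N. \<Phi> (e z) (A (e l)) * \<Phi> (e k) (a (e z)))"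
        by (simp only: a_sum a(2) form_simps finite_atLeastAtMost)
      finally show ?thesis by (simp only: mult.commute)
    qed
    note A' = isometry_so[OF iso A]
    have Rr: "(\<Sum>z=1..N. \<Phi> (e k) ((a \<circ> A \<circ> b) (e z)) * \<Phi> (e z) (a (e l))) = \<Phi> (e k) ((a \<circ> A \<circ> b) (a (e l)))"
      unfolding so_expand[OF A', of "a (e l)"] form_simps by (simp only: mult.commute)
    show ?thesis unfolding kl sum_basis gam.simps rep.simps L Rr by (simp add: a(5))
  qed
  have spin_cl: "R p (mo (spin_rep A) f) = mo (spin_rep (a \<circ> A \<circ> b)) (R p f)" if A: "A \<in> so" for A f
  proof -
    let ?I = "{1..N}"
    note A' = isometry_so[OF iso A]
    have "R p (mo (spin_rep A) f) = (\<Sum>i\<in>?I. \<Sum>j\<in>?I. (ent A i j / 4) *\<^sub>c R p (EE i (EE j f)))"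
      unfolding mo_spin_rep[OF A] clin_simps[OF clin_R] ..
    also have "\<dots> = (\<Sum>i\<in>?I. \<Sum>j\<in>?I. (ent A i j / 4) *\<^sub>c cl (a (e i)) (cl (a (e j)) (R p f)))"
      by (rule sum.cong[OF refl], rule sum.cong[OF refl]) (simp only: cl_e[symmetric] Rcl)
    also have "\<dots> = (\<Sum>i\<in>?I. \<Sum>j\<in>?I. (ent A i j / 4) *\<^sub>c (\<Sum>k\<in>?I. \<Sum>l\<in>?I. (\<Phi> (e k) (a (e i)) * \<Phi> (e l) (a (e j))) *\<^sub>c EE k (EE l (R p f))))"
      unfolding cl_def EE_simps cscale_sum_right cscale_cscale ..
    also have "\<dots> = (\<Sum>k\<in>?I. \<Sum>l\<in>?I. (\<Sum>i\<in>?I. \<Sum>j\<in>?I. (ent A i j / 4) * (\<Phi> (e k) (a (e i)) * \<Phi> (e l) (a (e j)))) *\<^sub>c EE k (EE l (R p f)))"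
      by (rule double_sum_collect)
    also have "\<dots> = (\<Sum>k\<in>?I. \<Sum>l\<in>?I. (ent (a \<circ> A \<circ> b) k l / 4) *\<^sub>c EE k (EE l (R p f)))"
    proof (rule sum.cong[OF refl], rule sum.cong[OF refl])
      fix k l
      have "ent (a \<circ> A \<circ> b) k l = \<Phi> (e k) (a (A (\<Sum>j\<in>?I. scale (\<Phi> (e j) (b (e l))) (e j))))" by (simp only: expand[symmetric] o_apply)
      also have "A (\<Sum>j\<in>?I. scale (\<Phi> (e j) (b (e l))) (e j)) = (\<Sum>j\<in>?I. scale (\<Phi> (e j) (b (e l))) (A (e j)))"
        using so_expand[OF A, of "b (e l)"] by (simp only: expand[symmetric])
      also have "\<Phi> (e k) (a \<dots>) = (\<Sum>j\<in>?I. \<Phi> (e j) (b (e l)) * \<Phi> (e k) (a (A (e j))))"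
        by (simp only: a_sum a(2) form_simps finite_atLeastAtMost)
      also have "\<dots> = (\<Sum>j\<in>?I. \<Phi> (e l) (a (e j)) * (\<Sum>i\<in>?I. ent A i j * \<Phi> (e k) (a (e i))))"
      proof (rule sum.cong[OF refl])
        fix j
        have "\<Phi> (e k) (a (A (e j))) = \<Phi> (e k) (a (\<Sum>i\<in>?I. scale (ent A i j) (e i)))" by (simp only: expand[symmetric])
        also have "\<dots> = (\<Sum>i\<in>?I. ent A i j * \<Phi> (e k) (a (e i)))" by (simp only: a_sum a(2) form_simps finite_atLeastAtMost)
        finally show "\<Phi> (e j) (b (e l)) * \<Phi> (e k) (a (A (e j))) = \<Phi> (e l) (a (e j)) * (\<Sum>i\<in>?I. ent A i j * \<Phi> (e k) (a (e i)))"
          by (simp only: a(6)[of "e j" "e l", symmetric] form_sym[of "a (e j)"])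
      qed
      also have "\<dots> = (\<Sum>i\<in>?I. \<Sum>j\<in>?I. ent A i j * (\<Phi> (e k) (a (e i)) * \<Phi> (e l) (a (e j))))"
        unfolding sum_distrib_left by (subst sum.swap) (simp only: mult_ac)
      finally have "(\<Sum>i\<in>?I. \<Sum>j\<in>?I. (ent A i j / 4) * (\<Phi> (e k) (a (e i)) * \<Phi> (e l) (a (e j)))) = ent (a \<circ> A \<circ> b) k l / 4"
        by (simp only: sum_divide_distrib times_divide_eq_left)
      then show "(\<Sum>i\<in>?I. \<Sum>j\<in>?I. (ent A i j / 4) * (\<Phi> (e k) (a (e i)) * \<Phi> (e l) (a (e j)))) *\<^sub>c EE k (EE l (R p f)) = (ent (a \<circ> A \<circ> b) k l / 4) *\<^sub>c EE k (EE l (R p f))"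
        by (simp only:)
    qed
    also have "\<dots> = mo (spin_rep (a \<circ> A \<circ> b)) (R p f)" unfolding mo_spin_rep[OF A'] ..
    finally show ?thesis .
  qed
  have T2S: "(\<Sum>z\<in>BS. gam a p Spin x z * rep Spin A z y) = (\<Sum>z\<in>BS. rep Spin (a \<circ> A \<circ> b) x z * gam a p Spin z y)"
    if A: "A \<in> so" and xy: "x \<in> BS" "y \<in> BS" for A x y
  proof -
    obtain I J where IJ: "x = XI I" "I \<in> Z" "y = XI J" "J \<in> Z" using xy by (auto elim!: basis_SpinE)
    have "(\<Sum>K\<in>Z. R p (del K) I * spin_rep A K J) = (\<Sum>K\<in>Z. R p (del K) I * mo (spin_rep A) (del J) K)"
      by (rule sum.cong[OF refl]) (simp only: mo_del IJ)
    also have "\<dots> = R p (mo (spin_rep A) (del J)) I" by (rule R_expand[symmetric])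
    also have "\<dots> = (\<Sum>K\<in>Z. spin_rep (a \<circ> A \<circ> b) I K * R p (del J) K)"
      unfolding spin_cl[OF A] mo_def if_P[OF IJ(2)] ..
    finally show ?thesis unfolding IJ sum_basis gam.simps rep.simps .
  qed
  have fmR: "fm (R p f) (R p g) = fm f g" for f g
  proof -
    have "fm (R p f) (R p g) = fm f (rz g)" unfolding fm_R[OF parity] i(2) ..
    also have "\<dots> = fm f g" unfolding fm_def by (rule sum.cong[OF refl]) (simp add: rz_def)
    finally show ?thesis .
  qed
  have fm_form: "fm f g = (\<Sum>I\<in>Z. \<Sum>J\<in>Z. form Spin (XI I) (XI J) * (f I * g J))" for f g
  proof -
    have "(\<Sum>J\<in>Z. form Spin (XI I) (XI J) * (f I * g J)) = weight I * (f I * g (comp I))" if "I \<in> Z" for I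
      using sum_form_Spin[OF that, of "\<lambda>J. f I * g J"] .
    from this[symmetric] show ?thesis unfolding fm_def by (rule sum.cong[OF refl])
  qed
  have fdel: "fm (del I) (del J) = form Spin (XI I) (XI J)" if "I \<in> Z" "J \<in> Z" for I J
  proof -
    have "fm (del I) (del J) = (\<Sum>K\<in>Z. (if K = I then 1 else 0) * form Spin (XI K) (XI J))" by (rule fm_del(1)[OF that(2)])
    also have "\<dots> = (if I = I then 1 else 0) * form Spin (XI I) (XI J)" by (rule sum_pick) (use that in auto)
    finally show ?thesis by simp
  qed
  have T3: "(\<Sum>x\<in>bas X. \<Sum>y\<in>bas X. form X x y * (gam a p X x x' * gam a p X y y')) = form X x' y'"
    if xy: "x' \<in> bas X" "y' \<in> bas X" for X x' y'
  proof (cases X)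
    case Spin
    obtain I J where IJ: "x' = XI I" "I \<in> Z" "y' = XI J" "J \<in> Z" using xy Spin by (auto elim!: basis_SpinE)
    show ?thesis unfolding Spin IJ sum_basis gam.simps fm_form[symmetric] fmR by (rule fdel[OF IJ(2,4)])
  next
    case Vect
    obtain k l where kl: "x' = EI k" "k \<in> {1..N}" "y' = EI l" "l \<in> {1..N}" using xy Vect by (auto elim!: basis_VectE)
    have "(\<Sum>x\<in>BV. \<Sum>y\<in>BV. form Vect x y * (gam a p Vect x x' * gam a p Vect y y'))
      = (\<Sum>x\<in>BV. gam a p Vect x x' * gam a p Vect x y')"
    proof (rule sum.cong[OF refl])
      fix x assume x: "x \<in> BV"
      have "(\<Sum>y\<in>BV. form Vect x y * (gam a p Vect x x' * gam a p Vect y y'))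
        = (\<Sum>y\<in>BV. (if x = y then 1 else 0) * (gam a p Vect x x' * gam a p Vect y y'))"
        by (rule sum.cong[OF refl]) (simp only: form_Vect_eq x)
      also have "\<dots> = gam a p Vect x x' * gam a p Vect x y'"
        by (rule sum_delta_mult(1)[OF finite_basis x])
      finally show "(\<Sum>y\<in>BV. form Vect x y * (gam a p Vect x x' * gam a p Vect y y')) = gam a p Vect x x' * gam a p Vect x y'" .
    qed
    also have "\<dots> = \<Phi> (a (e k)) (a (e l))" unfolding kl sum_basis gam.simps parseval[of "a (e k)"] ..
    also have "\<dots> = form Vect x' y'" unfolding a(3) kl form.simps ..
    finally show ?thesis unfolding Vect .
  qed
  have inv: "(\<Sum>z\<in>bas X. gam a p X x z * gam b ?q X z y) = (if x = y then 1 else 0)"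
    if xy: "x \<in> bas X" "y \<in> bas X" for X x y
  proof (cases X)
    case Spin
    obtain I J where IJ: "x = XI I" "I \<in> Z" "y = XI J" "J \<in> Z" using xy Spin by (auto elim!: basis_SpinE)
    have "(\<Sum>K\<in>Z. R p (del K) I * R ?q (del J) K) = rz (del J) I" unfolding R_expand[symmetric] i ..
    then show ?thesis unfolding Spin IJ sum_basis gam.simps using IJ by (simp add: rz_def)
  next
    case Vect
    obtain k l where kl: "x = EI k" "k \<in> {1..N}" "y = EI l" "l \<in> {1..N}" using xy Vect by (auto elim!: basis_VectE)
    have "(\<Sum>z=1..N. \<Phi> (e k) (a (e z)) * \<Phi> (e z) (b (e l))) = \<Phi> (e k) (a (\<Sum>z=1..N. scale (\<Phi> (e z) (b (e l))) (e z)))"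
      by (simp only: a_sum a(2) form_simps finite_atLeastAtMost mult.commute)
    also have "\<dots> = (if k = l then 1 else 0)" unfolding expand[symmetric] a(4) by (rule orthonormal[OF kl(2,4)])
    finally show ?thesis unfolding Vect kl sum_basis gam.simps by simp
  qed
  have T5: "(\<Sum>x\<in>BV. \<Sum>y\<in>BS. mu z x y * (gam a p Vect x x' * gam a p Spin y y')) = (\<Sum>z'\<in>BS. gam a p Spin z z' * mu z' x' y')"
    if zxy: "z \<in> BS" "x' \<in> BV" "y' \<in> BS" for z x' y'
  proof -
    obtain I where I: "z = XI I" "I \<in> Z" using zxy by (auto elim!: basis_SpinE)
    obtain J where J: "y' = XI J" "J \<in> Z" using zxy by (auto elim!: basis_SpinE)
    obtain k where k: "x' = EI k" "k \<in> {1..N}" using zxy by (auto elim!: basis_VectE)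
    have "(\<Sum>l=1..N. \<Sum>K\<in>Z. e_mat l I K * (\<Phi> (e l) (a (e k)) * R p (del J) K)) = cl (a (e k)) (R p (del J)) I"
      unfolding cl_def EE_def mo_def sum_fun_apply cscale_fun_apply if_P[OF I(2)] cscale_complex sum_distrib_left
      by (simp only: mult.left_commute)
    also have "\<dots> = R p (EE k (del J)) I" unfolding Rcl[symmetric] cl_e[OF k(2)] ..
    also have "\<dots> = (\<Sum>K\<in>Z. R p (del K) I * EE k (del J) K)" by (rule R_expand)
    also have "\<dots> = (\<Sum>K\<in>Z. R p (del K) I * e_mat k K J)" by (rule sum.cong[OF refl]) (simp only: EE_del J)
    finally show ?thesis unfolding I J k sum_basis gam.simps mu_coeff.simps .
  qed
  have T6: "(\<lambda>A. a \<circ> A \<circ> b) (MM i j) = M_op (a (e i)) (a (e j))" for i j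
    by (rule ext) (simp add: M_op_def a(6)[of "e _"] a_diff a(2))
  have T6': "(\<Sum>i=1..N. \<Phi> (e k) (a (e i)) * \<Phi> (e l) (a (e i))) = (if k = l then 1 else 0)"
    if "k \<in> {1..N}" "l \<in> {1..N}" for k l
  proof -
    have "(\<Sum>i=1..N. \<Phi> (e k) (a (e i)) * \<Phi> (e l) (a (e i))) = \<Phi> (b (e k)) (b (e l))"
      unfolding parseval[of "b (e k)"] by (rule sum.cong[OF refl]) (simp only: a(6)[symmetric] form_sym[of "a (e _)"])
    then show ?thesis unfolding b(3) orthonormal[OF that] .
  qed
  show ?thesis unfolding twist_def
  proof (intro conjI ballI allI)
    show "a \<circ> A \<circ> b \<in> so" if "A \<in> so" for A by (rule isometry_so[OF iso that])
    show "(\<Sum>z\<in>bas X. gam a p X x z * rep X A z y) = (\<Sum>z\<in>bas X. rep X (a \<circ> A \<circ> b) x z * gam a p X z y)"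
      if "A \<in> so" "x \<in> bas X" "y \<in> bas X" for X A x y
      using T2V[OF that(1), of x y] T2S[OF that(1), of x y] that(2,3) by (cases X) (simp_all only:)
    show "(\<Sum>x'\<in>bas X. \<Sum>y'\<in>bas X. gam a p X x x' * gam a p X y y' * dual_coord X x' y') = dual_coord X x y"
      if "x \<in> bas X" "y \<in> bas X" for X x y
      by (rule dual_form_invariant[where F = "form X" and \<delta> = "gam b ?q X", OF finite_basis dual_form form_dual inv T3 that])
    show "\<exists>f. (\<forall>i\<in>{1..N}. \<forall>j\<in>{1..N}. a \<circ> MM i j \<circ> b = M_op (f i) (f j)) \<and>
        (\<forall>k\<in>{1..N}. \<forall>l\<in>{1..N}. (\<Sum>i=1..N. \<Phi> (e k) (f i) * \<Phi> (e l) (f i)) = (if k = l then 1 else 0))"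
      using T6 T6' by (intro exI[of _ "\<lambda>i. a (e i)"]) blast
  qed (fact T3 T5)+
qed

subsection \<open>The image is central and invariant\<close>

abbreviation vac0 :: "label list => ('v => 'v) nc_poly" where "vac0 \<equiv> (\<lambda>l. if l = [] then U.nf 1 else 0)"

lemma if_Nil_cong: "x = y ==> (\<lambda>l. if l = [] then x else 0) = (\<lambda>l. if l = [] then y else 0)"
  by (rule arg_cong)

text \<open>Twisted naturality for a semilinear self-map \<open>h\<close> of the enveloping algebra:
  \<open>h\<close> is made into a map of label families by normalizing before and after.\<close>

lemma G_regular_hom:
  assumes h: "clin h" "\<And>p. h p \<in> FA so" and \<theta>: "twist \<gamma> \<theta>"
    and eq: "\<And>A p. A \<in> so ==> p \<in> FA so ==> U.nf (h (U.nf (letter A * p))) = U.nf (letter (\<theta> A) * U.nf (h p))"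
    and f: "f \<in> arrows [] []"
  shows "G f reg (\<lambda>l. if l = [] then U.nf (h (U.nf (t []))) else 0) [] = U.nf (h (U.nf (G f reg t [])))"
proof -
  let ?h = "\<lambda>(t :: label list => _) (l :: label list). if l = [] then U.nf (h (U.nf (t []))) else 0"
  note n = clin_simps[OF U.nf(1)] clin_simps[OF h(1)]
  have cl: "clin ?h" by (rule clinI; rule ext) (simp_all add: plus_fun_apply cscale_fun_apply n)
  have "G f reg (tws \<gamma> (src f) ?h t) = tws \<gamma> (tgt f) ?h (G f reg t)"
  proof (rule twisted_naturality[where \<theta> = \<theta>, OF \<theta> gmod_reg gmod_reg cl])
    fix A and t :: "label list => ('v => 'v) nc_poly" assume A: "A \<in> so"
    have "U.nf (h (U.nf (U.nf (letter A * U.nf (t []))))) = U.nf (letter (\<theta> A) * U.nf (U.nf (h (U.nf (t [])))))"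
      using A by (simp add: U.nf_nf U.nf eq h(2))
    then show "?h (reg A t) = reg (\<theta> A) (?h t)" unfolding reg_def by (intro if_Nil_cong) simp
  qed (use f in \<open>simp add: arrows_def\<close>)
  then show ?thesis using f by (simp add: arrows_def)
qed

lemma map_letters_FA:
  assumes "\<And>A. A \<in> so ==> \<theta> A \<in> so" "q \<in> FA so" shows "map_letters \<theta> q \<in> FA so"
proof -
  have "(\<Sum>w\<in>S. Poly_Mapping.lookup q w *\<^sub>c monw (map \<theta> w)) \<in> FA so" if "finite S" "S \<subseteq> Poly_Mapping.keys q" for S
    using that
  proof (induction S rule: finite_induct)
    case (insert w S)
    then have "w \<in> Poly_Mapping.keys q" by simp
    then have "set w \<subseteq> so" using assms(2) unfolding FA_iff by blast
    then have "set (map \<theta> w) \<subseteq> so" using assms(1) by auto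
    then show ?case using insert by simp
  qed simp
  then show ?thesis unfolding map_letters_ev ev_def by simp
qed

text \<open>Conjugation by an isometry is an automorphism of the Lie algebra, so it maps each
  defining relation of the enveloping algebra to a relation of the same kind.\<close>

lemma map_letters_ideal:
  assumes iso: "isometry a b" and p: "p \<in> U_ideal"
  shows "map_letters (\<lambda>A. a \<circ> A \<circ> b) p \<in> U_ideal"
  using p
proof (rule U.K_least[where P = "\<lambda>p. map_letters (\<lambda>A. a \<circ> A \<circ> b) p \<in> U_ideal"])
  let ?\<theta> = "\<lambda>A. a \<circ> A \<circ> b"
  note cl = clin_ev[of "\<lambda>w :: ('v => 'v) list. monw (map ?\<theta> w)", folded map_letters_ev]
  have FA: "map_letters ?\<theta> q \<in> FA so" if "q \<in> FA so" for q
    by (rule map_letters_FA[OF isometry_so[OF iso] that])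
  have l: "map_letters ?\<theta> (letter A) = letter (?\<theta> A)" for A by (simp add: map_letters_ev letter_monw)
  note a = isometryD[OF iso]
  have a_diff: "a (v - w) = a v - a w" for v w
    using a(1)[of v "scale (-1) w"] a(2)[of "-1" w] by simp
  show "map_letters ?\<theta> 0 \<in> U_ideal" using clin_0[OF cl] U.K_0 by simp
  show "map_letters ?\<theta> (p + q) \<in> U_ideal" if "map_letters ?\<theta> p \<in> U_ideal" "map_letters ?\<theta> q \<in> U_ideal" for p q
    using that by (simp add: clin_add[OF cl] U.K_add)
  show "map_letters ?\<theta> (q * p) \<in> U_ideal" "map_letters ?\<theta> (p * q) \<in> U_ideal"
    if "map_letters ?\<theta> p \<in> U_ideal" "q \<in> FA so" for p q
    using that FA by (simp_all add: map_letters_mult U.K_mult)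
  fix p assume "p \<in> U_rel"
  then show "map_letters ?\<theta> p \<in> U_ideal"
    unfolding U_rel_def linear_relations_def
  proof (elim UnE CollectE exE conjE)
    fix A B assume p: "p = letter (\<lambda>v. A v + B v) - letter A - letter B" and AB: "A \<in> so" "B \<in> so"
    have "?\<theta> (\<lambda>v. A v + B v) = (\<lambda>v. ?\<theta> A v + ?\<theta> B v)" by (rule ext) (simp add: a)
    then have "map_letters ?\<theta> p = letter (\<lambda>v. ?\<theta> A v + ?\<theta> B v) - (letter (?\<theta> A) + letter (?\<theta> B))"
      unfolding p clin_diff[OF cl] l by (simp only: diff_diff_eq)
    then show ?thesis using U_rels(1)[OF isometry_so[OF iso AB(1)] isometry_so[OF iso AB(2)]] by (simp only:)
  next
    fix c A assume p: "p = letter (\<lambda>v. scale c (A v)) - const c * letter A" and A: "A \<in> so"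
    have "?\<theta> (\<lambda>v. scale c (A v)) = (\<lambda>v. scale c (?\<theta> A v))" by (rule ext) (simp add: a)
    then have "map_letters ?\<theta> p = letter (\<lambda>v. scale c (?\<theta> A v)) - c *\<^sub>c letter (?\<theta> A)"
      unfolding p clin_diff[OF cl] const_mult clin_scale[OF cl] l by (simp only:)
    then show ?thesis using U_rels(2)[OF isometry_so[OF iso A]] by (simp only:)
  next
    fix A B assume p: "p = letter A * letter B - letter B * letter A - letter (\<lambda>v. A (B v) - B (A v))" and AB: "A \<in> so" "B \<in> so"
    have "?\<theta> (br A B) = br (?\<theta> A) (?\<theta> B)" by (rule ext) (simp add: a a_diff)
    then have "map_letters ?\<theta> p = - (letter (br (?\<theta> A) (?\<theta> B)) - (letter (?\<theta> A) * letter (?\<theta> B) - letter (?\<theta> B) * letter (?\<theta> A)))"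
      unfolding p clin_diff[OF cl] map_letters_mult l by (simp only: minus_diff_eq)
    then show ?thesis using U.K_minus[OF U_rels(3)[OF isometry_so[OF iso AB(1)] isometry_so[OF iso AB(2)]]] by (simp only:)
  qed
qed

lemma val_FA: "val f \<in> FA so" unfolding val_def by (rule U.nf(2))

lemma val_vac0:
  assumes "f \<in> arrows [] []" shows "G f reg vac0 [] = val f"
proof -
  have "G f reg (\<lambda>l. if l = [] then U.nf (U.nf (U.nf (vac []))) else 0) [] = U.nf (U.nf (U.nf (G f reg vac [])))"
  proof (rule G_regular_hom[where h = U.nf and \<theta> = "\<lambda>A. A", OF U.nf(1,2) twist_identity _ assms])
    fix A p assume "A \<in> so" "p \<in> FA so"
    then show "U.nf (U.nf (U.nf (letter A * p))) = U.nf (letter A * U.nf (U.nf p))"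
      by (simp add: U.nf_nf U.nf U.nf_mult_nf)
  qed
  moreover have "(\<lambda>l. if l = [] then U.nf (U.nf (U.nf (vac []))) else 0) = vac0"
    by (rule if_Nil_cong) (simp add: vac_def U.nf_nf U.nf)
  ultimately show ?thesis by (simp only: val_def U.nf_nf U.nf)
qed

text \<open>The vector represented by \<open>A\<close> arises from the unit in two ways: by right
  multiplication, which is a module map and is handled by naturality, and by the action of
  \<open>A\<close>, which is handled by equivariance. Comparing the values of the closed diagram on
  it gives the two products.\<close>

lemma val_commutes_letter:
  assumes f: "f \<in> arrows [] []" and A: "A \<in> so"
  shows "U.nf (letter A * val f) = U.nf (val f * letter A)"
proof -
  let ?h = "\<lambda>p. U.nf p * letter A"
  have "G f reg (\<lambda>l. if l = [] then U.nf (?h (U.nf (vac0 []))) else 0) [] = U.nf (?h (U.nf (G f reg vac0 [])))"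
  proof (rule G_regular_hom[where h = ?h and \<theta> = "\<lambda>A. A", OF _ _ twist_identity _ f])
    show "clin ?h" by (rule clin_comp[OF clin_mult(2) U.nf(1)])
    show "?h p \<in> FA so" for p using A by (simp add: U.nf)
    fix B p assume "B \<in> so" "p \<in> FA so"
    then show "U.nf (?h (U.nf (letter B * p))) = U.nf (letter B * U.nf (?h p))"
      using A by (simp add: U.nf_nf U.nf U.nf_mult_nf mult.assoc)
  qed
  moreover have "(\<lambda>l. if l = [] then U.nf (?h (U.nf (vac0 []))) else 0) = reg A vac0"
    unfolding reg_def by (rule if_Nil_cong) (use A in \<open>simp add: U.nf_nf U.nf U.nf_mult_nf\<close>)
  moreover have "G f reg (reg A vac0) = reg A (G f reg vac0)"
    using G_equivariant[OF gmod_reg A, of f vac0] f by (simp add: arrows_def)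
  ultimately show ?thesis using A val_vac0[OF f] val_FA[of f]
    by (simp add: reg_def U.nf_nf U.nf U.nf_mult_nf)
qed

lemma val_commutes:
  assumes f: "f \<in> arrows [] []" and q: "q \<in> FA so"
  shows "U.nf (q * val f) = U.nf (val f * q)"
proof (rule nc_linear_eqI[where h = "\<lambda>q. U.nf (q * val f)" and k = "\<lambda>q. U.nf (val f * q)", OF _ _ q])
  show "clin (\<lambda>q. U.nf (q * val f))" by (rule clin_comp[OF U.nf(1) clin_mult(2)])
  show "clin (\<lambda>q. U.nf (val f * q))" by (rule clin_comp[OF U.nf(1) clin_mult(1)])
  fix w :: "('v => 'v) list" assume "set w \<subseteq> so"
  then show "U.nf (monw w * val f) = U.nf (val f * monw w)"
  proof (induction w)
    case Nil show ?case by (simp add: monw_Nil)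
  next
    case (Cons A w)
    then have A: "A \<in> so" and w: "monw w \<in> FA so" by simp_all
    have c: "monw (A # w) = letter A * monw w" by (simp add: letter_monw monw_mult)
    have "U.nf (monw (A # w) * val f) = U.nf (letter A * U.nf (monw w * val f))"
      unfolding c mult.assoc using A w val_FA by (simp add: U.nf_mult_nf)
    also have "\<dots> = U.nf (letter A * U.nf (val f * monw w))" using Cons by simp
    also have "\<dots> = U.nf (U.nf (letter A * val f) * monw w)" using A w val_FA by (simp add: U.nf_mult_nf mult.assoc)
    also have "\<dots> = U.nf (val f * monw (A # w))"
      unfolding val_commutes_letter[OF f A] c using A w val_FA by (simp add: U.nf_mult_nf mult.assoc)
    finally show ?case .
  qed
qed

lemma nf_eq_ideal: "p \<in> FA so ==> q \<in> FA so ==> U.nf p = U.nf q ==> p - q \<in> U_ideal"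
  using U.K_diff[OF U.nf(3)[of p] U.nf(3)[of q]] by simp

lemma val_central: assumes "f \<in> arrows [] []" shows "U.cs (val f) \<in> Zg"
proof -
  have "U.cs (val f * q) = U.cs (q * val f)" if "q \<in> FA so" for q
    unfolding U.cs_eq_iff by (rule nf_eq_ideal) (use that val_FA val_commutes[OF assms that] in simp_all)
  then show ?thesis unfolding Zg_def Ug_def using val_FA by (auto simp: U.carrier_Q U.mult_Q)
qed

text \<open>The automorphism of the enveloping algebra induced by a group element is semilinear and
  fixes the unit; by naturality it fixes the value of a closed diagram on the unit.\<close>

lemma val_twist:
  assumes imp: "implements p a b" and f: "f \<in> arrows [] []"
  shows "map_letters (\<lambda>A. a \<circ> A \<circ> b) (val f) - val f \<in> U_ideal"
proof -
  let ?\<theta> = "\<lambda>A. a \<circ> A \<circ> b"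
  note iso = implements_isometry[OF imp]
  note cl = clin_ev[of "\<lambda>w :: ('v => 'v) list. monw (map ?\<theta> w)", folded map_letters_ev]
  have so: "?\<theta> A \<in> so" if "A \<in> so" for A by (rule isometry_so[OF iso that])
  have ml: "U.nf (map_letters ?\<theta> (U.nf p)) = U.nf (map_letters ?\<theta> p)" if "p \<in> FA so" for p
    using map_letters_ideal[OF iso U.nf(3)[OF that]] by (intro U.nf_cong[symmetric]) (simp add: clin_diff[OF cl])
  have l: "map_letters ?\<theta> (letter A) = letter (?\<theta> A)" for A by (simp add: map_letters_ev letter_monw)
  have one: "map_letters ?\<theta> 1 = 1" unfolding monw_Nil[symmetric] map_letters_ev by simp
  have FA: "map_letters ?\<theta> p \<in> FA so" if "p \<in> FA so" for p by (rule map_letters_FA[OF so that])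
  let ?h = "\<lambda>p. map_letters ?\<theta> (U.nf p)"
  have "G f reg (\<lambda>l. if l = [] then U.nf (?h (U.nf (vac0 []))) else 0) [] = U.nf (?h (U.nf (G f reg vac0 [])))"
  proof (rule G_regular_hom[where h = ?h and \<theta> = ?\<theta>, OF _ _ implements_twist[OF imp] _ f])
    show "clin ?h" by (rule clin_comp[OF cl U.nf(1)])
    show "?h p \<in> FA so" for p by (rule FA) (rule U.nf)
    fix A p assume A: "A \<in> so" and p: "p \<in> FA so"
    have "U.nf (?h (U.nf (letter A * p))) = U.nf (letter (?\<theta> A) * map_letters ?\<theta> p)"
      using A p by (simp add: ml U.nf map_letters_mult l del: o_apply)
    also have "\<dots> = U.nf (letter (?\<theta> A) * U.nf (?h p))"
      using U.nf_mult_nf(1)[OF FA_letter[OF so[OF A]] FA[OF p]] p by (simp add: ml del: o_apply)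
    finally show "U.nf (?h (U.nf (letter A * p))) = U.nf (letter (?\<theta> A) * U.nf (?h p))" .
  qed
  moreover have "(\<lambda>l. if l = [] then U.nf (?h (U.nf (vac0 []))) else 0) = vac0"
    by (rule if_Nil_cong) (simp add: ml U.nf one del: o_apply)
  ultimately have "val f = U.nf (map_letters ?\<theta> (val f))"
    by (simp only: val_vac0[OF f] ml U.nf val_FA)
  then have "U.nf (map_letters ?\<theta> (val f)) = U.nf (val f)" using U.nf_nf[OF FA[OF val_FA]] by metis
  then show ?thesis by (rule nf_eq_ideal[OF FA[OF val_FA] val_FA])
qed

text \<open>Invariance of \<open>z\<close> modulo the ideal gives one inclusion. For the other, an
  element of the coset is pulled back by the inverse automorphism, which also preserves the
  ideal.\<close>

lemma map_letters_image_coset: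
  assumes iso: "isometry a b" and z: "z \<in> FA so" and inv: "map_letters (\<lambda>A. a \<circ> A \<circ> b) z - z \<in> U_ideal"
  shows "map_letters (\<lambda>A. a \<circ> A \<circ> b) ` U.cs z = U.cs z"
proof (intro Set.equalityI subsetI)
  let ?\<theta> = "\<lambda>A. a \<circ> A \<circ> b" and ?\<eta> = "\<lambda>A. b \<circ> A \<circ> a"
  note cl = clin_ev[of "\<lambda>w :: ('v => 'v) list. monw (map ?\<theta> w)", folded map_letters_ev]
  note cl' = clin_ev[of "\<lambda>w :: ('v => 'v) list. monw (map ?\<eta> w)", folded map_letters_ev]
  have id: "a \<circ> b = id" "b \<circ> a = id" using isometryD(4,5)[OF iso] by auto
  have \<theta>\<eta>: "?\<theta> (?\<eta> A) = A" "?\<eta> (?\<theta> A) = A" for A using isometryD(4,5)[OF iso] by (simp_all add: fun_eq_iff)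
  have mm: "map_letters f (map_letters g p) = p" if "\<And>A. f (g A) = A" for f g :: "('v => 'v) => 'v => 'v" and p
  proof -
    have m: "map f (map g w) = w" for w using that by (simp add: map_idI)
    show ?thesis unfolding map_letters_ev
    proof (rule nc_linear_eqI[where A = UNIV and p = p and h = "\<lambda>p. ev (\<lambda>w. monw (map f w)) (ev (\<lambda>w. monw (map g w)) p)" and k = "\<lambda>p. p"])
      show "clin (\<lambda>p. ev (\<lambda>w. monw (map f w)) (ev (\<lambda>w. monw (map g w)) p))" by (rule clin_comp[OF clin_ev clin_ev])
      show "clin (\<lambda>p :: ('v => 'v) nc_poly. p)" by (rule clin_id)
      show "ev (\<lambda>w. monw (map f w)) (ev (\<lambda>w. monw (map g w)) (monw w)) = monw w" for w by (simp only: ev_monw m)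
    qed simp
  qed
  fix x
  show "x \<in> U.cs z" if h: "x \<in> map_letters ?\<theta> ` U.cs z"
  proof -
    obtain y where y0: "x = map_letters ?\<theta> y" "y \<in> U.cs z" using h by (rule imageE)
    then have y: "x = map_letters ?\<theta> y" "y - z \<in> U_ideal" by (simp_all add: U.cs_eq)
    have "x - z = map_letters ?\<theta> (y - z) + (map_letters ?\<theta> z - z)" unfolding y(1) clin_diff[OF cl] by simp
    then show ?thesis using U.K_add[OF map_letters_ideal[OF iso y(2)] inv] unfolding U.cs_eq mem_Collect_eq by (simp only:)
  qed
  show "x \<in> map_letters ?\<theta> ` U.cs z" if "x \<in> U.cs z"
  proof -
    have x: "x - z \<in> U_ideal" using that by (simp add: U.cs_eq)
    have "map_letters ?\<eta> x - z = map_letters ?\<eta> (x - z) - map_letters ?\<eta> (map_letters ?\<theta> z - z)"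
      unfolding clin_diff[OF cl'] mm[of ?\<eta> ?\<theta>, OF \<theta>\<eta>(2)] by simp
    then have "map_letters ?\<eta> x \<in> U.cs z"
      using U.K_diff[OF map_letters_ideal[OF isometry_sym[OF iso] x] map_letters_ideal[OF isometry_sym[OF iso] inv]] by (simp add: U.cs_eq)
    then show ?thesis using mm[of ?\<theta> ?\<eta>, OF \<theta>\<eta>(1), of x] by (metis imageI)
  qed
qed

theorem image_subset: assumes "f \<in> arrows [] []" shows "U.cs (val f) \<in> Zg_invariants"
  unfolding Zg_invariants_def
proof (intro CollectI conjI ballI val_central[OF assms])
  fix g assume "g \<in> GV"
  then obtain p where p: "implements p (vec_act g) (vec_act (inv\<^bsub>Cl\<^esub> g))" using GV_implements by blast
  have "Ad g = (\<lambda>A. vec_act g \<circ> A \<circ> vec_act (inv\<^bsub>Cl\<^esub> g))" by (rule ext) (simp add: Ad_def)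
  then show "Ad_U g (U.cs (val f)) = U.cs (val f)"
    unfolding Ad_U_def using map_letters_image_coset[OF implements_isometry[OF p] val_FA val_twist[OF p assms]] by (simp only:)
qed

subsection \<open>Reflections in the group\<close>

definition Ceq :: "'v nc_poly => 'v nc_poly => bool" where "Ceq p q \<longleftrightarrow> p - q \<in> Cl_ideal"

lemma Ceq_refl: "Ceq p p" by (simp add: Ceq_def C.K_0)

lemma Ceq_trans: "Ceq p q ==> Ceq q r ==> Ceq p r"
  using C.K_add[of "p - q" "q - r"] by (simp add: Ceq_def)

lemma Ceq_mult: "Ceq p q ==> Ceq (x * p * y) (x * q * y)"
  using C.K_mult(2)[OF C.K_mult(1)[of "p - q" x], of y] by (simp add: Ceq_def left_diff_distrib right_diff_distrib)

lemma Ceq_cs: "C.cs p = C.cs q \<longleftrightarrow> Ceq p q" by (simp add: C.cs_eq_iff Ceq_def)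

text \<open>The negative of the reflection in \<open>e b\<close>: conjugation by \<open>e b\<close>
  without the grading sign fixes \<open>e b\<close> and negates its orthogonal complement.\<close>

definition rfl :: "nat => 'v => 'v" where "rfl b v = scale (2 * \<Phi> (e b) v) (e b) - v"

lemma Ceq_square:
  assumes "b \<in> {1..N}" shows "Ceq (letter (e b) * letter (e b)) 1"
proof -
  have "letter (e b) * letter (e b) + letter (e b) * letter (e b) - const (2 * \<Phi> (e b) (e b)) \<in> Cl_ideal"
    by (rule C.gen_K) (auto simp: Cl_rel_def)
  then have "(1/2) *\<^sub>c (letter (e b) * letter (e b) + letter (e b) * letter (e b) - const 2) \<in> Cl_ideal"
    unfolding orthonormal[OF assms assms] by (intro C.K_scale) simp
  moreover have "(1/2) *\<^sub>c (x + x - const 2) = x - 1" for x :: "'v nc_poly"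
  proof -
    have "(1/2) *\<^sub>c (x + x) = x" unfolding cscale_add_right cscale_add_left[symmetric] by simp
    then show ?thesis by (simp add: cscale_diff_right const_eq monw_Nil)
  qed
  ultimately show ?thesis by (simp only: Ceq_def)
qed

text \<open>With b for the letter of \<open>e b\<close>: b(bv + vb) equals both 2 \<Phi> b and bbv +
  bvb, and bb = 1. The proof writes the difference as a combination of elements of the
  ideal.\<close>

lemma Ceq_rfl:
  assumes "b \<in> {1..N}" shows "Ceq (letter (e b) * letter v * letter (e b)) (letter (rfl b v))"
proof -
  let ?b = "letter (e b)" and ?v = "letter v" and ?c = "2 * \<Phi> (e b) v"
  have 1: "?b * ?v + ?v * ?b - const ?c \<in> Cl_ideal" by (rule C.gen_K) (auto simp: Cl_rel_def)
  have 2: "?b * (?b * ?v + ?v * ?b - const ?c) \<in> Cl_ideal" by (rule C.K_mult(1)[OF 1]) simp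
  have 3: "(?b * ?b - 1) * ?v \<in> Cl_ideal" using Ceq_square[OF assms] unfolding Ceq_def by (rule C.K_mult(2)) simp
  have 4: "letter (scale ?c (e b)) - const ?c * ?b \<in> Cl_ideal"
    by (rule C.gen_K) (auto simp: Cl_rel_def linear_relations_def)
  have 5: "letter (rfl b v + v) - letter (rfl b v) - letter v \<in> Cl_ideal"
    by (rule C.gen_K) (auto simp: Cl_rel_def linear_relations_def)
  have "?b * ?v * ?b - letter (rfl b v) = ?b * (?b * ?v + ?v * ?b - const ?c) - (?b * ?b - 1) * ?v
    - (letter (scale ?c (e b)) - const ?c * ?b) + (letter (rfl b v + v) - letter (rfl b v) - letter v)"
    unfolding rfl_def by (simp add: algebra_simps mult_const const_mult)
  then show ?thesis using C.K_add[OF C.K_diff[OF C.K_diff[OF 2 3] 4] 5] by (simp only: Ceq_def)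
qed

abbreviation ew :: "nat list => 'v nc_poly" where "ew bs \<equiv> monw (map e bs)"

lemma ew_Cons: "ew (b # bs) = letter (e b) * ew bs" by (simp add: letter_monw monw_mult)

lemma ew_snoc: "ew (bs @ [b]) = ew bs * letter (e b)" by (simp add: letter_monw monw_mult)

lemma ew_conj: "set bs \<subseteq> {1..N} ==> Ceq (ew bs * letter v * ew (rev bs)) (letter (foldr rfl bs v))"
proof (induction bs)
  case Nil show ?case by (simp add: monw_Nil Ceq_refl)
next
  case (Cons b bs)
  have "ew (b # bs) * letter v * ew (rev (b # bs)) = letter (e b) * (ew bs * letter v * ew (rev bs)) * letter (e b)"
    unfolding rev.simps ew_snoc ew_Cons by (simp only: mult.assoc)
  then show ?case using Ceq_trans[OF Ceq_mult[OF Cons.IH, of "letter (e b)" "letter (e b)"] Ceq_rfl[of b "foldr rfl bs v"]] Cons.prems by simp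
qed

lemma ew_norm: "set bs \<subseteq> {1..N} ==> Ceq (ew bs * ew (rev bs)) 1"
proof (induction bs)
  case Nil show ?case by (simp add: monw_Nil Ceq_refl)
next
  case (Cons b bs)
  have "ew (b # bs) * ew (rev (b # bs)) = letter (e b) * (ew bs * ew (rev bs)) * letter (e b)"
    unfolding rev.simps ew_snoc ew_Cons by (simp only: mult.assoc)
  then show ?case using Ceq_trans[OF Ceq_mult[OF Cons.IH, of "letter (e b)" "letter (e b)"], of 1] Ceq_square[of b] Cons.prems by simp
qed

lemma rfl_rfl: "b \<in> {1..N} ==> rfl b (rfl b v) = v"
  unfolding rfl_def by (simp add: form_simps orthonormal del: atLeastAtMost_iff)

lemma foldr_rfl_surj: "set bs \<subseteq> {1..N} ==> \<exists>w. foldr rfl bs w = v"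
proof (induction bs arbitrary: v)
  case (Cons b bs)
  then obtain w where "foldr rfl bs w = rfl b v" by auto
  then show ?case using Cons.prems rfl_rfl[of b v] by (intro exI[of _ w]) simp
qed simp

lemma ew_unit:
  assumes "set bs \<subseteq> {1..N}"
  shows "C.cs (ew bs) \<in> Units Cl" "inv\<^bsub>Cl\<^esub> (C.cs (ew bs)) = C.cs (ew (rev bs))"
proof -
  interpret Cl: ring Cl by (rule ring_Cl)
  have c: "C.cs p \<in> carrier Cl" for p unfolding Cl_def C.carrier_Q by simp
  have one: "\<one>\<^bsub>Cl\<^esub> = C.cs 1" unfolding Cl_def by (rule C.one_Q)
  have 1: "C.cs (ew bs) \<otimes>\<^bsub>Cl\<^esub> C.cs (ew (rev bs)) = \<one>\<^bsub>Cl\<^esub>" unfolding Cl_mult one Ceq_cs by (rule ew_norm[OF assms])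
  have 2: "C.cs (ew (rev bs)) \<otimes>\<^bsub>Cl\<^esub> C.cs (ew bs) = \<one>\<^bsub>Cl\<^esub>" unfolding Cl_mult one Ceq_cs using ew_norm[of "rev bs"] assms by simp
  show "C.cs (ew bs) \<in> Units Cl" unfolding Units_def using c 1 2 by blast
  show "inv\<^bsub>Cl\<^esub> (C.cs (ew bs)) = C.cs (ew (rev bs))" by (rule Cl.inv_char[OF c c 1 2])
qed

lemma ew_conj_cs:
  assumes "set bs \<subseteq> {1..N}"
  shows "C.cs (ew bs) \<otimes>\<^bsub>Cl\<^esub> Cl_vec v \<otimes>\<^bsub>Cl\<^esub> inv\<^bsub>Cl\<^esub> (C.cs (ew bs)) = Cl_vec (foldr rfl bs v)"
  unfolding ew_unit(2)[OF assms] Cl_vec_def Cl_mult Ceq_cs by (rule ew_conj[OF assms])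

lemma ew_vec_act:
  assumes "set bs \<subseteq> {1..N}" shows "vec_act (C.cs (ew bs)) v = foldr rfl bs v"
  unfolding vec_act_def ew_conj_cs[OF assms] by (rule the_equality[OF HOL.refl Cl_vec_inj])

lemma ew_GV:
  assumes bs: "set bs \<subseteq> {1..N}" and par: "odd N ==> even (length bs)"
  shows "C.cs (ew bs) \<in> GV"
proof -
  have k: "Poly_Mapping.keys (ew bs) = {map e bs}" by (simp add: monw_def)
  have ev: "C.cs (ew bs) \<in> Cl_even" if "even (length bs)" unfolding Cl_even_def using k that by (intro CollectI exI[of _ "ew bs"]) simp
  have od: "C.cs (ew bs) \<in> Cl_odd" if "odd (length bs)" unfolding Cl_odd_def using k that by (intro CollectI exI[of _ "ew bs"]) simp
  have im: "(\<lambda>x. C.cs (ew bs) \<otimes>\<^bsub>Cl\<^esub> x \<otimes>\<^bsub>Cl\<^esub> inv\<^bsub>Cl\<^esub> (C.cs (ew bs))) ` range Cl_vec = range Cl_vec"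
  proof -
    have "range (\<lambda>v. Cl_vec (foldr rfl bs v)) = range Cl_vec"
    proof (intro Set.equalityI subsetI)
      fix x assume "x \<in> range Cl_vec"
      then obtain v where v: "x = Cl_vec v" by auto
      obtain w where "foldr rfl bs w = v" using foldr_rfl_surj[OF bs] by blast
      then show "x \<in> range (\<lambda>v. Cl_vec (foldr rfl bs v))" unfolding v by blast
    qed auto
    then show ?thesis unfolding image_image ew_conj_cs[OF bs] .
  qed
  have norm: "C.cs (ew bs) \<otimes>\<^bsub>Cl\<^esub> Cl_rev (C.cs (ew bs)) = \<one>\<^bsub>Cl\<^esub>"
  proof -
    have "reverse_words (ew bs) = ew (rev bs)" by (simp add: reverse_words_ev rev_map)
    moreover have "\<one>\<^bsub>Cl\<^esub> = C.cs 1" unfolding Cl_def by (rule C.one_Q)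
    ultimately show ?thesis unfolding Cl_rev_cs Cl_mult by (simp only: Ceq_cs ew_norm[OF bs])
  qed
  have "C.cs (ew bs) \<in> Pin" unfolding Pin_def using ew_unit(1)[OF bs] im norm ev od by auto
  then show ?thesis unfolding GV_def SpinGroup_def using ev par by auto
qed

lemma rfl_scale: "rfl b (scale c v) = scale c (rfl b v)"
  unfolding rfl_def by (simp add: form_simps scale_right_diff_distrib mult.left_commute)

lemma rfl_e: "b \<in> {1..N} ==> c \<in> {1..N} ==> rfl b (e c) = scale (if b = c then 1 else -1) (e c)"
  unfolding rfl_def by (cases "b = c") (simp_all add: orthonormal scale_left_distrib[of 1 1, simplified] del: atLeastAtMost_iff)

lemma foldr_rfl_e:
  "set bs \<subseteq> {1..N} ==> c \<in> {1..N} ==> foldr rfl bs (e c) = scale ((-1) ^ length (filter (\<lambda>b. b \<noteq> c) bs)) (e c)"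
  by (induction bs) (simp_all add: rfl_scale rfl_e)

text \<open>Conjugation by the product of all basis vectors except \<open>e a\<close> is a
  reflection in \<open>e a\<close> up to a global sign. The word has length N - 1, which is even for
  odd \<open>N\<close>, so it lies in G(V) in both cases.\<close>

definition others :: "nat => nat list" where "others a = filter (\<lambda>b. b \<noteq> a) [1..<Suc N]"

lemma others: "set (others a) \<subseteq> {1..N}" "a \<in> {1..N} ==> length (others a) = N - 1"
  "a \<in> {1..N} ==> c \<in> {1..N} ==> length (filter (\<lambda>b. b \<noteq> c) (others a)) = (if c = a then N - 1 else N - 2)"
proof -
  have len: "length (filter P [1..<Suc N]) = card {b \<in> {1..N}. P b}" for P
    by (subst distinct_card[symmetric]) (auto intro!: arg_cong[where f = card])
  show "set (others a) \<subseteq> {1..N}" by (auto simp: others_def)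
  have s: "{b \<in> {1..N}. b \<noteq> a} = {1..N} - {a}" by auto
  show l: "length (others a) = N - 1" if "a \<in> {1..N}" for a
  proof -
    have "{b \<in> {1..N}. b \<noteq> a} = {1..N} - {a}" by auto
    then show ?thesis unfolding others_def len using that by simp
  qed
  show "length (filter (\<lambda>b. b \<noteq> c) (others a)) = (if c = a then N - 1 else N - 2)" if "a \<in> {1..N}" "c \<in> {1..N}"
  proof -
    have "{b \<in> {1..N}. b \<noteq> c \<and> b \<noteq> a} = {1..N} - {a, c}" by auto
    then have "length (filter (\<lambda>b. b \<noteq> c) (others a)) = card ({1..N} - {a, c})"
      unfolding others_def filter_filter len by (simp add: conj_commute)
    also have "\<dots> = N - card {a, c}" using that by (subst card_Diff_subset) auto
    finally show ?thesis by (cases "c = a") simp_all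
  qed
qed

definition flp :: "nat => 'v nc_poly set" where "flp a = C.cs (ew (others a))"

lemma flp_GV: "a \<in> {1..N} ==> flp a \<in> GV"
  unfolding flp_def by (rule ew_GV[OF others(1)]) (simp add: others(2))

definition sgn_of :: "nat => nat => complex" where "sgn_of a i = (if i = a then -1 else 1)"

text \<open>On vectors the element multiplies \<open>e c\<close> by (-1)^N, and by a further -1 if
  \<open>c = a\<close>. The global sign occurs twice in a generator with two indices and
  cancels.\<close>

lemma Ad_flp:
  assumes a: "a \<in> {1..N}" and ij: "i \<in> {1..N}" "j \<in> {1..N}"
  shows "Ad (flp a) (MM i j) = (\<lambda>v. scale (sgn_of a i * sgn_of a j) (MM i j v))"
proof
  fix v
  obtain p where "implements p (vec_act (flp a)) (vec_act (inv\<^bsub>Cl\<^esub> (flp a)))" using GV_implements[OF flp_GV[OF a]] by blast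
  note iso = isometryD[OF implements_isometry[OF this]]
  let ?a = "vec_act (flp a)"
  have a_diff: "?a (v - w) = ?a v - ?a w" for v w
    using iso(1)[of v "scale (-1) w"] iso(2)[of "-1" w] by simp
  define s :: complex where "s = (-1) ^ N"
  have N: "(-1 :: complex) ^ (N - 1) = - s" "(-1 :: complex) ^ (N - 2) = s"
  proof -
    obtain m where m: "N = m + 2" using N_ge_2 by (metis add.commute le_Suc_ex)
    have "N = Suc (Suc m)" "N - 1 = Suc m" "N - 2 = m" using m by simp_all
    then show "(-1 :: complex) ^ (N - 1) = - s" "(-1 :: complex) ^ (N - 2) = s" by (simp_all only: s_def power_Suc) simp_all
  qed
  have ss: "s * s = 1" by (simp add: s_def power_mult_distrib[symmetric])
  have e: "?a (e c) = scale (s * sgn_of a c) (e c)" if "c \<in> {1..N}" for c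
    unfolding flp_def ew_vec_act[OF others(1)] foldr_rfl_e[OF others(1) that] others(3)[OF a that]
    by (simp add: N sgn_of_def)
  have "Ad (flp a) (MM i j) v = M_op (?a (e i)) (?a (e j)) v"
    unfolding Ad_def o_apply by (simp add: M_op_def iso(6) a_diff iso(2))
  also have "\<dots> = scale ((s * s) * (sgn_of a i * sgn_of a j)) (MM i j v)"
    unfolding e[OF ij(1)] e[OF ij(2)] M_op_def form_simps by (simp add: scale_right_diff_distrib mult_ac)
  finally show "Ad (flp a) (MM i j) v = scale (sgn_of a i * sgn_of a j) (MM i j v)" unfolding ss by simp
qed

subsection \<open>Words in the generators of the enveloping algebra\<close>

definition Ueq :: "('v => 'v) nc_poly => ('v => 'v) nc_poly => bool"
  where "Ueq p q \<longleftrightarrow> p \<in> FA so \<and> q \<in> FA so \<and> p - q \<in> U_ideal"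

lemma Ueq_refl: "p \<in> FA so ==> Ueq p p" by (simp add: Ueq_def U.K_0)

lemma Ueq_sym: "Ueq p q ==> Ueq q p" using U.K_minus[of "p - q"] by (simp add: Ueq_def)

lemma Ueq_trans: "Ueq p q ==> Ueq q r ==> Ueq p r"
  using U.K_add[of "p - q" "q - r"] by (simp add: Ueq_def)

lemma Ueq_add: "Ueq p q ==> Ueq p' q' ==> Ueq (p + p') (q + q')"
  using U.K_add[of "p - q" "p' - q'"] by (simp add: Ueq_def algebra_simps)

lemma Ueq_diff: "Ueq p q ==> Ueq p' q' ==> Ueq (p - p') (q - q')"
  using U.K_diff[of "p - q" "p' - q'"] by (simp add: Ueq_def algebra_simps)

lemma Ueq_scale: "Ueq p q ==> Ueq (c *\<^sub>c p) (c *\<^sub>c q)"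
  using U.K_scale[of "p - q" c] by (simp add: Ueq_def cscale_diff_right)

lemma Ueq_mult: "Ueq p q ==> Ueq p' q' ==> Ueq (p * p') (q * q')"
proof -
  assume a: "Ueq p q" "Ueq p' q'"
  have "p * p' - q * q' = (p - q) * p' + q * (p' - q')" by (simp add: algebra_simps)
  then show ?thesis using a U.K_add[OF U.K_mult(2)[of "p - q" p'] U.K_mult(1)[of "p' - q'" q]] by (simp add: Ueq_def)
qed

lemma Ueq_sum: "finite S ==> (\<And>i. i \<in> S ==> Ueq (f i) (g i)) ==> Ueq (\<Sum>i\<in>S. f i) (\<Sum>i\<in>S. g i)"
  by (induction S rule: finite_induct) (auto simp: Ueq_refl intro: Ueq_add)

lemma Ueq_nf: "Ueq p q ==> U.nf p = U.nf q" by (rule U.nf_cong) (simp add: Ueq_def)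

lemma Ueq_letter:
  "A \<in> so ==> B \<in> so ==> Ueq (letter (\<lambda>v. A v + B v)) (letter A + letter B)"
  "A \<in> so ==> Ueq (letter (\<lambda>v. scale c (A v))) (c *\<^sub>c letter A)"
  "A \<in> so ==> B \<in> so ==> Ueq (letter A * letter B - letter B * letter A) (letter (br A B))"
  "Ueq (letter (\<lambda>v. 0)) 0"
proof -
  show 2: "Ueq (letter (\<lambda>v. scale c (A v))) (c *\<^sub>c letter A)" if "A \<in> so" for c A
    using that U_rels(2)[of A c] by (simp add: Ueq_def so_scale)
  show "Ueq (letter (\<lambda>v. A v + B v)) (letter A + letter B)" if "A \<in> so" "B \<in> so"
    using that U_rels(1) by (simp add: Ueq_def so_add)
  show "Ueq (letter A * letter B - letter B * letter A) (letter (br A B))" if "A \<in> so" "B \<in> so"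
    by (rule Ueq_sym) (use that U_rels(3) in \<open>simp add: Ueq_def so_bracket\<close>)
  show "Ueq (letter (\<lambda>v. 0)) 0" using 2[OF so_zero, of 0] by simp
qed

abbreviation LM :: "nat => nat => ('v => 'v) nc_poly" where "LM i j \<equiv> letter (MM i j)"

lemma LM_FA [simp]: "LM i j \<in> FA so" by (simp add: so_M)

lemma Ueq_letter_sum:
  assumes "finite S" "\<And>i. i \<in> S ==> A i \<in> so"
  shows "Ueq (letter (\<lambda>v. \<Sum>i\<in>S. A i v)) (\<Sum>i\<in>S. letter (A i))"
  using assms
proof (induction S rule: finite_induct)
  case empty show ?case using Ueq_letter(4) by simp
next
  case (insert i S)
  have "Ueq (letter (\<lambda>v. A i v + (\<Sum>i\<in>S. A i v))) (letter (A i) + letter (\<lambda>v. \<Sum>i\<in>S. A i v))"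
    by (rule Ueq_letter(1)) (use insert in \<open>auto intro: so_sum\<close>)
  then show ?case using Ueq_trans[OF _ Ueq_add[OF Ueq_refl insert.IH]] insert by simp
qed

lemma Ueq_letter_expand:
  assumes A: "A \<in> so"
  shows "Ueq (letter A) (\<Sum>i=1..N. \<Sum>j=1..N. (ent A i j / 2) *\<^sub>c LM i j)"
proof -
  have "Ueq (letter (\<lambda>v. \<Sum>i=1..N. \<Sum>j=1..N. scale (ent A i j / 2) (MM i j v))) (\<Sum>i=1..N. letter (\<lambda>v. \<Sum>j=1..N. scale (ent A i j / 2) (MM i j v)))"
    by (rule Ueq_letter_sum) (auto intro!: so_sum so_scale so_M)
  also have "Ueq \<dots> (\<Sum>i=1..N. \<Sum>j=1..N. (ent A i j / 2) *\<^sub>c LM i j)"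
  proof (rule Ueq_sum)
    fix i
    have "Ueq (letter (\<lambda>v. \<Sum>j=1..N. scale (ent A i j / 2) (MM i j v))) (\<Sum>j=1..N. letter (\<lambda>v. scale (ent A i j / 2) (MM i j v)))"
      by (rule Ueq_letter_sum) (auto intro!: so_scale so_M)
    moreover have "Ueq (\<Sum>j=1..N. letter (\<lambda>v. scale (ent A i j / 2) (MM i j v))) (\<Sum>j=1..N. (ent A i j / 2) *\<^sub>c LM i j)"
      by (rule Ueq_sum) (auto intro: Ueq_letter(2) so_M)
    ultimately show "Ueq (letter (\<lambda>v. \<Sum>j=1..N. scale (ent A i j / 2) (MM i j v))) (\<Sum>j=1..N. (ent A i j / 2) *\<^sub>c LM i j)"
      by (rule Ueq_trans)
  qed simp
  finally (Ueq_trans) show ?thesis unfolding so_expand_M[OF A, symmetric] .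
qed

text \<open>The leading pair becomes the rightmost factor, because in \<open>DD\<close> the cup
  carrying the first two labels acts first. Odd words get the default value 0.\<close>

fun W :: "nat list => ('v => 'v) nc_poly" where
  "W [] = 1"
| "W [x] = 0"
| "W (x # y # c) = W c * LM x y"

lemma W_FA [simp]: "W c \<in> FA so"
  by (induction c rule: W.induct) simp_all

lemma letter_M_action:
  assumes "a \<in> {1..N}" "b \<in> {1..N}" "x \<in> {1..N}"
  shows "Ueq (letter (M_op (MM a b (e x)) w)) ((if x = b then letter (M_op (e a) w) else 0) - (if x = a then letter (M_op (e b) w) else 0))"
    and "Ueq (letter (M_op w (MM a b (e x)))) ((if x = b then letter (M_op w (e a)) else 0) - (if x = a then letter (M_op w (e b)) else 0))"
proof -
  have m: "MM a b (e x) = (if x = b then e a else 0) - (if x = a then e b else 0)"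
  proof -
    have "\<Phi> (e b) (e x) = (if x = b then 1 else 0)" "\<Phi> (e a) (e x) = (if x = a then 1 else 0)"
      using orthonormal[OF assms(2,3)] orthonormal[OF assms(1,3)] by (auto simp: eq_commute)
    then show ?thesis unfolding M_op_def by simp
  qed
  have neg: "M_op (- u) w = (\<lambda>v. scale (-1) (M_op u w v))" "M_op w (- u) = (\<lambda>v. scale (-1) (M_op w u v))"
    "M_op 0 w = (\<lambda>v. 0)" "M_op w 0 = (\<lambda>v. 0)" for u
    by (rule ext, simp add: M_op_def form_simps)+
  have n: "Ueq (letter (\<lambda>v. scale (-1) (M_op u w v))) (0 - letter (M_op u w))" for u w
    using Ueq_letter(2)[OF so_M, of "-1" u w] by simp
  have cases: "(x = b \<and> x = a) \<or> (x = b \<and> x \<noteq> a) \<or> (x \<noteq> b \<and> x = a) \<or> (x \<noteq> b \<and> x \<noteq> a)" by blast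
  show "Ueq (letter (M_op (MM a b (e x)) w)) ((if x = b then letter (M_op (e a) w) else 0) - (if x = a then letter (M_op (e b) w) else 0))"
    unfolding m using Ueq_letter(4) n[of "e b" w] Ueq_refl[of "letter (M_op (e a) w)"]
    by (cases "x = b"; cases "x = a") (simp_all add: neg so_M)
  show "Ueq (letter (M_op w (MM a b (e x)))) ((if x = b then letter (M_op w (e a)) else 0) - (if x = a then letter (M_op w (e b)) else 0))"
    unfolding m using Ueq_letter(4) n[of w "e b"] Ueq_refl[of "letter (M_op w (e a))"]
    by (cases "x = b"; cases "x = a") (simp_all add: neg so_M)
qed

text \<open>The generator M with indices \<open>a\<close>, \<open>b\<close> sends \<open>e b\<close>
  to \<open>e a\<close> and \<open>e a\<close> to the negative of \<open>e b\<close>. Its commutator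
  acts on a monomial as the corresponding derivation on the index word.\<close>

lemma W_polarize:
  assumes ab: "a \<in> {1..N}" "b \<in> {1..N}"
  shows "set c \<subseteq> {1..N} ==> even (length c) ==>
    Ueq (LM a b * W c - W c * LM a b) (polarize b a c W - polarize a b c W)"
proof (induction c rule: W.induct)
  case 1 show ?case by (simp add: Ueq_refl)
next
  case (2 x) then show ?case by simp
next
  case (3 x y c)
  then have xy: "x \<in> {1..N}" "y \<in> {1..N}" and IH: "Ueq (LM a b * W c - W c * LM a b) (polarize b a c W - polarize a b c W)" by auto
  have hom: "polarize p q c (\<lambda>d. W (x # y # d)) = polarize p q c W * LM x y" for p q
    using polarize_hom[of "\<lambda>z. z * LM x y" p q c W] by (simp add: distrib_right)
  have br: "Ueq (LM a b * LM x y - LM x y * LM a b)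
    (((if x = b then LM a y else 0) - (if x = a then LM b y else 0)) + ((if y = b then LM x a else 0) - (if y = a then LM x b else 0)))"
  proof -
    note [trans] = Ueq_trans
    have "Ueq (LM a b * LM x y - LM x y * LM a b) (letter (br (MM a b) (MM x y)))" by (rule Ueq_letter(3)[OF so_M so_M])
    also have "letter (br (MM a b) (MM x y)) = letter (\<lambda>v. M_op (MM a b (e x)) (e y) v + M_op (e x) (MM a b (e y)) v)"
      unfolding bracket_M[OF so_M] ..
    also have "Ueq \<dots> (letter (M_op (MM a b (e x)) (e y)) + letter (M_op (e x) (MM a b (e y))))"
      by (rule Ueq_letter(1)[OF so_M so_M])
    also have "Ueq \<dots> (((if x = b then LM a y else 0) - (if x = a then LM b y else 0)) + ((if y = b then LM x a else 0) - (if y = a then LM x b else 0)))"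
      by (rule Ueq_add[OF letter_M_action(1)[OF ab xy(1)] letter_M_action(2)[OF ab xy(2)]])
    finally show ?thesis .
  qed
  have "Ueq ((LM a b * W c - W c * LM a b) * LM x y + W c * (LM a b * LM x y - LM x y * LM a b))
    ((polarize b a c W - polarize a b c W) * LM x y + W c * (((if x = b then LM a y else 0) - (if x = a then LM b y else 0)) + ((if y = b then LM x a else 0) - (if y = a then LM x b else 0))))"
    by (intro Ueq_add Ueq_mult IH br Ueq_refl W_FA LM_FA)
  moreover have "(LM a b * W c - W c * LM a b) * LM x y + W c * (LM a b * LM x y - LM x y * LM a b) = LM a b * W (x # y # c) - W (x # y # c) * LM a b"
    by (simp add: algebra_simps)
  moreover have "(polarize b a c W - polarize a b c W) * LM x y + W c * (((if x = b then LM a y else 0) - (if x = a then LM b y else 0)) + ((if y = b then LM x a else 0) - (if y = a then LM x b else 0)))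
    = polarize b a (x # y # c) W - polarize a b (x # y # c) W"
    unfolding polarize.simps hom
    by (cases "x = b"; cases "x = a"; cases "y = b"; cases "y = a") (simp_all only: if_True if_False W.simps, simp_all add: algebra_simps)
  ultimately show ?case by (simp only:)
qed

text \<open>Each occurrence of the index \<open>a\<close> contributes one factor -1 under the
  reflection.\<close>

lemma map_letters_W:
  assumes a: "a \<in> {1..N}"
  shows "set c \<subseteq> {1..N} ==> even (length c) ==> Ueq (map_letters (Ad (flp a)) (W c)) ((-1) ^ count_list c a *\<^sub>c W c)"
proof (induction c rule: W.induct)
  case 1
  have "map_letters (Ad (flp a)) 1 = 1" unfolding monw_Nil[symmetric] map_letters_ev by simp
  then show ?case by (simp add: Ueq_refl)
next
  case (2 x) then show ?case by simp
next
  case (3 x y c)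
  then have xy: "x \<in> {1..N}" "y \<in> {1..N}" and IH: "Ueq (map_letters (Ad (flp a)) (W c)) ((-1) ^ count_list c a *\<^sub>c W c)" by auto
  have "map_letters (Ad (flp a)) (LM x y) = letter (\<lambda>v. scale (sgn_of a x * sgn_of a y) (MM x y v))"
    by (simp add: map_letters_ev letter_monw Ad_flp[OF a xy])
  then have "Ueq (map_letters (Ad (flp a)) (W (x # y # c))) (((-1) ^ count_list c a *\<^sub>c W c) * ((sgn_of a x * sgn_of a y) *\<^sub>c LM x y))"
    unfolding W.simps map_letters_mult using Ueq_mult[OF IH Ueq_letter(2)[OF so_M]] by (simp only:)
  moreover have "((-1) ^ count_list c a *\<^sub>c W c) * ((sgn_of a x * sgn_of a y) *\<^sub>c LM x y) = (-1) ^ count_list (x # y # c) a *\<^sub>c W (x # y # c)"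
    unfolding scale_mult W.simps cscale_cscale
    by (rule arg_cong[where f = "\<lambda>k. k *\<^sub>c (W c * LM x y)"]) (simp add: sgn_of_def power_add)
  ultimately show ?case by (simp only:)
qed

subsection \<open>Realizing the invariants\<close>

lemma EI_basis: "i \<in> {1..N} ==> EI i \<in> BV" by (simp add: basis_of.simps)

lemma slw_append: "slw (l @ l') t = slw l' (slw l t)"
  by (induction l arbitrary: t) simp_all

lemma clin_slw: "clin (slw l :: (label list => 'm::cvec) => label list => 'm)"
proof (induction l)
  case Nil show ?case using clin_id by (simp add: clin_def)
next
  case (Cons b l)
  have "clin (sl b :: (label list => 'm) => label list => 'm)" by (rule clinI) simp_all
  from clin_comp[OF Cons this] show ?case by (simp add: clin_def)
qed

lemma slw_lsts:
  "c \<in> words {1..N} m ==> slw (map EI c) (lsts (replicate m Vect) h t) = h (slw (map EI c) t)"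
proof (induction m arbitrary: c t)
  case (Suc m)
  then obtain x c' where c: "c = x # c'" "x \<in> {1..N}" "c' \<in> words {1..N} m"
    by (cases c) (auto simp: words_def)
  show ?case using Suc.IH[OF c(3)] by (simp add: c(1) sl_lst[OF EI_basis[OF c(2)]])
qed simp

lemma middle:
  "G (Idm a \<boxtimes> f \<boxtimes> Idm b) \<rho> u = lsts a (\<lambda>s. G f (tens b \<rho>) (lsts (src f) (lsts b (\<lambda>t. t)) s)) u"
  by (simp add: lsts_lsts)

lemma replicate_split:
  "i \<le> m ==> replicate i X @ [X, X] @ replicate (m - i) X = replicate (m + 2) X"
proof -
  assume "i \<le> m"
  then have "length (replicate i X @ [X, X] @ replicate (m - i) X) = m + 2" by simp
  moreover have "replicate (length (replicate i X @ [X, X] @ replicate (m - i) X)) X = replicate i X @ [X, X] @ replicate (m - i) X"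
    by (rule replicate_length_same) auto
  ultimately show ?thesis by (simp only:)
qed

lemma sum_words_split:
  assumes "i \<le> m"
  shows "(\<Sum>d\<in>words {1..N} (m + 2). F d) = (\<Sum>c\<in>words {1..N} i. \<Sum>x=1..N. \<Sum>y=1..N. \<Sum>d\<in>words {1..N} (m - i). F (c @ x # y # d))"
proof -
  have "m + 2 = i + Suc (Suc (m - i))" using assms by simp
  then show ?thesis by (simp only: sum_words_append sum_words_Suc finite_atLeastAtMost)
qed

text \<open>Each rule of \<open>brauer\<close> is matched by a construction on morphisms: a delta at
  positions \<open>i\<close>, \<open>i + 1\<close> by precomposing with a cap between identity
  strands, a transposition by precomposing with a crossing. The tensor becomes the linear functional
  evaluated by the morphism.\<close>

lemma brauer_morphism:
  "brauer {1..N} m p ==> \<exists>f\<in>arrows (replicate m Vect) [].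
    \<forall>u. G f reg u = (\<Sum>c\<in>words {1..N} m. p c *\<^sub>c slw (map EI c) u)"
proof (induction rule: brauer.induct)
  case unit
  show ?case by (rule bexI[of _ "Idm []"]) (simp_all add: arrows_def)
next
  case (zero m)
  show ?case by (rule bexI[of _ "Zero (replicate m Vect) []"]) (simp_all add: arrows_def)
next
  case (add m p q)
  then obtain f g where f: "f \<in> arrows (replicate m Vect) []" "\<And>u. G f reg u = (\<Sum>c\<in>words {1..N} m. p c *\<^sub>c slw (map EI c) u)"
    and g: "g \<in> arrows (replicate m Vect) []" "\<And>u. G g reg u = (\<Sum>c\<in>words {1..N} m. q c *\<^sub>c slw (map EI c) u)"
    by blast
  show ?case by (rule bexI[of _ "f \<boxplus> g"]) (use f g in \<open>simp_all add: arrows_def cscale_add_left sum.distrib\<close>)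
next
  case (scale m p k)
  then obtain f where f: "f \<in> arrows (replicate m Vect) []" "\<And>u. G f reg u = (\<Sum>c\<in>words {1..N} m. p c *\<^sub>c slw (map EI c) u)"
    by blast
  show ?case by (rule bexI[of _ "k \<star> f"]) (use f in \<open>simp_all add: arrows_def cscale_sum_right\<close>)
next
  case (cap m p i)
  then obtain f where f: "f \<in> arrows (replicate m Vect) []" "\<And>u. G f reg u = (\<Sum>c\<in>words {1..N} m. p c *\<^sub>c slw (map EI c) u)"
    by blast
  let ?I = "{1..N}" and ?a = "replicate i Vect" and ?b = "replicate (m - i) Vect"
  let ?K = "Idm ?a \<boxtimes> Cap Vect \<boxtimes> Idm ?b"
  have m: "m = i + (m - i)" using cap.hyps by simp
  have ab: "?a @ ?b = replicate m Vect" unfolding replicate_add[symmetric] m[symmetric] ..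
  have mid: "slw (map EI (c @ d)) (G ?K reg u) = (\<Sum>x\<in>?I. slw (map EI (c @ x # x # d)) u)"
    if c: "c \<in> words ?I i" and d: "d \<in> words ?I (m - i)" for c d u
  proof -
    let ?s = "slw (map EI c) u"
    have "slw (map EI (c @ d)) (G ?K reg u) = slw (map EI d) (G (Cap Vect) (tens ?b reg) (lst Vect (lst Vect (lsts ?b (\<lambda>t. t))) ?s))"
      unfolding middle map_append slw_append slw_lsts[OF c] by simp
    also have "G (Cap Vect) (tens ?b reg) (lst Vect (lst Vect (lsts ?b (\<lambda>t. t))) ?s)
      = (\<Sum>x\<in>BV. \<Sum>y\<in>BV. (if x = y then 1 else 0) *\<^sub>c lsts ?b (\<lambda>t. t) (sl y (sl x ?s)))"
      by (simp only: G.simps sl_lst form_Vect_eq cong: sum.cong)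
    also have "\<dots> = (\<Sum>x\<in>BV. lsts ?b (\<lambda>t. t) (sl x (sl x ?s)))"
      by (rule sum.cong[OF refl]) (rule sum_delta_cscale)
    also have "slw (map EI d) \<dots> = (\<Sum>x\<in>?I. slw (map EI d) (sl (EI x) (sl (EI x) ?s)))"
      unfolding clin_sum[OF clin_slw] slw_lsts[OF d] sum_basis ..
    finally show ?thesis by (simp add: slw_append)
  qed
  have "G (f \<bullet> ?K) reg u = (\<Sum>d\<in>words ?I (m + 2). (if d \<in> words ?I (m + 2) \<and> d ! i = d ! Suc i then p (take i d @ drop (i + 2) d) else 0) *\<^sub>c slw (map EI d) u)" for u
  proof -
    have "G (f \<bullet> ?K) reg u = (\<Sum>c\<in>words ?I (i + (m - i)). p c *\<^sub>c slw (map EI c) (G ?K reg u))"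
      unfolding m[symmetric] G.simps(7) f(2) ..
    also have "\<dots> = (\<Sum>c\<in>words ?I i. \<Sum>d\<in>words ?I (m - i). p (c @ d) *\<^sub>c (\<Sum>x\<in>?I. slw (map EI (c @ x # x # d)) u))"
      unfolding sum_words_append[OF finite_atLeastAtMost]
      by (rule sum.cong[OF refl], rule sum.cong[OF refl]) (simp only: mid)
    also have "\<dots> = (\<Sum>c\<in>words ?I i. \<Sum>x\<in>?I. \<Sum>d\<in>words ?I (m - i). p (c @ d) *\<^sub>c slw (map EI (c @ x # x # d)) u)"
      unfolding cscale_sum_right by (rule sum.cong[OF refl], rule sum.swap)
    also have "\<dots> = (\<Sum>c\<in>words ?I i. \<Sum>x\<in>?I. \<Sum>y\<in>?I. \<Sum>d\<in>words ?I (m - i). (if x = y then p (c @ d) else 0) *\<^sub>c slw (map EI (c @ x # y # d)) u)"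
    proof (rule sum.cong[OF refl], rule sum.cong[OF refl])
      fix c x assume x: "x \<in> ?I"
      have "(\<Sum>y\<in>?I. \<Sum>d\<in>words ?I (m - i). (if x = y then p (c @ d) else 0) *\<^sub>c slw (map EI (c @ x # y # d)) u)
        = (\<Sum>d\<in>words ?I (m - i). (if x = x then p (c @ d) else 0) *\<^sub>c slw (map EI (c @ x # x # d)) u)"
        by (rule sum_pick) (use x in auto)
      then show "(\<Sum>d\<in>words ?I (m - i). p (c @ d) *\<^sub>c slw (map EI (c @ x # x # d)) u)
        = (\<Sum>y\<in>?I. \<Sum>d\<in>words ?I (m - i). (if x = y then p (c @ d) else 0) *\<^sub>c slw (map EI (c @ x # y # d)) u)" by simp
    qed
    also have "\<dots> = (\<Sum>d\<in>words ?I (m + 2). (if d \<in> words ?I (m + 2) \<and> d ! i = d ! Suc i then p (take i d @ drop (i + 2) d) else 0) *\<^sub>c slw (map EI d) u)"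
      unfolding sum_words_split[OF cap.hyps(2)]
    proof ((rule sum.cong[OF refl])+)
      fix c x y d assume h: "c \<in> words ?I i" "x \<in> ?I" "y \<in> ?I" "d \<in> words ?I (m - i)"
      have "c @ x # y # d \<in> words ?I (m + 2)" using h cap.hyps(2) by (auto simp: words_def)
      moreover have "length c = i" using h(1) by (simp add: words_def)
      ultimately have "(if x = y then p (c @ d) else 0)
        = (if c @ x # y # d \<in> words ?I (m + 2) \<and> (c @ x # y # d) ! i = (c @ x # y # d) ! Suc i then p (take i (c @ x # y # d) @ drop (i + 2) (c @ x # y # d)) else 0)"
        by (simp add: nth_append)
      then show "(if x = y then p (c @ d) else 0) *\<^sub>c slw (map EI (c @ x # y # d)) u
        = (if c @ x # y # d \<in> words ?I (m + 2) \<and> (c @ x # y # d) ! i = (c @ x # y # d) ! Suc i then p (take i (c @ x # y # d) @ drop (i + 2) (c @ x # y # d)) else 0) *\<^sub>c slw (map EI (c @ x # y # d)) u"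
        by (rule arg_cong)
    qed
    finally show ?thesis .
  qed
  moreover have "f \<bullet> ?K \<in> arrows (replicate (m + 2) Vect) []"
    using f(1) replicate_split[OF cap.hyps(2), of Vect] ab by (simp add: arrows_def)
  ultimately show ?case by blast
next
  case (swap m p i)
  then obtain f where f: "f \<in> arrows (replicate m Vect) []" "\<And>u. G f reg u = (\<Sum>c\<in>words {1..N} m. p c *\<^sub>c slw (map EI c) u)"
    by blast
  let ?I = "{1..N}" and ?a = "replicate i Vect" and ?b = "replicate (m - 2 - i) Vect"
  let ?K = "Idm ?a \<boxtimes> Swap Vect Vect \<boxtimes> Idm ?b"
  have m2: "m - 2 + 2 = m" "i \<le> m - 2" using swap.hyps(2) by simp_all
  have ab: "?a @ [Vect, Vect] @ ?b = replicate m Vect" using replicate_split[OF m2(2), of Vect] unfolding m2(1) .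
  have mid: "slw (map EI c) (G ?K reg u) = slw (map EI (swap_at i c)) u" if c: "c \<in> words ?I m" for c u
  proof -
    have "Suc i < length c" using c swap.hyps(2) by (simp add: words_def)
    then obtain c1 x y d where s: "c = c1 @ x # y # d" "length c1 = i" by (rule split_at)
    have c1: "c1 \<in> words ?I i" and d: "d \<in> words ?I (m - 2 - i)" and xy: "x \<in> ?I" "y \<in> ?I"
      using c s by (auto simp: words_def)
    note b = EI_basis[OF xy(1)] EI_basis[OF xy(2)]
    let ?s = "slw (map EI c1) u"
    have "slw (map EI c) (G ?K reg u) = slw (map EI d) (sl (EI y) (sl (EI x) (G (Swap Vect Vect) (tens ?b reg) (lst Vect (lst Vect (lsts ?b (\<lambda>t. t))) ?s))))"
      unfolding middle s(1) map_append slw_append slw_lsts[OF c1] by simp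
    also have "sl (EI y) (sl (EI x) (G (Swap Vect Vect) (tens ?b reg) (lst Vect (lst Vect (lsts ?b (\<lambda>t. t))) ?s)))
      = lsts ?b (\<lambda>t. t) (sl (EI x) (sl (EI y) ?s))"
      by (simp add: sl_lst b)
    finally show ?thesis unfolding s(1) swap_at_append[OF s(2)] slw_lsts[OF d] by (simp add: slw_append)
  qed
  have "G (f \<bullet> ?K) reg u = (\<Sum>c\<in>words ?I m. p (swap_at i c) *\<^sub>c slw (map EI c) u)" for u
  proof -
    have "G (f \<bullet> ?K) reg u = (\<Sum>c\<in>words ?I m. p c *\<^sub>c slw (map EI (swap_at i c)) u)"
      unfolding G.simps(7) f(2) by (rule sum.cong[OF refl]) (simp only: mid)
    also have "\<dots> = (\<Sum>c\<in>words ?I m. p (swap_at i c) *\<^sub>c slw (map EI c) u)"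
      by (rule sum.reindex_bij_witness[where i = "swap_at i" and j = "swap_at i"]) simp_all
    finally show ?thesis .
  qed
  moreover have "f \<bullet> ?K \<in> arrows (replicate m Vect) []"
    using f(1) ab by (simp add: arrows_def)
  ultimately show ?case by blast
qed

text \<open>A cup with a dot on its second strand. Its entry at the labels k, l is twice the action
  of \<open>MM k l\<close> plus a Casimir term; since the latter is symmetric in k and l,
  subtracting the crossed cup in \<open>D1\<close> removes it.\<close>

definition E1 :: mor where "E1 = (Idm [Vect] \<boxtimes> Dot Vect) \<bullet> Cup Vect"

definition D1 :: mor where "D1 = E1 \<boxminus> Swap Vect Vect \<bullet> E1"

lemma D1_simps [simp]: "src D1 = []" "tgt D1 = [Vect, Vect]" "wf_mor D1" "src E1 = []" "tgt E1 = [Vect, Vect]" "wf_mor E1"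
  by (simp_all add: D1_def E1_def)

lemma sl_E1:
  fixes u :: "label list => 'm::cvec"
  assumes \<rho>: "gmod \<rho>" and x: "x \<in> BV" and y: "y \<in> BV"
  shows "sl y (sl x (G E1 \<rho> u)) = (\<Sum>i=1..N. \<Sum>j=1..N. rep Vect (MM i j) y x *\<^sub>c \<rho> (MM j i) u)
    + (1/2) *\<^sub>c (\<Sum>i=1..N. \<Sum>j=1..N. (\<Sum>z\<in>BV. rep Vect (MM i j) y z * rep Vect (MM j i) z x) *\<^sub>c u)"
proof -
  let ?V = "BV"
  let ?s = "mk Vect (\<lambda>z. (if x = z then 1 else 0) *\<^sub>c u)"
  have pick: "(\<Sum>z\<in>?V. K z *\<^sub>c h ((if x = z then 1 else 0) *\<^sub>c u)) = K x *\<^sub>c h u" if "clin h" for K and h :: "(label list => 'm) => label list => 'm"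
  proof -
    have "(\<Sum>z\<in>?V. K z *\<^sub>c h ((if x = z then 1 else 0) *\<^sub>c u)) = K x *\<^sub>c h ((if x = x then 1 else 0) *\<^sub>c u)"
      by (rule sum_pick) (use x in \<open>auto simp: clin_0[OF that]\<close>)
    then show ?thesis by simp
  qed
  have 1: "sl y (rp Vect A (lst Vect h ?s)) = rep Vect A y x *\<^sub>c h u" if "clin h" for A and h :: "(label list => 'm) => label list => 'm"
    unfolding sl_tw[OF y] by (simp only: sl_lst sl_mk_in pick[OF that] cong: sum.cong)
  have 2: "sl y (rp Vect A (rp Vect B ?s)) = (\<Sum>z\<in>?V. rep Vect A y z * rep Vect B z x) *\<^sub>c u" for A B
  proof -
    have "sl z (rp Vect B ?s) = rep Vect B z x *\<^sub>c u" if "z \<in> ?V" for z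
      unfolding sl_tw[OF that] by (simp only: sl_mk_in pick[OF clin_id] cong: sum.cong)
    then show ?thesis unfolding sl_tw[OF y] by (simp only: cscale_cscale cscale_sum_left cong: sum.cong)
  qed
  have "sl x (G E1 \<rho> u) = Om Vect \<rho> ?s"
    using x by (simp add: E1_def lst_lst sl_lst dual_Vect_eq cong: mk_cong)
  then show ?thesis unfolding Om_full[OF \<rho>] by (simp only: sl_linear sl_sum 1[OF gmodD(1)[OF \<rho> so_M]] 2)
qed

text \<open>The factor 4 is 2 times 2: the matrix of a generator on V has two nonzero entries, and
  the antisymmetrization doubles the antisymmetric part.\<close>

lemma sl_D1:
  assumes \<rho>: "gmod \<rho>" and k: "k \<in> {1..N}" and l: "l \<in> {1..N}"
  shows "sl (EI l) (sl (EI k) (G D1 \<rho> u)) = 4 *\<^sub>c \<rho> (MM k l) u"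
proof -
  let ?I = "{1..N}" and ?V = "BV"
  note b = EI_basis[OF k] EI_basis[OF l]
  have anti: "rep Vect (MM i j) x y = - rep Vect (MM i j) y x" if xy: "x \<in> ?V" "y \<in> ?V" for i j x y
  proof -
    obtain p q where "x = EI p" "y = EI q" using xy by (auto elim!: basis_VectE)
    then show ?thesis using ent_antisym[OF so_M[of "e i" "e j"], of p q] by simp
  qed
  let ?c = "\<lambda>y x. \<Sum>i\<in>?I. \<Sum>j\<in>?I. (\<Sum>z\<in>?V. rep Vect (MM i j) y z * rep Vect (MM j i) z x) *\<^sub>c u"
  \<comment> \<open>Transposing both matrices in the product changes two signs and exchanges the
    roles of \<open>i\<close> and \<open>j\<close>.\<close>
  have sym: "?c (EI l) (EI k) = ?c (EI k) (EI l)"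
  proof -
    have "?c (EI l) (EI k) = (\<Sum>j\<in>?I. \<Sum>i\<in>?I. (\<Sum>z\<in>?V. rep Vect (MM i j) (EI l) z * rep Vect (MM j i) z (EI k)) *\<^sub>c u)"
      by (rule sum.swap)
    also have "\<dots> = ?c (EI k) (EI l)"
    proof (rule sum.cong[OF refl], rule sum.cong[OF refl], rule arg_cong[where f = "\<lambda>c. c *\<^sub>c u"], rule sum.cong[OF refl])
      fix i j z assume z: "z \<in> ?V"
      show "rep Vect (MM i j) (EI l) z * rep Vect (MM j i) z (EI k) = rep Vect (MM j i) (EI k) z * rep Vect (MM i j) z (EI l)"
        using anti[OF b(2) z, of i j] anti[OF z b(1), of j i] by simp
    qed
    finally show ?thesis .
  qed
  have 1: "(\<Sum>i\<in>?I. \<Sum>j\<in>?I. rep Vect (MM i j) (EI q) (EI p) *\<^sub>c \<rho> (MM j i) u) = 2 *\<^sub>c \<rho> (MM p q) u" if pq: "p \<in> ?I" "q \<in> ?I" for p q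
  proof -
    have two: "(\<Sum>i\<in>?I. \<Sum>j\<in>?I. (if j = s \<and> i = r then 1 else 0) *\<^sub>c \<rho> (MM j i) u) = \<rho> (MM s r) u" if "r \<in> ?I" "s \<in> ?I" for r s
    proof -
      have "(\<Sum>i\<in>?I. \<Sum>j\<in>?I. (if j = s \<and> i = r then 1 else 0) *\<^sub>c \<rho> (MM j i) u) = (\<Sum>j\<in>?I. (if j = s \<and> r = r then 1 else 0) *\<^sub>c \<rho> (MM j r) u)"
        by (rule sum_pick) (use that in auto)
      also have "\<dots> = (if s = s \<and> r = r then 1 else 0) *\<^sub>c \<rho> (MM s r) u"
        by (rule sum_pick) (use that in auto)
      finally show ?thesis by simp
    qed
    have "(\<Sum>i\<in>?I. \<Sum>j\<in>?I. rep Vect (MM i j) (EI q) (EI p) *\<^sub>c \<rho> (MM j i) u)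
      = (\<Sum>i\<in>?I. \<Sum>j\<in>?I. (if j = p \<and> i = q then 1 else 0) *\<^sub>c \<rho> (MM j i) u - (if j = q \<and> i = p then 1 else 0) *\<^sub>c \<rho> (MM j i) u)"
      by (rule sum.cong[OF refl], rule sum.cong[OF refl])
        (simp only: rep.simps ent_M[OF _ _ pq(2,1)] cscale_diff_left conj_commute[of "_ = p" "_ = q"])
    also have "\<dots> = \<rho> (MM p q) u - \<rho> (MM q p) u"
      unfolding sum_subtractf two[OF pq(2,1)] two[OF pq] ..
    also have "\<dots> = 2 *\<^sub>c \<rho> (MM p q) u"
      unfolding gmod_MM_swap[OF \<rho>, of q p] using cscale_add_left[of 1 1 "\<rho> (MM p q) u"] by simp
    finally show ?thesis .
  qed
  have "sl (EI l) (sl (EI k) (G D1 \<rho> u)) = sl (EI l) (sl (EI k) (G E1 \<rho> u)) - sl (EI k) (sl (EI l) (G E1 \<rho> u))"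
    using b by (simp add: D1_def)
  also have "\<dots> = 2 *\<^sub>c \<rho> (MM k l) u - 2 *\<^sub>c \<rho> (MM l k) u"
    unfolding sl_E1[OF \<rho> b] sl_E1[OF \<rho> b(2,1)] 1[OF k l] 1[OF l k] sym by simp
  also have "\<dots> = 4 *\<^sub>c \<rho> (MM k l) u"
    unfolding gmod_MM_swap[OF \<rho>, of l k] by (simp add: cvec.scale_minus_right cscale_add_left[symmetric])
  finally show ?thesis .
qed

text \<open>Parallel dotted cups, all acting on the same module: each further cup stands to the
  right of the strands already present and so acts next to the module, which multiplies its
  generator from the left.\<close>

primrec DD :: "nat => mor" where
  "DD 0 = Idm []"
| "DD (Suc k) = (Idm [Vect, Vect] \<boxtimes> DD k) \<bullet> D1"

lemma DD_arrows: "DD k \<in> arrows [] (replicate (2 * k) Vect)"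
  by (induction k) (simp_all add: arrows_def)

abbreviation inj0 :: "('v => 'v) nc_poly => label list => ('v => 'v) nc_poly"
  where "inj0 q \<equiv> (\<lambda>l. if l = [] then U.nf q else 0)"

lemma cscale_inj0: "c *\<^sub>c inj0 q = inj0 (c *\<^sub>c q)"
  by (rule ext) (simp add: cscale_fun_apply clin_scale[OF U.nf(1)])

lemma reg_inj0: "A \<in> so ==> q \<in> FA so ==> reg A (inj0 q) = inj0 (letter A * q)"
  unfolding reg_def by (rule if_Nil_cong) (simp add: U.nf_mult_nf U.nf U.nf_nf)

lemma slw_DD:
  "c \<in> words {1..N} (2 * k) ==> q \<in> FA so ==> slw (map EI c) (G (DD k) reg (inj0 q)) = inj0 (4 ^ k *\<^sub>c (W c * q))"
proof (induction k arbitrary: c q)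
  case 0
  have "4 ^ 0 *\<^sub>c (W [] * q) = q" by simp
  with 0 show ?case by (simp only: mult_0_right words_0 singleton_iff list.map slw.simps DD.simps G.simps lsts.simps)
next
  case (Suc k)
  then obtain x y c' where c: "c = x # y # c'" and xy: "x \<in> {1..N}" "y \<in> {1..N}" and c': "c' \<in> words {1..N} (2 * k)"
    by (cases c; cases "tl c") (auto simp: words_def)
  have "slw (map EI c) (G (DD (Suc k)) reg (inj0 q)) = slw (map EI c') (G (DD k) reg (sl (EI y) (sl (EI x) (G D1 reg (inj0 q)))))"
    by (simp add: c sl_lst EI_basis[OF xy(1)] EI_basis[OF xy(2)])
  also have "\<dots> = slw (map EI c') (G (DD k) reg (inj0 (4 *\<^sub>c (LM x y * q))))"
    unfolding sl_D1[OF gmod_reg xy] reg_inj0[OF so_M Suc.prems(2)] cscale_inj0 ..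
  also have "\<dots> = inj0 (4 ^ k *\<^sub>c (W c' * (4 *\<^sub>c (LM x y * q))))"
    by (rule Suc.IH[OF c']) (simp add: Suc.prems)
  also have "4 ^ k *\<^sub>c (W c' * (4 *\<^sub>c (LM x y * q))) = 4 ^ Suc k *\<^sub>c (W c * q)"
    unfolding c W.simps scale_mult cscale_cscale mult.assoc by (simp add: mult.commute)
  finally show ?case .
qed

section \<open>Elements of the enveloping algebra that come from closed diagrams\<close>

definition realized :: "('v => 'v) nc_poly => bool"
  where "realized q \<longleftrightarrow> (\<exists>f\<in>arrows [] []. val f = U.nf q)"

lemma realizedI: "f \<in> arrows [] [] ==> G f reg vac0 [] = U.nf q ==> realized q"
  unfolding realized_def using val_vac0 by metis

lemma realizedE: assumes "realized q" obtains f where "f \<in> arrows [] []" "G f reg vac0 [] = U.nf q"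
  using assms val_vac0 unfolding realized_def by metis

lemma realized_0: "realized 0"
  by (rule realizedI[of "Zero [] []"]) (simp_all add: arrows_def zero_fun_apply clin_0[OF U.nf(1)])

lemma realized_add: assumes "realized p" "realized q" shows "realized (p + q)"
proof -
  obtain f g where "f \<in> arrows [] []" "G f reg vac0 [] = U.nf p" "g \<in> arrows [] []" "G g reg vac0 [] = U.nf q"
    using assms by (metis realizedE)
  then show ?thesis by (intro realizedI[of "f \<boxplus> g"]) (simp_all add: arrows_def plus_fun_apply clin_add[OF U.nf(1)])
qed

lemma realized_scale: assumes "realized p" shows "realized (c *\<^sub>c p)"
proof -
  obtain f where "f \<in> arrows [] []" "G f reg vac0 [] = U.nf p" using assms by (rule realizedE)
  then show ?thesis by (intro realizedI[of "c \<star> f"]) (simp_all add: arrows_def cscale_fun_apply clin_scale[OF U.nf(1)])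
qed

lemma realized_sum: "finite S ==> (\<And>i. i \<in> S ==> realized (f i)) ==> realized (\<Sum>i\<in>S. f i)"
  by (induction S rule: finite_induct) (auto simp: realized_0 intro: realized_add)

text \<open>The morphism attached to the tensor is composed with \<open>k\<close> dotted cups. The
  factor \<open>4 ^ k\<close> that they produce is removed by scaling.\<close>

lemma realized_brauer:
  assumes "brauer {1..N} (2 * k) t" shows "realized (\<Sum>c\<in>words {1..N} (2 * k). t c *\<^sub>c W c)"
proof -
  let ?w = "words {1..N} (2 * k)"
  obtain f where f: "f \<in> arrows (replicate (2 * k) Vect) []" "\<And>u. G f reg u = (\<Sum>c\<in>?w. t c *\<^sub>c slw (map EI c) u)"
    using brauer_morphism[OF assms] by blast
  have "G (f \<bullet> DD k) reg vac0 = (\<Sum>c\<in>?w. t c *\<^sub>c inj0 (4 ^ k *\<^sub>c (W c * 1)))"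
    unfolding G.simps(7) f(2) by (rule sum.cong[OF refl]) (simp only: slw_DD FA_closed(2))
  then have "G (f \<bullet> DD k) reg vac0 [] = U.nf (4 ^ k *\<^sub>c (\<Sum>c\<in>?w. t c *\<^sub>c W c))"
    by (simp add: sum_fun_apply cscale_fun_apply clin_simps[OF U.nf(1)] cscale_sum_right mult.commute)
  moreover have "f \<bullet> DD k \<in> arrows [] []" using f(1) DD_arrows[of k] by (simp add: arrows_def)
  ultimately have "realized (4 ^ k *\<^sub>c (\<Sum>c\<in>?w. t c *\<^sub>c W c))" by (rule realizedI[rotated])
  from realized_scale[OF this, of "1 / 4 ^ k"] show ?thesis by simp
qed

subsection \<open>Every invariant is in the image\<close>

definition Zs :: "nat => nat list set" where "Zs M = (\<Union>k\<in>{..M}. words {1..N} (2 * k))"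

definition qz :: "nat => (nat list => complex) => ('v => 'v) nc_poly" where "qz M t = (\<Sum>c\<in>Zs M. t c *\<^sub>c W c)"

lemma finite_Zs [simp]: "finite (Zs M)" unfolding Zs_def by (intro finite_UN_I) simp_all

lemma Zs_iff: "c \<in> Zs M \<longleftrightarrow> set c \<subseteq> {1..N} \<and> even (length c) \<and> length c \<le> 2 * M"
proof
  assume "set c \<subseteq> {1..N} \<and> even (length c) \<and> length c \<le> 2 * M"
  then obtain k where "length c = 2 * k" by (auto elim!: evenE)
  with \<open>set c \<subseteq> _ \<and> _\<close> show "c \<in> Zs M" unfolding Zs_def words_def by (intro UN_I[of k]) auto
qed (auto simp: Zs_def words_def)

lemma sum_Zs: "(\<Sum>c\<in>Zs M. f c) = (\<Sum>k\<in>{..M}. \<Sum>c\<in>words {1..N} (2 * k). f c)"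
  unfolding Zs_def by (rule sum.UNION_disjoint) (auto simp: words_def intro: finite_words[unfolded words_def])

lemma sum_FA: "(\<And>i. i \<in> S ==> f i \<in> FA so) ==> (\<Sum>i\<in>S. f i) \<in> FA so"
  by (induction S rule: infinite_finite_induct) auto

lemma qz_FA: "qz M t \<in> FA so" unfolding qz_def by (rule sum_FA) simp

abbreviation Wspan :: "('v => 'v) nc_poly set" where "Wspan \<equiv> cvec.span (W ` {c. set c \<subseteq> {1..N} \<and> even (length c)})"

lemma Wspan_mult: "s \<in> Wspan ==> i \<in> {1..N} ==> j \<in> {1..N} ==> s * LM i j \<in> Wspan"
proof (induction rule: cvec.span_induct_alt)
  case base show ?case by (simp add: cvec.span_zero)
next
  case (step k x s)
  then obtain c where c: "x = W c" "set c \<subseteq> {1..N}" "even (length c)" by auto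
  have "W (i # j # c) \<in> Wspan" by (rule cvec.span_base) (use c step.prems in \<open>auto simp del: W.simps\<close>)
  then have "x * LM i j \<in> Wspan" by (simp add: c)
  then show ?case using step by (simp add: distrib_right scale_mult cvec.span_add cvec.span_scale)
qed

text \<open>Letters are absorbed at the right end of the word: each is expanded in the generators
  \<open>LM i j\<close>, and right multiplication by such a generator prepends a pair of
  indices.\<close>

lemma word_Wspan: "set w \<subseteq> so ==> \<exists>s\<in>Wspan. Ueq (monw w) s"
proof (induction w rule: rev_induct)
  case Nil
  have "W [] \<in> Wspan" by (rule cvec.span_base, rule imageI) simp
  then show ?case by (intro bexI[of _ 1]) (simp_all add: monw_Nil Ueq_refl)
next
  case (snoc A w)
  then obtain s where s: "s \<in> Wspan" "Ueq (monw w) s" and A: "A \<in> so" by auto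
  let ?r = "\<Sum>i=1..N. \<Sum>j=1..N. (ent A i j / 2) *\<^sub>c LM i j"
  have 1: "Ueq (monw w * letter A) (s * ?r)" by (rule Ueq_mult[OF s(2) Ueq_letter_expand[OF A]])
  have 2: "monw (w @ [A]) = monw w * letter A" by (simp add: letter_monw monw_mult)
  have "s * ?r = (\<Sum>i=1..N. \<Sum>j=1..N. (ent A i j / 2) *\<^sub>c (s * LM i j))"
    by (simp only: sum_distrib_left scale_mult)
  also have "\<dots> \<in> Wspan" by (intro cvec.span_sum cvec.span_scale Wspan_mult s(1))
  finally have "s * ?r \<in> Wspan" .
  with 1 show ?case unfolding 2 by blast
qed

lemma FA_Wspan: assumes p: "p \<in> FA so" shows "\<exists>s\<in>Wspan. Ueq p s"
proof -
  have "\<exists>s\<in>Wspan. Ueq (\<Sum>w\<in>S. Poly_Mapping.lookup p w *\<^sub>c monw w) s" if "finite S" "S \<subseteq> Poly_Mapping.keys p" for S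
    using that
  proof (induction S rule: finite_induct)
    case empty show ?case by (intro bexI[of _ 0]) (simp_all add: Ueq_refl cvec.span_zero)
  next
    case (insert w S)
    then obtain s where s: "s \<in> Wspan" "Ueq (\<Sum>w\<in>S. Poly_Mapping.lookup p w *\<^sub>c monw w) s" by auto
    have "set w \<subseteq> so" using insert.prems p unfolding FA_iff by blast
    then obtain r where r: "r \<in> Wspan" "Ueq (monw w) r" using word_Wspan by blast
    have "Ueq (Poly_Mapping.lookup p w *\<^sub>c monw w + (\<Sum>w\<in>S. Poly_Mapping.lookup p w *\<^sub>c monw w)) (Poly_Mapping.lookup p w *\<^sub>c r + s)"
      by (rule Ueq_add[OF Ueq_scale[OF r(2)] s(2)])
    moreover have "Poly_Mapping.lookup p w *\<^sub>c r + s \<in> Wspan" by (intro cvec.span_add cvec.span_scale r s)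
    ultimately show ?case using insert.hyps by (intro bexI[of _ "Poly_Mapping.lookup p w *\<^sub>c r + s"]) simp_all
  qed
  from this[of "Poly_Mapping.keys p"] show ?thesis by (simp only: poly_expand[symmetric] finite_keys Set.subset_refl)
qed

lemma Wspan_qz: assumes "s \<in> Wspan" shows "\<exists>M t. s = qz M t"
proof -
  obtain B r where B: "finite B" "B \<subseteq> W ` {c. set c \<subseteq> {1..N} \<and> even (length c)}" "s = (\<Sum>a\<in>B. r a *\<^sub>c a)"
    using assms unfolding cvec.span_explicit by blast
  then obtain S where S: "S \<subseteq> {c. set c \<subseteq> {1..N} \<and> even (length c)}" "inj_on W S" "B = W ` S"
    unfolding subset_image_inj by blast
  have fin: "finite S" using B(1) S(2,3) finite_imageD by blast
  let ?M = "Max (insert 0 (length ` S))" and ?t = "\<lambda>c. if c \<in> S then r (W c) else 0"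
  have "length c \<le> 2 * ?M" if "c \<in> S" for c
  proof -
    have "length c \<le> ?M" by (rule Max_ge) (use that fin in auto)
    then show ?thesis by simp
  qed
  then have sub: "S \<subseteq> Zs ?M" using S(1) by (auto simp: Zs_iff)
  have "s = (\<Sum>c\<in>S. r (W c) *\<^sub>c W c)" unfolding B(3) S(3) by (simp add: sum.reindex[OF S(2)])
  also have "\<dots> = (\<Sum>c\<in>S. ?t c *\<^sub>c W c)" by (rule sum.cong) auto
  also have "\<dots> = qz ?M ?t" unfolding qz_def by (rule sum.mono_neutral_left) (use sub in auto)
  finally show ?thesis by blast
qed

text \<open>The commutator with \<open>LM a b\<close>, transported to coefficient families.
  Polarization preserves length and alphabet, so the truncation to \<open>Zs M\<close> is compatible
  with it.\<close>

definition XX :: "nat => nat => nat => (nat list => complex) => nat list => complex"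
  where "XX M a b t c = (if c \<in> Zs M then polarize a b c t - polarize b a c t else 0)"

lemma words_Zs: "k \<le> M ==> c \<in> words {1..N} (2 * k) ==> c \<in> Zs M"
  unfolding Zs_def by blast

text \<open>The operator is skew for every biadditive pairing, because adjunction exchanges its two
  polarizations. It is used for the pairing with monomials and for the Hermitian product.\<close>

lemma sum_XX:
  assumes ab: "a \<in> {1..N}" "b \<in> {1..N}"
    and add: "\<And>x x' y. \<beta> (x + x') y = \<beta> x y + \<beta> x' y" "\<And>x y y'. \<beta> x (y + y') = \<beta> x y + \<beta> x y'"
    and zero: "\<And>y. \<beta> 0 y = 0" "\<And>x. \<beta> x 0 = (0 :: 'z::ab_group_add)"
  shows "(\<Sum>c\<in>Zs M. \<beta> (XX M a b t c) (u c)) = (\<Sum>c\<in>Zs M. \<beta> (t c) (polarize b a c u - polarize a b c (u :: nat list => 'y::ab_group_add)))"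
proof -
  have diff: "\<beta> (x - x') y = \<beta> x y - \<beta> x' y" for x x' y using add(1)[of "x - x'" x' y] by (simp add: algebra_simps)
  have diff': "\<beta> x (y - y') = \<beta> x y - \<beta> x y'" for x y y' using add(2)[of x "y - y'" y'] by (simp add: algebra_simps)
  have adj: "(\<Sum>c\<in>Zs M. \<beta> (polarize p q c t) (u c)) = (\<Sum>c\<in>Zs M. \<beta> (t c) (polarize q p c u))"
    if "p \<in> {1..N}" "q \<in> {1..N}" for p q
    unfolding sum_Zs by (rule sum.cong[OF refl]) (rule polarize_adjoint[of "{1..N}" p q \<beta>, OF finite_atLeastAtMost that add zero])
  have "(\<Sum>c\<in>Zs M. \<beta> (XX M a b t c) (u c)) = (\<Sum>c\<in>Zs M. \<beta> (polarize a b c t) (u c)) - (\<Sum>c\<in>Zs M. \<beta> (polarize b a c t) (u c))"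
    unfolding sum_subtractf[symmetric] by (rule sum.cong[OF refl]) (simp add: XX_def diff)
  then show ?thesis unfolding adj[OF ab] adj[OF ab(2,1)] sum_subtractf[symmetric] diff' .
qed

lemma qz_XX:
  assumes ab: "a \<in> {1..N}" "b \<in> {1..N}"
  shows "Ueq (LM a b * qz M t - qz M t * LM a b) (qz M (XX M a b t))"
proof -
  have X: "qz M (XX M a b t) = (\<Sum>c\<in>Zs M. t c *\<^sub>c (polarize b a c W - polarize a b c W))"
    unfolding qz_def
    by (rule sum_XX[where \<beta> = "\<lambda>x y. x *\<^sub>c y" and a = a and b = b and u = W and t = t and M = M, OF ab])
      (simp_all only: cscale_add_left cscale_add_right cvec.scale_zero_left cvec.scale_zero_right)
  have Y: "LM a b * qz M t - qz M t * LM a b = (\<Sum>c\<in>Zs M. t c *\<^sub>c (LM a b * W c - W c * LM a b))"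
    unfolding qz_def sum_distrib_left sum_distrib_right scale_mult sum_subtractf[symmetric] cscale_diff_right ..
  show ?thesis unfolding X Y
    by (rule Ueq_sum[OF finite_Zs]) (rule Ueq_scale, rule W_polarize[OF ab], auto simp: Zs_iff)
qed

lemma Ueq_ideal: "Ueq p q ==> p \<in> U_ideal \<longleftrightarrow> q \<in> U_ideal"
  using U.K_add[of "p - q" q] U.K_diff[of p "p - q"] by (auto simp: Ueq_def)

lemma qz_linear: "qz M (\<lambda>c. t c + u c) = qz M t + qz M u" "qz M (\<lambda>c. k * t c) = k *\<^sub>c qz M t" "qz M (\<lambda>c. t c - u c) = qz M t - qz M u"
  by (simp_all add: qz_def cscale_add_left cscale_diff_left sum.distrib sum_subtractf cscale_sum_right)

text \<open>Among the coefficient families that represent \<open>z\<close> choose the one orthogonal to the families that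
  represent \<open>0\<close>; it inherits the invariance of \<open>z\<close>.\<close>

theorem invariant_realized:
  assumes z: "z \<in> FA so" and inv: "U.cs z \<in> Zg_invariants"
  shows "realized z"
proof -
  obtain s where s: "s \<in> Wspan" "Ueq z s" using FA_Wspan[OF z] by blast
  then obtain M t0 where t0: "Ueq z (qz M t0)" using Wspan_qz by blast
  let ?Z = "Zs M" and ?I = "{1..N}"
  define P where "P = {p. (\<forall>c. c \<notin> ?Z \<longrightarrow> p c = 0) \<and> qz M p \<in> U_ideal}"
  have "\<exists>p\<in>P. \<forall>u\<in>P. (\<Sum>x\<in>?Z. cnj (u x) * (t0 x - p x)) = 0"
  proof (rule orthogonal_decomposition)
    show "(\<lambda>_. 0) \<in> P" by (simp add: P_def qz_def U.K_0)
    show "(\<lambda>x. p x + q x) \<in> P" if "p \<in> P" "q \<in> P" for p q using that by (simp add: P_def qz_linear U.K_add)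
    show "(\<lambda>x. c * p x) \<in> P" if "p \<in> P" for c p using that by (simp add: P_def qz_linear U.K_scale)
  qed (simp_all add: P_def)
  then obtain p where p: "p \<in> P" "\<And>u. u \<in> P ==> (\<Sum>x\<in>?Z. cnj (u x) * (t0 x - p x)) = 0" by blast
  \<comment> \<open>The component of \<open>t0\<close> orthogonal to \<open>P\<close>. The removed
    part represents 0, so \<open>t\<close> still represents \<open>z\<close>.\<close>
  define t where "t c = (if c \<in> ?Z then t0 c - p c else 0)" for c
  have orth: "(\<Sum>x\<in>?Z. cnj (u x) * t x) = 0" if "u \<in> P" for u
    using p(2)[OF that] by (simp add: t_def cong: sum.cong)
  have qt: "qz M t = qz M t0 - qz M p" unfolding qz_linear(3)[symmetric] unfolding qz_def by (rule sum.cong[OF refl]) (simp add: t_def)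
  have zt: "Ueq z (qz M t)"
  proof -
    have "qz M p \<in> U_ideal" using p(1) by (simp add: P_def)
    then have "Ueq (qz M t0) (qz M t)" using qt qz_FA by (simp add: Ueq_def)
    with t0 show ?thesis by (rule Ueq_trans)
  qed
  have central: "U.cs z \<in> Zg" and Ginv: "\<And>g. g \<in> GV ==> Ad_U g (U.cs z) = U.cs z"
    using inv unfolding Zg_invariants_def by auto
  have comm: "LM a b * z - z * LM a b \<in> U_ideal" for a b
  proof -
    have "U.cs (LM a b) \<in> carrier Ug" unfolding Ug_def U.carrier_Q by simp
    then have "U.cs z \<otimes>\<^bsub>Ug\<^esub> U.cs (LM a b) = U.cs (LM a b) \<otimes>\<^bsub>Ug\<^esub> U.cs z" using central unfolding Zg_def by blast
    then have "U.cs (z * LM a b) = U.cs (LM a b * z)" unfolding Ug_def U.mult_Q[OF z LM_FA] U.mult_Q[OF LM_FA z] .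
    then show ?thesis unfolding U.cs_eq_iff using U.K_minus by fastforce
  qed
  have XP: "XX M a b u \<in> P" if "LM a b * qz M u - qz M u * LM a b \<in> U_ideal" "a \<in> ?I" "b \<in> ?I" for a b u
    using that(1) Ueq_ideal[OF qz_XX[OF that(2,3), of M u]] by (simp add: P_def XX_def)
  have polar: "polarize a b c t = polarize b a c t" if ab: "a \<in> ?I" "b \<in> ?I" and c: "c \<in> ?Z" for a b c
  proof -
    have "Ueq (LM a b * z - z * LM a b) (LM a b * qz M t - qz M t * LM a b)"
      by (intro Ueq_diff Ueq_mult zt Ueq_refl LM_FA)
    then have X: "XX M a b t \<in> P" using comm[of a b] Ueq_ideal by (intro XP ab) blast
    then have "qz M (XX M a b t) \<in> U_ideal" by (simp add: P_def)
    \<comment> \<open>The first application represents 0 because \<open>z\<close> is central; its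
      commutator with a generator then lies in the ideal, so a second application stays in
      \<open>P\<close>.\<close>
    then have XX: "XX M a b (XX M a b t) \<in> P"
      by (intro XP ab U.K_diff U.K_mult) simp_all
    \<comment> \<open>By skewness, the pairing of the second application with \<open>t\<close> is
      minus the squared norm of the first. Orthogonality makes it 0, so the first application
      already vanishes.\<close>
    have "0 = (\<Sum>c\<in>?Z. cnj (XX M a b (XX M a b t) c) * t c)" using orth[OF XX] by simp
    also have "\<dots> = (\<Sum>c\<in>?Z. cnj (XX M a b t c) * (polarize b a c t - polarize a b c t))"
      by (rule sum_XX[where \<beta> = "\<lambda>x y. cnj x * y" and a = a and b = b and u = t and t = "XX M a b t" and M = M, OF ab])
        (simp_all only: complex_cnj_add complex_cnj_zero distrib_left distrib_right mult_zero_left mult_zero_right)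
    also have "\<dots> = - (\<Sum>c\<in>?Z. of_real ((cmod (XX M a b t c))\<^sup>2))"
      unfolding sum_negf[symmetric]
    proof (rule sum.cong[OF refl])
      fix c assume "c \<in> ?Z"
      then have "polarize b a c t - polarize a b c t = - XX M a b t c" by (simp add: XX_def)
      then show "cnj (XX M a b t c) * (polarize b a c t - polarize a b c t) = - of_real ((cmod (XX M a b t c))\<^sup>2)"
        by (simp only: mult_minus_right cnj_mult_self)
    qed
    finally have "(\<Sum>c\<in>?Z. (cmod (XX M a b t c))\<^sup>2) = 0"
      unfolding of_real_sum[symmetric] by (metis neg_equal_0_iff_equal of_real_eq_0_iff)
    then have "XX M a b t c = 0" using c by (simp add: sum_nonneg_eq_0_iff)
    then show ?thesis using c by (simp add: XX_def)
  qed
  have evenness: "even (count_list c a)" if a: "a \<in> ?I" and tc: "t c \<noteq> 0" for a c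
  proof (rule ccontr)
    assume odd: "odd (count_list c a)"
    let ?ml = "map_letters (Ad (flp a))"
    note cl = clin_ev[of "\<lambda>w :: ('v => 'v) list. monw (map (Ad (flp a)) w)", folded map_letters_ev]
    \<comment> \<open>The difference between \<open>t\<close> reflected in \<open>e a\<close> and
      \<open>t\<close> itself. It represents 0 by invariance of \<open>z\<close>, hence is
      orthogonal to \<open>t\<close>, while each summand of that pairing is a multiple of a square
      with factor 0 or -2.\<close>
    define u where "u c = (if c \<in> ?Z then ((-1) ^ count_list c a - 1) * t c else 0)" for c
    have q1: "qz M u = (\<Sum>c\<in>?Z. t c *\<^sub>c (-1) ^ count_list c a *\<^sub>c W c) - qz M t"
      unfolding qz_def sum_subtractf[symmetric]
    proof (rule sum.cong[OF refl])
      fix c assume "c \<in> ?Z"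
      then have "u c = t c * (-1) ^ count_list c a - t c" by (simp add: u_def algebra_simps)
      then show "u c *\<^sub>c W c = t c *\<^sub>c (-1) ^ count_list c a *\<^sub>c W c - t c *\<^sub>c W c"
        by (simp only: cscale_diff_left cscale_cscale)
    qed
    have q2: "Ueq (?ml (qz M t)) (\<Sum>c\<in>?Z. t c *\<^sub>c (-1) ^ count_list c a *\<^sub>c W c)"
    proof -
      have Y: "?ml (qz M t) = (\<Sum>c\<in>?Z. t c *\<^sub>c ?ml (W c))" unfolding qz_def clin_simps[OF cl] ..
      show ?thesis unfolding Y
        by (rule Ueq_sum[OF finite_Zs]) (rule Ueq_scale, rule map_letters_W[OF a], auto simp: Zs_iff)
    qed
    have q3: "Ueq (?ml (qz M t)) (qz M t)"
    proof -
      have "qz M t \<in> U.cs z" using Ueq_sym[OF zt] by (simp add: U.cs_eq Ueq_def)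
      then have "?ml (qz M t) \<in> Ad_U (flp a) (U.cs z)" unfolding Ad_U_def by (rule imageI)
      then have "?ml (qz M t) - z \<in> U_ideal" unfolding Ginv[OF flp_GV[OF a]] by (simp add: U.cs_eq)
      moreover have "(?ml (qz M t) - z) + z \<in> FA so" by (rule FA_closed(3)[OF U.K_FA[OF calculation] z])
      ultimately have "Ueq (?ml (qz M t)) z" using z by (simp add: Ueq_def)
      then show ?thesis using zt by (rule Ueq_trans)
    qed
    have "qz M u \<in> U_ideal" using Ueq_trans[OF Ueq_sym[OF q2] q3] unfolding q1 by (simp only: Ueq_def)
    then have "u \<in> P" by (simp add: P_def u_def)
    from orth[OF this] have "0 = (\<Sum>c\<in>?Z. cnj (u c) * t c)" by simp
    also have "\<dots> = (\<Sum>c\<in>?Z. of_real (((-1) ^ count_list c a - 1) * (cmod (t c))\<^sup>2))"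
    proof (rule sum.cong[OF refl])
      fix c assume "c \<in> ?Z"
      then have "cnj (u c) * t c = ((-1) ^ count_list c a - 1) * (cnj (t c) * t c)" by (simp add: u_def)
      then show "cnj (u c) * t c = of_real (((-1) ^ count_list c a - 1) * (cmod (t c))\<^sup>2)" unfolding cnj_mult_self by simp
    qed
    finally have "(\<Sum>c\<in>?Z. (1 - (-1) ^ count_list c a) * (cmod (t c))\<^sup>2) = 0"
    proof -
      assume "0 = (\<Sum>c\<in>?Z. complex_of_real (((-1) ^ count_list c a - 1) * (cmod (t c))\<^sup>2))"
      then have "(\<Sum>c\<in>?Z. ((-1) ^ count_list c a - 1) * (cmod (t c))\<^sup>2) = 0"
        unfolding of_real_sum[symmetric] by (metis of_real_eq_0_iff)
      then have "- (\<Sum>c\<in>?Z. ((-1) ^ count_list c a - 1) * (cmod (t c))\<^sup>2) = 0" by simp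
      then show ?thesis unfolding sum_negf[symmetric] by (simp add: left_diff_distrib)
    qed
    moreover have "0 \<le> (1 - (-1) ^ k) * (cmod x)\<^sup>2" for k :: nat and x
      by (cases "even k") simp_all
    moreover have "c \<in> ?Z" using tc by (auto simp: t_def split: if_splits)
    ultimately have "(1 - (-1) ^ count_list c a) * (cmod (t c))\<^sup>2 = 0"
      by (simp add: sum_nonneg_eq_0_iff del: mult_eq_0_iff)
    then show False using odd tc by simp
  qed
  have "realized (\<Sum>k\<in>{..M}. \<Sum>c\<in>words ?I (2 * k). t c *\<^sub>c W c)"
  proof (rule realized_sum)
    fix k assume k: "k \<in> {..M}"
    \<comment> \<open>The part of \<open>t\<close> in one degree. Polarization preserves the length
      of words, so each part is separately invariant and the first fundamental theorem applies to
      it.\<close>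
    define tk where "tk c = (if c \<in> words ?I (2 * k) then t c else 0)" for c
    have "brauer ?I (2 * k) tk"
    proof (rule orthogonal_FFT)
      show "tk c = 0" if "c \<notin> words ?I (2 * k)" for c using that by (simp add: tk_def)
      fix a b c assume ab: "a \<in> ?I" "b \<in> ?I" and c: "c \<in> words ?I (2 * k)"
      have "polarize p q c tk = polarize p q c t" if "q \<in> ?I" for p q
        by (rule polarize_cong) (use c that in \<open>auto simp: tk_def words_def\<close>)
      then show "polarize a b c tk = polarize b a c tk" using polar[OF ab words_Zs[OF _ c]] k ab by simp
    next
      fix a c assume "a \<in> ?I" "tk c \<noteq> 0"
      then show "even (count_list c a)" using evenness[of a c] by (auto simp: tk_def split: if_splits)
    qed simp
    from realized_brauer[OF this] show "realized (\<Sum>c\<in>words ?I (2 * k). t c *\<^sub>c W c)"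
      by (simp add: tk_def cong: sum.cong)
  qed simp
  then have "realized (qz M t)" unfolding qz_def sum_Zs .
  then show ?thesis using Ueq_nf[OF zt] by (simp add: realized_def)
qed

theorem chi_image_invariants:
  "chi ` ASB_hom (of_nat N) (sigma N * 2 ^ (N div 2)) (kappa N) [] [] = Zg_invariants"
  unfolding chi_image
proof (intro Set.equalityI subsetI)
  fix x assume "x \<in> (\<lambda>f. U.cs (val f)) ` arrows [] []"
  then show "x \<in> Zg_invariants" using image_subset by auto
next
  fix x assume x: "x \<in> Zg_invariants"
  then have "x \<in> carrier Ug" by (simp add: Zg_invariants_def Zg_def)
  then obtain z where z: "x = U.cs z" "z \<in> FA so" unfolding Ug_def U.carrier_Q by auto
  obtain f where f: "f \<in> arrows [] []" "val f = U.nf z"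
    using invariant_realized[OF z(2)] x unfolding z(1) realized_def by blast
  then have "x = U.cs (val f)" using U.cs_nf[OF z(2)] z(1) by simp
  then show "x \<in> (\<lambda>f. U.cs (val f)) ` arrows [] []" using f(1) by blast
qed

end

theorem theorem10p1:
  fixes scale :: "complex \<Rightarrow> 'v::ab_group_add \<Rightarrow> 'v"
    and \<Phi> :: "'v \<Rightarrow> 'v \<Rightarrow> complex"
    and N :: nat
    and e :: "nat \<Rightarrow> 'v"
    and \<epsilon> :: complex
  assumes "spin_setting scale \<Phi> N e \<epsilon>"
  shows "spin_setting.chi scale \<Phi> N e \<epsilon>
      ` ASB_hom (of_nat N) (sigma N * 2 ^ (N div 2)) (kappa N) [] []
    = spin_setting.Zg_invariants scale \<Phi> N"
  using assms by (rule spin_setting.chi_image_invariants)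

end
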